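(* Let $\xi \in \mathcal{D}_1$ and let $N$, $M$ be arbitrary non-negative integers. Let $\lambda$ and $\nu$ be complex numbers satisfying $\left|\Re\lambda - \frac{1}{2}\right| <\min \left( N + \frac{1}{2},M + \frac{1}{2} \right)$ and $\Re\nu > \max \left( N - \Re\lambda ,M - \Re\lambda \right)$. Then there exist remainder terms $R_N^{(C1)} (\xi ,\lambda ,\nu )$ and $R_M^{(C2)} (\xi ,\lambda ,\nu )$ such that $$\begin{aligned} C_\nu ^{(\lambda )} (\cosh \xi ) = \;& \frac{e^{\xi (\nu + \lambda )} }{\Gamma (\lambda )(2\sinh \xi )^\lambda }\left( \sum_{n = 0}^{N - 1} a_n \left( \lambda - \tfrac{1}{2} \right)\frac{\Gamma (\nu + \lambda -n)}{\Gamma (\nu+1)}\left( \frac{-e^{ - \xi } }{\sinh \xi } \right)^n+ R_N^{(C1)} (\xi ,\lambda ,\nu ) \right)\\ & + K(\xi ,\lambda )\frac{e^{ - \xi (\nu + \lambda )} }{\Gamma (\lambda )(2\sinh \xi )^\lambda }\left( \sum_{m = 0}^{M - 1} a_m\left( \lambda - \tfrac{1}{2} \right)\frac{\Gamma (\nu + \lambda - m)}{\Gamma (\nu + 1)}\left( \frac{e^\xi }{\sinh \xi } \right)^m + R_M^{(C2)} (\xi ,\lambda ,\nu ) \right),\end{aligned}$$ and the remainder terms satisfy the estimates $$\begin{aligned}\left| R_N^{(C1)} (\xi ,\lambda ,\nu ) \right| \le \; & \left|\frac{\sin (\pi \lambda )}{\sin (\pi \Re\lambda )}\right|\left| a_N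 \left(\Re\lambda - \tfrac{1}{2} \right) \right| \frac{\Gamma \left( \Re\nu+\Re\lambda - N \right)}{|\Gamma (\nu + 1)|} \left| \frac{e^{ - \xi } }{\sinh \xi } \right|^N \\ & \times \begin{cases} 1 & \text{if } \Re (e^{2\xi } ) \le 1, \\ \min\left(\left| 1 - e^{ - 2\xi } \right|\left| \csc (2\Im\xi ) \right|,\,1 + \chi\left(N+\tfrac{1}{2}\right)\right) & \text{if } \Re (e^{2\xi } ) > 1, \end{cases}\end{aligned}$$ and $$\left| R_M^{(C2)} (\xi ,\lambda ,\nu ) \right| \le \left|\frac{\sin (\pi \lambda )}{\sin (\pi \Re\lambda )}\right|\left|a_M \left(\Re\lambda - \tfrac{1}{2} \right)\right|\frac{\Gamma \left( \Re\nu+\Re\lambda - M \right)}{|\Gamma (\nu + 1)|} \left| \frac{e^\xi}{\sinh \xi } \right|^M .$$ If $\Re\lambda $ is an integer, then the limiting values have to be taken in these bounds. The fractional powers are positive for positive real $\xi$ (and real exponent) and are defined by continuity elsewhere. In addition, $R_M^{(C2)} (\xi ,\lambda,\nu)$ does not exceed the corresponding first neglected term $a_M(\lambda-\frac12)\frac{\Gamma(\nu+\lambda-M)}{\Gamma(\nu+1)}\left(\frac{e^\xi}{\sinh\xi}\right)^M$ in absolute value and has the same sign, provided that $\xi$ is positive, $\lambda$ and $\nu$ are real, $\left| \lambda - \frac{1}{2}\right| <M + \frac{1}{2}$ and $\nu > M - \lambda$.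
   Context: $\mathcal{D}_1=\{\xi\in\mathbb{C} : \Re \xi>0,\ |\Im \xi |<\pi\}$; $\cosh$ maps $\mathcal{D}_1$ biholomorphically onto $\mathbb{C}\setminus(-\infty,1]$. The Gegenbauer function is defined for $z\in\mathbb{C}\setminus(-\infty,1]$ by $$C_\nu ^{(\lambda )} (z) = \frac{\sqrt\pi\, \Gamma (\nu + 2\lambda )}{\Gamma (\lambda )\Gamma (\nu + 1)\left(2\sqrt{z^2-1}\right)^{\lambda - \frac{1}{2}} }P_{\nu + \lambda - \frac{1}{2}}^{\frac{1}{2} - \lambda } (z),$$ where $P_\nu ^\mu (z) = \left(\frac{z + 1}{z - 1}\right)^{\mu /2}\mathbf{F}\left(\nu+1,-\nu;1-\mu;\frac{1-z}{2}\right)$ is the associated Legendre function (powers positive-based for $z>1$, continued by analyticity; $\sqrt{z^2-1}=\sinh\xi$ for $z=\cosh\xi$) and $\mathbf{F}(a,b;c;w)=\sum_{n\ge 0}\frac{(a)_n(b)_n}{\Gamma(c+n)\,n!}w^n$ ($|w|<1$), continued analytically to $\mathbb{C}\setminus[1,+\infty)$, is the regularised hypergeometric function. $1/\Gamma$ is $0$ at the poles of $\Gamma$. $a_n (\mu ) = \frac{(4\mu ^2 - 1^2 )(4\mu ^2 - 3^2 ) \cdots (4\mu ^2 - (2n - 1)^2 )}{8^n n!}$. $K(\xi ,\lambda ) = \cos (\pi \lambda )$ if $\xi > 0$, and $K(\xi,\lambda)=e^{ \pm \pi i\lambda }$ if $0<\pm \Im\xi < \pi$. $\chi(p)= \frac{\sqrt\pi\,\Gamma\left(\frac{p}{2}+1\right)}{\Gamma\left(\frac{p}{2}+\frac{1}{2}\right)}$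 for $p>0$. "Limiting value" means that $|a_k(\Re\lambda-\frac12)|/|\sin(\pi\Re\lambda)|$ is replaced by $\lim_{x\to\Re\lambda}|a_k(x-\frac12)|/|\sin(\pi x)|$. When $\sin(2\Im\xi)=0$, $|\csc(2\Im\xi)|$ is read as $+\infty$. *)

theory Defs
  imports "HOL-Analysis.Analysis"
begin

definition D1 :: "complex set" where
  "D1 = {\<xi>. Re \<xi> > 0 \<and> \<bar>Im \<xi>\<bar> < pi}"

definition hyp_series :: "complex \<Rightarrow> complex \<Rightarrow> complex \<Rightarrow> complex \<Rightarrow> complex" where
  "hyp_series a b c w =
     (\<Sum>n. pochhammer a n * pochhammer b n * rGamma (c + of_nat n) / fact n * w ^ n)"

text \<open>The value at \<open>w\<close> of the analytic continuation of the series from the unit disc to the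
  plane cut along \<open>[1, \<infinity>)\<close>; for \<open>w\<close> in the cut plane it is unique because the cut plane is
  connected.\<close>

definition reg_hyp2F1 :: "complex \<Rightarrow> complex \<Rightarrow> complex \<Rightarrow> complex \<Rightarrow> complex" where
  "reg_hyp2F1 a b c w =
     (THE y. \<exists>f. f holomorphic_on (- complex_of_real ` {1..}) \<and>
                 (\<forall>v. norm v < 1 \<longrightarrow> f v = hyp_series a b c v) \<and> f w = y)"

text \<open>For \<open>z\<close> outside \<open>(-\<infinity>, 1]\<close> the base \<open>(z + 1) / (z - 1)\<close> avoids \<open>(-\<infinity>, 0]\<close>, so the
  principal power is the analytic continuation of the positive-based one.\<close>

definition legendre_P :: "complex \<Rightarrow> complex \<Rightarrow> complex \<Rightarrow> complex" where
  "legendre_P \<mu> \<nu> z =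
     ((z + 1) / (z - 1)) powr (\<mu> / 2) * reg_hyp2F1 (\<nu> + 1) (- \<nu>) (1 - \<mu>) ((1 - z) / 2)"

text \<open>The branch of the square root of \<open>z\<^sup>2 - 1\<close> that is analytic off \<open>(-\<infinity>, 1]\<close> and positive for
  \<open>z > 1\<close>, so that it equals \<open>sinh \<xi>\<close> at \<open>z = cosh \<xi>\<close>, \<open>\<xi> \<in> D1\<close>. The principal value
  \<open>csqrt (z\<^sup>2 - 1)\<close> would have the wrong sign for \<open>Re z < 0\<close>. The values of the product avoid
  \<open>(-\<infinity>, 0]\<close>, so principal powers of it are again the analytic continuations.\<close>

definition sqrt_z2m1 :: "complex \<Rightarrow> complex" where
  "sqrt_z2m1 z = csqrt (z - 1) * csqrt (z + 1)"

definition gegenbauer_C :: "complex \<Rightarrow> complex \<Rightarrow> complex \<Rightarrow> complex" where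
  "gegenbauer_C lam \<nu> z =
     of_real (sqrt pi) * Gamma (\<nu> + 2 * lam) * rGamma lam * rGamma (\<nu> + 1)
       / (2 * sqrt_z2m1 z) powr (lam - 1 / 2)
       * legendre_P (1 / 2 - lam) (\<nu> + lam - 1 / 2) z"

definition acoef :: "nat \<Rightarrow> 'a::field_char_0 \<Rightarrow> 'a" where
  "acoef n \<mu> = (\<Prod>k=1..n. 4 * \<mu>\<^sup>2 - (2 * of_nat k - 1)\<^sup>2) / (8 ^ n * fact n)"

definition Kfac :: "complex \<Rightarrow> complex \<Rightarrow> complex" where
  "Kfac \<xi> lam =
     (if Im \<xi> = 0 then cos (of_real pi * lam)
      else if Im \<xi> > 0 then exp (of_real pi * \<i> * lam)
      else exp (- (of_real pi * \<i> * lam)))"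

definition chi :: "real \<Rightarrow> real" where
  "chi p = sqrt pi * Gamma (p / 2 + 1) / Gamma (p / 2 + 1 / 2)"

definition acoef_over_sin :: "nat \<Rightarrow> real \<Rightarrow> real" where
  "acoef_over_sin k x =
     (if x \<in> \<int> then Lim (at x) (\<lambda>t. \<bar>acoef k (t - 1 / 2)\<bar> / \<bar>sin (pi * t)\<bar>)
      else \<bar>acoef k (x - 1 / 2)\<bar> / \<bar>sin (pi * x)\<bar>)"

text \<open>The branch \<open>sin (2 * Im \<xi>) = 0\<close> is the one where the cosecant is \<open>+\<infinity>\<close>, so that the minimum
  is its second argument.\<close>

definition C1_factor :: "nat \<Rightarrow> complex \<Rightarrow> real" where
  "C1_factor N \<xi> =
     (if Re (exp (2 * \<xi>)) \<le> 1 then 1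
      else if sin (2 * Im \<xi>) = 0 then 1 + chi (real N + 1 / 2)
      else min (norm (1 - exp (- 2 * \<xi>)) * \<bar>1 / sin (2 * Im \<xi>)\<bar>) (1 + chi (real N + 1 / 2)))"

end

theory Submission
  imports Defs "HOL-Complex_Analysis.Complex_Analysis"
begin

text \<open>Put \<open>\<alpha> = \<nu> + \<lambda>\<close>, \<open>\<mu> = \<lambda> - 1/2\<close>, \<open>\<kappa> = \<alpha> + 1/2\<close>, \<open>w\<^sub>1 = 1 / (1 - e\<^bsup>2\<xi>\<^esup>)\<close>, \<open>w\<^sub>2 = 1 / (1 - e\<^bsup>-2\<xi>\<^esup>)\<close>
  and \<open>g(w) = \<Gamma>(\<kappa>) / (2 \<surd>\<pi>) w\<^sup>\<alpha> \<integral> (w + sinh\<^sup>2 (\<eta>/2))\<^bsup>-\<kappa>\<^esup> e\<^bsup>-\<mu>\<eta>\<^esup> d\<eta>\<close>, integrated over the real line.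
  Off the real axis, up to the common prefactor, the Gegenbauer function is
  \<open>e\<^bsup>\<xi>\<alpha>\<^esup> g(w\<^sub>1) + K e\<^bsup>-\<xi>\<alpha>\<^esup> g(w\<^sub>2)\<close>. For \<open>\<xi> = i\<theta>\<close> and \<open>0 < Re \<alpha> < 1/2\<close> this follows by shifting the two
  contours by \<open>\<plusminus> i\<pi>/2\<close>, which turns \<open>g(w\<^sub>1)\<close> and \<open>g(w\<^sub>2)\<close> into combinations of the same two real
  integrals, one of which cancels while the other is Euler's integral; the general case follows by analytic continuation.

  Expanding \<open>cosh (\<mu>\<eta>) / cosh (\<eta>/2)\<close> in powers of \<open>sinh\<^sup>2 (\<eta>/2)\<close> with an integral remainder yields
  the expansion of \<open>g(w)\<close> in powers of \<open>2w\<close>, and \<open>2w\<^sub>1 = - e\<^bsup>-\<xi>\<^esup> / sinh \<xi>\<close>, \<open>2w\<^sub>2 = e\<^bsup>\<xi>\<^esup> / sinh \<xi>\<close>. The remainder is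
  an average of \<open>\<Lambda>(c) = \<integral>\<^sub>0\<^sup>\<infinity> v\<^bsup>N-1/2\<^esup> e\<^bsup>-v\<^esup> / (1 + cv) dv\<close> over positive multiples \<open>c\<close> of \<open>w\<close>, so that
  bounding \<open>|\<Lambda>(c)|\<close> in terms of \<open>arg c\<close> alone gives the error bounds. On the real axis \<open>w\<^sub>1\<close> lies on the cut of
  \<open>g\<close>, and the first remainder is the mean of its limits from above and below.\<close>

section \<open>Parameter integrals\<close>

text \<open>The contours are pushed until they meet the branch point of the integrand: on the lines
  with imaginary part \<plusminus> \<pi>/2 the base has a zero at a real \<eta>, near which the
  integrand behaves like the power -\<kappa>. This is integrable only for Re \<kappa> < 1, that is
  Re \<alpha> < 1/2, so larger \<alpha> are accessible only by continuation in the parameters. For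
  \<xi> = i \<theta> both shifted integrals have their zero at the same place, sinh \<eta> = cot
  \<theta>, and this is what lets one pair of real integrals serve for both. The remainder is exact:
  a geometric tail under a Beta weight in x. Taking moduli replaces lam by Re lam inside that
  weight, while the factor sin (\<pi> lam) stands outside and keeps the complex lam; hence the
  quotient sin (\<pi> lam) / sin (\<pi> Re lam) and the coefficient a_N at Re lam in the bounds. Up
  to sign, a_N(l - 1/2) / sin (\<pi> l) is a product of Gamma functions of positive arguments, so
  integer Re lam needs no separate estimate.\<close>

lemma holomorphic_on_integral:
  fixes f :: "complex \<Rightarrow> 'a \<Rightarrow> complex"
  assumes S: "open S"
    and meas: "\<And>z. z \<in> S \<Longrightarrow> f z \<in> borel_measurable M"
    and hol: "\<And>x. x \<in> space M \<Longrightarrow> (\<lambda>z. f z x) holomorphic_on S"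
    and dom: "\<And>z0. z0 \<in> S \<Longrightarrow> \<exists>d>0. \<exists>h. integrable M h \<and>
                (\<forall>z \<in> ball z0 d \<inter> S. \<forall>x \<in> space M. norm (f z x) \<le> h x)"
  shows "(\<lambda>z. \<integral>x. f z x \<partial>M) holomorphic_on S"
proof -
  have "(\<lambda>z. \<integral>x. f z x \<partial>M) field_differentiable at z0" if z0: "z0 \<in> S" for z0
  proof -
    from dom[OF z0] obtain d h where d: "d > 0" and h: "integrable M h"
      and bd: "\<And>z x. z \<in> ball z0 d \<inter> S \<Longrightarrow> x \<in> space M \<Longrightarrow> norm (f z x) \<le> h x" by blast
    from S z0 obtain e where e: "e > 0" "ball z0 e \<subseteq> S" by (meson open_contains_ball)
    \<comment> \<open>Discs of radius r about points of the disc of radius r must stay inside the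
      dominated ball, with room to spare; hence the quarter.\<close>
    define r where "r = min d e / 4"
    have r: "r > 0" using d e by (simp add: r_def)
    have sub: "cball z0 (2*r) \<subseteq> ball z0 d \<inter> S"
    proof
      fix z assume "z \<in> cball z0 (2*r)"
      hence "dist z0 z \<le> 2 * r" by simp
      also have "2 * r < d" "2 * r < e" using d e by (auto simp: r_def min_def)
      ultimately show "z \<in> ball z0 d \<inter> S" using e by (auto simp: subset_iff)
    qed
    have int: "integrable M (f z)" if "z \<in> cball z0 (2*r)" for z
      by (rule Bochner_Integration.integrable_bound[OF h])
         (use that sub bd meas in \<open>force intro!: AE_I2\<close>)+
    define f' where "f' = (\<lambda>x. deriv (\<lambda>z. f z x) z0)"
    have holS: "(\<lambda>z. f z x) holomorphic_on S" if "x \<in> space M" for x using hol that by auto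
    have der: "((\<lambda>z. f z x) has_field_derivative f' x) (at z0)" if "x \<in> space M" for x
      unfolding f'_def using holomorphic_derivI[OF holS[OF that] S z0] .
    \<comment> \<open>Cauchy's inequality on circles of radius r turns the bound on f into one on
      its derivative, so only f itself has to be dominated. The mean value estimate in
      \<open>quot\<close> passes the same bound on to the difference quotients.\<close>
    have derbd: "norm (deriv (\<lambda>z. f z x) z) \<le> h x / r" if x: "x \<in> space M" and z: "z \<in> cball z0 r" for x z
    proof -
      have sz: "cball z r \<subseteq> cball z0 (2*r)"
      proof
        fix y assume "y \<in> cball z r"
        hence "dist z0 y \<le> dist z0 z + dist z y" "dist z y \<le> r" "dist z0 z \<le> r"
          using z by (auto intro: dist_triangle)
        thus "y \<in> cball z0 (2*r)" by simp
      qed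
      have "norm ((deriv ^^ 1) (\<lambda>z. f z x) z) \<le> fact 1 * h x / r ^ 1"
      proof (rule Cauchy_inequality)
        show "(\<lambda>z. f z x) holomorphic_on ball z r"
          by (rule holomorphic_on_subset[OF holS[OF x]]) (use sz sub in \<open>auto simp: subset_iff\<close>)
        show "continuous_on (cball z r) (\<lambda>z. f z x)"
          by (rule holomorphic_on_imp_continuous_on, rule holomorphic_on_subset[OF holS[OF x]])
             (use sz sub in \<open>auto simp: subset_iff\<close>)
        show "0 < r" by fact
        fix y assume "norm (z - y) = r"
        hence "y \<in> cball z r" by (simp add: dist_norm)
        thus "norm (f y x) \<le> h x" using sz sub bd x by blast
      qed
      thus ?thesis by simp
    qed
    have quot: "norm ((f z x - f z0 x) / (z - z0)) \<le> h x / r" if x: "x \<in> space M" and z: "z \<in> cball z0 r" for x z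
    proof (cases "z = z0")
      case True
      have "0 \<le> h x" using bd[of z0 x] x z0 d by (auto intro: order_trans[OF norm_ge_zero])
      thus ?thesis using True r by simp
    next
      case False
      have "norm (f z x - f z0 x) \<le> h x / r * norm (z - z0)"
      proof (rule field_differentiable_bound[of "cball z0 r" "\<lambda>z. f z x" "deriv (\<lambda>z. f z x)"])
        show "convex (cball z0 r)" by simp
        fix y assume y: "y \<in> cball z0 r"
        hence "y \<in> S" using sub r by (auto simp: subset_iff)
        thus "((\<lambda>z. f z x) has_field_derivative deriv (\<lambda>z. f z x) y) (at y within cball z0 r)"
          using holomorphic_derivI[OF holS[OF x] S] by (blast intro: has_field_derivative_at_within)
        show "norm (deriv (\<lambda>z. f z x) y) \<le> h x / r" using derbd x y by blast
      qed (use z r in auto)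
      thus ?thesis using False by (simp add: norm_divide field_simps)
    qed
    have "((\<lambda>z. (\<integral>x. f z x \<partial>M)) has_field_derivative (\<integral>x. f' x \<partial>M)) (at z0)"
      unfolding has_field_derivative_iff
    proof (subst tendsto_at_iff_sequentially, intro allI impI)
      fix X :: "nat \<Rightarrow> complex"
      assume X: "\<forall>i. X i \<in> UNIV - {z0}" and lim: "X \<longlonglongrightarrow> z0"
      have "eventually (\<lambda>i. X i \<in> cball z0 r) sequentially"
        using tendstoD[OF lim r] by eventually_elim (simp add: dist_commute)
      then obtain n0 where n0: "\<And>i. i \<ge> n0 \<Longrightarrow> X i \<in> cball z0 r" by (auto simp: eventually_sequentially)
      define Y where "Y = (\<lambda>i. X (i + n0))"
      have Y: "Y i \<in> cball z0 r" "Y i \<noteq> z0" for i using n0 X by (auto simp: Y_def)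
      have Ylim: "Y \<longlonglongrightarrow> z0" unfolding Y_def using lim by (simp add: LIMSEQ_ignore_initial_segment)
      have Y2: "Y i \<in> cball z0 (2*r)" "Y i \<in> S" for i
        using Y(1)[of i] r sub by (auto simp: subset_iff)
      have z02: "z0 \<in> cball z0 (2*r)" using r by simp
      have lim1: "(\<lambda>i. (f (Y i) x - f z0 x) / (Y i - z0)) \<longlonglongrightarrow> f' x" if "x \<in> space M" for x
      proof -
        have "((\<lambda>z. (f z x - f z0 x) / (z - z0)) \<longlongrightarrow> f' x) (at z0)"
          using der[OF that] unfolding has_field_derivative_iff .
        thus ?thesis using Y Ylim unfolding tendsto_at_iff_sequentially by (auto simp: o_def)
      qed
      have "(\<lambda>i. \<integral>x. (f (Y i) x - f z0 x) / (Y i - z0) \<partial>M) \<longlonglongrightarrow> (\<integral>x. f' x \<partial>M)"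
      proof (rule integral_dominated_convergence[where w = "\<lambda>x. h x / r"])
        show meas': "(\<lambda>x. (f (Y i) x - f z0 x) / (Y i - z0)) \<in> borel_measurable M" for i
          using meas[OF z0] meas[OF Y2(2)[of i]] by measurable
        show "f' \<in> borel_measurable M"
          by (rule borel_measurable_LIMSEQ_metric[OF meas' lim1])
        show "integrable M (\<lambda>x. h x / r)" using h by simp
        show "AE x in M. (\<lambda>i. (f (Y i) x - f z0 x) / (Y i - z0)) \<longlonglongrightarrow> f' x"
          using lim1 by (auto intro!: AE_I2)
        show "AE x in M. norm ((f (Y i) x - f z0 x) / (Y i - z0)) \<le> h x / r" for i
          using quot Y by (auto intro!: AE_I2)
      qed
      moreover have "(\<integral>x. (f (Y i) x - f z0 x) / (Y i - z0) \<partial>M) =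
          ((\<integral>x. f (Y i) x \<partial>M) - (\<integral>x. f z0 x \<partial>M)) / (Y i - z0)" for i
        using int[OF Y2(1)[of i]] int[OF z02] by simp
      ultimately have "(\<lambda>i. ((\<integral>x. f (Y i) x \<partial>M) - (\<integral>x. f z0 x \<partial>M)) / (Y i - z0)) \<longlonglongrightarrow> (\<integral>x. f' x \<partial>M)"
        by (simp only:)
      thus "((\<lambda>z. ((\<integral>x. f z x \<partial>M) - (\<integral>x. f z0 x \<partial>M)) / (z - z0)) \<circ> X) \<longlonglongrightarrow> (\<integral>x. f' x \<partial>M)"
        unfolding Y_def o_def by (rule LIMSEQ_offset)
    qed
    thus ?thesis by (auto simp: field_differentiable_def)
  qed
  thus ?thesis by (simp add: holomorphic_on_def field_differentiable_at_within)
qed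

lemma set_integrable_dominated:
  fixes f :: "'a::euclidean_space \<Rightarrow> complex"
  assumes h: "set_integrable lborel A h" and A: "A \<in> sets borel"
    and c: "continuous_on A f" and bd: "\<And>x. x \<in> A \<Longrightarrow> norm (f x) \<le> (h x :: real)"
  shows "set_integrable lborel A f"
  unfolding set_integrable_def
proof (rule Bochner_Integration.integrable_bound)
  show "integrable lborel (\<lambda>x. indicator A x *\<^sub>R h x)" using h by (simp add: set_integrable_def)
  show "(\<lambda>x. indicator A x *\<^sub>R f x) \<in> borel_measurable lborel"
    using borel_measurable_continuous_on_indicator[OF A c] by simp
  show "AE x in lborel. norm (indicator A x *\<^sub>R f x) \<le> norm (indicator A x *\<^sub>R h x)"
  proof (rule AE_I2)
    fix x show "norm (indicator A x *\<^sub>R f x) \<le> norm (indicator A x *\<^sub>R h x)"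
      using bd[of x] by (cases "x \<in> A") auto
  qed
qed

lemma holomorphic_on_set_integral:
  fixes f :: "complex \<Rightarrow> 'a::euclidean_space \<Rightarrow> complex"
  assumes S: "open S" and A: "A \<in> sets borel"
    and cont: "\<And>z. z \<in> S \<Longrightarrow> continuous_on A (f z)"
    and hol: "\<And>x. x \<in> A \<Longrightarrow> (\<lambda>z. f z x) holomorphic_on S"
    and dom: "\<And>z0. z0 \<in> S \<Longrightarrow> \<exists>d>0. \<exists>h. set_integrable lborel A h \<and>
                (\<forall>z \<in> ball z0 d \<inter> S. \<forall>x \<in> A. norm (f z x) \<le> h x)"
  shows "(\<lambda>z. LINT x:A|lborel. f z x) holomorphic_on S"
  unfolding set_lebesgue_integral_def
proof (rule holomorphic_on_integral[OF S])
  show "(\<lambda>x. indicator A x *\<^sub>R f z x) \<in> borel_measurable lborel" if "z \<in> S" for z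
    using borel_measurable_continuous_on_indicator[OF A cont[OF that]] by simp
  show "(\<lambda>z. indicat_real A x *\<^sub>R f z x) holomorphic_on S" for x
    using hol[of x] by (cases "x \<in> A") (auto simp: scaleR_conv_of_real intro!: holomorphic_intros)
  fix z0 assume "z0 \<in> S"
  from dom[OF this] obtain d h where d: "d > 0" "set_integrable lborel A h"
      "\<forall>z \<in> ball z0 d \<inter> S. \<forall>x \<in> A. norm (f z x) \<le> h x" by blast
  have "norm (indicator A x *\<^sub>R f z x) \<le> indicator A x *\<^sub>R h x" if "z \<in> ball z0 d \<inter> S" for z x
    using d(3) that by (cases "x \<in> A") auto
  with d show "\<exists>d>0. \<exists>h. integrable lborel h \<and>
            (\<forall>z\<in>ball z0 d \<inter> S. \<forall>x\<in>space lborel. norm (indicator A x *\<^sub>R f z x) \<le> h x)"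
    unfolding set_integrable_def by blast
qed

text \<open>A product bound makes the double integral absolutely convergent at once. Integrands
  whose bound does not factor are left to \<open>set_integral_Fubini_bound\<close>.\<close>

lemma set_integral_Fubini_dominated:
  fixes f :: "real \<Rightarrow> real \<Rightarrow> complex"
  assumes A: "A \<in> sets borel" and B: "B \<in> sets borel"
    and c: "continuous_on (A \<times> B) (\<lambda>(x,y). f x y)"
    and h: "set_integrable lborel A h" and k: "set_integrable lborel B k"
    and bd: "\<And>x y. x \<in> A \<Longrightarrow> y \<in> B \<Longrightarrow> norm (f x y) \<le> h x * k y"
  shows "(LINT x:A|lborel. LINT y:B|lborel. f x y) = (LINT y:B|lborel. LINT x:A|lborel. f x y)"
    and "set_integrable lborel A (\<lambda>x. LINT y:B|lborel. f x y)"
proof -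
  have AB: "A \<times> B \<in> sets borel" using A B by (rule borel_Times)
  have m: "(\<lambda>(x,y). indicator A x *\<^sub>R (indicator B y *\<^sub>R f x y)) \<in> borel_measurable (lborel \<Otimes>\<^sub>M lborel)"
  proof -
    have "(\<lambda>z. indicator (A \<times> B) z *\<^sub>R (case z of (x,y) \<Rightarrow> f x y)) \<in> borel_measurable borel"
      by (rule borel_measurable_continuous_on_indicator[OF AB c])
    also have "(\<lambda>z. indicator (A \<times> B) z *\<^sub>R (case z of (x,y) \<Rightarrow> f x y)) =
        (\<lambda>(x,y). indicator A x *\<^sub>R (indicator B y *\<^sub>R f x y))"
      by (auto simp: indicator_def fun_eq_iff)
    finally show ?thesis by (simp add: lborel_prod)
  qed
  have "integrable (lborel \<Otimes>\<^sub>M lborel) (\<lambda>(x,y). indicator A x *\<^sub>R h x * (indicator B y *\<^sub>R k y))"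
    using h k integrable_abs[OF h[unfolded set_integrable_def]] integrable_abs[OF k[unfolded set_integrable_def]]
    unfolding set_integrable_def
    by (intro lborel_pair.Fubini_integrable) (auto simp: abs_mult)
  hence I: "integrable (lborel \<Otimes>\<^sub>M lborel) (\<lambda>(x,y). indicator A x *\<^sub>R (indicator B y *\<^sub>R f x y))"
    by (rule Bochner_Integration.integrable_bound[OF _ m])
       (auto intro!: AE_I2 simp: indicator_def intro: order_trans[OF bd abs_ge_self])
  show "(LINT x:A|lborel. LINT y:B|lborel. f x y) = (LINT y:B|lborel. LINT x:A|lborel. f x y)"
    using lborel_pair.Fubini_integral[OF I] unfolding set_lebesgue_integral_def
    by (simp add: mult.commute flip: integral_scaleR_right)
  show "set_integrable lborel A (\<lambda>x. LINT y:B|lborel. f x y)"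
    using lborel_pair.integrable_fst[OF I] unfolding set_lebesgue_integral_def set_integrable_def
    by (simp flip: integral_scaleR_right)
qed

text \<open>The change of variables theorem speaks of absolute integrability for the completed
  measure, so both integrands are carried there and back by Borel measurability. The transformed
  integrand \<open>F\<close> is a free parameter, which lets each application supply it already
  simplified.\<close>

lemma set_integral_substitution:
  fixes f :: "real \<Rightarrow> complex"
  assumes S: "S \<in> sets borel" "g ` S = T" "T \<in> sets borel"
    and der: "\<And>x. x \<in> S \<Longrightarrow> (g has_field_derivative h x) (at x)"
    and inj: "inj_on g S" and f: "continuous_on T f" and h: "continuous_on S h"
    and F: "\<And>x. x \<in> S \<Longrightarrow> F x = of_real \<bar>h x\<bar> * f (g x)"
  shows "set_integrable lborel T f \<longleftrightarrow> set_integrable lborel S F"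
    and "(LINT x:T|lborel. f x) = (LINT x:S|lborel. F x)"
proof -
  let ?F = "\<lambda>x. \<bar>h x\<bar> *\<^sub>R f (g x)"
  have g: "continuous_on S g"
    using der DERIV_continuous continuous_at_imp_continuous_on by blast
  have cF: "continuous_on S ?F"
    using S(2) by (intro continuous_intros h continuous_on_compose2[OF f g]) auto
  have mf: "(\<lambda>x. indicator T x *\<^sub>R f x) \<in> borel_measurable lborel"
    using borel_measurable_continuous_on_indicator[OF S(3) f] by simp
  have mF: "(\<lambda>x. indicator S x *\<^sub>R ?F x) \<in> borel_measurable lborel"
    using borel_measurable_continuous_on_indicator[OF S(1) cF] by simp
  have cong1: "set_integrable lborel S F = set_integrable lborel S ?F"
    by (rule set_integrable_cong) (auto simp: F scaleR_conv_of_real)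
  have cong2: "(LINT x:S|lborel. F x) = (LINT x:S|lborel. ?F x)"
    by (rule set_lebesgue_integral_cong) (use S in \<open>auto simp: F scaleR_conv_of_real\<close>)
  have e1: "set_integrable lborel T f \<longleftrightarrow> f absolutely_integrable_on T"
    unfolding set_integrable_def by (rule integrable_completion[OF mf, symmetric])
  have e2: "set_integrable lborel S ?F \<longleftrightarrow> ?F absolutely_integrable_on S"
    unfolding set_integrable_def by (rule integrable_completion[OF mF, symmetric])
  have SL: "S \<in> sets lebesgue" using S by simp
  note main = has_absolute_integral_change_of_variables_real[OF SL
      has_field_derivative_at_within[OF der] inj, of f, unfolded S(2)]
  show iff: "set_integrable lborel T f \<longleftrightarrow> set_integrable lborel S F"
    unfolding cong1 e1 e2 using main by blast
  show "(LINT x:T|lborel. f x) = (LINT x:S|lborel. F x)"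
  proof (cases "set_integrable lborel T f")
    case True
    hence T2: "set_integrable lborel S ?F" using iff cong1 by simp
    have "integral T f = integral S ?F" using main True T2 e1 e2 by blast
    thus ?thesis unfolding cong2
      using set_borel_integral_eq_integral(2)[OF True] set_borel_integral_eq_integral(2)[OF T2] by simp
  next
    \<comment> \<open>A non-integrable function has integral 0 by convention, and by the equivalence
      just shown this happens on both sides together.\<close>
    case False
    hence "\<not> set_integrable lborel S F" using iff by simp
    with False show ?thesis
      by (simp add: set_lebesgue_integral_def set_integrable_def not_integrable_integral_eq)
  qed
qed

text \<open>The modulus is |z| powr Re a times exp (- Im a arg z), and the principal argument is at
  most \<pi> in absolute value.\<close>

lemma norm_powr_le:
  assumes "z \<noteq> 0"
  shows "norm (z powr a :: complex) \<le> norm z powr Re a * exp (pi * \<bar>Im a\<bar>)"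
proof -
  have "norm (z powr a) = exp (Re (a * Ln z))"
    using assms by (simp add: powr_def)
  also have "\<dots> = norm z powr Re a * exp (- (Im a * Im (Ln z)))"
    using assms by (simp add: powr_def exp_diff exp_minus divide_inverse)
  also have "\<dots> \<le> norm z powr Re a * exp (pi * \<bar>Im a\<bar>)"
  proof (intro mult_left_mono)
    have "- (Im a * Im (Ln z)) \<le> \<bar>Im a * Im (Ln z)\<bar>" by simp
    also have "\<dots> \<le> \<bar>Im a\<bar> * pi" unfolding abs_mult
      using mpi_less_Im_Ln[OF assms] Im_Ln_le_pi[OF assms] by (intro mult_left_mono) auto
    finally show "exp (- (Im a * Im (Ln z))) \<le> exp (pi * \<bar>Im a\<bar>)" by (simp add: mult.commute)
  qed auto
  finally show ?thesis .
qed

lemma norm_of_real_powr: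
  assumes "x > 0"
  shows "norm (complex_of_real x powr a) = x powr Re a"
  using assms by (simp add: norm_powr_real_powr)

text \<open>The identity theorem in the shape used throughout, with the midpoint of the segment as
  limit point. Identities are established for real parameters or along a line and carried from there
  to the whole domain.\<close>

lemma holomorphic_eq_on_segment:
  assumes "f holomorphic_on S" "g holomorphic_on S" "open S" "connected S"
    and lr: "l < r" and v: "v \<noteq> 0"
    and eq: "\<And>t. l < t \<Longrightarrow> t < r \<Longrightarrow> p + of_real t * v \<in> S \<and> f (p + of_real t * v) = g (p + of_real t * v)"
    and "z \<in> S"
  shows "f z = (g z :: complex)"
proof -
  define m where "m = (l + r) / 2"
  have m: "l < m" "m < r" using lr by (auto simp: m_def)
  define U where "U = (\<lambda>t. p + of_real t * v) ` {l<..<r}"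
  have lim: "(p + of_real m * v) islimpt U"
    unfolding islimpt_approachable
  proof (intro allI impI)
    fix e :: real assume e: "e > 0"
    \<comment> \<open>At most half of the way from the midpoint to the end of the segment, and short
      enough for a displacement by \<open>d * v\<close> to stay below e.\<close>
    define d where "d = min ((r - m) / 2) (e / (2 * norm v))"
    have d: "d > 0" "d < r - m" "d * norm v < e"
    proof -
      show "d > 0" using m e v by (simp add: d_def)
      have "d \<le> (r - m) / 2" unfolding d_def by (rule min.cobounded1)
      thus "d < r - m" using m by simp
      have "d * norm v \<le> e / (2 * norm v) * norm v"
        by (intro mult_right_mono) (auto simp: d_def)
      also have "\<dots> < e" using e v by simp
      finally show "d * norm v < e" .
    qed
    have "p + of_real (m + d) * v \<in> U" unfolding U_def by (rule imageI) (use m d in auto)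
    moreover have "p + of_real (m + d) * v - (p + of_real m * v) = of_real d * v"
      by (simp add: algebra_simps)
    ultimately show "\<exists>x'\<in>U. x' \<noteq> p + of_real m * v \<and> dist x' (p + of_real m * v) < e"
      using d v by (intro bexI[of _ "p + of_real (m + d) * v"]) (auto simp: dist_norm norm_mult)
  qed
  have "f z - g z = 0"
    by (rule analytic_continuation[of "\<lambda>z. f z - g z" S U "p + of_real m * v"])
       (use assms lim m in \<open>auto simp: U_def intro!: holomorphic_intros\<close>)
  thus ?thesis by simp
qed

lemma continuous_on_of_real_powr:
  assumes "\<And>x. x \<in> A \<Longrightarrow> g x > 0" "continuous_on A g"
  shows "continuous_on A (\<lambda>x. complex_of_real (g x) powr a)"
proof -
  have "continuous_on A (\<lambda>x. exp (a * complex_of_real (ln (g x))))"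
    by (intro continuous_intros assms) (use assms in force)
  thus ?thesis
    by (rule continuous_on_eq) (use assms(1) in \<open>force simp: powr_def Ln_of_real\<close>)
qed

section \<open>Gamma and Beta integrals with complex parameters\<close>

lemma set_integrable_powr_exp:
  assumes "r > 0" "c > (0::real)"
  shows "set_integrable lborel {0<..} (\<lambda>s::real. s powr (r - 1) * exp (- c * s))"
proof -
  have "(\<lambda>t. complex_of_real t powr (of_real r - 1) / of_real (exp (c * t))) absolutely_integrable_on {0<..}"
    using absolutely_integrable_Gamma_integral[of "of_real r" c] assms by simp
  hence "set_integrable lborel {0<..} (\<lambda>t. complex_of_real t powr (of_real r - 1) / of_real (exp (c * t)))"
    unfolding set_integrable_def
    by (subst (asm) integrable_completion)
       (auto intro!: borel_measurable_continuous_on_indicator continuous_intros continuous_on_of_real_powr)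
  hence "set_integrable lborel {0<..} (\<lambda>t. norm (complex_of_real t powr (of_real r - 1) / of_real (exp (c * t))))"
    by (rule set_integrable_norm)
  thus ?thesis
    by (rule set_integrable_cong[THEN iffD1, rotated -1])
       (auto simp: norm_divide norm_of_real_powr exp_minus field_simps)
qed

lemma set_integrable_powr_exp_complex:
  assumes "Re a > 0" "Re z > 0"
  shows "set_integrable lborel {0<..} (\<lambda>s. of_real s powr (a - 1) * exp (- z * of_real s))"
  by (rule set_integrable_dominated[OF set_integrable_powr_exp[OF assms]])
     (auto intro!: continuous_intros continuous_on_of_real_powr simp: norm_mult norm_of_real_powr)

lemma Re_ge_half_on_ball:
  assumes "z \<in> ball z0 (Re z0 / 2)"
  shows "Re z \<ge> Re z0 / 2"
proof -
  have "\<bar>Re (z0 - z)\<bar> < Re z0 / 2" using assms abs_Re_le_cmod[of "z0 - z"] by (simp add: dist_norm)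
  thus ?thesis by (simp add: abs_if split: if_splits)
qed

text \<open>For real z = t the scaling of s by t reduces the integral to Euler's; both sides are
  holomorphic in z for Re z > 0, so a real segment suffices.\<close>

lemma Gamma_set_integral:
  assumes a: "Re a > 0" and z: "Re z > 0"
  shows "(LINT s:{0<..}|lborel. of_real s powr (a - 1) * exp (- z * of_real s)) = Gamma a * z powr (- a)"
proof (rule holomorphic_eq_on_segment[where f = "\<lambda>z. LINT s:{0<..}|lborel. of_real s powr (a - 1) * exp (- z * of_real s)"
      and g = "\<lambda>z. Gamma a * z powr (- a)" and S = "{z. Re z > 0}" and l = 1 and r = 2 and v = 1 and p = 0])
  show "open {z. Re z > 0}" "connected {z. Re z > 0}"
    by (simp_all add: open_halfspace_Re_gt convex_connected convex_halfspace_Re_gt)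
  show "(\<lambda>z. Gamma a * z powr - a) holomorphic_on {z. Re z > 0}"
    by (intro holomorphic_intros) (auto simp: complex_nonpos_Reals_iff)
  show "(\<lambda>z. LINT s:{0<..}|lborel. of_real s powr (a - 1) * exp (- z * of_real s)) holomorphic_on {z. Re z > 0}"
  proof (rule holomorphic_on_set_integral)
    fix z0 assume z0: "z0 \<in> {z. Re z > 0}"
    define c where "c = Re z0 / 2"
    have c: "c > 0" using z0 by (simp add: c_def)
    have "norm (of_real s powr (a - 1) * exp (- z * of_real s)) \<le> s powr (Re a - 1) * exp (- c * s)"
      if "z \<in> ball z0 c" "s > 0" for z s
    proof -
      have "c \<le> Re z" using Re_ge_half_on_ball that unfolding c_def by blast
      thus ?thesis using that by (auto simp: norm_mult norm_of_real_powr intro!: mult_left_mono mult_right_mono)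
    qed
    with c set_integrable_powr_exp[OF a c]
    show "\<exists>d>0. \<exists>h. set_integrable lborel {0<..} h \<and> (\<forall>z\<in>ball z0 d \<inter> {z. 0 < Re z}.
        \<forall>x\<in>{0<..}. norm (of_real x powr (a - 1) * exp (- z * of_real x)) \<le> h x)"
      by blast
  qed (auto intro!: holomorphic_intros continuous_intros continuous_on_of_real_powr simp: open_halfspace_Re_gt)
  fix t :: real assume t: "1 < t" "t < 2"
  have "(LINT s:{0<..}|lborel. of_real s powr (a - 1) * exp (- of_real s)) =
    (LINT s:{0<..}|lborel. of_real (t powr 1) * of_real (t * s) powr (a - 1) * exp (- of_real (t * s)))"
  proof (rule set_integral_substitution(2)[where g = "\<lambda>s. t * s" and h = "\<lambda>_. t"])
    show "(*) t ` {0<..} = {0<..}"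
    proof
      show "{0<..} \<subseteq> (*) t ` {0<..}"
        using t by (intro subsetI, rule_tac x = "x / t" in image_eqI) auto
    qed (use t in auto)
  qed (use t in \<open>auto intro!: derivative_eq_intros inj_onI continuous_intros continuous_on_of_real_powr\<close>)
  also have "\<dots> = (LINT s:{0<..}|lborel. of_real t powr a * (of_real s powr (a - 1) * exp (- of_real t * of_real s)))"
    using t by (intro set_lebesgue_integral_cong) (auto simp: powr_times_real powr_diff field_simps)
  also have "\<dots> = of_real t powr a * (LINT s:{0<..}|lborel. of_real s powr (a - 1) * exp (- of_real t * of_real s))"
    by simp
  finally have *: "(LINT s:{0<..}|lborel. of_real s powr (a - 1) * exp (- of_real s)) = \<dots>" .
  have "(LINT s:{0<..}|lborel. of_real s powr (a - 1) * exp (- of_real s)) =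
     integral {0<..} (\<lambda>s. of_real s powr (a - 1) * exp (- of_real s))"
    using set_borel_integral_eq_integral(2)[OF set_integrable_powr_exp_complex[OF a, of 1]] by simp
  also have "\<dots> = Gamma a"
    using integral_unique[OF Gamma_integral_complex'[OF a]]
    by (simp add: exp_minus field_simps exp_of_real)
  finally have "Gamma a = of_real t powr a * (LINT s:{0<..}|lborel. of_real s powr (a - 1) * exp (- of_real t * of_real s))"
    using * by simp
  thus "0 + of_real t * 1 \<in> {z. 0 < Re z} \<and>
    (LINT s:{0<..}|lborel. of_real s powr (a - 1) * exp (- (0 + of_real t * 1) * of_real s)) =
         Gamma a * (0 + complex_of_real t * 1) powr - a"
    using t by (simp add: powr_minus field_simps)
qed (use z in auto)

lemma set_integrable_Beta:
  assumes "a > 0" "b > 0"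
  shows "set_integrable lborel {0<..<1} (\<lambda>x::real. x powr (a - 1) * (1 - x) powr (b - 1))"
  by (rule set_integrable_subset[OF integrable_Beta[OF assms]]) auto

lemma set_integrable_Beta_complex:
  assumes "Re a > 0" "Re b > 0"
  shows "set_integrable lborel {0<..<1} (\<lambda>x. complex_of_real x powr (a - 1) * of_real (1 - x) powr (b - 1))"
  by (rule set_integrable_dominated[OF set_integrable_Beta[OF assms]])
     (auto intro!: continuous_intros continuous_on_of_real_powr simp: norm_mult norm_of_real_powr
           simp del: of_real_diff)

lemma Beta_set_integral_holomorphic:
  assumes "Re b > 0"
  shows "(\<lambda>a. LINT x:{0<..<1}|lborel. complex_of_real x powr (a - 1) * of_real (1 - x) powr (b - 1)) holomorphic_on {a. Re a > 0}"
proof (rule holomorphic_on_set_integral)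
  fix a0 assume a0: "a0 \<in> {a. Re a > 0}"
  define c where "c = Re a0 / 2"
  have c: "c > 0" using a0 by (simp add: c_def)
  have "norm (complex_of_real x powr (a - 1) * of_real (1 - x) powr (b - 1)) \<le> x powr (c - 1) * (1 - x) powr (Re b - 1)"
    if "a \<in> ball a0 c" "x \<in> {0<..<1}" for a x
  proof -
    have "c \<le> Re a" using Re_ge_half_on_ball that unfolding c_def by blast
    hence "x powr (Re a - 1) \<le> x powr (c - 1)" using that by (intro powr_mono') auto
    thus ?thesis using that by (auto simp: norm_mult norm_of_real_powr simp del: of_real_diff intro!: mult_right_mono)
  qed
  with c set_integrable_Beta[OF c assms]
  show "\<exists>d>0. \<exists>h. set_integrable lborel {0<..<1} h \<and> (\<forall>z\<in>ball a0 d \<inter> {a. 0 < Re a}.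
        \<forall>x\<in>{0<..<1}. norm (complex_of_real x powr (z - 1) * of_real (1 - x) powr (b - 1)) \<le> h x)"
    by blast
qed (auto intro!: holomorphic_intros continuous_intros continuous_on_of_real_powr
       simp: open_halfspace_Re_gt simp del: of_real_diff)

lemma nonpos_Ints_Re_pos: "Re z > 0 \<Longrightarrow> z \<notin> \<int>\<^sub>\<le>\<^sub>0"
  by (auto elim!: nonpos_Ints_cases)

text \<open>Starting from real parameters, continuation in the first one makes it complex. The
  reflection x -> 1 - x exchanges the parameters, so the same continuation can then be applied to
  the other.\<close>

lemma Beta_set_integral:
  assumes a: "Re a > 0" and b: "Re b > 0"
  shows "(LINT x:{0<..<1}|lborel. complex_of_real x powr (a - 1) * of_real (1 - x) powr (b - 1)) = Beta a b"
proof -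
  let ?I = "\<lambda>a b. LINT x:{0<..<1}|lborel. complex_of_real x powr (a - 1) * of_real (1 - x) powr (b - 1)"
  have real: "?I (of_real r) (of_real s) = Beta (of_real r) (of_real s)" if "r > 0" "s > 0" for r s
  proof -
    have "?I (of_real r) (of_real s) = (LINT x:{0<..<1}|lborel. of_real (x powr (r - 1) * (1 - x) powr (s - 1)))"
    proof (intro set_lebesgue_integral_cong allI impI)
      fix x :: real assume x: "x \<in> {0<..<1}"
      have e: "complex_of_real r - 1 = of_real (r - 1)" "complex_of_real s - 1 = of_real (s - 1)" by simp_all
      show "complex_of_real x powr (of_real r - 1) * of_real (1 - x) powr (of_real s - 1) =
         of_real (x powr (r - 1) * (1 - x) powr (s - 1))"
        unfolding e using x by (subst (1 2) powr_of_real) auto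
    qed auto
    also have "\<dots> = of_real (LINT x:{0<..<1}|lborel. x powr (r - 1) * (1 - x) powr (s - 1))"
      by (rule set_integral_complex_of_real)
    also have "(LINT x:{0<..<1}|lborel. x powr (r - 1) * (1 - x) powr (s - 1)) =
      integral {0<..<1} (\<lambda>x. x powr (r - 1) * (1 - x) powr (s - 1))"
      by (rule set_borel_integral_eq_integral(2)[OF set_integrable_Beta[OF that]])
    also have "\<dots> = integral {0..1} (\<lambda>x. x powr (r - 1) * (1 - x) powr (s - 1))"
      by (simp add: integral_open_interval_real)
    also have "\<dots> = Beta r s" using has_integral_Beta_real[OF that] by (rule integral_unique)
    finally show ?thesis by (simp add: Beta_complex_of_real)
  qed
  have op: "open {z. Re z > 0}" "connected {z. Re z > 0}"
    by (simp_all add: open_halfspace_Re_gt convex_connected convex_halfspace_Re_gt)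
  have holB: "(\<lambda>a. Beta a b) holomorphic_on {z. Re z > 0}" if "Re b > 0" for b
    using that by (intro holomorphic_intros) (auto intro!: nonpos_Ints_Re_pos)
  have 1: "?I a (of_real s) = Beta a (of_real s)" if "Re a > 0" "s > 0" for a s
    by (rule holomorphic_eq_on_segment[OF Beta_set_integral_holomorphic holB op, of _ _ 1 2 1 0])
       (use that real[of _ s] in auto)
  have sym: "?I a b = ?I b a" for a b
  proof (rule set_integral_substitution(2)[where g = "\<lambda>x. 1 - x" and h = "\<lambda>_. -1"])
    show "(-) 1 ` {0<..<1::real} = {0<..<1}"
    proof
      show "{0<..<1} \<subseteq> (-) 1 ` {0<..<1::real}"
        by (intro subsetI, rule_tac x = "1 - x" in image_eqI) auto
    qed auto
  qed (auto intro!: derivative_eq_intros inj_onI continuous_intros continuous_on_of_real_powr simp del: of_real_diff)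
  have left: "?I (of_real s) a = Beta (of_real s) a" if "s > 0" for s
    using sym[of "of_real s" a] 1[of a s] Beta_commute[of "of_real s" a] a that by simp
  have 2: "?I b a = Beta b a"
    by (rule holomorphic_eq_on_segment[OF Beta_set_integral_holomorphic holB op, of _ _ 1 2 1 0])
       (use a b left in auto)
  thus ?thesis using sym[of a b] Beta_commute[of a b] by simp
qed

text \<open>A power is monotone in one direction or the other according to the sign of r; the sum of
  the endpoint values covers both cases.\<close>

lemma powr_le_sum_endpoints:
  assumes "0 < d" "d \<le> x" "x \<le> M"
  shows "x powr r \<le> d powr r + M powr (r::real)"
proof (cases "r \<ge> 0")
  case True
  hence "x powr r \<le> M powr r" using assms by (intro powr_mono2) auto
  thus ?thesis by (simp add: add_increasing)
next
  case False
  hence "x powr r \<le> d powr r" using assms by (intro powr_mono2') auto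
  thus ?thesis by (simp add: add_increasing2)
qed

lemma continuous_on_powr_const:
  assumes "continuous_on A f" "\<And>x. x \<in> A \<Longrightarrow> f x \<notin> \<real>\<^sub>\<le>\<^sub>0"
  shows "continuous_on A (\<lambda>x. f x powr (a::complex))"
proof -
  have "continuous_on A (\<lambda>x. exp (a * Ln (f x)))"
    by (intro continuous_intros assms)
  thus ?thesis
    by (rule continuous_on_eq) (use assms(2) in \<open>force simp: powr_def\<close>)
qed

section \<open>The regularised hypergeometric function\<close>

definition hyp_coeff :: "complex \<Rightarrow> complex \<Rightarrow> complex \<Rightarrow> nat \<Rightarrow> complex" where
  "hyp_coeff a b c n = pochhammer a n * pochhammer b n * rGamma (c + of_nat n) / fact n"

lemma hyp_series_altdef: "hyp_series a b c w = (\<Sum>n. hyp_coeff a b c n * w ^ n)"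
  by (simp add: hyp_series_def hyp_coeff_def)

lemma hyp_coeff_Suc:
  "hyp_coeff a b c (Suc n) * ((c + of_nat n) * of_nat (Suc n)) =
     hyp_coeff a b c n * ((a + of_nat n) * (b + of_nat n))"
proof -
  have "rGamma (c + of_nat n) = (c + of_nat n) * rGamma (c + of_nat (Suc n))"
    using rGamma_plus1[of "c + of_nat n"] by (simp add: add_ac)
  thus ?thesis
    by (simp add: hyp_coeff_def pochhammer_Suc field_simps del: of_nat_Suc)
qed

lemma hyp_coeff_diffs:
  "of_nat (Suc n) * hyp_coeff a b c (Suc n) = a * b * hyp_coeff (a + 1) (b + 1) (c + 1) n"
proof -
  have e: "c + of_nat (Suc n) = c + 1 + of_nat n" by simp
  have "(of_nat (Suc n) :: complex) \<noteq> 0" by (simp del: of_nat_Suc)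
  thus ?thesis unfolding hyp_coeff_def pochhammer_rec fact_Suc e
    by (simp add: field_simps del: of_nat_Suc)
qed

text \<open>The ratio of consecutive coefficients is at most (n + A)^2 / ((n - A) (n + 1)) for n >
  A, uniformly in the parameters, and this tends to 1 < R. The finitely many earlier coefficients
  are bounded because \<open>rGamma\<close> is entire and hence bounded on a disc; c may therefore
  be a pole of \<Gamma>.\<close>

lemma hyp_coeff_bound:
  fixes A R :: real
  assumes A: "A \<ge> 0" and R: "R > 1"
  obtains B where "\<And>a b c n. norm a \<le> A \<Longrightarrow> norm b \<le> A \<Longrightarrow> norm c \<le> A \<Longrightarrow> norm (hyp_coeff a b c n) \<le> B * R ^ n"
proof -
  have "((\<lambda>n. (real n + A)\<^sup>2 / ((real n - A) * (real n + 1))) \<longlongrightarrow> 1) sequentially"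
    by real_asymp
  hence "eventually (\<lambda>n. (real n + A)\<^sup>2 / ((real n - A) * (real n + 1)) < R) sequentially"
    using R by (rule order_tendstoD)
  moreover have "eventually (\<lambda>n. real n > A) sequentially" by real_asymp
  ultimately have "eventually (\<lambda>n. (real n + A)\<^sup>2 / ((real n - A) * (real n + 1)) < R \<and> real n > A) sequentially"
    by eventually_elim auto
  then obtain n0 where n0: "\<And>n. n \<ge> n0 \<Longrightarrow> (real n + A)\<^sup>2 / ((real n - A) * (real n + 1)) < R \<and> real n > A"
    by (auto simp: eventually_sequentially)
  have "bounded (rGamma ` cball (0::complex) (A + real n0))"
    by (intro compact_imp_bounded compact_continuous_image holomorphic_on_imp_continuous_on
        holomorphic_rGamma) auto
  then obtain K where K: "K > 0" "\<And>z. norm z \<le> A + real n0 \<Longrightarrow> norm (rGamma (z::complex)) \<le> K"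
    by (auto simp: bounded_pos)
  have poch: "norm (pochhammer a n) \<le> pochhammer A n" if "norm a \<le> A" for a :: complex and n
    unfolding pochhammer_prod prod_norm [symmetric]
    by (rule prod_mono) (use that in \<open>auto intro: order_trans[OF norm_triangle_ineq]\<close>)
  define B where "B = (\<Sum>n\<le>n0. pochhammer A n * pochhammer A n * K / fact n)"
  have pos: "pochhammer A n * pochhammer A n * K / fact n \<ge> 0" for n
    using K by (simp add: divide_nonneg_pos)
  have B: "B \<ge> 0" unfolding B_def by (intro sum_nonneg pos)
  have low: "norm (hyp_coeff a b c n) \<le> B" if "norm a \<le> A" "norm b \<le> A" "norm c \<le> A" "n \<le> n0" for a b c n
  proof -
    have "norm (c + of_nat n) \<le> norm c + norm (of_nat n :: complex)" by (rule norm_triangle_ineq)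
    also have "\<dots> \<le> A + real n0" using that by auto
    finally have "norm (rGamma (c + of_nat n)) \<le> K" by (rule K)
    hence "norm (hyp_coeff a b c n) \<le> pochhammer A n * pochhammer A n * K / fact n"
      unfolding hyp_coeff_def norm_mult norm_divide norm_fact
      using poch[of a n] poch[of b n] that K
      by (intro divide_right_mono mult_mono mult_nonneg_nonneg) (auto intro: order_trans[OF norm_ge_zero poch])
    also have "\<dots> \<le> B" unfolding B_def
      by (rule member_le_sum[of n "{..n0}" "\<lambda>n. pochhammer A n * pochhammer A n * K / fact n"]) (use that pos in auto)
    finally show ?thesis .
  qed
  have high: "norm (hyp_coeff a b c (n0 + k)) \<le> B * R ^ k" if abc: "norm a \<le> A" "norm b \<le> A" "norm c \<le> A" for a b c k
  proof (induction k)
    case 0 thus ?case using low[OF abc, of n0] by simp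
  next
    case (Suc k)
    define n where "n = n0 + k"
    have n: "real n > A" "(real n + A)\<^sup>2 / ((real n - A) * (real n + 1)) < R"
      using n0[of n] by (auto simp: n_def)
    have l: "real n - A \<le> norm (c + of_nat n)"
      using norm_triangle_ineq2[of "of_nat n" "- c"] abc by (simp add: add.commute)
    have u: "norm (a + of_nat n) \<le> real n + A" "norm (b + of_nat n) \<le> real n + A"
      using norm_triangle_ineq[of a "of_nat n"] norm_triangle_ineq[of b "of_nat n"] abc by auto
    have "norm (hyp_coeff a b c (Suc n)) * ((real n - A) * (real n + 1)) \<le>
          norm (hyp_coeff a b c (Suc n)) * (norm (c + of_nat n) * (real n + 1))"
      using l n A by (intro mult_left_mono mult_right_mono) auto
    also have "\<dots> = norm (hyp_coeff a b c (Suc n) * ((c + of_nat n) * of_nat (Suc n)))"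
      by (simp only: norm_mult norm_of_nat) (simp add: add.commute)
    also have "\<dots> = norm (hyp_coeff a b c n) * (norm (a + of_nat n) * norm (b + of_nat n))"
      unfolding hyp_coeff_Suc by (simp add: norm_mult)
    also have "\<dots> \<le> norm (hyp_coeff a b c n) * (real n + A)\<^sup>2"
      using u A n by (intro mult_left_mono) (auto simp: power2_eq_square intro!: mult_mono)
    finally have "norm (hyp_coeff a b c (Suc n)) \<le> norm (hyp_coeff a b c n) * ((real n + A)\<^sup>2 / ((real n - A) * (real n + 1)))"
      using n A by (simp only: times_divide_eq_right) (subst pos_le_divide_eq, auto)
    also have "\<dots> \<le> (B * R ^ k) * R"
      using Suc n R B by (intro mult_mono) (auto simp: n_def)
    finally show ?case by (simp add: n_def mult_ac)
  qed
  have "norm (hyp_coeff a b c n) \<le> B * R ^ n" if abc: "norm a \<le> A" "norm b \<le> A" "norm c \<le> A" for a b c n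
  proof (cases "n \<le> n0")
    case True
    have "B * 1 \<le> B * R ^ n" using R B by (intro mult_left_mono) auto
    with low[OF abc True] show ?thesis by simp
  next
    case False
    hence "norm (hyp_coeff a b c n) \<le> B * R ^ (n - n0)" using high[OF abc, of "n - n0"] by simp
    also have "\<dots> \<le> B * R ^ n" using R B by (intro mult_left_mono power_increasing) auto
    finally show ?thesis .
  qed
  thus ?thesis by (rule that)
qed

text \<open>With R = 1/p for some p between q and 1, \<open>hyp_coeff_bound\<close> leaves a
  geometric series of ratio q/p.\<close>

lemma hyp_coeff_majorant:
  fixes A q :: real
  assumes "A \<ge> 0" "0 \<le> q" "q < 1"
  obtains M where "summable M" and
    "\<And>a b c w n. norm a \<le> A \<Longrightarrow> norm b \<le> A \<Longrightarrow> norm c \<le> A \<Longrightarrow> norm w \<le> q \<Longrightarrow> norm (hyp_coeff a b c n * w ^ n) \<le> M n"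
proof -
  obtain p where p: "q < p" "p < 1" using assms dense by blast
  have p0: "p > 0" using p assms by simp
  obtain B where B: "\<And>a b c n. norm a \<le> A \<Longrightarrow> norm b \<le> A \<Longrightarrow> norm c \<le> A \<Longrightarrow> norm (hyp_coeff a b c n) \<le> B * (1 / p) ^ n"
    using hyp_coeff_bound[of A "1 / p"] p p0 assms by auto
  have "norm (q / p) < 1" using p p0 assms by simp
  hence "summable (\<lambda>n. B * (q / p) ^ n)" by (intro summable_mult summable_geometric)
  moreover have "norm (hyp_coeff a b c n * w ^ n) \<le> B * (q / p) ^ n"
    if "norm a \<le> A" "norm b \<le> A" "norm c \<le> A" "norm w \<le> q" for a b c w n
  proof -
    have "norm (hyp_coeff a b c n * w ^ n) = norm (hyp_coeff a b c n) * norm w ^ n" by (simp add: norm_mult norm_power)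
    also have "\<dots> \<le> (B * (1 / p) ^ n) * q ^ n"
      using that by (intro mult_mono B power_mono) (auto intro: order_trans[OF norm_ge_zero B])
    finally show ?thesis by (simp add: power_divide)
  qed
  ultimately show ?thesis using that by blast
qed

lemma summable_hyp_series:
  assumes "norm w < 1"
  shows "summable (\<lambda>n. hyp_coeff a b c n * w ^ n)"
proof -
  define A where "A = max (norm a) (max (norm b) (norm c))"
  have A: "A \<ge> 0" by (simp add: A_def max_def)
  obtain M where M: "summable M" "\<And>n. norm (hyp_coeff a b c n * w ^ n) \<le> M n"
  proof -
    obtain M where "summable M" and M: "\<And>a b c v n. norm a \<le> A \<Longrightarrow> norm b \<le> A \<Longrightarrow> norm c \<le> A \<Longrightarrow> norm v \<le> norm w
        \<Longrightarrow> norm (hyp_coeff a b c n * v ^ n) \<le> M n"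
      using hyp_coeff_majorant[OF A norm_ge_zero assms] by blast
    moreover have "norm a \<le> A" "norm b \<le> A" "norm c \<le> A" unfolding A_def by linarith+
    ultimately show ?thesis using that by blast
  qed
  show ?thesis by (rule summable_comparison_test'[OF M(1)]) (use M in auto)
qed

text \<open>Convergence is locally uniform in the parameters and the argument jointly, so all of
  them may vary with t. \<open>connection_theta\<close> needs this in order to continue in the
  parameters of the series.\<close>

lemma holomorphic_on_hyp_series:
  assumes S: "open S" and hol: "a holomorphic_on S" "b holomorphic_on S" "c holomorphic_on S" "w holomorphic_on S"
    and w: "\<And>t. t \<in> S \<Longrightarrow> norm (w t) < 1"
  shows "(\<lambda>t. hyp_series (a t) (b t) (c t) (w t)) holomorphic_on S"
proof (rule holomorphic_uniform_sequence[OF S, of "\<lambda>n t. \<Sum>i<n. hyp_coeff (a t) (b t) (c t) i * w t ^ i"])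
  show "(\<lambda>t. \<Sum>i<n. hyp_coeff (a t) (b t) (c t) i * w t ^ i) holomorphic_on S" for n
    unfolding hyp_coeff_def pochhammer_prod by (intro holomorphic_intros hol) auto
  fix t0 assume t0: "t0 \<in> S"
  then obtain d where d: "d > 0" "cball t0 d \<subseteq> S" using S open_contains_cball by blast
  have bdd: "\<exists>K. K \<ge> 0 \<and> (\<forall>t\<in>cball t0 d. norm (f t) \<le> K)" if "f holomorphic_on S" for f :: "complex \<Rightarrow> complex"
  proof -
    have "bounded (f ` cball t0 d)"
      by (intro compact_imp_bounded compact_continuous_image holomorphic_on_imp_continuous_on
          holomorphic_on_subset[OF that d(2)]) auto
    then obtain K where "K > 0" "\<forall>y\<in>f ` cball t0 d. norm y \<le> K" unfolding bounded_pos by blast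
    thus ?thesis by (intro exI[of _ K]) auto
  qed
  obtain K1 K2 K3 where K: "K1 \<ge> 0" "\<forall>t\<in>cball t0 d. norm (a t) \<le> K1" "\<forall>t\<in>cball t0 d. norm (b t) \<le> K2"
    "\<forall>t\<in>cball t0 d. norm (c t) \<le> K3"
    using bdd[OF hol(1)] bdd[OF hol(2)] bdd[OF hol(3)] by blast
  define A where "A = max K1 (max K2 K3)"
  have A: "A \<ge> 0" using K by (simp add: A_def max_def)
  have cw: "continuous_on (cball t0 d) (\<lambda>t. norm (w t))"
    using holomorphic_on_imp_continuous_on[OF holomorphic_on_subset[OF hol(4) d(2)]]
    by (intro continuous_intros)
  obtain t1 where t1: "t1 \<in> cball t0 d" "\<forall>t\<in>cball t0 d. norm (w t) \<le> norm (w t1)"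
    using continuous_attains_sup[OF _ _ cw] d by auto
  have q: "norm (w t1) < 1" using t1 d w by blast
  obtain M where M: "summable M" "\<And>a b c v n. norm a \<le> A \<Longrightarrow> norm b \<le> A \<Longrightarrow> norm c \<le> A \<Longrightarrow> norm v \<le> norm (w t1) \<Longrightarrow> norm (hyp_coeff a b c n * v ^ n) \<le> M n"
    using hyp_coeff_majorant[OF A norm_ge_zero q] by blast
  have "uniform_limit (cball t0 d) (\<lambda>n t. \<Sum>i<n. hyp_coeff (a t) (b t) (c t) i * w t ^ i)
           (\<lambda>t. hyp_series (a t) (b t) (c t) (w t)) sequentially"
    unfolding hyp_series_altdef
  proof (rule Weierstrass_m_test[OF _ M(1)])
    fix n t assume t: "t \<in> cball t0 d"
    have "norm (a t) \<le> K1" "norm (b t) \<le> K2" "norm (c t) \<le> K3" using K t by auto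
    hence "norm (a t) \<le> A" "norm (b t) \<le> A" "norm (c t) \<le> A"
      unfolding A_def by linarith+
    thus "norm (hyp_coeff (a t) (b t) (c t) n * w t ^ n) \<le> M n"
      using t1 t by (intro M(2)) auto
  qed
  with d show "\<exists>d>0. cball t0 d \<subseteq> S \<and> uniform_limit (cball t0 d)
            (\<lambda>n t. \<Sum>i<n. hyp_coeff (a t) (b t) (c t) i * w t ^ i)
            (\<lambda>t. hyp_series (a t) (b t) (c t) (w t)) sequentially"
    by blast
qed

lemma hyp_series_deriv:
  assumes "norm w < 1"
  shows "(hyp_series a b c has_field_derivative a * b * hyp_series (a + 1) (b + 1) (c + 1) w) (at w)"
proof -
  have "diffs (hyp_coeff a b c) n = a * b * hyp_coeff (a + 1) (b + 1) (c + 1) n" for n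
    by (simp add: diffs_def hyp_coeff_diffs del: of_nat_Suc)
  hence "(\<Sum>n. diffs (hyp_coeff a b c) n * w ^ n) = (\<Sum>n. a * b * (hyp_coeff (a + 1) (b + 1) (c + 1) n * w ^ n))"
    by (simp add: mult_ac)
  also have "\<dots> = a * b * hyp_series (a + 1) (b + 1) (c + 1) w"
    unfolding hyp_series_altdef by (rule suminf_mult[OF summable_hyp_series[OF assms]])
  finally show ?thesis
    using termdiffs_strong'[OF summable_hyp_series assms, of a b c]
    by (simp add: hyp_series_altdef[abs_def])
qed

text \<open>The operator w d/dw + c - 1 multiplies the n-th coefficient by c - 1 + n, which turns
  1/\<Gamma>(c + n) into 1/\<Gamma>(c - 1 + n).\<close>

lemma hyp_series_lower_c:
  assumes "norm w < 1"
  shows "hyp_series a b (c - 1) w = (c - 1) * hyp_series a b c w + w * (a * b * hyp_series (a + 1) (b + 1) (c + 1) w)"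
proof -
  let ?h = "hyp_coeff a b c"
  have s1: "summable (\<lambda>n. ?h n * w ^ n)" by (rule summable_hyp_series[OF assms])
  have s2: "(\<lambda>n. diffs ?h n * w ^ n) sums (a * b * hyp_series (a + 1) (b + 1) (c + 1) w)"
  proof -
    have "(\<lambda>n. a * b * (hyp_coeff (a + 1) (b + 1) (c + 1) n * w ^ n)) sums (a * b * hyp_series (a + 1) (b + 1) (c + 1) w)"
      unfolding hyp_series_altdef by (intro sums_mult summable_sums summable_hyp_series assms)
    moreover have "diffs ?h n * w ^ n = a * b * (hyp_coeff (a + 1) (b + 1) (c + 1) n * w ^ n)" for n
      by (simp add: diffs_def hyp_coeff_diffs del: of_nat_Suc)
    ultimately show ?thesis by (simp only:)
  qed
  have s3: "(\<lambda>n. of_nat n * ?h n * w ^ n) sums (w * (a * b * hyp_series (a + 1) (b + 1) (c + 1) w))"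
  proof -
    have "(\<lambda>n. of_nat (Suc n) * ?h (Suc n) * w ^ Suc n) sums (w * (a * b * hyp_series (a + 1) (b + 1) (c + 1) w))"
      using sums_mult[OF s2, of w] by (simp add: diffs_def mult_ac)
    thus ?thesis by (subst (asm) sums_Suc_iff) simp
  qed
  have "(\<lambda>n. (c - 1) * (?h n * w ^ n) + of_nat n * ?h n * w ^ n) sums
      ((c - 1) * hyp_series a b c w + w * (a * b * hyp_series (a + 1) (b + 1) (c + 1) w))"
    unfolding hyp_series_altdef[of a b c] by (intro sums_add sums_mult summable_sums[OF s1] s3)
  moreover have "(c - 1) * (?h n * w ^ n) + of_nat n * ?h n * w ^ n = hyp_coeff a b (c - 1) n * w ^ n" for n
  proof -
    have "rGamma (c - 1 + of_nat n) = (c - 1 + of_nat n) * rGamma (c + of_nat n)"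
      using rGamma_plus1[of "c - 1 + of_nat n"] by (simp add: algebra_simps)
    hence hc: "hyp_coeff a b (c - 1) n = (c - 1 + of_nat n) * ?h n"
      by (simp only: hyp_coeff_def) simp
    show ?thesis unfolding hc by (simp add: algebra_simps)
  qed
  ultimately have "(\<lambda>n. hyp_coeff a b (c - 1) n * w ^ n) sums
      ((c - 1) * hyp_series a b c w + w * (a * b * hyp_series (a + 1) (b + 1) (c + 1) w))"
    by (simp only:)
  thus ?thesis unfolding hyp_series_altdef[of a b "c - 1"] by (rule sums_unique[symmetric])
qed

section \<open>Analytic continuation of the series to the cut plane\<close>

definition cutplane :: "complex set" where
  "cutplane = - complex_of_real ` {1..}"

lemma cutplane_iff: "w \<in> cutplane \<longleftrightarrow> 1 - w \<notin> \<real>\<^sub>\<le>\<^sub>0"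
  by (auto simp: cutplane_def complex_nonpos_Reals_iff complex_eq_iff image_iff)

lemma open_cutplane: "open cutplane"
proof -
  have "cutplane = (\<lambda>w. 1 - w) -` (- \<real>\<^sub>\<le>\<^sub>0)" by (auto simp: cutplane_iff)
  moreover have "open ((\<lambda>w::complex. 1 - w) -` (- \<real>\<^sub>\<le>\<^sub>0))"
    by (intro open_vimage continuous_intros) (simp add: open_Compl)
  ultimately show ?thesis by simp
qed

lemma cutplane_scale:
  assumes "w \<in> cutplane" "0 \<le> s" "s \<le> 1"
  shows "of_real s * w \<in> cutplane"
proof (rule ccontr)
  assume "\<not> ?thesis"
  hence *: "s * Im w = 0" "s * Re w \<ge> 1" by (auto simp: cutplane_iff complex_nonpos_Reals_iff)
  hence "s \<noteq> 0" by auto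
  hence "Im w = 0" "s > 0" using * assms by auto
  moreover have "Re w \<ge> 1"
  proof (rule ccontr)
    assume "\<not> Re w \<ge> 1"
    hence "s * Re w < s * 1" using \<open>s > 0\<close> by (intro mult_strict_left_mono) auto
    thus False using * assms by simp
  qed
  ultimately show False using assms(1) by (auto simp: cutplane_iff complex_nonpos_Reals_iff)
qed

text \<open>Besides the connectedness that makes continuations unique, starlikeness provides the
  primitives used in \<open>hyp_series_continuation_exists\<close>.\<close>

lemma starlike_cutplane: "starlike cutplane"
  unfolding starlike_def
proof (intro bexI ballI subsetI)
  show "0 \<in> cutplane" by (simp add: cutplane_iff complex_nonpos_Reals_iff)
  fix w x assume w: "w \<in> cutplane" and "x \<in> closed_segment 0 w"
  then obtain u where "0 \<le> u" "u \<le> 1" "x = of_real u * w"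
    by (auto simp: closed_segment_def scaleR_conv_of_real)
  thus "x \<in> cutplane" using cutplane_scale w by blast
qed

lemma connected_cutplane: "connected cutplane"
  by (rule starlike_imp_connected[OF starlike_cutplane])

lemma ball_subset_cutplane: "norm w < 1 \<Longrightarrow> w \<in> cutplane"
  using complex_Re_le_cmod[of w] by (auto simp: cutplane_iff complex_nonpos_Reals_iff)

text \<open>For w in a compact disc and s in the closed unit interval, |1 - w s| lies between two
  positive constants by compactness. The power of 1 - w s is therefore bounded, and the Beta weight
  alone dominates the integrand.\<close>

lemma Euler_integral_holomorphic:
  assumes b: "Re b > 0" and d: "Re d > 0"
  shows "(\<lambda>w. LINT s:{0<..<1}|lborel. complex_of_real s powr (b - 1) * of_real (1 - s) powr (d - 1) *
            (1 - w * of_real s) powr (- a)) holomorphic_on cutplane"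
proof (rule holomorphic_on_set_integral[OF open_cutplane])
  have nn: "1 - w * of_real s \<notin> \<real>\<^sub>\<le>\<^sub>0" if "w \<in> cutplane" "s \<in> {0<..<1}" for w s
    using cutplane_scale[of w s] that by (auto simp: cutplane_iff mult.commute)
  show "continuous_on {0<..<1} (\<lambda>s. complex_of_real s powr (b - 1) * of_real (1 - s) powr (d - 1) *
            (1 - w * of_real s) powr (- a))" if "w \<in> cutplane" for w
    using nn[OF that]
    by (intro continuous_intros continuous_on_of_real_powr continuous_on_powr_const) auto
  show "(\<lambda>w. complex_of_real s powr (b - 1) * of_real (1 - s) powr (d - 1) *
            (1 - w * of_real s) powr (- a)) holomorphic_on cutplane" if "s \<in> {0<..<1}" for s
    using nn that by (intro holomorphic_intros) auto
  fix w0 assume w0: "w0 \<in> cutplane"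
  then obtain e where e: "e > 0" "cball w0 e \<subseteq> cutplane" using open_cutplane open_contains_cball by blast
  let ?K = "cball w0 e \<times> {0..1::real}"
  have cK: "compact ?K" "?K \<noteq> {}" using e by (auto intro!: compact_Times)
  have cont: "continuous_on ?K (\<lambda>(w,s). norm (1 - w * of_real s))"
    unfolding case_prod_beta by (intro continuous_intros)
  obtain p where p: "p \<in> ?K" "\<And>q. q \<in> ?K \<Longrightarrow> (case p of (w,s) \<Rightarrow> norm (1 - w * of_real s)) \<le> (case q of (w,s) \<Rightarrow> norm (1 - w * of_real s))"
    using continuous_attains_inf[OF cK cont] by blast
  obtain q :: "complex \<times> real" where q: "\<And>p. p \<in> ?K \<Longrightarrow> (case p of (w,s) \<Rightarrow> norm (1 - w * of_real s)) \<le> (case q of (w,s) \<Rightarrow> norm (1 - w * of_real s))"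
    using continuous_attains_sup[OF cK cont] by blast
  define dl where "dl = (case p of (w,s) \<Rightarrow> norm (1 - w * of_real s))"
  define M where "M = (case q of (w,s) \<Rightarrow> norm (1 - w * of_real s))"
  have dl: "dl > 0"
  proof -
    obtain w s where ws: "p = (w, s)" by force
    hence "of_real s * w \<in> cutplane" using p(1) e by (intro cutplane_scale) auto
    hence "1 - w * of_real s \<noteq> 0" by (auto simp: cutplane_iff mult.commute)
    thus ?thesis by (simp add: dl_def ws)
  qed
  have rng: "dl \<le> norm (1 - w * of_real s)" "norm (1 - w * of_real s) \<le> M" if "w \<in> cball w0 e" "s \<in> {0<..<1}" for w s
    using p(2)[of "(w,s)"] q[of "(w,s)"] that by (auto simp: dl_def M_def)
  define C where "C = (dl powr Re (-a) + M powr Re (-a)) * exp (pi * \<bar>Im (-a)\<bar>)"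
  have "norm (complex_of_real s powr (b - 1) * of_real (1 - s) powr (d - 1) * (1 - w * of_real s) powr (- a))
      \<le> s powr (Re b - 1) * (1 - s) powr (Re d - 1) * C" if "w \<in> ball w0 e" "s \<in> {0<..<1}" for w s
  proof -
    have w: "w \<in> cball w0 e" using that by simp
    have "1 - w * of_real s \<noteq> 0" using rng(1)[OF w that(2)] dl by auto
    hence "norm ((1 - w * of_real s) powr (- a)) \<le> norm (1 - w * of_real s) powr Re (-a) * exp (pi * \<bar>Im (-a)\<bar>)"
      by (rule norm_powr_le)
    also have "\<dots> \<le> C" unfolding C_def
      by (intro mult_right_mono powr_le_sum_endpoints dl rng[OF w that(2)]) auto
    finally show ?thesis using that
      by (auto simp: norm_mult norm_of_real_powr simp del: of_real_diff intro!: mult_left_mono)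
  qed
  moreover have "set_integrable lborel {0<..<1} (\<lambda>s. s powr (Re b - 1) * (1 - s) powr (Re d - 1) * C)"
    by (intro set_integrable_mult_left set_integrable_Beta b d)
  ultimately show "\<exists>e>0. \<exists>h. set_integrable lborel {0<..<1} h \<and> (\<forall>w\<in>ball w0 e \<inter> cutplane. \<forall>s\<in>{0<..<1}.
      norm (complex_of_real s powr (b - 1) * of_real (1 - s) powr (d - 1) * (1 - w * of_real s) powr (- a)) \<le> h s)"
    using e(1) by blast
qed auto

lemma binomial_series_complex:
  assumes "norm z < 1"
  shows "(\<lambda>n. pochhammer a n / fact n * z ^ n) sums (1 - z) powr (- a :: complex)"
    and "summable (\<lambda>n. norm (pochhammer a n / fact n * z ^ n))"
proof -
  have s: "(\<lambda>n. pochhammer a n / fact n * z ^ n) sums (1 - z) powr (- a)" if "norm z < 1" for z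
  proof -
    have "(- a gchoose n) * (- z) ^ n = pochhammer a n / fact n * z ^ n" for n
    proof -
      have "(- 1) ^ n * (- 1) ^ n = (1::complex)" by (simp flip: power_mult_distrib)
      moreover have "(- a gchoose n) * (- z) ^ n = ((- 1) ^ n * (- 1) ^ n) * (pochhammer a n / fact n * z ^ n)"
        by (simp only: gbinomial_pochhammer power_minus[of z n] minus_minus times_divide_eq_left
            times_divide_eq_right mult_ac)
      ultimately show ?thesis by simp
    qed
    thus ?thesis using gen_binomial_complex[of "-z" "-a"] that by simp
  qed
  show "(\<lambda>n. pochhammer a n / fact n * z ^ n) sums (1 - z) powr (- a :: complex)" by (rule s[OF assms])
  obtain r where r: "norm z < r" "r < 1" using assms dense by blast
  have "r > 0" using r by (meson norm_ge_zero le_less_trans)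
  hence "summable (\<lambda>n. pochhammer a n / fact n * (of_real r) ^ n)"
    using s[of "of_real r"] r by (auto simp: sums_iff)
  thus "summable (\<lambda>n. norm (pochhammer a n / fact n * z ^ n))"
    by (rule powser_insidea) (use r \<open>r > 0\<close> in auto)
qed

text \<open>The binomial series of (1 - w s) powr (-a) is integrated term by term. The n-th term is
  a Beta integral with b + n in place of b, and \<Gamma>(b + n) = (b)_n \<Gamma>(b) produces the
  hypergeometric coefficient; absolute convergence of the binomial series at w justifies the
  interchange.\<close>

lemma Euler_integral:
  assumes b: "Re b > 0" and d: "Re (c - b) > 0" and w: "norm w < 1"
  shows "(LINT s:{0<..<1}|lborel. complex_of_real s powr (b - 1) * of_real (1 - s) powr (c - b - 1) *
            (1 - w * of_real s) powr (- a)) = Gamma b * Gamma (c - b) * hyp_series a b c w"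
proof -
  let ?B = "\<lambda>s. complex_of_real s powr (b - 1) * of_real (1 - s) powr (c - b - 1)"
  let ?k = "\<lambda>n. pochhammer a n / fact n * w ^ n"
  define f where "f = (\<lambda>n s. indicator {0<..<1} s *\<^sub>R (?k n * (complex_of_real s powr (b + of_nat n - 1) * of_real (1 - s) powr (c - b - 1))))"
  have Bn: "Re (b + of_nat n) > 0" for n using b by simp
  have fB: "f n s = indicator {0<..<1} s *\<^sub>R (?B s * (pochhammer a n / fact n * (w * of_real s) ^ n))" for n s
  proof (cases "s \<in> {0<..<1}")
    case True
    have "complex_of_real s powr (b + of_nat n - 1) = of_real s powr (b - 1) * of_real s ^ n"
    proof -
      have "complex_of_real s powr (b + of_nat n - 1) = of_real s powr ((b - 1) + of_nat n)"
        by (simp add: algebra_simps)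
      also have "\<dots> = of_real s powr (b - 1) * of_real s powr of_nat n" by (rule powr_add)
      finally show ?thesis using True by (simp add: powr_nat')
    qed
    thus ?thesis using True by (simp add: f_def power_mult_distrib)
  qed (simp add: f_def)
  have int: "integrable lborel (f n)" for n
    using set_integrable_mult_right[OF set_integrable_Beta_complex[OF Bn d], of "?k n" n]
    unfolding f_def set_integrable_def by simp
  have val: "integral\<^sup>L lborel (f n) = Gamma b * Gamma (c - b) * (hyp_coeff a b c n * w ^ n)" for n
  proof -
    have "integral\<^sup>L lborel (f n) = ?k n * Beta (b + of_nat n) (c - b)"
      using Beta_set_integral[OF Bn d, of n]
      unfolding f_def set_lebesgue_integral_def
      by (simp only: mult_scaleR_right[symmetric] integral_mult_right_zero)
    also have "Beta (b + of_nat n) (c - b) = pochhammer b n * Gamma b * Gamma (c - b) * rGamma (c + of_nat n)"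
      using pochhammer_Gamma[of b n] nonpos_Ints_Re_pos[OF b]
      by (simp add: Beta_altdef add_ac Gamma_eq_zero_iff)
    finally show ?thesis by (simp add: hyp_coeff_def)
  qed
  have nrm: "norm (f n s) \<le> norm (?k n) * (indicator {0<..<1} s *\<^sub>R (s powr (Re b - 1) * (1 - s) powr (Re (c - b) - 1)))" for n s
  proof (cases "s \<in> {0<..<1}")
    case True
    have "norm (f n s) = norm (?k n) * (s powr (Re b + real n - 1) * (1 - s) powr (Re (c - b) - 1))"
    proof -
      have "norm (complex_of_real s powr (b + of_nat n - 1)) = s powr (Re b + real n - 1)"
           "norm (complex_of_real (1 - s) powr (c - b - 1)) = (1 - s) powr (Re (c - b) - 1)"
        using True norm_of_real_powr[of s] norm_of_real_powr[of "1 - s"] by simp_all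
      thus ?thesis
        by (simp only: f_def indicator_simps(1)[OF True] scaleR_one norm_mult)
    qed
    also have "\<dots> \<le> norm (?k n) * (s powr (Re b - 1) * (1 - s) powr (Re (c - b) - 1))"
      using True by (intro mult_left_mono mult_right_mono powr_mono') auto
    finally show ?thesis using True by simp
  qed (simp add: f_def)
  have I0: "integrable lborel (\<lambda>s. indicator {0<..<1} s *\<^sub>R (s powr (Re b - 1) * (1 - s) powr (Re (c - b) - 1)))"
    using set_integrable_Beta[OF b d] unfolding set_integrable_def .
  have sk: "summable (\<lambda>n. norm (?k n))" by (rule binomial_series_complex(2)[OF w])
  have sm1: "summable (\<lambda>n. norm (f n s))" for s
    by (rule summable_comparison_test'[OF summable_mult2[OF sk]]) (use nrm[of _ s] in auto)
  have sm2: "summable (\<lambda>n. \<integral>s. norm (f n s) \<partial>lborel)"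
  proof (rule summable_comparison_test'[OF summable_mult2[OF sk]])
    fix n
    have "(\<integral>s. norm (f n s) \<partial>lborel) \<le> (\<integral>s. norm (?k n) * (indicator {0<..<1} s *\<^sub>R (s powr (Re b - 1) * (1 - s) powr (Re (c - b) - 1))) \<partial>lborel)"
      by (intro integral_mono nrm integrable_norm int integrable_mult_right I0)
    also have "\<dots> = norm (?k n) * (\<integral>s. (indicator {0<..<1} s *\<^sub>R (s powr (Re b - 1) * (1 - s) powr (Re (c - b) - 1))) \<partial>lborel)"
      by (rule integral_mult_right_zero)
    finally show "norm (\<integral>s. norm (f n s) \<partial>lborel) \<le> norm (?k n) * (\<integral>s. (indicator {0<..<1} s *\<^sub>R (s powr (Re b - 1) * (1 - s) powr (Re (c - b) - 1))) \<partial>lborel)"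
      by simp
  qed
  have "(\<Sum>n. f n s) = indicator {0<..<1} s *\<^sub>R (?B s * (1 - w * of_real s) powr (- a))" for s
  proof (cases "s \<in> {0<..<1}")
    case True
    have "norm (w * of_real s) < 1 * 1" unfolding norm_mult
      using True w by (intro mult_strict_mono') auto
    hence "(\<lambda>n. ?B s * (pochhammer a n / fact n * (w * of_real s) ^ n)) sums (?B s * (1 - w * of_real s) powr (- a))"
      by (intro sums_mult binomial_series_complex) simp
    thus ?thesis using True by (simp add: fB sums_iff)
  qed (simp add: fB)
  hence "(LINT s:{0<..<1}|lborel. ?B s * (1 - w * of_real s) powr (- a)) = (\<integral>s. (\<Sum>n. f n s) \<partial>lborel)"
    by (simp add: set_lebesgue_integral_def)
  also have "\<dots> = (\<Sum>n. integral\<^sup>L lborel (f n))"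
    by (rule integral_suminf[OF int _ sm2]) (simp add: sm1)
  also have "\<dots> = Gamma b * Gamma (c - b) * hyp_series a b c w"
    unfolding val hyp_series_altdef by (rule suminf_mult[OF summable_hyp_series[OF w]])
  finally show ?thesis .
qed

text \<open>Euler's integral continues the series when \<open>Re c > Re b > 0\<close>; the general case is reduced to it by
  lowering \<open>c\<close> and integrating the derivative formula.\<close>

lemma hyp_series_continuation_exists:
  "\<exists>f. f holomorphic_on cutplane \<and> (\<forall>v. norm v < 1 \<longrightarrow> f v = hyp_series a b c v)"
proof -
  define P where "P = (\<lambda>a b c. \<exists>f. f holomorphic_on cutplane \<and> (\<forall>v. norm v < 1 \<longrightarrow> f v = hyp_series a b c v))"
  have Euler: "P a b c" if "Re b > 0" "Re (c - b) > 0" for a b c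
    unfolding P_def
  proof (intro exI conjI allI impI)
    show "(\<lambda>w. (LINT s:{0<..<1}|lborel. complex_of_real s powr (b - 1) * of_real (1 - s) powr (c - b - 1) *
            (1 - w * of_real s) powr (- a)) / (Gamma b * Gamma (c - b))) holomorphic_on cutplane"
      using nonpos_Ints_Re_pos that
      by (intro holomorphic_on_divide holomorphic_on_const Euler_integral_holomorphic that) (auto simp: Gamma_eq_zero_iff)
    fix v :: complex assume "norm v < 1"
    thus "(LINT s:{0<..<1}|lborel. complex_of_real s powr (b - 1) * of_real (1 - s) powr (c - b - 1) *
            (1 - v * of_real s) powr (- a)) / (Gamma b * Gamma (c - b)) = hyp_series a b c v"
      unfolding Euler_integral[OF that \<open>norm v < 1\<close>]
      using nonpos_Ints_Re_pos[OF that(1)] nonpos_Ints_Re_pos[OF that(2)] by (simp add: Gamma_eq_zero_iff)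
  qed
  have lower: "P a b (c - 1)" if "P a b c" for a b c
  proof -
    from that obtain f where f: "f holomorphic_on cutplane" "\<And>v. norm v < 1 \<Longrightarrow> f v = hyp_series a b c v"
      by (auto simp: P_def)
    have "deriv f v = a * b * hyp_series (a + 1) (b + 1) (c + 1) v" if v: "norm v < 1" for v
    proof -
      have "(f has_field_derivative a * b * hyp_series (a + 1) (b + 1) (c + 1) v) (at v)"
        by (rule has_field_derivative_transform_within_open[OF hyp_series_deriv[OF v], of "ball 0 1"])
           (use v f in auto)
      thus ?thesis by (rule DERIV_imp_deriv)
    qed
    hence "(c - 1) * f v + v * deriv f v = hyp_series a b (c - 1) v" if "norm v < 1" for v
      using that f by (simp add: hyp_series_lower_c)
    moreover have "(\<lambda>w. (c - 1) * f w + w * deriv f w) holomorphic_on cutplane"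
      by (intro holomorphic_intros f holomorphic_deriv open_cutplane)
    ultimately show ?thesis unfolding P_def by blast
  qed
  have prim: "P a b c" if "P (a + 1) (b + 1) (c + 1)" for a b c
  proof -
    from that obtain f where f: "f holomorphic_on cutplane"
      "\<And>v. norm v < 1 \<Longrightarrow> f v = hyp_series (a + 1) (b + 1) (c + 1) v"
      by (auto simp: P_def)
    have hol: "(\<lambda>w. a * b * f w) holomorphic_on cutplane" by (intro holomorphic_intros f)
    \<comment> \<open>The derivative of the series is a b times the series with raised parameters,
      so a primitive of the continued derivative agrees with the original series on the disc up to a
      constant.\<close>
    obtain G where G: "\<forall>x\<in>cutplane. (G has_field_derivative a * b * f x) (at x)"
      using holomorphic_starlike_primitive[OF holomorphic_on_imp_continuous_on[OF hol] starlike_cutplane open_cutplane finite.emptyI]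
        holomorphic_on_imp_differentiable_at[OF hol open_cutplane] by auto
    have "\<exists>k. \<forall>x\<in>ball 0 1. G x - hyp_series a b c x = k"
    proof (rule has_field_derivative_zero_constant)
      fix x :: complex assume x: "x \<in> ball 0 1"
      hence nx: "norm x < 1" by simp
      have "((\<lambda>x. G x - hyp_series a b c x) has_field_derivative (a * b * f x - a * b * f x)) (at x)"
        using G ball_subset_cutplane[OF nx] hyp_series_deriv[OF nx, of a b c] f(2)[OF nx]
        by (intro derivative_intros) auto
      thus "((\<lambda>x. G x - hyp_series a b c x) has_field_derivative 0) (at x within ball 0 1)"
        by (auto intro: has_field_derivative_at_within)
    qed auto
    then obtain k where k: "\<And>x. norm x < 1 \<Longrightarrow> G x - k = hyp_series a b c x"
      by (auto simp: algebra_simps)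
    have "G holomorphic_on cutplane"
      using G by (auto simp: holomorphic_on_open[OF open_cutplane])
    hence "(\<lambda>w. G w - k) holomorphic_on cutplane" by (intro holomorphic_intros)
    thus ?thesis unfolding P_def using k by blast
  qed
  have lowers: "P a b (c + of_nat n) \<Longrightarrow> P a b c" for a b c n
  proof (induction n)
    case (Suc n)
    thus ?case using lower[of a b "c + of_nat (Suc n)"] by (simp add: algebra_simps)
  qed auto
  have prims: "P (a + of_nat n) (b + of_nat n) (c + of_nat n) \<Longrightarrow> P a b c" for a b c n
  proof (induction n)
    case (Suc n)
    thus ?case using prim[of "a + of_nat n" "b + of_nat n" "c + of_nat n"] by (simp add: algebra_simps)
  qed auto
  \<comment> \<open>Raising a, b and c together by n makes Re b positive without changing c - b;
    raising c alone by m then makes Re (c - b) positive.\<close>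
  obtain n :: nat where n: "real n > - Re b" using reals_Archimedean2 by blast
  obtain m :: nat where m: "real m > Re b - Re c" using reals_Archimedean2 by blast
  have "P (a + of_nat n) (b + of_nat n) (c + of_nat n + of_nat m)"
    using n m by (intro Euler) auto
  hence "P a b c" using lowers prims by blast
  thus ?thesis by (simp add: P_def)
qed

lemma reg_hyp2F1_eq:
  assumes f: "f holomorphic_on cutplane" "\<And>v. norm v < 1 \<Longrightarrow> f v = hyp_series a b c v" and w: "w \<in> cutplane"
  shows "reg_hyp2F1 a b c w = f w"
  unfolding reg_hyp2F1_def cutplane_def[symmetric]
proof (rule the_equality)
  show "\<exists>g. g holomorphic_on cutplane \<and> (\<forall>v. norm v < 1 \<longrightarrow> g v = hyp_series a b c v) \<and> g w = f w"
    using f by blast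
  fix y assume "\<exists>g. g holomorphic_on cutplane \<and> (\<forall>v. norm v < 1 \<longrightarrow> g v = hyp_series a b c v) \<and> g w = y"
  then obtain g where g: "g holomorphic_on cutplane" "\<And>v. norm v < 1 \<Longrightarrow> g v = hyp_series a b c v" "g w = y" by blast
  have "g w = f w"
    by (rule analytic_continuation_open[OF _ open_cutplane _ connected_cutplane _ g(1) f(1) _ w, of "ball 0 1"])
       (use f g ball_subset_cutplane in auto)
  thus "y = f w" using g by simp
qed

lemma reg_hyp2F1_holomorphic: "reg_hyp2F1 a b c holomorphic_on cutplane"
  and reg_hyp2F1_series: "norm w < 1 \<Longrightarrow> reg_hyp2F1 a b c w = hyp_series a b c w"
proof -
  obtain f where f: "f holomorphic_on cutplane" "\<And>v. norm v < 1 \<Longrightarrow> f v = hyp_series a b c v"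
    using hyp_series_continuation_exists by blast
  show "reg_hyp2F1 a b c holomorphic_on cutplane"
    by (rule holomorphic_transform[OF f(1)]) (use reg_hyp2F1_eq[OF f] in auto)
  show "reg_hyp2F1 a b c w = hyp_series a b c w" if "norm w < 1"
    using reg_hyp2F1_eq[OF f ball_subset_cutplane[OF that]] f(2)[OF that] by simp
qed

section \<open>The connection formula\<close>

lemma of_real_powr_exp: "x > 0 \<Longrightarrow> complex_of_real x powr a = exp (a * of_real (ln x))"
  by (simp add: powr_def Ln_of_real)

lemma exp_powr: "\<bar>Im z\<bar> < pi \<Longrightarrow> exp z powr a = exp (a * z :: complex)"
  by (simp add: powr_def)

lemma integrable_exp_minus_abs:
  assumes "c > (0::real)"
  shows "integrable lborel (\<lambda>x. exp (- c * \<bar>x\<bar>))"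
proof -
  let ?f = "\<lambda>x::real. indicator {0<..} x * exp (- c * x)"
  have 1: "integrable lborel ?f"
  proof -
    have "set_integrable lborel {0<..} (\<lambda>s::real. exp (- c * s))"
      by (rule set_integrable_cong[THEN iffD1, OF _ _ _ set_integrable_powr_exp[of 1 c]]) (use assms in auto)
    thus ?thesis by (simp add: set_integrable_def)
  qed
  have 2: "integrable lborel (\<lambda>x. ?f (- x))"
    using lborel_integrable_real_affine[OF 1, of "-1" 0] by simp
  have 3: "integrable lborel (indicator {0::real} :: real \<Rightarrow> real)"
    by (rule integrable_real_indicator) auto
  have "exp (- c * \<bar>x\<bar>) = ?f x + ?f (- x) + indicator {0} x" for x
    by (auto simp: indicator_def)
  thus ?thesis using 1 2 3 by simp
qed

section \<open>The Legendre-type integral over the real line\<close>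

lemma add_nonneg_notin_nonpos_Reals:
  "w \<notin> \<real>\<^sub>\<le>\<^sub>0 \<Longrightarrow> S \<ge> 0 \<Longrightarrow> w + complex_of_real S \<notin> \<real>\<^sub>\<le>\<^sub>0"
  by (auto simp: complex_nonpos_Reals_iff)

text \<open>The point -S lies on the excluded half-line, hence at distance at least r from w0, so |w
  + S| is at least h = r/2 near w0; for large S the triangle inequality gives S - K. The constant h
  / (1 + K + h) is what both bounds allow after division by 1 + S.\<close>

lemma norm_add_nonneg_lower:
  assumes "w0 \<notin> \<real>\<^sub>\<le>\<^sub>0"
  obtains e d where "e > 0" "d > 0" "\<And>w S. w \<in> ball w0 e \<Longrightarrow> S \<ge> 0 \<Longrightarrow> norm (w + complex_of_real S) \<ge> d * (1 + S)"
proof -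
  obtain r where r: "r > 0" "ball w0 r \<subseteq> - \<real>\<^sub>\<le>\<^sub>0"
    using assms open_Compl[OF closed_nonpos_Reals_complex] by (metis ComplI open_contains_ball)
  define h where "h = r / 2"
  define K where "K = norm w0 + h"
  have h: "h > 0" using r by (simp add: h_def)
  have K: "K \<ge> 0" using h by (simp add: K_def)
  have "norm (w + of_real S) \<ge> h / (1 + K + h) * (1 + S)" if w: "w \<in> ball w0 h" and S: "S \<ge> 0" for w S
  proof -
    have "norm (w0 + of_real S) \<ge> r"
    proof (rule ccontr)
      assume "\<not> ?thesis"
      hence "- of_real S \<in> ball w0 r" by (simp add: dist_norm)
      moreover have "- of_real S \<in> (\<real>\<^sub>\<le>\<^sub>0 :: complex set)" using S by (simp add: complex_nonpos_Reals_iff)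
      ultimately show False using r(2) by blast
    qed
    moreover have "norm (w0 + of_real S) \<le> norm (w0 - w) + norm (w + of_real S)"
      using norm_triangle_ineq[of "w0 - w" "w + of_real S"] by simp
    ultimately have 1: "norm (w + of_real S) \<ge> h"
      using w by (simp add: h_def dist_norm)
    have "norm w \<le> norm w0 + norm (w0 - w)"
      using norm_triangle_ineq4[of w0 "w0 - w"] by simp
    hence "norm w \<le> K" using w by (simp add: K_def dist_norm)
    hence 2: "norm (w + of_real S) \<ge> S - K"
      using norm_triangle_ineq2[of "of_real S" "- w"] S by (simp add: add.commute)
    have "h * (1 + S) \<le> norm (w + of_real S) * (1 + K + h)"
    proof (cases "S \<le> K + h")
      case True
      hence "h * (1 + S) \<le> h * (1 + K + h)" using h by (intro mult_left_mono) auto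
      also have "\<dots> \<le> norm (w + of_real S) * (1 + K + h)" using 1 h K by (intro mult_right_mono) auto
      finally show ?thesis .
    next
      case False
      hence "h * (S - K - h) \<le> (1 + K + h) * (S - K - h)" using K h by (intro mult_right_mono) auto
      hence "h * (1 + S) \<le> (S - K) * (1 + K + h)" by (simp add: algebra_simps)
      also have "\<dots> \<le> norm (w + of_real S) * (1 + K + h)" using 2 h K by (intro mult_right_mono) auto
      finally show ?thesis .
    qed
    thus ?thesis using h K by (simp add: field_simps)
  qed
  moreover have "h / (1 + K + h) > 0" using h K by simp
  ultimately show ?thesis using that h by blast
qed

text \<open>Since sinh^2 (\<eta>/2) = (cosh \<eta> - 1) / 2, the base is half of cosh \<eta> + 2 w -
  1, so this is an integral representation of Legendre type. In the present form the base visibly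
  avoids the cut of the power whenever w does.\<close>

definition legint :: "complex \<Rightarrow> complex \<Rightarrow> complex \<Rightarrow> complex" where
  "legint \<kappa> \<mu> w = (LINT \<eta>|lborel. (w + of_real ((sinh (\<eta> / 2))\<^sup>2)) powr (- \<kappa>) * exp (- \<mu> * of_real \<eta>))"

lemma one_plus_sinh_half_sq_ge: "1 + (sinh (\<eta> / 2))\<^sup>2 \<ge> exp \<bar>\<eta>\<bar> / (4::real)"
proof -
  have "1 + (sinh (\<eta> / 2))\<^sup>2 = (cosh (\<eta> / 2))\<^sup>2" using cosh_square_eq[of "\<eta> / 2"] by simp
  also have "\<dots> = (exp \<eta> + exp (- \<eta>) + 2) / 4"
    by (simp add: cosh_field_def power2_eq_square field_simps flip: exp_add)
  also have "\<dots> \<ge> exp \<bar>\<eta>\<bar> / 4" by (cases "\<eta> \<ge> 0") auto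
  finally show ?thesis .
qed

text \<open>The bound is uniform over a box of values of \<kappa> and \<mu> and over all w sharing
  the same d, since \<open>holomorphic_on_legint\<close> moves all three. The decay rate k0 - m0 is
  kept positive there by the condition |Re \<mu>| < Re \<kappa>.\<close>

lemma legint_integrand_bound:
  fixes \<kappa> \<mu> w :: complex
  assumes d: "d > 0" "\<And>S. S \<ge> 0 \<Longrightarrow> norm (w + complex_of_real S) \<ge> d * (1 + S)"
    and k: "0 < k0" "k0 \<le> Re \<kappa>" "Re \<kappa> \<le> k1" and m: "\<bar>Re \<mu>\<bar> \<le> m0" and B: "\<bar>Im \<kappa>\<bar> \<le> B"
  shows "norm ((w + of_real ((sinh (\<eta> / 2))\<^sup>2)) powr (- \<kappa>) * exp (- \<mu> * of_real \<eta>)) \<le>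
           (max 1 (1/d) powr k1 * 4 powr k0 * exp (pi * B)) * exp (- (k0 - m0) * \<bar>\<eta>\<bar>)"
proof -
  define S where "S = (sinh (\<eta> / 2))\<^sup>2"
  have S: "S \<ge> 0" by (simp add: S_def)
  have p: "d * (1 + S) > 0" using d S by simp
  have nz: "w + of_real S \<noteq> 0" using d(2)[OF S] p by auto
  have "norm ((w + of_real S) powr (- \<kappa>)) \<le> norm (w + of_real S) powr (- Re \<kappa>) * exp (pi * \<bar>Im \<kappa>\<bar>)"
    using norm_powr_le[OF nz, of "-\<kappa>"] by simp
  also have "\<dots> \<le> (d * (1 + S)) powr (- Re \<kappa>) * exp (pi * B)"
    using d(2)[OF S] p k B by (intro mult_mono powr_mono2') auto
  also have "(d * (1 + S)) powr (- Re \<kappa>) = (1 / d) powr Re \<kappa> * (1 + S) powr (- Re \<kappa>)"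
    using d S by (simp add: powr_mult powr_divide powr_minus_divide)
  also have "\<dots> \<le> max 1 (1/d) powr k1 * (4 powr k0 * exp (- k0 * \<bar>\<eta>\<bar>))"
  proof (intro mult_mono)
    have "(1 / d) powr Re \<kappa> \<le> max 1 (1/d) powr Re \<kappa>" using k d by (intro powr_mono2) auto
    also have "\<dots> \<le> max 1 (1/d) powr k1" using k by (intro powr_mono) auto
    finally show "(1 / d) powr Re \<kappa> \<le> max 1 (1/d) powr k1" .
    have "(1 + S) powr (- Re \<kappa>) \<le> (1 + S) powr (- k0)" using k S by (intro powr_mono) auto
    also have "\<dots> \<le> (exp \<bar>\<eta>\<bar> / 4) powr (- k0)"
      using one_plus_sinh_half_sq_ge[of \<eta>] k unfolding S_def by (intro powr_mono2') auto
    also have "\<dots> = 4 powr k0 * exp (- k0 * \<bar>\<eta>\<bar>)"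
      by (simp add: powr_def ln_div right_diff_distrib flip: exp_add)
    finally show "(1 + S) powr (- Re \<kappa>) \<le> 4 powr k0 * exp (- k0 * \<bar>\<eta>\<bar>)" .
  qed auto
  finally have 1: "norm ((w + of_real S) powr (- \<kappa>)) \<le> max 1 (1/d) powr k1 * (4 powr k0 * exp (- k0 * \<bar>\<eta>\<bar>)) * exp (pi * B)"
    by (simp add: mult_right_mono)
  have "- (Re \<mu> * \<eta>) \<le> \<bar>Re \<mu> * \<eta>\<bar>" by simp
  also have "\<dots> \<le> m0 * \<bar>\<eta>\<bar>" unfolding abs_mult using m by (intro mult_right_mono) auto
  finally have 2: "norm (exp (- \<mu> * of_real \<eta>)) \<le> exp (m0 * \<bar>\<eta>\<bar>)" by simp
  have "norm ((w + of_real S) powr (- \<kappa>) * exp (- \<mu> * of_real \<eta>)) \<le>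
     (max 1 (1/d) powr k1 * (4 powr k0 * exp (- k0 * \<bar>\<eta>\<bar>)) * exp (pi * B)) * exp (m0 * \<bar>\<eta>\<bar>)"
    unfolding norm_mult by (intro mult_mono 1 2) auto
  also have "\<dots> = (max 1 (1/d) powr k1 * 4 powr k0 * exp (pi * B)) * exp (- (k0 - m0) * \<bar>\<eta>\<bar>)"
    by (simp add: algebra_simps flip: exp_add)
  finally show ?thesis unfolding S_def .
qed

lemma continuous_legint_integrand:
  assumes "w \<notin> \<real>\<^sub>\<le>\<^sub>0"
  shows "continuous_on A (\<lambda>\<eta>. (w + of_real ((sinh (\<eta> / 2))\<^sup>2)) powr (- \<kappa>) * exp (- \<mu> * complex_of_real \<eta>))"
  by (intro continuous_intros continuous_on_powr_const add_nonneg_notin_nonpos_Reals assms) auto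

lemma legint_integrable:
  assumes w: "w \<notin> \<real>\<^sub>\<le>\<^sub>0" and k: "\<bar>Re \<mu>\<bar> < Re \<kappa>"
  shows "integrable lborel (\<lambda>\<eta>. (w + of_real ((sinh (\<eta> / 2))\<^sup>2)) powr (- \<kappa>) * exp (- \<mu> * of_real \<eta>))"
proof -
  obtain e d where d: "e > 0" "d > 0" "\<And>v S. v \<in> ball w e \<Longrightarrow> S \<ge> 0 \<Longrightarrow> norm (v + complex_of_real S) \<ge> d * (1 + S)"
    using norm_add_nonneg_lower[OF w] by metis
  show ?thesis
  proof (rule Bochner_Integration.integrable_bound)
    show "integrable lborel (\<lambda>\<eta>. (max 1 (1/d) powr (Re \<kappa>) * 4 powr (Re \<kappa>) * exp (pi * \<bar>Im \<kappa>\<bar>)) * exp (- (Re \<kappa> - \<bar>Re \<mu>\<bar>) * \<bar>\<eta>\<bar>))"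
      by (intro integrable_mult_right integrable_exp_minus_abs) (use k in auto)
    show "AE \<eta> in lborel. norm ((w + of_real ((sinh (\<eta> / 2))\<^sup>2)) powr (- \<kappa>) * exp (- \<mu> * of_real \<eta>))
       \<le> norm ((max 1 (1/d) powr (Re \<kappa>) * 4 powr (Re \<kappa>) * exp (pi * \<bar>Im \<kappa>\<bar>)) * exp (- (Re \<kappa> - \<bar>Re \<mu>\<bar>) * \<bar>\<eta>\<bar>))"
    proof (intro AE_I2)
      fix \<eta> :: real
      have "norm ((w + of_real ((sinh (\<eta> / 2))\<^sup>2)) powr (- \<kappa>) * exp (- \<mu> * of_real \<eta>))
       \<le> (max 1 (1/d) powr (Re \<kappa>) * 4 powr (Re \<kappa>) * exp (pi * \<bar>Im \<kappa>\<bar>)) * exp (- (Re \<kappa> - \<bar>Re \<mu>\<bar>) * \<bar>\<eta>\<bar>)"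
        by (rule legint_integrand_bound[OF d(2)]) (use d k in auto)
      also have "\<dots> \<le> norm \<dots>" by (simp only: real_norm_def abs_ge_self)
      finally show "norm ((w + of_real ((sinh (\<eta> / 2))\<^sup>2)) powr (- \<kappa>) * exp (- \<mu> * of_real \<eta>))
       \<le> norm ((max 1 (1/d) powr (Re \<kappa>) * 4 powr (Re \<kappa>) * exp (pi * \<bar>Im \<kappa>\<bar>)) * exp (- (Re \<kappa> - \<bar>Re \<mu>\<bar>) * \<bar>\<eta>\<bar>))" .
    qed
  qed (use continuous_legint_integrand[OF w] borel_measurable_continuous_onI in auto)
qed

lemma holomorphic_on_legint:
  assumes S: "open S" and hol: "k holomorphic_on S" "m holomorphic_on S" "w holomorphic_on S"
    and w: "\<And>t. t \<in> S \<Longrightarrow> w t \<notin> \<real>\<^sub>\<le>\<^sub>0" and km: "\<And>t. t \<in> S \<Longrightarrow> \<bar>Re (m t)\<bar> < Re (k t)"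
  shows "(\<lambda>t. legint (k t) (m t) (w t)) holomorphic_on S"
  unfolding legint_def
proof (rule holomorphic_on_integral[OF S])
  have nn: "w t + of_real ((sinh (\<eta> / 2))\<^sup>2) \<notin> \<real>\<^sub>\<le>\<^sub>0" if "t \<in> S" for t and \<eta> :: real
    by (rule add_nonneg_notin_nonpos_Reals[OF w[OF that]]) simp
  show "(\<lambda>\<eta>. (w t + of_real ((sinh (\<eta> / 2))\<^sup>2)) powr (- k t) * exp (- m t * complex_of_real \<eta>)) \<in> borel_measurable lborel"
    if "t \<in> S" for t
    using continuous_legint_integrand[OF w[OF that], of UNIV] borel_measurable_continuous_onI by auto
  show "(\<lambda>t. (w t + of_real ((sinh (\<eta> / 2))\<^sup>2)) powr (- k t) * exp (- m t * complex_of_real \<eta>)) holomorphic_on S" for \<eta>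
    by (intro holomorphic_intros hol) (use nn in auto)
  fix t0 assume t0: "t0 \<in> S"
  obtain e d where d: "e > 0" "d > 0" "\<And>v S. v \<in> ball (w t0) e \<Longrightarrow> S \<ge> 0 \<Longrightarrow> norm (v + complex_of_real S) \<ge> d * (1 + S)"
    using norm_add_nonneg_lower[OF w[OF t0]] by metis
  \<comment> \<open>Each of \<kappa> and \<mu> may drift by ep, which uses up two of the four parts
    of the gap and leaves k0 - m0 = 2 ep.\<close>
  define ep where "ep = (Re (k t0) - \<bar>Re (m t0)\<bar>) / 4"
  have ep: "ep > 0" using km[OF t0] by (simp add: ep_def)
  have cont: "\<exists>d>0. \<forall>t\<in>ball t0 d. norm (f t - f t0) < r" if "f holomorphic_on S" "r > 0" for f r
  proof -
    have "isCont f t0" using that(1) S t0 holomorphic_on_imp_continuous_on continuous_on_eq_continuous_at by blast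
    thus ?thesis using that(2) unfolding continuous_at_eps_delta by (metis dist_norm dist_commute mem_ball)
  qed
  obtain d1 where d1: "d1 > 0" "\<And>t. t \<in> ball t0 d1 \<Longrightarrow> norm (k t - k t0) < ep" using cont[OF hol(1) ep] by blast
  obtain d2 where d2: "d2 > 0" "\<And>t. t \<in> ball t0 d2 \<Longrightarrow> norm (m t - m t0) < ep" using cont[OF hol(2) ep] by blast
  obtain d3 where d3: "d3 > 0" "\<And>t. t \<in> ball t0 d3 \<Longrightarrow> norm (w t - w t0) < e" using cont[OF hol(3) d(1)] by blast
  define k0 where "k0 = Re (k t0) - ep"
  define k1 where "k1 = Re (k t0) + ep"
  define m0 where "m0 = \<bar>Re (m t0)\<bar> + ep"
  define B where "B = \<bar>Im (k t0)\<bar> + ep"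
  have k0m0: "k0 - m0 > 0" using ep by (simp add: k0_def m0_def ep_def field_simps)
  have k0: "k0 > 0" using k0m0 ep by (simp add: m0_def)
  define h where "h = (\<lambda>\<eta>. (max 1 (1/d) powr k1 * 4 powr k0 * exp (pi * B)) * exp (- (k0 - m0) * \<bar>\<eta>\<bar>))"
  define dd where "dd = min d1 (min d2 d3)"
  have "norm ((w t + of_real ((sinh (\<eta> / 2))\<^sup>2)) powr (- k t) * exp (- m t * complex_of_real \<eta>)) \<le> h \<eta>"
    if t: "t \<in> ball t0 dd" for t \<eta>
    unfolding h_def
  proof (rule legint_integrand_bound[OF d(2)])
    have t': "t \<in> ball t0 d1" "t \<in> ball t0 d2" "t \<in> ball t0 d3" using t by (auto simp: dd_def)
    show "norm (w t + of_real S) \<ge> d * (1 + S)" if "S \<ge> 0" for S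
      using d3(2)[OF t'(3)] that by (intro d(3)) (auto simp: dist_norm norm_minus_commute)
    have "\<bar>Re (k t) - Re (k t0)\<bar> < ep" "\<bar>Im (k t) - Im (k t0)\<bar> < ep"
      using d1(2)[OF t'(1)] abs_Re_le_cmod[of "k t - k t0"] abs_Im_le_cmod[of "k t - k t0"] by auto
    moreover have "\<bar>Re (m t) - Re (m t0)\<bar> < ep"
      using d2(2)[OF t'(2)] abs_Re_le_cmod[of "m t - m t0"] by auto
    ultimately show "k0 \<le> Re (k t)" "Re (k t) \<le> k1" "\<bar>Re (m t)\<bar> \<le> m0" "\<bar>Im (k t)\<bar> \<le> B"
      unfolding k0_def k1_def m0_def B_def by linarith+
  qed (rule k0)
  moreover have "integrable lborel h" unfolding h_def
    by (intro integrable_mult_right integrable_exp_minus_abs k0m0)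
  moreover have "dd > 0" using d1 d2 d3 by (simp add: dd_def)
  ultimately show "\<exists>d>0. \<exists>h. integrable lborel h \<and> (\<forall>t\<in>ball t0 d \<inter> S. \<forall>\<eta>\<in>space lborel.
      norm ((w t + of_real ((sinh (\<eta> / 2))\<^sup>2)) powr (- k t) * exp (- m t * complex_of_real \<eta>)) \<le> h \<eta>)"
    by blast
qed

section \<open>Real integrals with a power singularity at sinh \<eta> = k\<close>

lemma sinh_minus_ln: "\<rho> > (0::real) \<Longrightarrow> sinh (- ln \<rho>) = (1 / \<rho> - \<rho>) / 2"
  by (simp add: sinh_ln_real field_simps)

text \<open>The substitution \<eta> = - ln (\<rho> (1 - s)) maps the unit interval onto the
  half-line and makes sinh \<eta> - k a product of powers of s, 1 - s and 1 - w s with w = \<rho>^2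
  / (1 + \<rho>^2), which is Euler's integral. The zero at the left end becomes s powr (-\<kappa>),
  integrable because Re \<kappa> < 1; the decay at infinity becomes the exponent \<kappa> + \<mu> -
  1 of 1 - s.\<close>

lemma sinh_Euler_integral:
  fixes \<rho> :: real and \<kappa> \<mu> :: complex
  assumes \<rho>: "\<rho> > 0" and \<kappa>: "Re \<kappa> < 1" and \<mu>: "Re (\<kappa> + \<mu>) > 0"
  defines "k \<equiv> (1 / \<rho> - \<rho>) / 2"
  shows "set_integrable lborel {- ln \<rho><..} (\<lambda>\<eta>. of_real (sinh \<eta> - k) powr (- \<kappa>) * exp (- \<mu> * of_real \<eta>))"
    and "(LINT \<eta>:{- ln \<rho><..}|lborel. of_real (sinh \<eta> - k) powr (- \<kappa>) * exp (- \<mu> * of_real \<eta>)) =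
           of_real (2 * \<rho> / (1 + \<rho>\<^sup>2)) powr \<kappa> * of_real \<rho> powr \<mu> *
           (Gamma (1 - \<kappa>) * Gamma (\<kappa> + \<mu>) * hyp_series \<kappa> (1 - \<kappa>) (1 + \<mu>) (of_real (\<rho>\<^sup>2 / (1 + \<rho>\<^sup>2))))"
proof -
  define w where "w = \<rho>\<^sup>2 / (1 + \<rho>\<^sup>2)"
  have w: "0 < w" "w < 1" using \<rho> by (auto simp: w_def add_pos_pos field_simps)
  define C where "C = of_real (2 * \<rho> / (1 + \<rho>\<^sup>2)) powr \<kappa> * complex_of_real \<rho> powr \<mu>"
  define E where "E = (\<lambda>s. complex_of_real s powr ((1 - \<kappa>) - 1) * of_real (1 - s) powr ((1 + \<mu>) - (1 - \<kappa>) - 1) *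
            (1 - of_real w * of_real s) powr (- \<kappa>))"
  define f where "f = (\<lambda>\<eta>. complex_of_real (sinh \<eta> - k) powr (- \<kappa>) * exp (- \<mu> * of_real \<eta>))"
  let ?g = "\<lambda>s. - ln (\<rho> * (1 - s))"
  let ?h = "\<lambda>s::real. 1 / (1 - s)"
  have pos: "sinh \<eta> - k > 0" if "\<eta> > - ln \<rho>" for \<eta>
    using that sinh_real_less_iff[of "- ln \<rho>" \<eta>] sinh_minus_ln[OF \<rho>] by (simp add: k_def)
  have img: "?g ` {0<..<1} = {- ln \<rho><..}"
  proof (intro equalityI subsetI)
    fix y assume "y \<in> ?g ` {0<..<1}"
    then obtain s where s: "s \<in> {0<..<1}" and y: "y = ?g s" by blast
    hence "ln (\<rho> * (1 - s)) < ln \<rho>" using \<rho> by (subst ln_less_cancel_iff) (auto simp: mult_less_cancel_left1)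
    thus "y \<in> {- ln \<rho><..}" by (simp add: y)
  next
    fix x :: real assume "x \<in> {- ln \<rho><..}"
    hence x: "- x < ln \<rho>" by simp
    hence "exp (- x) < exp (ln \<rho>)" by (simp only: exp_less_cancel_iff)
    hence "exp (- x) < \<rho>" using \<rho> by simp
    thus "x \<in> ?g ` {0<..<1}"
      using \<rho> by (intro image_eqI[of _ _ "1 - exp (- x) / \<rho>"]) (auto simp: field_simps)
  qed
  have inj: "inj_on ?g {0<..<1}"
    using \<rho> by (auto intro!: inj_onI simp: ln_inj_iff)
  have der: "(?g has_field_derivative ?h s) (at s)" if "s \<in> {0<..<1}" for s
    using that \<rho> by (auto intro!: derivative_eq_intros simp: field_simps)
  have F: "C * E s = of_real \<bar>?h s\<bar> * f (?g s)" if "s \<in> {0<..<1}" for s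
  proof -
    have s: "0 < s" "s < 1" using that by auto
    have "w * s < 1 * 1" using w s by (intro mult_strict_mono) auto
    hence ws: "1 - w * s > 0" by simp
    have "sinh (?g s) = (1 / (\<rho> * (1 - s)) - \<rho> * (1 - s)) / 2"
      using s \<rho> by (simp add: sinh_field_def exp_minus inverse_eq_divide)
    also have "\<dots> - k = s * (1 + \<rho>\<^sup>2 - \<rho>\<^sup>2 * s) / (2 * \<rho> * (1 - s))"
    proof -
      have nz: "\<rho> \<noteq> 0" "1 - s \<noteq> 0" using s \<rho> by auto
      show ?thesis unfolding k_def using nz
        by (simp add: divide_simps) (simp add: algebra_simps power2_eq_square)
    qed
    also have "1 + \<rho>\<^sup>2 - \<rho>\<^sup>2 * s = (1 - w * s) * (1 + \<rho>\<^sup>2)"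
    proof -
      have "1 + \<rho>\<^sup>2 \<noteq> 0" using \<rho> by (metis add_pos_pos less_irrefl zero_less_one zero_less_power)
      hence "w * (1 + \<rho>\<^sup>2) = \<rho>\<^sup>2" by (simp add: w_def)
      hence "(w * (1 + \<rho>\<^sup>2)) * s = \<rho>\<^sup>2 * s" by simp
      thus ?thesis by (simp add: algebra_simps)
    qed
    finally have sh: "sinh (?g s) - k = s * (1 - w * s) / ((2 * \<rho> / (1 + \<rho>\<^sup>2)) * (1 - s))"
      by simp
    define c where "c = 2 * \<rho> / (1 + \<rho>\<^sup>2)"
    have c: "c > 0" using \<rho> by (auto simp: c_def add_pos_pos)
    have lnsh: "ln (sinh (?g s) - k) = ln s + ln (1 - w * s) - ln c - ln (1 - s)"
      unfolding sh c_def[symmetric] using s ws c by (simp add: ln_mult ln_div)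
    have sp: "sinh (?g s) - k > 0" unfolding sh c_def[symmetric] using s ws c by simp
    have lns: "ln (\<rho> * (1 - s)) = ln \<rho> + ln (1 - s)" using \<rho> s by (simp add: ln_mult)
    have e1: "complex_of_real \<bar>1 / (1 - s)\<bar> = exp (of_real (- ln (1 - s)))"
      using s by (simp only: exp_of_real) (simp add: exp_minus inverse_eq_divide)
    have e2: "(1 - of_real w * of_real s) = complex_of_real (1 - w * s)" by simp
    have "of_real \<bar>?h s\<bar> * f (?g s) = exp (of_real (- ln (1 - s))) * (exp (- \<kappa> * of_real (ln s + ln (1 - w * s) - ln c - ln (1 - s))) *
        exp (- \<mu> * of_real (- (ln \<rho> + ln (1 - s)))))"
      unfolding f_def lns[symmetric] by (simp only: of_real_powr_exp[OF sp] lnsh e1)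
    also have "\<dots> = exp (\<kappa> * of_real (ln c)) * exp (\<mu> * of_real (ln \<rho>)) * (exp (((1 - \<kappa>) - 1) * of_real (ln s)) *
       exp (((1 + \<mu>) - (1 - \<kappa>) - 1) * of_real (ln (1 - s))) * exp (- \<kappa> * of_real (ln (1 - w * s))))"
      unfolding exp_add[symmetric] by (simp add: algebra_simps)
    also have "\<dots> = C * E s"
      unfolding C_def E_def e2 c_def[symmetric]
      using of_real_powr_exp[OF c] of_real_powr_exp[OF \<rho>] of_real_powr_exp[OF s(1)] of_real_powr_exp[OF ws]
        of_real_powr_exp[of "1 - s"] s by simp
    finally show ?thesis by simp
  qed
  have cont: "continuous_on {- ln \<rho><..} f"
    unfolding f_def by (intro continuous_intros continuous_on_of_real_powr) (use pos in auto)
  have conth: "continuous_on {0<..<1} ?h" by (intro continuous_intros) auto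
  have b: "Re (1 - \<kappa>) > 0" "Re ((1 + \<mu>) - (1 - \<kappa>)) > 0" using \<kappa> \<mu> by auto
  have nw: "norm (complex_of_real w) < 1" using w by simp
  have intE: "set_integrable lborel {0<..<1} E"
  proof -
    have "set_integrable lborel {0<..<1} (\<lambda>s. s powr (Re (1 - \<kappa>) - 1) * (1 - s) powr (Re ((1 + \<mu>) - (1 - \<kappa>)) - 1) *
        (((1 - w) powr Re (- \<kappa>) + 1 powr Re (- \<kappa>)) * exp (pi * \<bar>Im (- \<kappa>)\<bar>)))"
      by (intro set_integrable_mult_left set_integrable_Beta b)
    thus ?thesis unfolding E_def
    proof (rule set_integrable_dominated)
      have p: "1 - w * s > 0" "1 - w \<le> 1 - w * s" "1 - w * s \<le> 1" if "s \<in> {0<..<1}" for s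
      proof -
        have "w * s \<le> w * 1" using that w by (intro mult_left_mono) auto
        thus "1 - w \<le> 1 - w * s" "1 - w * s > 0" using w by linarith+
        show "1 - w * s \<le> 1" using that w by simp
      qed
      have e2: "(1 - of_real w * of_real s) = complex_of_real (1 - w * s)" for s by simp
      show "continuous_on {0<..<1} (\<lambda>s. complex_of_real s powr (1 - \<kappa> - 1) * of_real (1 - s) powr (1 + \<mu> - (1 - \<kappa>) - 1) *
            (1 - of_real w * of_real s) powr - \<kappa>)" unfolding e2
        by (intro continuous_intros continuous_on_of_real_powr) (use p in auto)
      fix s :: real assume s: "s \<in> {0<..<1}"
      have "norm (complex_of_real (1 - w * s) powr (- \<kappa>)) \<le> ((1 - w) powr Re (- \<kappa>) + 1 powr Re (- \<kappa>)) * exp (pi * \<bar>Im (- \<kappa>)\<bar>)"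
      proof (rule order_trans[OF norm_powr_le])
        show "complex_of_real (1 - w * s) \<noteq> 0" using p[OF s] by (metis of_real_eq_0_iff less_irrefl)
        have "norm (complex_of_real (1 - w * s)) = 1 - w * s" using p[OF s] by (simp only: norm_of_real abs_of_pos)
        thus "norm (complex_of_real (1 - w * s)) powr Re (- \<kappa>) * exp (pi * \<bar>Im (- \<kappa>)\<bar>)
          \<le> ((1 - w) powr Re (- \<kappa>) + 1 powr Re (- \<kappa>)) * exp (pi * \<bar>Im (- \<kappa>)\<bar>)"
          using p[OF s] w by (intro mult_right_mono) (auto intro: powr_le_sum_endpoints simp del: powr_one_eq_one)
      qed
      thus "norm (complex_of_real s powr (1 - \<kappa> - 1) * of_real (1 - s) powr (1 + \<mu> - (1 - \<kappa>) - 1) *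
            (1 - of_real w * of_real s) powr - \<kappa>) \<le> s powr (Re (1 - \<kappa>) - 1) * (1 - s) powr (Re ((1 + \<mu>) - (1 - \<kappa>)) - 1) *
        (((1 - w) powr Re (- \<kappa>) + 1 powr Re (- \<kappa>)) * exp (pi * \<bar>Im (- \<kappa>)\<bar>))"
        unfolding e2 norm_mult using s norm_of_real_powr[of s] norm_of_real_powr[of "1 - s"]
        by (intro mult_mono) auto
    qed auto
  qed
  note sub = set_integral_substitution[where F = "\<lambda>s. C * E s", OF _ img _ der inj cont conth F]
  show "set_integrable lborel {- ln \<rho><..} (\<lambda>\<eta>. of_real (sinh \<eta> - k) powr (- \<kappa>) * exp (- \<mu> * of_real \<eta>))"
    using sub(1) set_integrable_mult_right[OF intE, of C] unfolding f_def by auto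
  have "(LINT \<eta>:{- ln \<rho><..}|lborel. f \<eta>) = C * (LINT s:{0<..<1}|lborel. E s)"
    using sub(2) by auto
  also have "(LINT s:{0<..<1}|lborel. E s) = Gamma (1 - \<kappa>) * Gamma ((1 + \<mu>) - (1 - \<kappa>)) * hyp_series \<kappa> (1 - \<kappa>) (1 + \<mu>) (of_real w)"
    unfolding E_def by (rule Euler_integral[OF b nw])
  finally show "(LINT \<eta>:{- ln \<rho><..}|lborel. of_real (sinh \<eta> - k) powr (- \<kappa>) * exp (- \<mu> * of_real \<eta>)) =
           of_real (2 * \<rho> / (1 + \<rho>\<^sup>2)) powr \<kappa> * of_real \<rho> powr \<mu> *
           (Gamma (1 - \<kappa>) * Gamma (\<kappa> + \<mu>) * hyp_series \<kappa> (1 - \<kappa>) (1 + \<mu>) (of_real (\<rho>\<^sup>2 / (1 + \<rho>\<^sup>2))))"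
    unfolding f_def C_def w_def by (simp add: add.commute)
qed

text \<open>The reflection \<eta> -> -\<eta> exchanges \<rho> with 1/\<rho>, k with -k and \<mu>
  with -\<mu>.\<close>

lemma sinh_left_integrable:
  fixes \<rho> :: real and \<kappa> \<mu> :: complex
  assumes \<rho>: "\<rho> > 0" and \<kappa>: "Re \<kappa> < 1" and \<mu>: "Re (\<kappa> - \<mu>) > 0"
  defines "k \<equiv> (1 / \<rho> - \<rho>) / 2"
  shows "set_integrable lborel {..<- ln \<rho>} (\<lambda>\<eta>. of_real (k - sinh \<eta>) powr (- \<kappa>) * exp (- \<mu> * of_real \<eta>))"
proof -
  have pos: "k - sinh \<eta> > 0" if "\<eta> < - ln \<rho>" for \<eta>
    using that sinh_real_less_iff[of \<eta> "- ln \<rho>"] sinh_minus_ln[OF \<rho>] by (simp add: k_def)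
  have "set_integrable lborel {- ln (1/\<rho>)<..} (\<lambda>\<eta>. of_real (sinh \<eta> - (1 / (1/\<rho>) - 1/\<rho>) / 2) powr (- \<kappa>) * exp (- (- \<mu>) * of_real \<eta>))"
    by (rule sinh_Euler_integral(1)) (use assms in auto)
  hence *: "set_integrable lborel {ln \<rho><..} (\<lambda>\<eta>. of_real (sinh \<eta> + k) powr (- \<kappa>) * exp (\<mu> * of_real \<eta>))"
    using \<rho> by (simp add: ln_div k_def field_simps)
  have img: "uminus ` {ln \<rho><..} = {..<- ln \<rho>}" by simp
  show ?thesis
  proof (subst set_integral_substitution(1)[where S = "{ln \<rho><..}" and g = uminus and h = "\<lambda>_. -1"
        and F = "\<lambda>\<eta>. of_real (sinh \<eta> + k) powr (- \<kappa>) * exp (\<mu> * of_real \<eta>)"])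
    show "continuous_on {..<- ln \<rho>} (\<lambda>\<eta>. of_real (k - sinh \<eta>) powr (- \<kappa>) * exp (- \<mu> * of_real \<eta>))"
      by (intro continuous_intros continuous_on_of_real_powr) (use pos in auto)
  qed (use * in \<open>auto intro!: derivative_eq_intros simp: add.commute\<close>)
qed

text \<open>This supplies the dominating function for the passage to the boundary line: integrable
  across the zero of sinh \<eta> - k because r < 1, and at infinity because |m| < r.\<close>

lemma sinh_singular_integrable:
  fixes \<rho> r m :: real
  assumes \<rho>: "\<rho> > 0" and r: "r < 1" and m: "\<bar>m\<bar> < r"
  defines "k \<equiv> (1 / \<rho> - \<rho>) / 2"
  shows "integrable lborel (\<lambda>\<eta>. \<bar>sinh \<eta> - k\<bar> powr (- r) * exp (- m * \<eta>))"
proof -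
  have less: "\<eta> < - ln \<rho> \<longleftrightarrow> sinh \<eta> < k" "\<eta> > - ln \<rho> \<longleftrightarrow> sinh \<eta> > k" for \<eta>
    unfolding k_def sinh_minus_ln[OF \<rho>, symmetric] by (simp_all only: sinh_real_less_iff)
  have 1: "set_integrable lborel {- ln \<rho><..} (\<lambda>\<eta>. norm (complex_of_real (sinh \<eta> - k) powr (- of_real r) * exp (- of_real m * of_real \<eta>)))"
    unfolding k_def by (intro set_integrable_norm sinh_Euler_integral(1)) (use \<rho> r m in auto)
  have 2: "set_integrable lborel {..<- ln \<rho>} (\<lambda>\<eta>. norm (complex_of_real (k - sinh \<eta>) powr (- of_real r) * exp (- of_real m * of_real \<eta>)))"
    unfolding k_def by (intro set_integrable_norm sinh_left_integrable) (use \<rho> r m in auto)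
  have "(\<lambda>\<eta>. \<bar>sinh \<eta> - k\<bar> powr (- r) * exp (- m * \<eta>)) =
     (\<lambda>\<eta>. indicator {- ln \<rho><..} \<eta> *\<^sub>R norm (complex_of_real (sinh \<eta> - k) powr (- of_real r) * exp (- of_real m * of_real \<eta>)) +
          indicator {..<- ln \<rho>} \<eta> *\<^sub>R norm (complex_of_real (k - sinh \<eta>) powr (- of_real r) * exp (- of_real m * of_real \<eta>)))"
  proof
    fix \<eta>
    have n1: "norm (complex_of_real x powr (- of_real r)) = x powr (- r)" if "x > 0" for x
      using norm_of_real_powr[OF that, of "- of_real r"] by simp
    consider "sinh \<eta> > k" | "sinh \<eta> < k" | "sinh \<eta> = k" by linarith
    thus "\<bar>sinh \<eta> - k\<bar> powr (- r) * exp (- m * \<eta>) = indicator {- ln \<rho><..} \<eta> *\<^sub>R norm (complex_of_real (sinh \<eta> - k) powr (- of_real r) * exp (- of_real m * of_real \<eta>)) +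
          indicator {..<- ln \<rho>} \<eta> *\<^sub>R norm (complex_of_real (k - sinh \<eta>) powr (- of_real r) * exp (- of_real m * of_real \<eta>))"
    proof cases
      case 1
      thus ?thesis using n1[of "sinh \<eta> - k"] by (simp add: less indicator_def norm_mult del: of_real_diff)
    next
      case 2
      thus ?thesis using n1[of "k - sinh \<eta>"] by (simp add: less indicator_def norm_mult del: of_real_diff)
    qed (simp add: less indicator_def)
  qed
  thus ?thesis using 1 2 unfolding set_integrable_def by simp
qed


section \<open>Contour shift up to the boundary of the strip\<close>

lemma Re_cosh: "Re (cosh z) = cosh (Re z) * cos (Im z)"
  and Im_cosh: "Im (cosh z) = sinh (Re z) * sin (Im z)"
  and Re_sinh: "Re (sinh z) = sinh (Re z) * cos (Im z)"
  and Im_sinh: "Im (sinh z) = cosh (Re z) * sin (Im z)"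
  by (simp_all add: cosh_field_def sinh_field_def Re_exp Im_exp field_simps)

lemma cosh_real_ge: "cosh x \<ge> exp \<bar>x\<bar> / (2::real)"
  by (cases "x \<ge> 0") (auto simp: cosh_field_def)

lemma continuous_powr_at:
  assumes "z \<notin> \<real>\<^sub>\<le>\<^sub>0"
  shows "isCont (\<lambda>z. z powr (a::complex)) z"
proof -
  have "continuous_on (- \<real>\<^sub>\<le>\<^sub>0) (\<lambda>z. z powr a)"
    by (intro continuous_on_powr_const continuous_intros) auto
  thus ?thesis using assms by (subst (asm) continuous_on_eq_continuous_at) (auto simp: open_Compl)
qed

text \<open>Instead of closing a contour, the shift itself is made complex: the integral is
  holomorphic in the shift z on the strip |Re z| < \<pi>/2, where the base keeps a positive real
  part. For imaginary z the shift is a translation of the real variable and changes nothing, so the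
  integral is constant on the whole strip. Real z is the shift asked for; \<sigma> treats both
  directions together.\<close>

lemma cosh_line_shift:
  fixes \<sigma> k :: real and \<kappa> \<mu> :: complex
  assumes \<sigma>: "\<sigma> = 1 \<or> \<sigma> = -1" and km: "\<bar>Re \<mu>\<bar> < Re \<kappa>" and \<phi>: "\<bar>\<phi>\<bar> < pi / 2"
  shows "(LINT \<eta>|lborel. (cosh (of_real \<eta> + \<i> * of_real (\<sigma> * \<phi>)) - \<i> * of_real (\<sigma> * k)) powr (- \<kappa>) *
            exp (- \<mu> * (of_real \<eta> + \<i> * of_real (\<sigma> * \<phi>)))) =
         (LINT \<eta>|lborel. (cosh (of_real \<eta>) - \<i> * of_real (\<sigma> * k)) powr (- \<kappa>) * exp (- \<mu> * of_real \<eta>))"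
proof -
  define S where "S = {z. \<bar>Re z\<bar> < pi / 2}"
  define f where "f = (\<lambda>z \<eta>. (cosh (complex_of_real \<eta> + \<i> * of_real \<sigma> * z) - \<i> * of_real (\<sigma> * k)) powr (- \<kappa>) *
            exp (- \<mu> * (of_real \<eta> + \<i> * of_real \<sigma> * z)))"
  have Seq: "S = {z. Re z < pi / 2} \<inter> {z. Re z > - (pi / 2)}" by (auto simp: S_def)
  have opS: "open S" unfolding Seq by (intro open_Int open_halfspace_Re_lt open_halfspace_Re_gt)
  have conS: "connected S" unfolding Seq
    by (intro convex_connected convex_Int convex_halfspace_Re_lt convex_halfspace_Re_gt)
  have \<sigma>2: "\<sigma> * \<sigma> = 1" "\<bar>\<sigma>\<bar> = 1" using \<sigma> by auto
  have Rebase: "Re (cosh (complex_of_real \<eta> + \<i> * of_real \<sigma> * z) - \<i> * of_real (\<sigma> * k)) = cosh (\<eta> - \<sigma> * Im z) * cos (Re z)" for \<eta> z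
    using \<sigma> by (auto simp: Re_cosh)
  have Repos: "Re (cosh (complex_of_real \<eta> + \<i> * of_real \<sigma> * z) - \<i> * of_real (\<sigma> * k)) > 0" if "z \<in> S" for \<eta> z
  proof -
    have "cos (Re z) > 0" using that by (intro cos_gt_zero_pi) (auto simp: S_def)
    thus ?thesis unfolding Rebase by simp
  qed
  have nn: "cosh (complex_of_real \<eta> + \<i> * of_real \<sigma> * z) - \<i> * of_real (\<sigma> * k) \<notin> \<real>\<^sub>\<le>\<^sub>0" if "z \<in> S" for \<eta> z
    using Repos[OF that, of \<eta>] by (auto simp: complex_nonpos_Reals_iff)
  have holF: "(\<lambda>z. \<integral>\<eta>. f z \<eta> \<partial>lborel) holomorphic_on S"
  proof (rule holomorphic_on_integral[OF opS])
    show "f z \<in> borel_measurable lborel" if "z \<in> S" for z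
    proof -
      have "continuous_on UNIV (f z)" unfolding f_def
        by (intro continuous_intros continuous_on_powr_const) (use nn[OF that] in auto)
      thus ?thesis using borel_measurable_continuous_onI by auto
    qed
    show "(\<lambda>z. f z \<eta>) holomorphic_on S" for \<eta>
      unfolding f_def cosh_field_def using nn[of _ \<eta>]
      by (intro holomorphic_intros) (auto simp: cosh_field_def)
    fix z0 assume z0: "z0 \<in> S"
    define e where "e = (pi / 2 - \<bar>Re z0\<bar>) / 2"
    have e: "e > 0" using z0 by (simp add: e_def S_def)
    define a1 where "a1 = \<bar>Re z0\<bar> + e"
    have a1: "0 \<le> a1" "a1 < pi / 2" using e by (auto simp: a1_def e_def field_simps)
    define b1 where "b1 = \<bar>Im z0\<bar> + e"
    define c0 where "c0 = cos a1 * exp (- b1) / 2"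
    have c0: "c0 > 0" using cos_gt_zero_pi[of a1] a1 by (simp add: c0_def)
    define h where "h = (\<lambda>\<eta>. (c0 powr (- Re \<kappa>) * exp (pi * \<bar>Im \<kappa>\<bar>) * exp (norm \<mu> * (norm z0 + e))) * exp (- (Re \<kappa> - \<bar>Re \<mu>\<bar>) * \<bar>\<eta>\<bar>))"
    have "norm (f z \<eta>) \<le> h \<eta>" if z: "z \<in> ball z0 e \<inter> S" for z \<eta>
    proof -
      have dz: "norm (z - z0) < e" using z by (auto simp: dist_norm norm_minus_commute)
      have az: "\<bar>Re z\<bar> \<le> a1" "\<bar>Im z\<bar> \<le> b1"
        using dz abs_Re_le_cmod[of "z - z0"] abs_Im_le_cmod[of "z - z0"] by (auto simp: a1_def b1_def)
      have cosz: "cos (Re z) \<ge> cos a1"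
        using cos_monotone_0_pi_le[of "\<bar>Re z\<bar>" a1] az a1 by simp
      let ?b = "cosh (complex_of_real \<eta> + \<i> * of_real \<sigma> * z) - \<i> * of_real (\<sigma> * k)"
      have "\<bar>\<eta> - \<sigma> * Im z\<bar> \<ge> \<bar>\<eta>\<bar> - b1" using \<sigma> az by auto
      hence "exp (\<bar>\<eta>\<bar> - b1) / 2 \<le> cosh (\<eta> - \<sigma> * Im z)"
        by (intro order_trans[OF _ cosh_real_ge]) simp
      hence "exp (\<bar>\<eta>\<bar> - b1) / 2 * cos a1 \<le> cosh (\<eta> - \<sigma> * Im z) * cos (Re z)"
        using cosz cos_gt_zero_pi[of a1] a1 by (intro mult_mono) auto
      also have "\<dots> = Re ?b" by (rule Rebase[symmetric])
      also have "\<dots> \<le> norm ?b" by (rule complex_Re_le_cmod)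
      finally have lb: "c0 * exp \<bar>\<eta>\<bar> \<le> norm ?b" by (simp add: c0_def exp_diff exp_minus field_simps)
      have nz: "?b \<noteq> 0" using nn[of z \<eta>] z by auto
      have "norm (?b powr (- \<kappa>)) \<le> norm ?b powr (- Re \<kappa>) * exp (pi * \<bar>Im \<kappa>\<bar>)"
        using norm_powr_le[OF nz, of "- \<kappa>"] by simp
      also have "\<dots> \<le> (c0 * exp \<bar>\<eta>\<bar>) powr (- Re \<kappa>) * exp (pi * \<bar>Im \<kappa>\<bar>)"
        using lb c0 km by (intro mult_right_mono powr_mono2') auto
      also have "(c0 * exp \<bar>\<eta>\<bar>) powr (- Re \<kappa>) = c0 powr (- Re \<kappa>) * exp (- Re \<kappa> * \<bar>\<eta>\<bar>)"
        using c0 by (simp add: powr_def ln_mult distrib_left flip: exp_add)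
      finally have 1: "norm (?b powr (- \<kappa>)) \<le> c0 powr (- Re \<kappa>) * exp (- Re \<kappa> * \<bar>\<eta>\<bar>) * exp (pi * \<bar>Im \<kappa>\<bar>)" .
      have "Re (- \<mu> * (of_real \<eta> + \<i> * of_real \<sigma> * z)) = - (Re \<mu> * \<eta>) + Re (- \<mu> * (\<i> * of_real \<sigma> * z))"
        by (simp add: algebra_simps)
      also have "\<dots> \<le> \<bar>Re \<mu>\<bar> * \<bar>\<eta>\<bar> + norm \<mu> * (norm z0 + e)"
      proof (intro add_mono)
        show "- (Re \<mu> * \<eta>) \<le> \<bar>Re \<mu>\<bar> * \<bar>\<eta>\<bar>" unfolding abs_mult[symmetric] by simp
        have "norm z \<le> norm z0 + norm (z - z0)" using norm_triangle_ineq[of z0 "z - z0"] by simp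
        also have "\<dots> \<le> norm z0 + e" using dz by simp
        finally have "norm z \<le> norm z0 + e" .
        hence "norm \<mu> * norm z \<le> norm \<mu> * (norm z0 + e)" by (intro mult_left_mono) auto
        moreover have "norm (- \<mu> * (\<i> * of_real \<sigma> * z)) = norm \<mu> * norm z" using \<sigma>2 by (simp add: norm_mult)
        ultimately show "Re (- \<mu> * (\<i> * of_real \<sigma> * z)) \<le> norm \<mu> * (norm z0 + e)"
          using complex_Re_le_cmod[of "- \<mu> * (\<i> * of_real \<sigma> * z)"] by linarith
      qed
      finally have 2: "norm (exp (- \<mu> * (of_real \<eta> + \<i> * of_real \<sigma> * z))) \<le> exp (\<bar>Re \<mu>\<bar> * \<bar>\<eta>\<bar>) * exp (norm \<mu> * (norm z0 + e))"
        unfolding norm_exp_eq_Re exp_add[symmetric] by (simp only: exp_le_cancel_iff)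
      have "norm (f z \<eta>) \<le> (c0 powr (- Re \<kappa>) * exp (- Re \<kappa> * \<bar>\<eta>\<bar>) * exp (pi * \<bar>Im \<kappa>\<bar>)) * (exp (\<bar>Re \<mu>\<bar> * \<bar>\<eta>\<bar>) * exp (norm \<mu> * (norm z0 + e)))"
        unfolding f_def norm_mult using 1 2 by (intro mult_mono) auto
      also have "\<dots> = h \<eta>" by (simp add: h_def algebra_simps flip: exp_add)
      finally show ?thesis .
    qed
    moreover have "integrable lborel h" unfolding h_def
      by (intro integrable_mult_right integrable_exp_minus_abs) (use km in auto)
    ultimately show "\<exists>d>0. \<exists>h. integrable lborel h \<and> (\<forall>z\<in>ball z0 d \<inter> S. \<forall>\<eta>\<in>space lborel. norm (f z \<eta>) \<le> h \<eta>)"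
      using e by blast
  qed
  have "(\<integral>\<eta>. f (of_real \<phi>) \<eta> \<partial>lborel) = (\<integral>\<eta>. f 0 \<eta> \<partial>lborel)"
  proof (rule holomorphic_eq_on_segment[OF holF holomorphic_on_const opS conS, where l = 0 and r = 1 and v = \<i> and p = 0])
    show "complex_of_real \<phi> \<in> S" using \<phi> by (simp add: S_def)
    fix t :: real
    have "(\<integral>\<eta>. f 0 \<eta> \<partial>lborel) = (\<integral>\<eta>. f 0 (- \<sigma> * t + 1 * \<eta>) \<partial>lborel)"
      using lborel_integral_real_affine[of 1 "f 0" "- \<sigma> * t"] by simp
    also have "(\<lambda>\<eta>. f 0 (- \<sigma> * t + 1 * \<eta>)) = f (0 + of_real t * \<i>)"
      unfolding f_def by (intro ext) (simp add: algebra_simps)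
    finally show "0 + of_real t * \<i> \<in> S \<and> (\<integral>\<eta>. f (0 + of_real t * \<i>) \<eta> \<partial>lborel) = (\<integral>\<eta>. f 0 \<eta> \<partial>lborel)"
      by (simp add: S_def)
  qed auto
  thus ?thesis by (simp add: f_def mult.assoc)
qed

lemma powr_of_real_mult:
  assumes "r > 0" "z \<noteq> 0"
  shows "(complex_of_real r * z) powr a = of_real r powr a * z powr a"
  using assms Ln_times_of_real[of r z] by (simp add: powr_def Ln_of_real exp_add algebra_simps)

text \<open>On the boundary line the base is i \<sigma> (sinh \<eta> - k), with argument
  \<plusminus> \<pi>/2 according to its sign; this splits the integral at - ln \<rho> and gives the
  two halves opposite phases. The shift is available only strictly inside the strip, so the line is
  reached by dominated convergence.\<close>

lemma cosh_line_boundary: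
  fixes \<sigma> \<rho> :: real and \<kappa> \<mu> :: complex
  assumes \<sigma>: "\<sigma> = 1 \<or> \<sigma> = -1" and \<rho>: "\<rho> > 0" and km: "\<bar>Re \<mu>\<bar> < Re \<kappa>" and \<kappa>1: "Re \<kappa> < 1"
  defines "k \<equiv> (1 / \<rho> - \<rho>) / 2"
  shows "(LINT \<eta>|lborel. (cosh (of_real \<eta>) - \<i> * of_real (\<sigma> * k)) powr (- \<kappa>) * exp (- \<mu> * of_real \<eta>)) =
     exp (- (\<i> * of_real (\<sigma> * pi / 2) * \<mu>)) *
      (exp (- (\<i> * of_real (\<sigma> * pi / 2) * \<kappa>)) *
         (LINT \<eta>:{- ln \<rho><..}|lborel. of_real (sinh \<eta> - k) powr (- \<kappa>) * exp (- \<mu> * of_real \<eta>)) +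
       exp (\<i> * of_real (\<sigma> * pi / 2) * \<kappa>) *
         (LINT \<eta>:{..<- ln \<rho>}|lborel. of_real (k - sinh \<eta>) powr (- \<kappa>) * exp (- \<mu> * of_real \<eta>)))"
proof -
  \<comment> \<open>Shifts increasing to \<pi>/2; they are nonnegative because 1 \<le>
    \<pi>/2.\<close>
  define \<phi> where "\<phi> = (\<lambda>n. pi / 2 - 1 / real (Suc n))"
  have \<phi>: "0 \<le> \<phi> n" "\<phi> n < pi / 2" for n
  proof -
    have "1 / real (Suc n) \<le> 1" by simp
    thus "0 \<le> \<phi> n" using pi_ge_two unfolding \<phi>_def by linarith
  qed (auto simp: \<phi>_def)
  have \<phi>lim: "\<phi> \<longlonglongrightarrow> pi / 2"
    unfolding \<phi>_def using tendsto_diff[OF tendsto_const LIMSEQ_inverse_real_of_nat, of "pi / 2"] by (simp add: inverse_eq_divide)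
  define b where "b = (\<lambda>\<phi> \<eta>. cosh (complex_of_real \<eta> + \<i> * of_real (\<sigma> * \<phi>)) - \<i> * of_real (\<sigma> * k))"
  define f where "f = (\<lambda>\<phi> \<eta>. b \<phi> \<eta> powr (- \<kappa>) * exp (- \<mu> * (of_real \<eta> + \<i> * of_real (\<sigma> * \<phi>))))"
  have sk: "sinh (- ln \<rho>) = k" using sinh_minus_ln[OF \<rho>] by (simp add: k_def)
  have less: "\<eta> < - ln \<rho> \<longleftrightarrow> sinh \<eta> < k" "\<eta> > - ln \<rho> \<longleftrightarrow> sinh \<eta> > k" for \<eta>
    unfolding sk[symmetric] by (simp_all only: sinh_real_less_iff)
  have breal: "b \<phi> \<eta> = Complex (cosh \<eta> * cos \<phi>) (\<sigma> * (sinh \<eta> * sin \<phi> - k))" for \<phi> \<eta>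
    using \<sigma> by (auto simp: b_def complex_eq_iff Re_cosh Im_cosh)
  have blim: "b (pi / 2) \<eta> = \<i> * of_real (\<sigma> * (sinh \<eta> - k))" for \<eta>
    by (simp add: breal complex_eq_iff)
  \<comment> \<open>With s = sinh \<eta> and S = sin \<phi>, |b|^2 = 1 - S^2 + s^2 + k^2 - 2 S s k,
    which is at least (s - k)^2 / 2 for 0 \<le> S \<le> 1. The bound is free of \<phi> and vanishes
    only where the limit does.\<close>
  have bnorm: "norm (b \<phi> \<eta>) \<ge> \<bar>sinh \<eta> - k\<bar> / sqrt 2" if "0 \<le> \<phi>" "\<phi> \<le> pi / 2" for \<phi> \<eta>
  proof -
    define s where "s = sinh \<eta>"
    define S where "S = sin \<phi>"
    have S: "0 \<le> S" "S \<le> 1" unfolding S_def using that by (auto intro!: sin_ge_zero)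
    have "(norm (b \<phi> \<eta>))\<^sup>2 = (cosh \<eta>)\<^sup>2 * (cos \<phi>)\<^sup>2 + \<sigma>\<^sup>2 * (sinh \<eta> * sin \<phi> - k)\<^sup>2"
      by (simp add: breal cmod_power2 power_mult_distrib)
    also have "\<dots> = (1 + s\<^sup>2) * (1 - S\<^sup>2) + (s * S - k)\<^sup>2"
      using \<sigma> by (auto simp: s_def S_def cosh_square_eq cos_squared_eq add.commute)
    also have "\<dots> = (1 - S\<^sup>2) + s\<^sup>2 + k\<^sup>2 - 2 * S * (s * k)" by (simp add: algebra_simps power2_eq_square)
    finally have eq: "(norm (b \<phi> \<eta>))\<^sup>2 = (1 - S\<^sup>2) + s\<^sup>2 + k\<^sup>2 - 2 * S * (s * k)" .
    have "S\<^sup>2 \<le> 1" using S by (simp add: abs_square_le_1)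
    moreover have "\<bar>s * k\<bar> \<le> (s\<^sup>2 + k\<^sup>2) / 2"
    proof -
      have "0 \<le> (s - k)\<^sup>2" "0 \<le> (s + k)\<^sup>2" by simp_all
      hence "2 * (s * k) \<le> s\<^sup>2 + k\<^sup>2" "- 2 * (s * k) \<le> s\<^sup>2 + k\<^sup>2" unfolding power2_eq_square by (simp_all add: algebra_simps)
      thus ?thesis by (simp add: abs_le_iff)
    qed
    moreover have "\<bar>(2 * S - 1) * (s * k)\<bar> \<le> 1 * \<bar>s * k\<bar>"
      unfolding abs_mult[of "2 * S - 1"] using S by (intro mult_right_mono) auto
    ultimately have "(s\<^sup>2 + k\<^sup>2) / 2 \<ge> (2 * S - 1) * (s * k)"
      by (metis abs_ge_self mult_1 order_trans)
    hence "(norm (b \<phi> \<eta>))\<^sup>2 \<ge> (s\<^sup>2 + k\<^sup>2) / 2 - s * k"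
    proof -
      have gen: "T / 2 - x \<le> 1 - Q + T - (P + x)" if "Q \<le> 1" "P \<le> T / 2" for T P Q x :: real
        using that by simp
      have e: "2 * S * (s * k) = (2 * S - 1) * (s * k) + s * k" by (simp add: algebra_simps)
      have a: "1 - S\<^sup>2 + s\<^sup>2 + k\<^sup>2 = 1 - S\<^sup>2 + (s\<^sup>2 + k\<^sup>2)" by simp
      show ?thesis unfolding eq e a
        by (rule gen[OF \<open>S\<^sup>2 \<le> 1\<close> \<open>(s\<^sup>2 + k\<^sup>2) / 2 \<ge> (2 * S - 1) * (s * k)\<close>])
    qed
    also have "(s\<^sup>2 + k\<^sup>2) / 2 - s * k = (\<bar>sinh \<eta> - k\<bar> / sqrt 2)\<^sup>2"
      by (simp add: s_def power_divide) (simp add: power2_eq_square algebra_simps)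
    finally show ?thesis by (rule power2_le_imp_le) simp
  qed
  have const: "integral\<^sup>L lborel (f (\<phi> n)) = (LINT \<eta>|lborel. (cosh (of_real \<eta>) - \<i> * of_real (\<sigma> * k)) powr (- \<kappa>) * exp (- \<mu> * of_real \<eta>))" for n
    unfolding f_def b_def using \<phi>[of n] by (intro cosh_line_shift \<sigma> km) auto
  have nn: "b \<phi> \<eta> \<notin> \<real>\<^sub>\<le>\<^sub>0" if "0 \<le> \<phi>" "\<phi> < pi / 2" for \<phi> \<eta>
  proof -
    have "cosh \<eta> * cos \<phi> > 0" using that cos_gt_zero_pi[of \<phi>] by simp
    thus ?thesis by (auto simp: breal complex_nonpos_Reals_iff)
  qed
  \<comment> \<open>The two exponentials together dominate exp (|Re \<mu>| |\<eta>|), and 2 powr (Re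
    \<kappa> / 2) accounts for the square root of 2 in \<open>bnorm\<close>.\<close>
  define D where "D = (\<lambda>\<eta>. (2 powr (Re \<kappa> / 2) * exp (pi * \<bar>Im \<kappa>\<bar>) * exp (norm \<mu> * (pi / 2))) *
     (\<bar>sinh \<eta> - k\<bar> powr (- Re \<kappa>) * exp (- \<bar>Re \<mu>\<bar> * \<eta>) + \<bar>sinh \<eta> - k\<bar> powr (- Re \<kappa>) * exp (- (- \<bar>Re \<mu>\<bar>) * \<eta>)))"
  have bound: "norm (f (\<phi> n) \<eta>) \<le> D \<eta>" if "sinh \<eta> \<noteq> k" for n \<eta>
  proof -
    have nz: "b (\<phi> n) \<eta> \<noteq> 0" using nn[OF \<phi>[of n]] by (metis nonpos_Reals_zero_I)
    have p: "\<bar>sinh \<eta> - k\<bar> / sqrt 2 > 0" using that by simp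
    have "norm (b (\<phi> n) \<eta> powr (- \<kappa>)) \<le> norm (b (\<phi> n) \<eta>) powr (- Re \<kappa>) * exp (pi * \<bar>Im \<kappa>\<bar>)"
      using norm_powr_le[OF nz, of "- \<kappa>"] by simp
    also have "\<dots> \<le> (\<bar>sinh \<eta> - k\<bar> / sqrt 2) powr (- Re \<kappa>) * exp (pi * \<bar>Im \<kappa>\<bar>)"
      using bnorm[of "\<phi> n" \<eta>] \<phi>[of n] p km by (intro mult_right_mono powr_mono2') auto
    also have "(\<bar>sinh \<eta> - k\<bar> / sqrt 2) powr (- Re \<kappa>) = 2 powr (Re \<kappa> / 2) * \<bar>sinh \<eta> - k\<bar> powr (- Re \<kappa>)"
      using that by (simp add: powr_def ln_div ln_sqrt flip: exp_add) (simp add: algebra_simps)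
    finally have 1: "norm (b (\<phi> n) \<eta> powr (- \<kappa>)) \<le> 2 powr (Re \<kappa> / 2) * \<bar>sinh \<eta> - k\<bar> powr (- Re \<kappa>) * exp (pi * \<bar>Im \<kappa>\<bar>)" .
    have "Re (- \<mu> * (of_real \<eta> + \<i> * of_real (\<sigma> * \<phi> n))) = - (Re \<mu> * \<eta>) + Im \<mu> * (\<sigma> * \<phi> n)"
      by (simp add: algebra_simps)
    also have "\<dots> \<le> \<bar>Re \<mu>\<bar> * \<bar>\<eta>\<bar> + norm \<mu> * (pi / 2)"
    proof (intro add_mono)
      show "- (Re \<mu> * \<eta>) \<le> \<bar>Re \<mu>\<bar> * \<bar>\<eta>\<bar>" unfolding abs_mult[symmetric] by simp
      have "Im \<mu> * (\<sigma> * \<phi> n) \<le> \<bar>Im \<mu>\<bar> * \<bar>\<sigma> * \<phi> n\<bar>" unfolding abs_mult[symmetric] by simp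
      also have "\<dots> \<le> norm \<mu> * (pi / 2)"
        using \<sigma> \<phi>[of n] abs_Im_le_cmod[of \<mu>] by (intro mult_mono) (auto simp: abs_mult)
      finally show "Im \<mu> * (\<sigma> * \<phi> n) \<le> norm \<mu> * (pi / 2)" .
    qed
    finally have "norm (exp (- \<mu> * (of_real \<eta> + \<i> * of_real (\<sigma> * \<phi> n)))) \<le> exp (\<bar>Re \<mu>\<bar> * \<bar>\<eta>\<bar>) * exp (norm \<mu> * (pi / 2))"
      unfolding norm_exp_eq_Re exp_add[symmetric] by (simp only: exp_le_cancel_iff)
    also have "exp (\<bar>Re \<mu>\<bar> * \<bar>\<eta>\<bar>) \<le> exp (- \<bar>Re \<mu>\<bar> * \<eta>) + exp (- (- \<bar>Re \<mu>\<bar>) * \<eta>)"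
      by (cases "\<eta> \<ge> 0") (auto simp: add_increasing add_increasing2)
    finally have 2: "norm (exp (- \<mu> * (of_real \<eta> + \<i> * of_real (\<sigma> * \<phi> n)))) \<le>
       (exp (- \<bar>Re \<mu>\<bar> * \<eta>) + exp (- (- \<bar>Re \<mu>\<bar>) * \<eta>)) * exp (norm \<mu> * (pi / 2))" by (simp add: mult_right_mono)
    have "norm (f (\<phi> n) \<eta>) \<le> (2 powr (Re \<kappa> / 2) * \<bar>sinh \<eta> - k\<bar> powr (- Re \<kappa>) * exp (pi * \<bar>Im \<kappa>\<bar>)) *
        ((exp (- \<bar>Re \<mu>\<bar> * \<eta>) + exp (- (- \<bar>Re \<mu>\<bar>) * \<eta>)) * exp (norm \<mu> * (pi / 2)))"
      unfolding f_def norm_mult by (intro mult_mono 1 2) auto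
    also have "\<dots> = D \<eta>" by (simp add: D_def algebra_simps)
    finally show ?thesis .
  qed
  have AE: "AE \<eta> in lborel. \<eta> \<noteq> - ln \<rho>" by (rule AE_lborel_singleton)
  have ne: "sinh \<eta> \<noteq> k" if "\<eta> \<noteq> - ln \<rho>" for \<eta> using less[of \<eta>] that by (metis less_linear less_irrefl)
  define Y where "Y = (\<lambda>\<eta>. indicator {- ln \<rho><..} \<eta> *\<^sub>R (of_real (sinh \<eta> - k) powr (- \<kappa>) * exp (- \<mu> * of_real \<eta>)))"
  define X where "X = (\<lambda>\<eta>. indicator {..<- ln \<rho>} \<eta> *\<^sub>R (of_real (k - sinh \<eta>) powr (- \<kappa>) * exp (- \<mu> * of_real \<eta>)))"
  have YI: "integrable lborel Y"
    using sinh_Euler_integral(1)[OF \<rho> \<kappa>1, of \<mu>] km unfolding Y_def k_def set_integrable_def by simp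
  have XI: "integrable lborel X"
    using sinh_left_integrable[OF \<rho> \<kappa>1, of \<mu>] km unfolding X_def k_def set_integrable_def by simp
  have G: "f (pi / 2) \<eta> = exp (- (\<i> * of_real (\<sigma> * pi / 2) * \<mu>)) * (exp (- (\<i> * of_real (\<sigma> * pi / 2) * \<kappa>)) * Y \<eta> + exp (\<i> * of_real (\<sigma> * pi / 2) * \<kappa>) * X \<eta>)" for \<eta>
  proof -
    have e: "exp (- \<mu> * (of_real \<eta> + \<i> * of_real (\<sigma> * (pi / 2)))) = exp (- (\<i> * of_real (\<sigma> * pi / 2) * \<mu>)) * exp (- \<mu> * of_real \<eta>)"
      unfolding exp_add[symmetric] by (simp add: algebra_simps)
    have unit: "\<i> * of_real (\<tau> * x) = exp (\<i> * of_real (\<tau> * pi / 2) + of_real (ln x))" if "x > 0" "\<tau> = 1 \<or> \<tau> = -1" for \<tau> x :: real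
    proof -
      have "exp (\<i> * of_real (\<tau> * pi / 2)) = \<i> * of_real \<tau>"
        unfolding cis_conv_exp[symmetric] using that(2) by (auto simp: complex_eq_iff)
      thus ?thesis using that(1) by (simp add: exp_add exp_of_real)
    qed
    have pw: "(\<i> * of_real (\<tau> * x)) powr (- \<kappa>) = exp (- (\<i> * of_real (\<tau> * pi / 2) * \<kappa>)) * of_real x powr (- \<kappa>)" if "x > 0" "\<tau> = 1 \<or> \<tau> = -1" for \<tau> x :: real
    proof -
      have "\<bar>Im (\<i> * of_real (\<tau> * pi / 2) + of_real (ln x))\<bar> < pi" using that by auto
      thus ?thesis unfolding unit[OF that] exp_powr[OF \<open>\<bar>Im (\<i> * of_real (\<tau> * pi / 2) + of_real (ln x))\<bar> < pi\<close>] of_real_powr_exp[OF that(1)] exp_add[symmetric]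
        by (simp add: algebra_simps)
    qed
    consider "sinh \<eta> > k" | "sinh \<eta> < k" | "sinh \<eta> = k" by linarith
    thus ?thesis
    proof cases
      case 1
      hence "b (pi / 2) \<eta> powr (- \<kappa>) = exp (- (\<i> * of_real (\<sigma> * pi / 2) * \<kappa>)) * of_real (sinh \<eta> - k) powr (- \<kappa>)"
        unfolding blim using \<sigma> by (intro pw) auto
      moreover have "X \<eta> = 0" "Y \<eta> = of_real (sinh \<eta> - k) powr (- \<kappa>) * exp (- \<mu> * of_real \<eta>)"
        using 1 by (auto simp: X_def Y_def less)
      ultimately show ?thesis unfolding f_def e by simp
    next
      case 2
      have "\<i> * of_real (\<sigma> * (sinh \<eta> - k)) = \<i> * of_real ((- \<sigma>) * (k - sinh \<eta>))" by (simp add: algebra_simps)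
      hence "b (pi / 2) \<eta> powr (- \<kappa>) = (\<i> * of_real ((- \<sigma>) * (k - sinh \<eta>))) powr (- \<kappa>)" unfolding blim by (simp only:)
      also have "\<dots> = exp (- (\<i> * of_real (- \<sigma> * pi / 2) * \<kappa>)) * of_real (k - sinh \<eta>) powr (- \<kappa>)"
        using \<sigma> 2 by (intro pw) auto
      finally have "b (pi / 2) \<eta> powr (- \<kappa>) = exp (\<i> * of_real (\<sigma> * pi / 2) * \<kappa>) * of_real (k - sinh \<eta>) powr (- \<kappa>)" by simp
      moreover have "Y \<eta> = 0" "X \<eta> = of_real (k - sinh \<eta>) powr (- \<kappa>) * exp (- \<mu> * of_real \<eta>)"
        using 2 by (auto simp: X_def Y_def less)
      ultimately show ?thesis unfolding f_def e by simp
    next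
      case 3
      \<comment> \<open>Here 0 powr (-\<kappa>) is 0 by convention and both pieces vanish, so the
        splitting holds at every \<eta>, not only almost everywhere.\<close>
      have "b (pi / 2) \<eta> = 0" unfolding blim using 3 by simp
      thus ?thesis using 3 by (simp add: f_def X_def Y_def less)
    qed
  qed
  have "(\<lambda>n. integral\<^sup>L lborel (f (\<phi> n))) \<longlonglongrightarrow> integral\<^sup>L lborel (f (pi / 2))"
  proof (rule integral_dominated_convergence[where w = D])
    show "f (pi / 2) \<in> borel_measurable lborel" unfolding G[abs_def] using YI XI by simp
    show "f (\<phi> n) \<in> borel_measurable lborel" for n
    proof -
      have "continuous_on UNIV (f (\<phi> n))" unfolding f_def
        by (intro continuous_intros continuous_on_powr_const nn \<phi>) (auto simp: b_def[abs_def] intro!: continuous_intros)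
      thus ?thesis using borel_measurable_continuous_onI by auto
    qed
    show "integrable lborel D" unfolding D_def k_def using km \<kappa>1
      by (intro integrable_mult_right Bochner_Integration.integrable_add sinh_singular_integrable[OF \<rho>]) auto
    show "AE \<eta> in lborel. (\<lambda>n. f (\<phi> n) \<eta>) \<longlonglongrightarrow> f (pi / 2) \<eta>"
      using AE
    proof eventually_elim
      fix \<eta> assume "\<eta> \<noteq> - ln \<rho>"
      hence "sinh \<eta> \<noteq> k" by (rule ne)
      hence "b (pi / 2) \<eta> \<notin> \<real>\<^sub>\<le>\<^sub>0" unfolding blim using \<sigma> by (auto simp: complex_nonpos_Reals_iff)
      hence c: "isCont (\<lambda>z. z powr (- \<kappa>)) (b (pi / 2) \<eta>)" by (rule continuous_powr_at)
      have "(\<lambda>n. b (\<phi> n) \<eta>) \<longlonglongrightarrow> b (pi / 2) \<eta>"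
        unfolding b_def cosh_field_def by (intro tendsto_intros \<phi>lim) auto
      hence "(\<lambda>n. b (\<phi> n) \<eta> powr (- \<kappa>)) \<longlonglongrightarrow> b (pi / 2) \<eta> powr (- \<kappa>)"
        using isCont_tendsto_compose[OF c] by blast
      thus "(\<lambda>n. f (\<phi> n) \<eta>) \<longlonglongrightarrow> f (pi / 2) \<eta>"
        unfolding f_def by (rule tendsto_mult) (intro tendsto_intros \<phi>lim)
    qed
    show "AE \<eta> in lborel. norm (f (\<phi> n) \<eta>) \<le> D \<eta>" for n
      using AE by eventually_elim (use bound ne in blast)
  qed
  hence "integral\<^sup>L lborel (f (pi / 2)) = (LINT \<eta>|lborel. (cosh (of_real \<eta>) - \<i> * of_real (\<sigma> * k)) powr (- \<kappa>) * exp (- \<mu> * of_real \<eta>))"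
    unfolding const by (simp add: LIMSEQ_const_iff)
  moreover have "integral\<^sup>L lborel (f (pi / 2)) = exp (- (\<i> * of_real (\<sigma> * pi / 2) * \<mu>)) * (exp (- (\<i> * of_real (\<sigma> * pi / 2) * \<kappa>)) * integral\<^sup>L lborel Y + exp (\<i> * of_real (\<sigma> * pi / 2) * \<kappa>) * integral\<^sup>L lborel X)"
    unfolding G[abs_def] using YI XI by simp
  ultimately show ?thesis unfolding set_lebesgue_integral_def Y_def X_def by simp
qed


section \<open>The connection formula on the imaginary segment\<close>

definition gfun :: "complex \<Rightarrow> complex \<Rightarrow> complex \<Rightarrow> complex" where
  "gfun \<alpha> lam w = Gamma (\<alpha> + 1 / 2) / (2 * of_real (sqrt pi)) * w powr \<alpha> * legint (\<alpha> + 1 / 2) (lam - 1 / 2) w"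

text \<open>The Gegenbauer function stripped of the prefactor common to both sides, see
  \<open>gegenbauer_conn\<close>. The power of tanh (\<xi>/2) is the Legendre prefactor at z = cosh
  \<xi>, in a form that stays analytic in the whole strip 0 < Im \<xi> < \<pi>.\<close>

definition conn_lhs :: "complex \<Rightarrow> complex \<Rightarrow> complex \<Rightarrow> complex" where
  "conn_lhs \<alpha> lam \<xi> = of_real (sqrt pi) * Gamma (\<alpha> + lam) * (2 * sinh \<xi>) powr (1 / 2) *
     tanh (\<xi> / 2) powr (lam - 1 / 2) * reg_hyp2F1 (\<alpha> + 1 / 2) (1 / 2 - \<alpha>) (lam + 1 / 2) ((1 - cosh \<xi>) / 2)"

text \<open>The multiplier is the value of \<open>Kfac\<close> above the real axis; the lower half
  of the strip is reached by reflection in \<open>connection\<close>.\<close>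

definition conn_rhs :: "complex \<Rightarrow> complex \<Rightarrow> complex \<Rightarrow> complex" where
  "conn_rhs \<alpha> lam \<xi> = exp (\<xi> * \<alpha>) * gfun \<alpha> lam (1 / (1 - exp (2 * \<xi>))) +
     exp (of_real pi * \<i> * lam) * (exp (- \<xi> * \<alpha>) * gfun \<alpha> lam (1 / (1 - exp (- 2 * \<xi>))))"

text \<open>On the imaginary axis both arguments of \<open>gfun\<close> have real part 1/2, and w +
  sinh^2 (\<eta>/2) becomes half of cosh \<eta> - i \<sigma> k.\<close>

lemma legint_cosh:
  assumes \<sigma>: "\<sigma> = 1 \<or> \<sigma> = (-1::real)"
  shows "legint \<kappa> \<mu> (1 / 2 - \<i> * of_real (\<sigma> * k) / 2) =
    of_real 2 powr \<kappa> * (LINT \<eta>|lborel. (cosh (of_real \<eta>) - \<i> * of_real (\<sigma> * k)) powr (- \<kappa>) * exp (- \<mu> * of_real \<eta>))"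
proof -
  have "(1 / 2 - \<i> * of_real (\<sigma> * k) / 2 + of_real ((sinh (\<eta> / 2))\<^sup>2)) powr (- \<kappa>) =
     of_real 2 powr \<kappa> * (cosh (of_real \<eta>) - \<i> * of_real (\<sigma> * k)) powr (- \<kappa>)" for \<eta> :: real
  proof -
    have "(sinh (\<eta> / 2))\<^sup>2 = (cosh \<eta> - 1) / 2"
      using cosh_double[of "\<eta> / 2"] cosh_square_eq[of "\<eta> / 2"] by simp
    hence eq: "1 / 2 - \<i> * of_real (\<sigma> * k) / 2 + of_real ((sinh (\<eta> / 2))\<^sup>2) = of_real (1 / 2) * (cosh (of_real \<eta>) - \<i> * of_real (\<sigma> * k))"
      by (simp add: complex_eq_iff Re_cosh Im_cosh)
    have nz: "cosh (of_real \<eta>) - \<i> * of_real (\<sigma> * k) \<noteq> (0::complex)"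
    proof
      assume "cosh (of_real \<eta>) - \<i> * of_real (\<sigma> * k) = (0::complex)"
      hence "Re (cosh (of_real \<eta>) - \<i> * of_real (\<sigma> * k)) = 0" by (simp only: zero_complex.sel)
      thus False by (simp add: Re_cosh)
    qed
    have p: "complex_of_real (1 / 2) powr (- \<kappa>) = of_real 2 powr \<kappa>"
      using of_real_powr_exp[of "1/2" "- \<kappa>"] of_real_powr_exp[of 2 \<kappa>] by (simp add: ln_div)
    have half: "0 < (1 / 2 :: real)" by simp
    show ?thesis by (simp only: eq powr_of_real_mult[OF half nz] p)
  qed
  thus ?thesis unfolding legint_def by (simp only: mult.assoc integral_mult_right_zero)
qed

lemma connection_base:
  assumes \<theta>: "0 < \<theta>" "\<theta> < pi" and \<alpha>: "0 < Re \<alpha>" "Re \<alpha> < 1 / 2" and lam: "\<bar>Re lam - 1 / 2\<bar> < Re \<alpha> + 1 / 2"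
  shows "conn_lhs \<alpha> lam (\<i> * of_real \<theta>) = conn_rhs \<alpha> lam (\<i> * of_real \<theta>)"
proof -
  define \<mu> where "\<mu> = lam - 1 / 2"
  define \<kappa> where "\<kappa> = \<alpha> + 1 / 2"
  have \<kappa>: "\<bar>Re \<mu>\<bar> < Re \<kappa>" "Re \<kappa> < 1" using \<alpha> lam by (auto simp: \<mu>_def \<kappa>_def)
  have sin: "sin \<theta> > 0" using \<theta> by (simp add: sin_gt_zero)
  define L where "L = ln (2 * sin \<theta>)"
  have eL: "exp (complex_of_real L) = of_real (2 * sin \<theta>)" using sin by (simp add: L_def exp_of_real)
  \<comment> \<open>This choice makes k = cot \<theta>, turns 2 \<rho> / (1 + \<rho>^2) into sin
    \<theta>, and the argument \<rho>^2 / (1 + \<rho>^2) of Euler's integral into (1 - cos \<theta>)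
    / 2, the hypergeometric argument on the left.\<close>
  define \<rho> where "\<rho> = tan (\<theta> / 2)"
  have \<rho>: "\<rho> > 0" using \<theta> unfolding \<rho>_def by (intro tan_gt_zero) auto
  have c2: "cos (\<theta> / 2) > 0" using \<theta> by (intro cos_gt_zero) auto
  have c2sq: "(cos (\<theta> / 2))\<^sup>2 \<noteq> 0" using c2 by simp
  have one\<rho>: "1 + \<rho>\<^sup>2 = 1 / (cos (\<theta> / 2))\<^sup>2"
    using c2sq by (simp add: \<rho>_def tan_def power_divide field_simps)
  have sin\<rho>: "2 * \<rho> / (1 + \<rho>\<^sup>2) = sin \<theta>"
    using c2 sin_double[of "\<theta> / 2"] unfolding one\<rho> by (simp add: \<rho>_def tan_def power2_eq_square)
  have w\<rho>: "\<rho>\<^sup>2 / (1 + \<rho>\<^sup>2) = (1 - cos \<theta>) / 2"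
    using c2 cos_double_sin[of "\<theta> / 2"] unfolding one\<rho> by (simp add: \<rho>_def tan_def power_divide)
  define k where "k = (1 / \<rho> - \<rho>) / 2"
  have k: "k = cos \<theta> / sin \<theta>"
  proof -
    have "sin (\<theta> / 2) > 0" using \<theta> by (intro sin_gt_zero) auto
    thus ?thesis using c2 sin_double[of "\<theta> / 2"] cos_double[of "\<theta> / 2"]
      by (simp add: k_def \<rho>_def tan_def field_simps power2_eq_square)
  qed
  have E: "exp (\<i> * of_real \<theta>) = Complex (cos \<theta>) (sin \<theta>)"
    by (simp add: complex_eq_iff Re_exp Im_exp)
  have ei: "exp (\<i> * of_real (pi / 2)) = \<i>" unfolding cis_conv_exp[symmetric] by (simp add: complex_eq_iff)
  have Em: "exp (- (\<i> * of_real \<theta>)) = Complex (cos \<theta>) (- sin \<theta>)"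
    by (simp add: complex_eq_iff Re_exp Im_exp)
  have S: "2 * \<i> * of_real (sin \<theta>) = exp (\<i> * of_real \<theta>) - exp (- (\<i> * of_real \<theta>))"
    unfolding E Em by (simp add: complex_eq_iff)
  have d1: "1 - exp (2 * (\<i> * of_real \<theta>)) = - (2 * \<i> * of_real (sin \<theta>)) * exp (\<i> * of_real \<theta>)"
    unfolding S by (simp add: algebra_simps flip: exp_add)
  have d2: "1 - exp (- 2 * (\<i> * of_real \<theta>)) = 2 * \<i> * of_real (sin \<theta>) * exp (- (\<i> * of_real \<theta>))"
    unfolding S by (simp add: algebra_simps flip: exp_add)
  \<comment> \<open>\<open>z1\<close> and \<open>z2\<close> are the principal logarithms of the two
    arguments: their imaginary parts \<plusminus> (\<pi>/2 - \<theta>) are below \<pi> in modulus,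
    so the powers with exponent \<alpha> are plain exponentials.\<close>
  define z1 where "z1 = \<i> * of_real (pi / 2) - \<i> * of_real \<theta> - of_real L"
  define z2 where "z2 = - (\<i> * of_real (pi / 2)) + \<i> * of_real \<theta> - of_real L"
  have w1e: "1 / (1 - exp (2 * (\<i> * of_real \<theta>))) = exp z1"
    unfolding z1_def d1 exp_diff eL ei using sin by (simp add: field_simps)
  have w2e: "1 / (1 - exp (- 2 * (\<i> * of_real \<theta>))) = exp z2"
    unfolding z2_def d2 exp_diff exp_add exp_minus eL ei using sin by (simp add: field_simps)
  have w1k: "exp z1 = 1 / 2 - \<i> * of_real ((-1) * k) / 2"
  proof -
    have e: "exp z1 = of_real (1 / (2 * sin \<theta>)) * (\<i> * exp (- (\<i> * of_real \<theta>)))"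
      unfolding z1_def exp_diff eL ei exp_minus by (simp only: divide_inverse of_real_mult of_real_inverse mult_ac mult_1)
    show ?thesis unfolding e Em k using sin by (simp add: complex_eq_iff)
  qed
  have w2k: "exp z2 = 1 / 2 - \<i> * of_real (1 * k) / 2"
  proof -
    have e: "exp z2 = of_real (1 / (2 * sin \<theta>)) * (- \<i> * exp (\<i> * of_real \<theta>))"
      unfolding z2_def exp_diff exp_add exp_minus eL ei
      by (simp only: divide_inverse of_real_mult of_real_inverse mult_ac mult_1 inverse_i mult_minus_left mult_minus_right)
    show ?thesis unfolding e E k using sin by (simp add: complex_eq_iff)
  qed
  define Y where "Y = (LINT \<eta>:{- ln \<rho><..}|lborel. of_real (sinh \<eta> - k) powr (- \<kappa>) * exp (- \<mu> * of_real \<eta>))"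
  define X where "X = (LINT \<eta>:{..<- ln \<rho>}|lborel. of_real (k - sinh \<eta>) powr (- \<kappa>) * exp (- \<mu> * of_real \<eta>))"
  define h where "h = \<i> * complex_of_real pi / 2"
  have l1: "legint \<kappa> \<mu> (exp z1) = of_real 2 powr \<kappa> * (exp (h * \<mu>) * (exp (h * \<kappa>) * Y + exp (- h * \<kappa>) * X))"
    unfolding w1k legint_cosh[OF disjI2[OF refl]] k_def cosh_line_boundary[OF disjI2[OF refl] \<rho> \<kappa>] Y_def X_def h_def
    by (simp add: algebra_simps)
  have l2: "legint \<kappa> \<mu> (exp z2) = of_real 2 powr \<kappa> * (exp (- h * \<mu>) * (exp (- h * \<kappa>) * Y + exp (h * \<kappa>) * X))"
    unfolding w2k legint_cosh[OF disjI1[OF refl]] k_def cosh_line_boundary[OF disjI1[OF refl] \<rho> \<kappa>] Y_def X_def h_def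
    by (simp add: algebra_simps)
  have p1: "exp z1 powr \<alpha> = exp (\<alpha> * z1)" and p2: "exp z2 powr \<alpha> = exp (\<alpha> * z2)"
    using \<theta> by (auto intro!: exp_powr simp: z1_def z2_def)
  define F where "F = hyp_series \<kappa> (1 - \<kappa>) (1 + \<mu>) (of_real ((1 - cos \<theta>) / 2))"
  have Yv: "Y = exp (\<kappa> * of_real (ln (sin \<theta>))) * exp (\<mu> * of_real (ln \<rho>)) * (Gamma (1 - \<kappa>) * Gamma (\<kappa> + \<mu>) * F)"
    unfolding Y_def k_def using sinh_Euler_integral(2)[OF \<rho> \<kappa>(2), of \<mu>] \<kappa>(1)
    unfolding sin\<rho> w\<rho> F_def by (simp add: of_real_powr_exp sin \<rho>)
  define G where "G = Gamma \<kappa> / (2 * of_real (sqrt pi))"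
  \<comment> \<open>For the pieces to the left of the singularity the two phases differ by exp (i
    \<pi>), so these contributions cancel.\<close>
  have SX: "exp (h * \<alpha>) * exp (h * \<mu>) * exp (- h * \<kappa>) + exp (of_real pi * \<i> * lam) * exp (- h * \<alpha>) * exp (- h * \<mu>) * exp (h * \<kappa>) = 0"
  proof -
    have "exp (of_real pi * \<i> * lam) * exp (- h * \<alpha>) * exp (- h * \<mu>) * exp (h * \<kappa>) =
       exp (h * \<alpha>) * exp (h * \<mu>) * exp (- h * \<kappa>) * exp (\<i> * of_real pi)"
      unfolding exp_add[symmetric] by (rule arg_cong[where f = exp]) (simp add: h_def \<kappa>_def \<mu>_def field_simps)
    thus ?thesis by (simp add: mult.commute)
  qed
  \<comment> \<open>To the right of the singularity the phases are exp (\<plusminus> i \<pi>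
    \<alpha>) relative to exp (h lam), and they add up to a cosine.\<close>
  have SY: "exp (h * \<alpha>) * exp (h * \<mu>) * exp (h * \<kappa>) + exp (of_real pi * \<i> * lam) * exp (- h * \<alpha>) * exp (- h * \<mu>) * exp (- h * \<kappa>) = exp (h * lam) * (2 * cos (of_real pi * \<alpha>))"
  proof -
    have "exp (h * \<alpha>) * exp (h * \<mu>) * exp (h * \<kappa>) = exp (h * lam) * exp (\<i> * (of_real pi * \<alpha>))"
      unfolding exp_add[symmetric] by (rule arg_cong[where f = exp]) (simp add: h_def \<kappa>_def \<mu>_def field_simps)
    moreover have "exp (of_real pi * \<i> * lam) * exp (- h * \<alpha>) * exp (- h * \<mu>) * exp (- h * \<kappa>) = exp (h * lam) * exp (- (\<i> * (of_real pi * \<alpha>)))"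
      unfolding exp_add[symmetric] by (rule arg_cong[where f = exp]) (simp add: h_def \<kappa>_def \<mu>_def field_simps)
    ultimately show ?thesis by (simp add: cos_exp_eq algebra_simps)
  qed
  \<comment> \<open>Euler's integral brings in \<Gamma>(1 - \<kappa>), which has no counterpart on
    the left; reflection removes it together with \<Gamma>(\<kappa>) and the cosine.\<close>
  have refl: "Gamma \<kappa> * Gamma (1 - \<kappa>) * cos (of_real pi * \<alpha>) = of_real pi"
  proof -
    have s: "sin (of_real pi * \<kappa>) = cos (of_real pi * \<alpha>)"
    proof -
      have "of_real pi * \<kappa> = of_real pi * \<alpha> + of_real (pi / 2)" by (simp add: \<kappa>_def algebra_simps)
      thus ?thesis by (simp only: sin_add) (simp add: sin_of_real cos_of_real flip: of_real_divide)
    qed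
    have "Gamma \<kappa> * Gamma (1 - \<kappa>) = of_real pi / sin (of_real pi * \<kappa>)" by (rule Gamma_reflection_complex)
    moreover have "Gamma \<kappa> \<noteq> 0" "Gamma (1 - \<kappa>) \<noteq> 0"
      using \<kappa> nonpos_Ints_Re_pos[of \<kappa>] nonpos_Ints_Re_pos[of "1 - \<kappa>"] by (simp_all add: Gamma_eq_zero_iff)
    ultimately show ?thesis unfolding s[symmetric] by (auto simp: field_simps)
  qed
  have "conn_rhs \<alpha> lam (\<i> * of_real \<theta>) = exp (\<i> * of_real \<theta> * \<alpha>) * (G * exp (\<alpha> * z1) * (of_real 2 powr \<kappa> * (exp (h * \<mu>) * (exp (h * \<kappa>) * Y + exp (- h * \<kappa>) * X)))) +
     exp (of_real pi * \<i> * lam) * (exp (- (\<i> * of_real \<theta> * \<alpha>)) * (G * exp (\<alpha> * z2) * (of_real 2 powr \<kappa> * (exp (- h * \<mu>) * (exp (- h * \<kappa>) * Y + exp (h * \<kappa>) * X)))))"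
    unfolding conn_rhs_def gfun_def w1e w2e p1 p2 \<kappa>_def[symmetric] \<mu>_def[symmetric] l1 l2 G_def by simp
  also have "exp (\<alpha> * z1) = exp (- (\<i> * of_real \<theta> * \<alpha>)) * exp (h * \<alpha>) * exp (- \<alpha> * of_real L)"
    unfolding exp_add[symmetric] by (simp add: z1_def h_def algebra_simps)
  also have "exp (\<alpha> * z2) = exp (\<i> * of_real \<theta> * \<alpha>) * exp (- h * \<alpha>) * exp (- \<alpha> * of_real L)"
    unfolding exp_add[symmetric] by (simp add: z2_def h_def algebra_simps)
  also have "exp (\<i> * of_real \<theta> * \<alpha>) * (G * (exp (- (\<i> * of_real \<theta> * \<alpha>)) * exp (h * \<alpha>) * exp (- \<alpha> * of_real L)) * (of_real 2 powr \<kappa> * (exp (h * \<mu>) * (exp (h * \<kappa>) * Y + exp (- h * \<kappa>) * X)))) +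
     exp (of_real pi * \<i> * lam) * (exp (- (\<i> * of_real \<theta> * \<alpha>)) * (G * (exp (\<i> * of_real \<theta> * \<alpha>) * exp (- h * \<alpha>) * exp (- \<alpha> * of_real L)) * (of_real 2 powr \<kappa> * (exp (- h * \<mu>) * (exp (- h * \<kappa>) * Y + exp (h * \<kappa>) * X))))) =
     (exp (\<i> * of_real \<theta> * \<alpha>) * exp (- (\<i> * of_real \<theta> * \<alpha>))) * G * of_real 2 powr \<kappa> * exp (- \<alpha> * of_real L) *
      (Y * (exp (h * \<alpha>) * exp (h * \<mu>) * exp (h * \<kappa>) + exp (of_real pi * \<i> * lam) * exp (- h * \<alpha>) * exp (- h * \<mu>) * exp (- h * \<kappa>)) +
       X * (exp (h * \<alpha>) * exp (h * \<mu>) * exp (- h * \<kappa>) + exp (of_real pi * \<i> * lam) * exp (- h * \<alpha>) * exp (- h * \<mu>) * exp (h * \<kappa>)))"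
    by algebra
  also have "\<dots> = G * of_real 2 powr \<kappa> * exp (- \<alpha> * of_real L) * (Y * (exp (h * lam) * (2 * cos (of_real pi * \<alpha>))))"
    unfolding SX SY by (simp flip: exp_add)
  also have "\<dots> = (Gamma \<kappa> * Gamma (1 - \<kappa>) * cos (of_real pi * \<alpha>)) / of_real (sqrt pi) * (of_real 2 powr \<kappa> * exp (- \<alpha> * of_real L) * exp (\<kappa> * of_real (ln (sin \<theta>)))) * exp (\<mu> * of_real (ln \<rho>)) * exp (h * lam) * Gamma (\<kappa> + \<mu>) * F"
    unfolding Yv G_def by (simp add: field_simps)
  also have "of_real 2 powr \<kappa> * exp (- \<alpha> * of_real L) * exp (\<kappa> * of_real (ln (sin \<theta>))) = exp (of_real L / 2)"
  proof -
    have "complex_of_real 2 powr \<kappa> = exp (\<kappa> * of_real (ln 2))" by (rule of_real_powr_exp) simp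
    moreover have "L = ln 2 + ln (sin \<theta>)" unfolding L_def using sin by (simp add: ln_mult)
    ultimately show ?thesis unfolding exp_add[symmetric]
      by (simp only: exp_add[symmetric]) (rule arg_cong[where f = exp], simp add: \<kappa>_def field_simps)
  qed
  also have "(Gamma \<kappa> * Gamma (1 - \<kappa>) * cos (of_real pi * \<alpha>)) / of_real (sqrt pi) = of_real (sqrt pi)"
    unfolding refl by (simp add: field_simps flip: of_real_mult)
  finally have R: "conn_rhs \<alpha> lam (\<i> * of_real \<theta>) = of_real (sqrt pi) * exp (of_real L / 2) * exp (\<mu> * of_real (ln \<rho>)) * exp (h * lam) * Gamma (\<kappa> + \<mu>) * F" .
  have shp: "(2 * sinh (\<i> * of_real \<theta>)) powr (1 / 2) = exp ((1 / 2) * (h + of_real L))"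
  proof -
    have "2 * sinh (\<i> * of_real \<theta>) = exp (h + of_real L)"
      using ei by (simp add: exp_add eL h_def complex_eq_iff Re_sinh Im_sinh)
    thus ?thesis by (simp only:) (rule exp_powr, simp add: h_def)
  qed
  have thp: "tanh (\<i> * of_real \<theta> / 2) powr \<mu> = exp (\<mu> * (h + of_real (ln \<rho>)))"
  proof -
    have s2: "sinh (\<i> * of_real \<theta> / 2) = \<i> * of_real (sin (\<theta> / 2))" "cosh (\<i> * of_real \<theta> / 2) = of_real (cos (\<theta> / 2))"
      by (simp_all add: complex_eq_iff Re_sinh Im_sinh Re_cosh Im_cosh)
    have "tanh (\<i> * of_real \<theta> / 2) = \<i> * of_real \<rho>"
      by (simp add: tanh_def s2 \<rho>_def tan_def)
    also have "\<dots> = exp (h + of_real (ln \<rho>))"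
      using ei \<rho> by (simp add: exp_add exp_of_real h_def)
    finally show ?thesis by (simp only:) (rule exp_powr, simp add: h_def)
  qed
  have reg: "reg_hyp2F1 (\<alpha> + 1 / 2) (1 / 2 - \<alpha>) (lam + 1 / 2) ((1 - cosh (\<i> * of_real \<theta>)) / 2) = F"
  proof -
    have "(1 - cosh (\<i> * of_real \<theta>)) / 2 = complex_of_real ((1 - cos \<theta>) / 2)"
      by (simp add: complex_eq_iff Re_cosh Im_cosh)
    moreover have "norm (complex_of_real ((1 - cos \<theta>) / 2)) < 1"
    proof -
      have "cos \<theta> > cos pi" using \<theta> by (intro cos_monotone_0_pi) auto
      moreover have "\<bar>(1 - cos \<theta>) / 2\<bar> = (1 - cos \<theta>) / 2" by (rule abs_of_nonneg) simp
      ultimately show ?thesis unfolding norm_of_real by simp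
    qed
    ultimately show ?thesis unfolding F_def \<kappa>_def \<mu>_def by (simp only: reg_hyp2F1_series) (simp add: algebra_simps)
  qed
  have "conn_lhs \<alpha> lam (\<i> * of_real \<theta>) = of_real (sqrt pi) * Gamma (\<alpha> + lam) * exp ((1 / 2) * (h + of_real L)) * exp (\<mu> * (h + of_real (ln \<rho>))) * F"
    unfolding conn_lhs_def reg shp \<mu>_def[symmetric] thp ..
  also have "\<dots> = of_real (sqrt pi) * Gamma (\<alpha> + lam) * F * exp ((1 / 2) * (h + of_real L) + \<mu> * (h + of_real (ln \<rho>)))"
    by (simp add: exp_add)
  also have "(1 / 2) * (h + of_real L) + \<mu> * (h + of_real (ln \<rho>)) = of_real L / 2 + \<mu> * of_real (ln \<rho>) + h * lam"
    by (simp add: \<mu>_def field_simps)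
  also have "\<alpha> + lam = \<kappa> + \<mu>" by (simp add: \<kappa>_def \<mu>_def)
  finally show ?thesis unfolding R by (simp add: exp_add)
qed

section \<open>Continuation of the connection formula in the parameters and in \<xi>\<close>

lemma holomorphic_on_gfun:
  assumes S: "open S" and hol: "a holomorphic_on S" "l holomorphic_on S" "w holomorphic_on S"
    and w: "\<And>t. t \<in> S \<Longrightarrow> w t \<notin> \<real>\<^sub>\<le>\<^sub>0" and a: "\<And>t. t \<in> S \<Longrightarrow> Re (a t) > 0"
    and l: "\<And>t. t \<in> S \<Longrightarrow> \<bar>Re (l t) - 1 / 2\<bar> < Re (a t) + 1 / 2"
  shows "(\<lambda>t. gfun (a t) (l t) (w t)) holomorphic_on S"
  unfolding gfun_def
proof (intro holomorphic_on_mult holomorphic_on_divide holomorphic_on_legint[OF S] holomorphic_on_powr holomorphic_intros hol)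
  fix t assume t: "t \<in> S"
  show "a t + 1 / 2 \<notin> \<int>\<^sub>\<le>\<^sub>0" using a[OF t] by (intro nonpos_Ints_Re_pos) simp
qed (use w l in auto)

lemma tanh_half:
  assumes "\<bar>Im \<xi>\<bar> < pi"
  shows "cosh (\<xi> / 2) \<noteq> 0"
    and "Re (tanh (\<xi> / 2)) = sinh (Re \<xi> / 2) * cosh (Re \<xi> / 2) / (norm (cosh (\<xi> / 2)))\<^sup>2"
    and "Im (tanh (\<xi> / 2)) = sin (Im \<xi> / 2) * cos (Im \<xi> / 2) / (norm (cosh (\<xi> / 2)))\<^sup>2"
proof -
  have "cos (Im \<xi> / 2) > 0" using assms by (intro cos_gt_zero_pi) auto
  hence "Re (cosh (\<xi> / 2)) > 0" by (simp add: Re_cosh)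
  thus "cosh (\<xi> / 2) \<noteq> 0" by auto
  define x where "x = Re \<xi> / 2"
  define y where "y = Im \<xi> / 2"
  have n: "(norm (cosh (\<xi> / 2)))\<^sup>2 = (Re (cosh (\<xi> / 2)))\<^sup>2 + (Im (cosh (\<xi> / 2)))\<^sup>2" by (rule cmod_power2)
  have "sinh x * cos y * (cosh x * cos y) + cosh x * sin y * (sinh x * sin y) = sinh x * cosh x * ((cos y)\<^sup>2 + (sin y)\<^sup>2)"
    by (simp only: power2_eq_square algebra_simps)
  thus "Re (tanh (\<xi> / 2)) = sinh (Re \<xi> / 2) * cosh (Re \<xi> / 2) / (norm (cosh (\<xi> / 2)))\<^sup>2"
    unfolding tanh_def Re_divide n by (simp add: Re_sinh Im_sinh Re_cosh Im_cosh x_def y_def)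
  have "cosh x * sin y * (cosh x * cos y) - sinh x * cos y * (sinh x * sin y) = sin y * cos y * ((cosh x)\<^sup>2 - (sinh x)\<^sup>2)"
    by (simp only: power2_eq_square algebra_simps)
  also have "(cosh x)\<^sup>2 - (sinh x)\<^sup>2 = 1" by (rule hyperbolic_pythagoras)
  finally show "Im (tanh (\<xi> / 2)) = sin (Im \<xi> / 2) * cos (Im \<xi> / 2) / (norm (cosh (\<xi> / 2)))\<^sup>2"
    unfolding tanh_def Im_divide n by (simp add: Re_sinh Im_sinh Re_cosh Im_cosh x_def y_def)
qed

lemma Im_tanh_half_pos:
  assumes "0 < Im \<xi>" "Im \<xi> < pi"
  shows "Im (tanh (\<xi> / 2)) > 0"
proof -
  have "sin (Im \<xi> / 2) > 0" "cos (Im \<xi> / 2) > 0"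
    using assms by (auto intro!: sin_gt_zero cos_gt_zero_pi)
  thus ?thesis using tanh_half[of \<xi>] assms by simp
qed

lemma Re_tanh_half_pos:
  assumes "\<xi> \<in> D1"
  shows "Re (tanh (\<xi> / 2)) > 0"
  using tanh_half[of \<xi>] assms by (simp add: D1_def)

text \<open>A value on the half-line would require exp (2 \<xi>) to be real and at least 1, hence
  sin (2 Im \<xi>) = 0 with a positive cosine; for 0 < |Im \<xi>| < \<pi> the sine vanishes only at
  |Im \<xi>| = \<pi>/2, where the cosine is -1. For real \<xi> > 0 the first value does lie on the
  half-line.\<close>

lemma one_minus_exp_notin:
  assumes "Im \<xi> \<noteq> 0" "\<bar>Im \<xi>\<bar> < pi"
  shows "1 - exp (2 * \<xi>) \<notin> \<real>\<^sub>\<le>\<^sub>0" "1 - exp (- 2 * \<xi>) \<notin> \<real>\<^sub>\<le>\<^sub>0"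
proof -
  have *: "1 - exp (2 * \<xi>) \<notin> \<real>\<^sub>\<le>\<^sub>0" if "Im \<xi> \<noteq> 0" "\<bar>Im \<xi>\<bar> < pi" for \<xi>
  proof
    assume "1 - exp (2 * \<xi>) \<in> \<real>\<^sub>\<le>\<^sub>0"
    hence "1 \<le> Re (exp (2 * \<xi>))" "Im (exp (2 * \<xi>)) = 0" by (auto simp: complex_nonpos_Reals_iff)
    hence c: "exp (2 * Re \<xi>) * cos (2 * Im \<xi>) \<ge> 1" "sin (2 * Im \<xi>) = 0" by (simp_all add: Re_exp Im_exp)
    hence cp: "cos (2 * Im \<xi>) > 0" by (smt (verit) exp_gt_zero mult_nonneg_nonpos zero_less_mult_iff)
    have "sin (Im \<xi>) * cos (Im \<xi>) = 0" using c(2) by (simp add: sin_double)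
    moreover have "sin (Im \<xi>) \<noteq> 0"
    proof (cases "Im \<xi> > 0")
      case True thus ?thesis using sin_gt_zero[of "Im \<xi>"] that by simp
    next
      case False thus ?thesis using sin_gt_zero[of "- Im \<xi>"] that by simp
    qed
    ultimately have "cos (Im \<xi>) = 0" by simp
    thus False using cp by (simp add: cos_double)
  qed
  show "1 - exp (2 * \<xi>) \<notin> \<real>\<^sub>\<le>\<^sub>0" by (rule *[OF assms])
  show "1 - exp (- 2 * \<xi>) \<notin> \<real>\<^sub>\<le>\<^sub>0" using *[of "- \<xi>"] assms by simp
qed

lemma inverse_notin_nonpos_Reals: "z \<notin> \<real>\<^sub>\<le>\<^sub>0 \<Longrightarrow> 1 / (z::complex) \<notin> \<real>\<^sub>\<le>\<^sub>0"
proof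
  assume z: "z \<notin> \<real>\<^sub>\<le>\<^sub>0" and "1 / z \<in> \<real>\<^sub>\<le>\<^sub>0"
  then obtain r where r: "1 / z = of_real r" "r \<le> 0" by (auto elim: nonpos_Reals_cases)
  hence "z = of_real (1 / r)" by (metis of_real_1 of_real_divide div_by_1 divide_divide_eq_right mult_1)
  moreover have "1 / r \<le> 0" using r(2) by (simp add: divide_nonneg_nonpos)
  ultimately show False using z by (metis nonpos_Reals_of_real_iff)
qed

lemma recip_one_minus_exp_notin:
  assumes "Im \<xi> \<noteq> 0" "\<bar>Im \<xi>\<bar> < pi"
  shows "1 / (1 - exp (2 * \<xi>)) \<notin> \<real>\<^sub>\<le>\<^sub>0" "1 / (1 - exp (- 2 * \<xi>)) \<notin> \<real>\<^sub>\<le>\<^sub>0"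
  by (intro inverse_notin_nonpos_Reals one_minus_exp_notin assms)+

text \<open>The restriction \<open>Re \<alpha> < 1 / 2\<close> is removed by continuation along the segment
  \<open>t \<mapsto> (t\<alpha>, 1 / 2 + t\<mu>)\<close>.\<close>

lemma connection_theta:
  assumes \<theta>: "0 < \<theta>" "\<theta> < pi" and \<alpha>: "0 < Re \<alpha>" and lam: "\<bar>Re lam - 1 / 2\<bar> < Re \<alpha> + 1 / 2"
  shows "conn_lhs \<alpha> lam (\<i> * of_real \<theta>) = conn_rhs \<alpha> lam (\<i> * of_real \<theta>)"
proof -
  define \<mu> where "\<mu> = lam - 1 / 2"
  define \<xi> where "\<xi> = \<i> * complex_of_real \<theta>"
  define W where "W = (1 - cosh \<xi>) / 2"
  have W: "norm W < 1"
  proof -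
    have "cos \<theta> > cos pi" using \<theta> by (intro cos_monotone_0_pi) auto
    moreover have "\<bar>(1 - cos \<theta>) / 2\<bar> = (1 - cos \<theta>) / 2" by (rule abs_of_nonneg) simp
    moreover have "W = complex_of_real ((1 - cos \<theta>) / 2)" by (simp add: W_def \<xi>_def complex_eq_iff Re_cosh Im_cosh)
    ultimately show ?thesis by (simp only: norm_of_real) simp
  qed
  \<comment> \<open>An intersection of half-planes in t, hence convex. The conditions with \<alpha>
    + \<mu> and \<alpha> - \<mu> together say |Re (t \<mu>)| < Re (t \<alpha>) + 1/2.\<close>
  define S where "S = {t. Re (t * \<alpha>) > 0} \<inter> {t. Re (t * (\<alpha> + \<mu>)) > - (1 / 2)} \<inter> {t. Re (t * (\<alpha> - \<mu>)) > - (1 / 2)}"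
  have half: "open {t. Re (t * z) > c}" "convex {t. Re (t * z) > c}" for z :: complex and c
  proof -
    have e: "{t. Re (t * z) > c} = {t. cnj z \<bullet> t > c}" by (auto simp: inner_complex_def algebra_simps)
    show "open {t. Re (t * z) > c}" "convex {t. Re (t * z) > c}"
      unfolding e by (rule open_halfspace_gt, rule convex_halfspace_gt)
  qed
  have opS: "open S" "connected S" unfolding S_def
    by (intro open_Int half convex_connected convex_Int)+
  have S: "Re (t * \<alpha>) > 0 \<and> \<bar>Re (1 / 2 + t * \<mu>) - 1 / 2\<bar> < Re (t * \<alpha>) + 1 / 2" if "t \<in> S" for t
    using that by (auto simp: S_def algebra_simps abs_less_iff)
  have Sreal: "of_real t \<in> S" if "0 < t" "t \<le> 1" for t
  proof -
    have "t * Re (\<alpha> + \<mu>) > - (1 / 2)" "t * Re (\<alpha> - \<mu>) > - (1 / 2)"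
    proof -
      have *: "t * r > - (1 / 2)" if "r > - (1 / 2)" for r
      proof (cases "r \<ge> 0")
        case True
        hence "t * r \<ge> 0" using \<open>0 < t\<close> by simp
        thus ?thesis by linarith
      next
        case False
        hence "1 * r \<le> t * r" using \<open>t \<le> 1\<close> by (intro mult_right_mono_neg) auto
        thus ?thesis using that by linarith
      qed
      show "t * Re (\<alpha> + \<mu>) > - (1 / 2)" "t * Re (\<alpha> - \<mu>) > - (1 / 2)"
        by (rule *, use lam in \<open>simp add: \<mu>_def abs_less_iff\<close>)+
    qed
    thus ?thesis using that \<alpha> by (simp add: S_def)
  qed
  define f where "f = (\<lambda>t. of_real (sqrt pi) * Gamma (t * \<alpha> + (1 / 2 + t * \<mu>)) * (2 * sinh \<xi>) powr (1 / 2) *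
     tanh (\<xi> / 2) powr (1 / 2 + t * \<mu> - 1 / 2) * hyp_series (t * \<alpha> + 1 / 2) (1 / 2 - t * \<alpha>) (1 / 2 + t * \<mu> + 1 / 2) W)"
  define g where "g = (\<lambda>t. conn_rhs (t * \<alpha>) (1 / 2 + t * \<mu>) \<xi>)"
  have f_eq: "f t = conn_lhs (t * \<alpha>) (1 / 2 + t * \<mu>) \<xi>" for t
    unfolding f_def conn_lhs_def W_def[symmetric] by (simp only: reg_hyp2F1_series[OF W])
  have holf: "f holomorphic_on S" unfolding f_def
  proof (intro holomorphic_on_mult holomorphic_on_hyp_series[OF opS(1)] holomorphic_intros)
    fix t assume "t \<in> S"
    hence "Re (t * \<alpha> + (1 / 2 + t * \<mu>)) > 0" by (auto simp: S_def algebra_simps)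
    thus "t * \<alpha> + (1 / 2 + t * \<mu>) \<notin> \<int>\<^sub>\<le>\<^sub>0" by (rule nonpos_Ints_Re_pos)
  qed (use W in auto)
  have "Im \<xi> \<noteq> 0" "\<bar>Im \<xi>\<bar> < pi" using \<theta> by (auto simp: \<xi>_def)
  note wn = recip_one_minus_exp_notin[OF this]
  have holg: "g holomorphic_on S" unfolding g_def conn_rhs_def
    by (intro holomorphic_on_add holomorphic_on_mult holomorphic_on_gfun[OF opS(1)] holomorphic_intros)
       (use wn S in auto)
  \<comment> \<open>Real t below this bound satisfy t Re \<alpha> < 1/2, which is the range of
    \<open>connection_base\<close>.\<close>
  define r where "r = min 1 (1 / (2 * Re \<alpha>))"
  have r: "r > 0" using \<alpha> by (simp add: r_def)
  have "f 1 = g 1"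
  proof (rule holomorphic_eq_on_segment[OF holf holg opS r, of 1 0])
    fix t assume t: "0 < t" "t < r"
    have t1: "t \<le> 1" "t * Re \<alpha> < 1 / 2"
    proof -
      have "r \<le> 1" "r \<le> 1 / (2 * Re \<alpha>)" unfolding r_def by linarith+
      thus "t \<le> 1" using t by linarith
      have "t < 1 / (2 * Re \<alpha>)" using t \<open>r \<le> 1 / (2 * Re \<alpha>)\<close> by linarith
      thus "t * Re \<alpha> < 1 / 2" using \<alpha> by (simp add: field_simps)
    qed
    have tS: "of_real t \<in> S" using Sreal t t1 by blast
    have "f (of_real t) = g (of_real t)"
      unfolding f_eq g_def \<xi>_def by (rule connection_base[OF \<theta>]) (use S[OF tS] t1 in auto)
    thus "0 + of_real t * 1 \<in> S \<and> f (0 + of_real t * 1) = g (0 + of_real t * 1)" using tS by simp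
  qed (use Sreal[of 1] in auto)
  thus ?thesis unfolding f_eq g_def \<xi>_def \<mu>_def by simp
qed

lemma cosh_in_cutplane:
  assumes "\<bar>Im \<xi>\<bar> < pi"
  shows "(1 - cosh \<xi>) / 2 \<in> cutplane"
proof (rule ccontr)
  assume "\<not> ?thesis"
  hence "1 - (1 - cosh \<xi>) / 2 \<in> \<real>\<^sub>\<le>\<^sub>0" by (simp add: cutplane_iff)
  hence re: "cosh (Re \<xi>) * cos (Im \<xi>) \<le> - 1" and im: "sinh (Re \<xi>) * sin (Im \<xi>) = 0"
    by (auto simp: complex_nonpos_Reals_iff Re_cosh Im_cosh)
  have "Re \<xi> = 0 \<or> sin (Im \<xi>) = 0" using im by auto
  thus False
  proof
    assume "Re \<xi> = 0"
    hence "cos (Im \<xi>) \<le> - 1" using re by simp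
    moreover have "cos \<bar>Im \<xi>\<bar> > cos pi" using assms by (intro cos_monotone_0_pi) auto
    ultimately show False by simp
  next
    assume s: "sin (Im \<xi>) = 0"
    have "Im \<xi> = 0"
    proof (rule ccontr)
      assume "Im \<xi> \<noteq> 0"
      hence "\<bar>Im \<xi>\<bar> > 0" by simp
      hence "sin \<bar>Im \<xi>\<bar> > 0" using assms by (intro sin_gt_zero) auto
      thus False using s by (simp add: abs_if split: if_splits)
    qed
    hence "cosh (Re \<xi>) \<le> - 1" using re by simp
    thus False using cosh_real_ge_1[of "Re \<xi>"] by linarith
  qed
qed

lemma conn_lhs_holomorphic:
  assumes S: "open S" and im: "\<And>\<xi>. \<xi> \<in> S \<Longrightarrow> \<bar>Im \<xi>\<bar> < pi" and sh: "\<And>\<xi>. \<xi> \<in> S \<Longrightarrow> 2 * sinh \<xi> \<notin> \<real>\<^sub>\<le>\<^sub>0"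
    and th: "\<And>\<xi>. \<xi> \<in> S \<Longrightarrow> tanh (\<xi> / 2) \<notin> \<real>\<^sub>\<le>\<^sub>0"
  shows "conn_lhs \<alpha> lam holomorphic_on S"
proof -
  have h1: "sinh holomorphic_on S" "cosh holomorphic_on S" for S :: "complex set"
    unfolding sinh_field_def[abs_def] cosh_field_def[abs_def] by (intro holomorphic_intros; simp)+
  have h2: "(\<lambda>\<xi>. tanh (\<xi> / 2)) holomorphic_on S"
    unfolding tanh_def using tanh_half(1) im
    by (intro holomorphic_on_divide holomorphic_on_compose_gen[OF _ h1(1), of "\<lambda>\<xi>. \<xi> / 2", unfolded o_def, of _ UNIV]
        holomorphic_on_compose_gen[OF _ h1(2), of "\<lambda>\<xi>. \<xi> / 2", unfolded o_def, of _ UNIV] holomorphic_intros) auto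
  have h3: "(\<lambda>\<xi>. (1 - cosh \<xi>) / 2) holomorphic_on S" by (intro holomorphic_intros h1) auto
  have h4: "(\<lambda>\<xi>. reg_hyp2F1 a b c ((1 - cosh \<xi>) / 2)) holomorphic_on S" for a b c
  proof -
    have sub: "(\<lambda>\<xi>. (1 - cosh \<xi>) / 2) ` S \<subseteq> cutplane" using cosh_in_cutplane im by blast
    show ?thesis using holomorphic_on_compose_gen[OF h3 reg_hyp2F1_holomorphic sub, of a b c] by (simp add: o_def)
  qed
  show ?thesis unfolding conn_lhs_def[abs_def]
    by (intro holomorphic_on_mult holomorphic_on_powr holomorphic_intros h1 h2 h4) (use sh th in auto)
qed

text \<open>Both sides are analytic in the full strip and agree on its imaginary segment. The sign
  of Re \<xi> is left free on purpose, because \<open>connection\<close> applies the formula at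
  -\<xi>.\<close>

lemma connection_upper:
  assumes \<xi>: "0 < Im \<xi>" "Im \<xi> < pi" and \<alpha>: "0 < Re \<alpha>" and lam: "\<bar>Re lam - 1 / 2\<bar> < Re \<alpha> + 1 / 2"
  shows "conn_lhs \<alpha> lam \<xi> = conn_rhs \<alpha> lam \<xi>"
proof -
  define V where "V = {\<xi>. Im \<xi> > 0} \<inter> {\<xi>. Im \<xi> < pi}"
  have V: "open V" "connected V" unfolding V_def
    by (intro open_Int open_halfspace_Im_gt open_halfspace_Im_lt convex_connected convex_Int convex_halfspace_Im_gt convex_halfspace_Im_lt)+
  have L: "conn_lhs \<alpha> lam holomorphic_on V"
  proof (rule conn_lhs_holomorphic[OF V(1)])
    fix \<xi> assume x: "\<xi> \<in> V"
    thus "\<bar>Im \<xi>\<bar> < pi" by (auto simp: V_def)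
    have "Im (sinh \<xi>) > 0" using x by (auto simp: Im_sinh V_def intro!: mult_pos_pos sin_gt_zero)
    thus "2 * sinh \<xi> \<notin> \<real>\<^sub>\<le>\<^sub>0" by (auto simp: complex_nonpos_Reals_iff)
    have "Im (tanh (\<xi> / 2)) > 0" using x by (intro Im_tanh_half_pos) (auto simp: V_def)
    thus "tanh (\<xi> / 2) \<notin> \<real>\<^sub>\<le>\<^sub>0" by (auto simp: complex_nonpos_Reals_iff)
  qed
  have wn: "1 - exp (2 * \<xi>) \<notin> \<real>\<^sub>\<le>\<^sub>0" "1 - exp (- 2 * \<xi>) \<notin> \<real>\<^sub>\<le>\<^sub>0" if "\<xi> \<in> V" for \<xi>
    using one_minus_exp_notin[of \<xi>] that by (auto simp: V_def)
  have nz: "1 - exp (2 * \<xi>) \<noteq> 0" "1 - exp (- 2 * \<xi>) \<noteq> 0" if "\<xi> \<in> V" for \<xi>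
    using wn[OF that] by (metis nonpos_Reals_zero_I)+
  have R: "conn_rhs \<alpha> lam holomorphic_on V" unfolding conn_rhs_def[abs_def]
    by (intro holomorphic_on_add holomorphic_on_mult holomorphic_on_gfun[OF V(1)] holomorphic_on_divide holomorphic_intros inverse_notin_nonpos_Reals)
       (use wn nz \<alpha> lam in auto)
  show ?thesis
    by (rule holomorphic_eq_on_segment[OF L R V, of 0 pi \<i> 0])
       (use \<xi> connection_theta[OF _ _ \<alpha> lam] in \<open>auto simp: V_def mult.commute\<close>)
qed

lemma powr_uminus_lower:
  assumes "Im z < 0"
  shows "(- z) powr a = exp (\<i> * of_real pi * a) * z powr a"
proof -
  have "z \<noteq> 0" using assms by auto
  moreover have "Ln (- z) = Ln z + \<i> * of_real pi" using assms \<open>z \<noteq> 0\<close> by (subst Ln_minus) auto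
  ultimately show ?thesis by (simp add: powr_def exp_add algebra_simps)
qed

text \<open>Below the real axis the formula is read at -\<xi>, which lies in the upper strip. The
  reflection exchanges the two terms on the right and multiplies the left by exp (i \<pi> lam),
  where 1/2 of the exponent comes from the power of sinh and lam - 1/2 from that of tanh. Dividing
  by this factor turns the multiplier into exp (- i \<pi> lam).\<close>

theorem connection:
  assumes \<xi>: "\<xi> \<in> D1" "Im \<xi> \<noteq> 0" and \<alpha>: "0 < Re \<alpha>" and lam: "\<bar>Re lam - 1 / 2\<bar> < Re \<alpha> + 1 / 2"
  shows "conn_lhs \<alpha> lam \<xi> = exp (\<xi> * \<alpha>) * gfun \<alpha> lam (1 / (1 - exp (2 * \<xi>))) +
     Kfac \<xi> lam * (exp (- \<xi> * \<alpha>) * gfun \<alpha> lam (1 / (1 - exp (- 2 * \<xi>))))"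
proof (cases "Im \<xi> > 0")
  case True
  thus ?thesis using connection_upper[OF True _ \<alpha> lam] \<xi> by (simp add: conn_rhs_def Kfac_def D1_def)
next
  case False
  hence neg: "Im \<xi> < 0" using \<xi> by simp
  define e where "e = exp (of_real pi * \<i> * lam)"
  have "conn_lhs \<alpha> lam (- \<xi>) = conn_rhs \<alpha> lam (- \<xi>)"
    using neg \<xi> by (intro connection_upper \<alpha> lam) (auto simp: D1_def)
  moreover have "conn_lhs \<alpha> lam (- \<xi>) = e * conn_lhs \<alpha> lam \<xi>"
  proof -
    have "Im (2 * sinh \<xi>) < 0" using neg \<xi> sin_gt_zero[of "- Im \<xi>"]
      by (auto simp: Im_sinh D1_def mult_pos_neg)
    hence 1: "(2 * sinh (- \<xi>)) powr (1 / 2) = exp (\<i> * of_real pi * (1 / 2)) * (2 * sinh \<xi>) powr (1 / 2)"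
      using powr_uminus_lower[of "2 * sinh \<xi>" "1 / 2"] by simp
    have "Im (tanh ((- \<xi>) / 2)) > 0" using neg \<xi> by (intro Im_tanh_half_pos) (auto simp: D1_def)
    hence "Im (tanh (\<xi> / 2)) < 0" by simp
    hence 2: "tanh ((- \<xi>) / 2) powr (lam - 1 / 2) = exp (\<i> * of_real pi * (lam - 1 / 2)) * tanh (\<xi> / 2) powr (lam - 1 / 2)"
      using powr_uminus_lower[of "tanh (\<xi> / 2)" "lam - 1 / 2"] by simp
    have ee: "exp (\<i> * of_real pi * (1 / 2)) * exp (\<i> * of_real pi * (lam - 1 / 2)) = e"
      unfolding e_def exp_add[symmetric] by (rule arg_cong[where f = exp]) (simp add: field_simps)
    show ?thesis unfolding conn_lhs_def 1 2 cosh_minus ee[symmetric] by (simp only: mult_ac)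
  qed
  moreover have "conn_rhs \<alpha> lam (- \<xi>) = exp (- \<xi> * \<alpha>) * gfun \<alpha> lam (1 / (1 - exp (- 2 * \<xi>))) + e * (exp (\<xi> * \<alpha>) * gfun \<alpha> lam (1 / (1 - exp (2 * \<xi>))))"
    by (simp add: conn_rhs_def e_def)
  ultimately have "e * conn_lhs \<alpha> lam \<xi> = exp (- \<xi> * \<alpha>) * gfun \<alpha> lam (1 / (1 - exp (- 2 * \<xi>))) + e * (exp (\<xi> * \<alpha>) * gfun \<alpha> lam (1 / (1 - exp (2 * \<xi>))))" by simp
  hence "(inverse e * e) * conn_lhs \<alpha> lam \<xi> = inverse e * (exp (- \<xi> * \<alpha>) * gfun \<alpha> lam (1 / (1 - exp (- 2 * \<xi>)))) + (inverse e * e) * (exp (\<xi> * \<alpha>) * gfun \<alpha> lam (1 / (1 - exp (2 * \<xi>))))"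
    by (simp only: mult.assoc) (simp add: distrib_left)
  moreover have "inverse e * e = 1" by (simp add: e_def)
  moreover have "inverse e = Kfac \<xi> lam" using neg by (simp add: e_def Kfac_def exp_minus)
  ultimately show ?thesis by simp
qed

section \<open>From the connection formula to the Gegenbauer function on D1\<close>

lemma sinh_D1_notin:
  assumes "\<xi> \<in> D1"
  shows "2 * sinh \<xi> \<notin> \<real>\<^sub>\<le>\<^sub>0"
proof
  assume "2 * sinh \<xi> \<in> \<real>\<^sub>\<le>\<^sub>0"
  hence re: "cos (Im \<xi>) * sinh (Re \<xi>) \<le> 0" and im: "sin (Im \<xi>) = 0"
    by (auto simp: complex_nonpos_Reals_iff Re_sinh Im_sinh)
  have "Im \<xi> = 0"
  proof (rule ccontr)
    assume "Im \<xi> \<noteq> 0"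
    hence "sin \<bar>Im \<xi>\<bar> > 0" using assms by (intro sin_gt_zero) (auto simp: D1_def)
    thus False using im by (simp add: abs_if split: if_splits)
  qed
  thus False using re assms by (simp add: D1_def)
qed

lemma open_D1: "open D1"
proof -
  have e: "D1 = {\<xi>. Re \<xi> > 0} \<inter> {\<xi>. Im \<xi> < pi} \<inter> {\<xi>. Im \<xi> > - pi}" by (auto simp: D1_def)
  show ?thesis unfolding e by (intro open_Int open_halfspace_Re_gt open_halfspace_Im_gt open_halfspace_Im_lt)
qed

lemma conn_lhs_holomorphic_D1: "conn_lhs \<alpha> lam holomorphic_on D1"
proof (rule conn_lhs_holomorphic[OF open_D1])
  fix \<xi> assume x: "\<xi> \<in> D1"
  thus "\<bar>Im \<xi>\<bar> < pi" "2 * sinh \<xi> \<notin> \<real>\<^sub>\<le>\<^sub>0" using sinh_D1_notin by (auto simp: D1_def)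
  show "tanh (\<xi> / 2) \<notin> \<real>\<^sub>\<le>\<^sub>0" using Re_tanh_half_pos[OF x] by (auto simp: complex_nonpos_Reals_iff)
qed

text \<open>Half-angle formulas give both principal roots: cosh \<xi> - 1 and cosh \<xi> + 1 are
  twice the squares of sinh (\<xi>/2) and cosh (\<xi>/2), and on D1 these two functions have
  positive real part.\<close>

lemma sqrt_z2m1_cosh:
  assumes "\<xi> \<in> D1"
  shows "sqrt_z2m1 (cosh \<xi>) = sinh \<xi>"
proof -
  have c: "cos (Im \<xi> / 2) > 0" using assms by (intro cos_gt_zero_pi) (auto simp: D1_def)
  have d: "cosh \<xi> = (cosh (\<xi> / 2))\<^sup>2 + (sinh (\<xi> / 2))\<^sup>2" "(cosh (\<xi> / 2))\<^sup>2 = (sinh (\<xi> / 2))\<^sup>2 + 1"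
    using cosh_double[of "\<xi> / 2"] cosh_square_eq[of "\<xi> / 2"] by simp_all
  have s2: "complex_of_real (sqrt 2) * of_real (sqrt 2) = 2" by (simp flip: of_real_mult)
  have "csqrt (cosh \<xi> - 1) = of_real (sqrt 2) * sinh (\<xi> / 2)"
  proof (rule csqrt_unique)
    show "(of_real (sqrt 2) * sinh (\<xi> / 2))\<^sup>2 = cosh \<xi> - 1"
      using d s2 by (simp add: power2_eq_square algebra_simps)
    show "0 < Re (of_real (sqrt 2) * sinh (\<xi> / 2)) \<or> Re (of_real (sqrt 2) * sinh (\<xi> / 2)) = 0 \<and> 0 \<le> Im (of_real (sqrt 2) * sinh (\<xi> / 2))"
      using c assms by (simp add: Re_sinh D1_def)
  qed
  moreover have "csqrt (cosh \<xi> + 1) = of_real (sqrt 2) * cosh (\<xi> / 2)"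
  proof (rule csqrt_unique)
    show "(of_real (sqrt 2) * cosh (\<xi> / 2))\<^sup>2 = cosh \<xi> + 1"
      using d s2 by (simp add: power2_eq_square algebra_simps)
    show "0 < Re (of_real (sqrt 2) * cosh (\<xi> / 2)) \<or> Re (of_real (sqrt 2) * cosh (\<xi> / 2)) = 0 \<and> 0 \<le> Im (of_real (sqrt 2) * cosh (\<xi> / 2))"
      using c assms by (simp add: Re_cosh D1_def)
  qed
  ultimately show ?thesis unfolding sqrt_z2m1_def using sinh_double[of "\<xi> / 2"] s2
    by (simp add: algebra_simps)
qed

text \<open>The quotient is the inverse square of tanh (\<xi>/2), whose argument is below \<pi>/2 in
  modulus on D1; doubling the logarithm therefore stays on the principal branch.\<close>

lemma cosh_ratio_powr:
  assumes "\<xi> \<in> D1"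
  shows "((cosh \<xi> + 1) / (cosh \<xi> - 1)) powr (a / 2) = tanh (\<xi> / 2) powr (- a)"
proof -
  define T where "T = tanh (\<xi> / 2)"
  have T: "Re T > 0" using Re_tanh_half_pos[OF assms] by (simp add: T_def)
  hence nz: "T \<noteq> 0" by auto
  have d: "cosh \<xi> = (cosh (\<xi> / 2))\<^sup>2 + (sinh (\<xi> / 2))\<^sup>2" "(cosh (\<xi> / 2))\<^sup>2 = (sinh (\<xi> / 2))\<^sup>2 + 1"
    using cosh_double[of "\<xi> / 2"] cosh_square_eq[of "\<xi> / 2"] by simp_all
  have e1: "cosh \<xi> + 1 = 2 * (cosh (\<xi> / 2))\<^sup>2" using d by simp
  have e2: "cosh \<xi> - 1 = 2 * (sinh (\<xi> / 2))\<^sup>2" unfolding d(1) d(2) by simp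
  have "(cosh \<xi> + 1) / (cosh \<xi> - 1) = inverse (T * T)"
    unfolding e1 e2 T_def tanh_def by (simp add: power2_eq_square)
  also have "\<dots> = exp (- 2 * Ln T)"
  proof -
    have e: "- 2 * Ln T = - (Ln T + Ln T)" by simp
    show ?thesis by (simp only: e exp_minus exp_add exp_Ln[OF nz])
  qed
  also have "\<dots> powr (a / 2) = exp (a / 2 * (- 2 * Ln T))"
  proof (rule exp_powr)
    have "\<bar>Im (Ln T)\<bar> < pi / 2" using T nz Re_Ln_pos_lt by blast
    thus "\<bar>Im (- 2 * Ln T)\<bar> < pi" by simp
  qed
  also have "\<dots> = T powr (- a)" using nz by (simp add: powr_def)
  finally show ?thesis by (simp add: T_def)
qed

text \<open>Splitting (2 sinh \<xi>) powr (1/2) off the normalising power leaves exactly the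
  prefactor that both halves of the expansion share.\<close>

lemma gegenbauer_conn:
  assumes "\<xi> \<in> D1"
  shows "gegenbauer_C lam \<nu> (cosh \<xi>) = rGamma lam * rGamma (\<nu> + 1) / (2 * sinh \<xi>) powr lam * conn_lhs (\<nu> + lam) lam \<xi>"
proof -
  have nz: "2 * sinh \<xi> \<noteq> 0" using sinh_D1_notin[OF assms] by (metis nonpos_Reals_zero_I)
  have p: "(2 * sinh \<xi>) powr (lam - 1 / 2) = (2 * sinh \<xi>) powr lam / (2 * sinh \<xi>) powr (1 / 2)"
    by (rule powr_diff)
  have e: "\<nu> + lam - 1 / 2 + 1 = \<nu> + lam + 1 / 2" "- (\<nu> + lam - 1 / 2) = 1 / 2 - (\<nu> + lam)"
     "1 - (1 / 2 - lam) = lam + 1 / 2" "- (1 / 2 - lam) = lam - 1 / 2" "\<nu> + 2 * lam = \<nu> + lam + lam"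
    by (simp_all add: field_simps)
  show ?thesis
    unfolding gegenbauer_C_def legendre_P_def sqrt_z2m1_cosh[OF assms] cosh_ratio_powr[OF assms] conn_lhs_def p e
    by (simp add: field_simps)
qed

section \<open>Expansion with an integral remainder\<close>

text \<open>Each factor is a difference of two squares and splits as -4 (l + n) (1 - l + n). This
  symmetric form is the one that \<open>Beta_pair\<close> produces.\<close>

lemma acoef_pochhammer:
  fixes l :: "'a :: field_char_0"
  shows "acoef n (l - 1 / 2) = (- 1) ^ n * pochhammer l n * pochhammer (1 - l) n / (2 ^ n * fact n)"
proof -
  have "(\<Prod>k=1..n. 4 * (l - 1 / 2)\<^sup>2 - (2 * of_nat k - 1)\<^sup>2) = (- 4) ^ n * pochhammer l n * pochhammer (1 - l) n"
  proof (induction n)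
    case (Suc n)
    have E: "4 * (l - 1 / 2)\<^sup>2 - (2 * of_nat (Suc n) - 1)\<^sup>2 = - 4 * (l + of_nat n) * (1 - l + of_nat n)"
      by (simp add: power2_eq_square algebra_simps)
    have "(\<Prod>k=1..Suc n. 4 * (l - 1 / 2)\<^sup>2 - (2 * of_nat k - 1)\<^sup>2) =
        (4 * (l - 1 / 2)\<^sup>2 - (2 * of_nat (Suc n) - 1)\<^sup>2) * (\<Prod>k=1..n. 4 * (l - 1 / 2)\<^sup>2 - (2 * of_nat k - 1)\<^sup>2)"
      by (simp add: prod.nat_ivl_Suc')
    also have "\<dots> = (- 4) ^ Suc n * pochhammer l (Suc n) * pochhammer (1 - l) (Suc n)"
      unfolding E Suc.IH pochhammer_Suc power_Suc by (simp only: mult_ac)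
    finally show ?case .
  qed simp
  moreover have "(8::'a) ^ n = 4 ^ n * 2 ^ n" by (simp flip: power_mult_distrib)
  moreover have "(- 4 :: 'a) ^ n = (- 1) ^ n * 4 ^ n" by (simp flip: power_mult_distrib)
  ultimately show ?thesis unfolding acoef_def by (simp add: mult.assoc)
qed

text \<open>The two arguments add up to 2n + 1, so the denominator is (2n)!, and reflection absorbs
  \<Gamma>(lam) \<Gamma>(1 - lam). Through this identity the Beta moments of a geometric series
  become the coefficients of the expansion.\<close>

lemma Beta_pair:
  fixes lam :: complex
  assumes "lam \<notin> \<int>"
  shows "sin (of_real pi * lam) / of_real pi * Beta (lam + of_nat n) (of_nat n + 1 - lam) =
          pochhammer lam n * pochhammer (1 - lam) n / fact (2 * n)"
proof -
  have nz: "lam \<notin> \<int>\<^sub>\<le>\<^sub>0" using assms nonpos_Ints_Int by blast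
  have nz2: "1 - lam \<notin> \<int>\<^sub>\<le>\<^sub>0"
  proof
    assume "1 - lam \<in> \<int>\<^sub>\<le>\<^sub>0"
    hence "1 - (1 - lam) \<in> \<int>" by (intro Ints_diff) (auto dest: nonpos_Ints_Int)
    thus False using assms by simp
  qed
  have g1: "Gamma (lam + of_nat n) = pochhammer lam n * Gamma lam"
    using pochhammer_Gamma[OF nz, of n] nz by (simp add: Gamma_eq_zero_iff)
  have g2: "Gamma (of_nat n + 1 - lam) = pochhammer (1 - lam) n * Gamma (1 - lam)"
    using pochhammer_Gamma[OF nz2, of n] nz2 by (simp add: Gamma_eq_zero_iff algebra_simps)
  have g3: "rGamma (lam + of_nat n + (of_nat n + 1 - lam)) = 1 / fact (2 * n)"
  proof -
    have "lam + of_nat n + (of_nat n + 1 - lam) = of_nat (2 * n) + 1" by simp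
    thus ?thesis using Gamma_fact[of "2 * n", where 'a = complex] by (simp only: rGamma_inverse_Gamma) (simp add: add.commute inverse_eq_divide)
  qed
  have r: "Gamma lam * Gamma (1 - lam) = of_real pi / sin (of_real pi * lam)" by (rule Gamma_reflection_complex)
  have "sin (of_real pi * lam) \<noteq> 0"
  proof
    assume "sin (of_real pi * lam) = 0"
    hence "Gamma lam * Gamma (1 - lam) = 0" using r by simp
    thus False using nz nz2 by (simp add: Gamma_eq_zero_iff)
  qed
  hence "sin (of_real pi * lam) / of_real pi * (Gamma lam * Gamma (1 - lam)) = 1" unfolding r by simp
  hence *: "sin (of_real pi * lam) / of_real pi * (Gamma lam * Gamma (1 - lam)) * x = x" for x by simp
  show ?thesis unfolding Beta_altdef g1 g2 g3
    using *[of "pochhammer lam n * pochhammer (1 - lam) n / fact (2 * n)"] by (simp add: mult_ac)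
qed

text \<open>The Taylor coefficients in s of the Gauss function with parameters lam, 1 - lam; 1/2 at
  -s, which for s = sinh^2 (\<eta>/2) is cosh ((lam - 1/2) \<eta>) / cosh (\<eta>/2).\<close>

definition kcoef :: "nat \<Rightarrow> complex \<Rightarrow> complex" where
  "kcoef n lam = (- 4) ^ n * pochhammer lam n * pochhammer (1 - lam) n / fact (2 * n)"

text \<open>The N-th tail of the geometric series of 1 / (1 + 4 x (1 - x) s) under a Beta weight.
  The N powers of x and of 1 - x extracted from the series make the weight integrable for |Re lam -
  1/2| < N + 1/2; the exponents end in \<open>- 1\<close> to match the Beta integral.\<close>

definition Jint :: "nat \<Rightarrow> complex \<Rightarrow> real \<Rightarrow> complex" where
  "Jint N lam s = (LINT x:{0<..<1}|lborel. of_real x powr (lam + of_nat N - 1) * of_real (1 - x) powr (of_nat N + 1 - lam - 1) *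
      of_real (1 / (1 + 4 * x * (1 - x) * s)))"

lemma Jint_integrand_bound:
  assumes "x \<in> {0<..<1}" "s \<ge> 0"
  shows "1 + 4 * x * (1 - x) * s \<ge> 1" "\<bar>1 / (1 + 4 * x * (1 - x) * s)\<bar> \<le> (1::real)"
proof -
  have *: "\<bar>1 / X\<bar> \<le> 1" if "X \<ge> 1" for X :: real using that by simp
  show "1 + 4 * x * (1 - x) * s \<ge> 1" using assms by simp
  thus "\<bar>1 / (1 + 4 * x * (1 - x) * s)\<bar> \<le> 1" by (rule *)
qed

lemma Jint_continuous:
  assumes "s \<ge> 0"
  shows "continuous_on {0<..<1} (\<lambda>x. of_real x powr a * of_real (1 - x) powr b * complex_of_real (1 / (1 + 4 * x * (1 - x) * s)))"
proof -
  have "1 + 4 * x * (1 - x) * s \<noteq> 0" if "x \<in> {0<..<1}" for x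
    using Jint_integrand_bound(1)[OF that assms] by (metis not_one_le_zero)
  thus ?thesis by (intro continuous_intros continuous_on_of_real_powr ballI) auto
qed

lemma Jint_integrable:
  assumes "s \<ge> 0" "\<bar>Re lam - 1 / 2\<bar> < real N + 1 / 2"
  shows "set_integrable lborel {0<..<1} (\<lambda>x. of_real x powr (lam + of_nat N - 1) * of_real (1 - x) powr (of_nat N + 1 - lam - 1) *
      complex_of_real (1 / (1 + 4 * x * (1 - x) * s)))"
proof (rule set_integrable_dominated[OF set_integrable_Beta[of "Re lam + real N" "real N + 1 - Re lam"]])
  fix x :: real assume x: "x \<in> {0<..<1}"
  have "norm (of_real x powr (lam + of_nat N - 1) * of_real (1 - x) powr (of_nat N + 1 - lam - 1) *
      complex_of_real (1 / (1 + 4 * x * (1 - x) * s))) \<le> x powr (Re lam + real N - 1) * (1 - x) powr (real N + 1 - Re lam - 1) * 1"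
    unfolding norm_mult norm_of_real
    using x norm_of_real_powr[of x] norm_of_real_powr[of "1 - x"] Jint_integrand_bound(2)[OF x assms(1)]
    by (intro mult_mono) auto
  thus "norm (of_real x powr (lam + of_nat N - 1) * of_real (1 - x) powr (of_nat N + 1 - lam - 1) *
      complex_of_real (1 / (1 + 4 * x * (1 - x) * s))) \<le> x powr (Re lam + real N - 1) * (1 - x) powr (real N + 1 - Re lam - 1)"
    by simp
qed (use assms Jint_continuous[OF assms(1)] in auto)

lemma Jint_holomorphic:
  assumes s: "s \<ge> 0"
  shows "(\<lambda>lam. Jint N lam s) holomorphic_on {lam. \<bar>Re lam - 1 / 2\<bar> < real N + 1 / 2}"
  unfolding Jint_def
proof (rule holomorphic_on_set_integral)
  have "{lam. \<bar>Re lam - 1 / 2\<bar> < real N + 1 / 2} = {z. Re z < real N + 1} \<inter> {z. Re z > - real N}"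
    by (auto simp: abs_less_iff)
  thus "open {lam. \<bar>Re lam - 1 / 2\<bar> < real N + 1 / 2}"
    by (simp only:) (intro open_Int open_halfspace_Re_lt open_halfspace_Re_gt)
  show "continuous_on {0<..<1} (\<lambda>x. of_real x powr (lam + of_nat N - 1) * of_real (1 - x) powr (of_nat N + 1 - lam - 1) *
      complex_of_real (1 / (1 + 4 * x * (1 - x) * s)))" for lam by (rule Jint_continuous[OF s])
  show "(\<lambda>lam. of_real x powr (lam + of_nat N - 1) * of_real (1 - x) powr (of_nat N + 1 - lam - 1) *
      complex_of_real (1 / (1 + 4 * x * (1 - x) * s))) holomorphic_on {lam. \<bar>Re lam - 1 / 2\<bar> < real N + 1 / 2}" for x
    by (intro holomorphic_intros)
  fix l0 assume l0: "l0 \<in> {lam. \<bar>Re lam - 1 / 2\<bar> < real N + 1 / 2}"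
  define e where "e = (real N + 1 / 2 - \<bar>Re l0 - 1 / 2\<bar>) / 2"
  have e: "e > 0" using l0 by (simp add: e_def)
  define a where "a = Re l0 + real N - e"
  define b where "b = real N + 1 - Re l0 - e"
  have ab: "a > 0" "b > 0" using e unfolding a_def b_def e_def by (simp_all add: abs_if field_simps split: if_splits)
  have "norm (of_real x powr (lam + of_nat N - 1) * of_real (1 - x) powr (of_nat N + 1 - lam - 1) *
      complex_of_real (1 / (1 + 4 * x * (1 - x) * s))) \<le> x powr (a - 1) * (1 - x) powr (b - 1)"
    if "lam \<in> ball l0 e" and x: "x \<in> {0<..<1}" for lam x
  proof -
    have "\<bar>Re l0 - Re lam\<bar> < e" using that(1) abs_Re_le_cmod[of "l0 - lam"] by (simp add: dist_norm)
    hence "a \<le> Re lam + real N" "b \<le> real N + 1 - Re lam" by (auto simp: a_def b_def abs_less_iff)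
    hence "x powr (Re lam + real N - 1) \<le> x powr (a - 1)" "(1 - x) powr (real N + 1 - Re lam - 1) \<le> (1 - x) powr (b - 1)"
      using x by (intro powr_mono'; simp)+
    hence "x powr (Re lam + real N - 1) * (1 - x) powr (real N + 1 - Re lam - 1) * 1 \<le> x powr (a - 1) * (1 - x) powr (b - 1) * 1"
      by (intro mult_mono) auto
    moreover have "norm (of_real x powr (lam + of_nat N - 1) * of_real (1 - x) powr (of_nat N + 1 - lam - 1) *
      complex_of_real (1 / (1 + 4 * x * (1 - x) * s))) \<le> x powr (Re lam + real N - 1) * (1 - x) powr (real N + 1 - Re lam - 1) * 1"
      unfolding norm_mult norm_of_real
      using x norm_of_real_powr[of x] norm_of_real_powr[of "1 - x"] Jint_integrand_bound(2)[OF x s]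
      by (intro mult_mono) auto
    ultimately show ?thesis by simp
  qed
  with e set_integrable_Beta[OF ab]
  show "\<exists>d>0. \<exists>h. set_integrable lborel {0<..<1} h \<and> (\<forall>lam\<in>ball l0 d \<inter> {lam. \<bar>Re lam - 1 / 2\<bar> < real N + 1 / 2}. \<forall>x\<in>{0<..<1}.
      norm (of_real x powr (lam + of_nat N - 1) * of_real (1 - x) powr (of_nat N + 1 - lam - 1) *
      complex_of_real (1 / (1 + 4 * x * (1 - x) * s))) \<le> h x)"
    by blast
qed auto

text \<open>Euler's integral with first and last parameter 1, whose series collapses to the binomial
  series. The closed form continues through the cut plane, at the point -c, to all c > -1.\<close>

lemma Beta_linear_integral:
  assumes lam: "0 < Re lam" "Re lam < 1" and c: "c > (-1::real)"
  shows "(LINT x:{0<..<1}|lborel. of_real x powr (lam - 1) * of_real (1 - x) powr (1 - lam - 1) * complex_of_real (1 / (1 + c * x))) =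
     Gamma lam * Gamma (1 - lam) * of_real (1 + c) powr (- lam)"
proof -
  let ?I = "\<lambda>w. LINT s:{0<..<1}|lborel. complex_of_real s powr (lam - 1) * of_real (1 - s) powr (1 - lam - 1) * (1 - w * of_real s) powr (- 1)"
  have b: "Re lam > 0" "Re (1 - lam) > 0" using lam by auto
  have disc: "?I w = Gamma lam * Gamma (1 - lam) * (1 - w) powr (- lam)" if "norm w < 1" for w
  proof -
    have "hyp_coeff 1 lam 1 n * w ^ n = pochhammer lam n / fact n * w ^ n" for n
      using Gamma_fact[of n, where 'a = complex]
      by (simp add: hyp_coeff_def rGamma_inverse_Gamma pochhammer_fact[symmetric] field_simps)
    hence "hyp_series 1 lam 1 w = (1 - w) powr (- lam)"
      using binomial_series_complex(1)[OF that, of lam] unfolding hyp_series_altdef by (simp add: sums_iff)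
    thus ?thesis using Euler_integral[OF b that, of 1] by simp
  qed
  have "?I (- of_real c) = Gamma lam * Gamma (1 - lam) * (1 - (- of_real c)) powr (- lam)"
  proof (rule analytic_continuation_open[where f = ?I and g = "\<lambda>w. Gamma lam * Gamma (1 - lam) * (1 - w) powr (- lam)" and s = "ball 0 1" and s' = cutplane])
    show "?I holomorphic_on cutplane" by (rule Euler_integral_holomorphic[OF b])
    show "(\<lambda>w. Gamma lam * Gamma (1 - lam) * (1 - w) powr (- lam)) holomorphic_on cutplane"
      by (intro holomorphic_intros) (auto simp: cutplane_iff)
    show "- complex_of_real c \<in> cutplane" using c by (simp add: cutplane_iff complex_nonpos_Reals_iff)
  qed (use disc ball_subset_cutplane open_cutplane connected_cutplane in auto)
  moreover have "?I (- of_real c) = (LINT x:{0<..<1}|lborel. of_real x powr (lam - 1) * of_real (1 - x) powr (1 - lam - 1) * complex_of_real (1 / (1 + c * x)))"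
  proof (intro set_lebesgue_integral_cong allI impI)
    fix x :: real assume x: "x \<in> {0<..<1}"
    have "(1 - - of_real c * complex_of_real x) powr (- 1) = of_real (1 / (1 + c * x))"
      by (simp add: powr_minus inverse_eq_divide)
    thus "complex_of_real x powr (lam - 1) * of_real (1 - x) powr (1 - lam - 1) * (1 - - of_real c * of_real x) powr (- 1) =
      of_real x powr (lam - 1) * of_real (1 - x) powr (1 - lam - 1) * complex_of_real (1 / (1 + c * x))" by (simp only:)
  qed auto
  ultimately show ?thesis by simp
qed

lemma Beta_linear_integrable:
  assumes lam: "0 < Re lam" "Re lam < 1" and c: "c > (-1::real)"
  shows "set_integrable lborel {0<..<1} (\<lambda>x. of_real x powr (lam - 1) * of_real (1 - x) powr (1 - lam - 1) * complex_of_real (1 / (1 + c * x)))"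
proof -
  define m where "m = min 1 (1 + c)"
  have m: "m > 0" using c by (simp add: m_def)
  have l: "1 + c * x \<ge> m" if x: "x \<in> {0<..<1}" for x
  proof (cases "c \<ge> 0")
    case True thus ?thesis using that by (simp add: m_def min_le_iff_disj)
  next
    case False
    hence "c * 1 \<le> c * x" using x by (intro mult_left_mono_neg) auto
    thus ?thesis using False by (simp add: m_def min_le_iff_disj)
  qed
  have b: "Re lam > 0" "Re (1 - lam) > 0" using lam by auto
  show ?thesis
  proof (rule set_integrable_dominated[OF set_integrable_mult_left[OF set_integrable_Beta[OF b]]])
    show "continuous_on {0<..<1} (\<lambda>x. of_real x powr (lam - 1) * of_real (1 - x) powr (1 - lam - 1) * complex_of_real (1 / (1 + c * x)))"
      by (intro continuous_intros continuous_on_of_real_powr) (use l m in force)+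
    fix x :: real assume x: "x \<in> {0<..<1}"
    have "\<bar>1 / (1 + c * x)\<bar> \<le> 1 / m" using l[OF x] m by (simp add: frac_le)
    thus "norm (of_real x powr (lam - 1) * of_real (1 - x) powr (1 - lam - 1) * complex_of_real (1 / (1 + c * x))) \<le>
       x powr (Re lam - 1) * (1 - x) powr (Re (1 - lam) - 1) * (1 / m)"
      unfolding norm_mult norm_of_real using x norm_of_real_powr[of x] norm_of_real_powr[of "1 - x"] by (intro mult_mono) auto
  qed auto
qed

lemma Jint_0:
  assumes lam: "0 < Re lam" "Re lam < 1" and \<eta>: "\<eta> > (0::real)"
  shows "Jint 0 lam ((sinh (\<eta> / 2))\<^sup>2) = Gamma lam * Gamma (1 - lam) * (cosh ((lam - 1 / 2) * of_real \<eta>) / of_real (cosh (\<eta> / 2)))"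
proof -
  define a where "a = exp \<eta>"
  have a: "a > 1" using \<eta> by (simp add: a_def)
  \<comment> \<open>For c1 = exp \<eta> - 1 and c2 = exp (-\<eta>) - 1 both the sum and minus the
    product equal 4 sinh^2 (\<eta>/2), so the denominator factors as (1 + c1 x) (1 + c2 x). Moreover
    1 + c1 and 1 + c2 are the exponentials that later combine to a hyperbolic cosine.\<close>
  define c1 where "c1 = a - 1"
  define c2 where "c2 = 1 / a - 1"
  have c: "c1 > -1" "c2 > -1" using a by (auto simp: c1_def c2_def)
  define sh where "sh = sinh (\<eta> / 2)"
  define ch where "ch = cosh (\<eta> / 2)"
  define e where "e = exp (\<eta> / 2)"
  have e: "e > 0" "a = e * e" by (auto simp: e_def a_def simp flip: exp_add)
  have shp: "sh > 0" "ch > 0" using \<eta> by (auto simp: sh_def ch_def)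
  have she: "2 * sh = e - 1 / e" "2 * ch = e + 1 / e"
    by (simp_all add: sh_def ch_def e_def sinh_field_def cosh_field_def exp_minus inverse_eq_divide)
  have c1e: "c1 = e * (2 * sh)" unfolding c1_def she e(2) using e by (simp add: field_simps)
  have c2e: "c2 = - (1 / e) * (2 * sh)" unfolding c2_def she e(2) using e by (simp add: field_simps)
  have cd: "c1 - c2 = 4 * sh * ch"
  proof -
    have "c1 - c2 = (e + 1 / e) * (2 * sh)" unfolding c1e c2e by (simp add: algebra_simps)
    thus ?thesis by (simp only: she(2)[symmetric]) simp
  qed
  have fac: "1 + 4 * x * (1 - x) * sh\<^sup>2 = (1 + c1 * x) * (1 + c2 * x)" for x
  proof -
    have "c1 + c2 = (e - 1 / e) * (2 * sh)" unfolding c1e c2e by (simp add: algebra_simps)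
    hence s: "c1 + c2 = 4 * sh\<^sup>2" by (simp only: she(1)[symmetric]) (simp add: power2_eq_square)
    have p: "c1 * c2 = - 4 * sh\<^sup>2" unfolding c1e c2e using e by (simp add: power2_eq_square)
    have "(1 + c1 * x) * (1 + c2 * x) = 1 + (c1 + c2) * x + (c1 * c2) * x * x" by (simp add: algebra_simps)
    thus ?thesis unfolding s p by (simp add: algebra_simps)
  qed
  have pos: "1 + c1 * x > 0" "1 + c2 * x > 0" if "x \<in> {0<..<1}" for x
  proof -
    show "1 + c1 * x > 0" using a that by (simp add: c1_def add_pos_nonneg)
    have "c2 * 1 \<le> c2 * x" using that a by (intro mult_left_mono_neg) (auto simp: c2_def)
    thus "1 + c2 * x > 0" using c(2) by linarith
  qed
  define B where "B = (\<lambda>x. complex_of_real x powr (lam - 1) * of_real (1 - x) powr (1 - lam - 1))"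
  have "Jint 0 lam (sh\<^sup>2) = (LINT x:{0<..<1}|lborel. of_real (c1 / (c1 - c2)) * (B x * of_real (1 / (1 + c1 * x))) - of_real (c2 / (c1 - c2)) * (B x * of_real (1 / (1 + c2 * x))))"
    unfolding Jint_def
  proof (intro set_lebesgue_integral_cong allI impI)
    fix x :: real assume x: "x \<in> {0<..<1}"
    have "1 / (1 + 4 * x * (1 - x) * sh\<^sup>2) = c1 / (c1 - c2) * (1 / (1 + c1 * x)) - c2 / (c1 - c2) * (1 / (1 + c2 * x))"
    proof -
      have nz: "1 + c1 * x \<noteq> 0" "1 + c2 * x \<noteq> 0" "c1 - c2 \<noteq> 0" using pos[OF x] cd shp by auto
      have "c1 / (c1 - c2) * (1 / (1 + c1 * x)) - c2 / (c1 - c2) * (1 / (1 + c2 * x)) = (c1 * (1 + c2 * x) - c2 * (1 + c1 * x)) / ((c1 - c2) * ((1 + c1 * x) * (1 + c2 * x)))"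
        using nz by (simp add: divide_simps)
      also have "c1 * (1 + c2 * x) - c2 * (1 + c1 * x) = c1 - c2" by (simp add: algebra_simps)
      finally show ?thesis unfolding fac using nz by simp
    qed
    hence "complex_of_real (1 / (1 + 4 * x * (1 - x) * sh\<^sup>2)) = of_real (c1 / (c1 - c2)) * of_real (1 / (1 + c1 * x)) - of_real (c2 / (c1 - c2)) * of_real (1 / (1 + c2 * x))"
      by (simp only: of_real_mult[symmetric] of_real_diff[symmetric])
    thus "of_real x powr (lam + of_nat 0 - 1) * of_real (1 - x) powr (of_nat 0 + 1 - lam - 1) * complex_of_real (1 / (1 + 4 * x * (1 - x) * sh\<^sup>2)) =
       of_real (c1 / (c1 - c2)) * (B x * of_real (1 / (1 + c1 * x))) - of_real (c2 / (c1 - c2)) * (B x * of_real (1 / (1 + c2 * x)))"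
      unfolding B_def by (simp only: of_nat_0 add_0_left add_0_right right_diff_distrib mult_ac)
  qed auto
  also have "\<dots> = of_real (c1 / (c1 - c2)) * (Gamma lam * Gamma (1 - lam) * of_real (1 + c1) powr (- lam)) - of_real (c2 / (c1 - c2)) * (Gamma lam * Gamma (1 - lam) * of_real (1 + c2) powr (- lam))"
    unfolding B_def using Beta_linear_integrable[OF lam c(1)] Beta_linear_integrable[OF lam c(2)]
    by (subst set_integral_diff) (simp_all only: set_integrable_mult_right set_integral_mult_right Beta_linear_integral[OF lam c(1)] Beta_linear_integral[OF lam c(2)])
  also have "\<dots> = Gamma lam * Gamma (1 - lam) * (of_real (c1 / (c1 - c2)) * of_real (1 + c1) powr (- lam) - of_real (c2 / (c1 - c2)) * of_real (1 + c2) powr (- lam))"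
    by (simp only: right_diff_distrib mult_ac)
  also have "of_real (c1 / (c1 - c2)) * of_real (1 + c1) powr (- lam) - of_real (c2 / (c1 - c2)) * of_real (1 + c2) powr (- lam) = cosh ((lam - 1 / 2) * of_real \<eta>) / of_real ch"
  proof -
    have p1: "complex_of_real (1 + c1) powr (- lam) = exp (- lam * of_real \<eta>)"
      using of_real_powr_exp[of "1 + c1" "- lam"] a by (simp add: c1_def a_def)
    have p2: "complex_of_real (1 + c2) powr (- lam) = exp (lam * of_real \<eta>)"
      using of_real_powr_exp[of "1 + c2" "- lam"] a by (simp add: c2_def a_def ln_div)
    have "c1 / (c1 - c2) = (e * (2 * sh)) / (4 * sh * ch)" by (simp only: cd) (simp only: c1e)
    hence q1: "c1 / (c1 - c2) = e / (2 * ch)" using shp by simp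
    have "c2 / (c1 - c2) = (- (1 / e) * (2 * sh)) / (4 * sh * ch)" by (simp only: cd) (simp only: c2e)
    hence q2: "c2 / (c1 - c2) = - (1 / e) / (2 * ch)" using shp by simp
    have ee: "complex_of_real e = exp (of_real \<eta> / 2)" "complex_of_real (1 / e) = exp (- of_real \<eta> / 2)"
      unfolding e_def by (simp_all add: exp_of_real[symmetric] exp_minus inverse_eq_divide)
    have "of_real (c1 / (c1 - c2)) * of_real (1 + c1) powr (- lam) - of_real (c2 / (c1 - c2)) * of_real (1 + c2) powr (- lam) =
       (exp (of_real \<eta> / 2) * exp (- lam * of_real \<eta>) + exp (- of_real \<eta> / 2) * exp (lam * of_real \<eta>)) / (2 * of_real ch)"
    proof -
      have "complex_of_real (e / (2 * ch)) = exp (of_real \<eta> / 2) / (2 * of_real ch)" using ee(1) by simp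
      moreover have "complex_of_real (- (1 / e) / (2 * ch)) = - complex_of_real (1 / e) / (2 * of_real ch)" by simp
      ultimately show ?thesis unfolding p1 p2 q1 q2 ee(2) by (simp add: add_divide_distrib)
    qed
    also have "exp (of_real \<eta> / 2) * exp (- lam * of_real \<eta>) = exp (- ((lam - 1 / 2) * of_real \<eta>))"
      unfolding exp_add[symmetric] by (simp add: algebra_simps)
    also have "exp (- of_real \<eta> / 2) * exp (lam * of_real \<eta>) = exp ((lam - 1 / 2) * of_real \<eta>)"
      unfolding exp_add[symmetric] by (simp add: algebra_simps)
    finally show ?thesis by (simp add: cosh_field_def add.commute)
  qed
  finally show ?thesis unfolding sh_def ch_def .
qed

lemma Jint_geometric:
  assumes lam: "0 < Re lam" "Re lam < 1" and s: "s \<ge> (0::real)"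
  shows "Jint 0 lam s = (\<Sum>n<N. (- 4 * of_real s) ^ n * Beta (lam + of_nat n) (of_nat n + 1 - lam)) + (- 4 * of_real s) ^ N * Jint N lam s"
proof (induction N)
  case (Suc N)
  have ok: "\<bar>Re lam - 1 / 2\<bar> < real n + 1 / 2" for n using lam by (auto simp: abs_less_iff)
  have b: "Re (lam + of_nat N) > 0" "Re (of_nat N + 1 - lam) > 0" using lam by auto
  have "Jint N lam s = (LINT x:{0<..<1}|lborel. of_real x powr (lam + of_nat N - 1) * of_real (1 - x) powr (of_nat N + 1 - lam - 1) +
      (- 4 * of_real s) * (of_real x powr (lam + of_nat (Suc N) - 1) * of_real (1 - x) powr (of_nat (Suc N) + 1 - lam - 1) *
      complex_of_real (1 / (1 + 4 * x * (1 - x) * s))))"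
    unfolding Jint_def
  proof (intro set_lebesgue_integral_cong allI impI)
    fix x :: real assume x: "x \<in> {0<..<1}"
    define X where "X = 1 + 4 * x * (1 - x) * s"
    have X: "X \<noteq> 0" using Jint_integrand_bound(1)[OF x s] unfolding X_def[symmetric] by auto
    \<comment> \<open>One step of the geometric series; the factor x (1 - x) raises both Beta
      exponents by one and so passes from N to \<open>Suc N\<close>.\<close>
    have "1 / X = 1 + (- 4 * s) * (x * (1 - x)) * (1 / X)" using X by (simp add: field_simps X_def)
    hence eq: "complex_of_real (1 / X) = 1 + (- 4 * of_real s) * (of_real x * of_real (1 - x)) * of_real (1 / X)"
      by (metis (no_types, opaque_lifting) of_real_1 of_real_add of_real_mult of_real_minus of_real_numeral)
    have q1: "complex_of_real x powr (lam + of_nat (Suc N) - 1) = of_real x powr (lam + of_nat N - 1) * of_real x"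
      using x powr_add[of "of_real x" "lam + of_nat N - 1" 1] by (simp add: algebra_simps)
    have "complex_of_real (1 - x) powr (of_nat N + 1 - lam - 1 + 1) = of_real (1 - x) powr (of_nat N + 1 - lam - 1) * of_real (1 - x) powr 1"
      by (rule powr_add)
    moreover have "complex_of_real (1 - x) powr 1 = of_real (1 - x)" by simp
    ultimately have q2: "complex_of_real (1 - x) powr (of_nat (Suc N) + 1 - lam - 1) = of_real (1 - x) powr (of_nat N + 1 - lam - 1) * of_real (1 - x)"
      by (simp add: algebra_simps)
    show "of_real x powr (lam + of_nat N - 1) * of_real (1 - x) powr (of_nat N + 1 - lam - 1) * complex_of_real (1 / (1 + 4 * x * (1 - x) * s)) =
      of_real x powr (lam + of_nat N - 1) * of_real (1 - x) powr (of_nat N + 1 - lam - 1) +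
      (- 4 * of_real s) * (of_real x powr (lam + of_nat (Suc N) - 1) * of_real (1 - x) powr (of_nat (Suc N) + 1 - lam - 1) *
      complex_of_real (1 / (1 + 4 * x * (1 - x) * s)))"
      unfolding X_def[symmetric] q1 q2 by (subst eq) (simp only: distrib_left mult_1 mult_1_right mult_ac)
  qed auto
  also have "\<dots> = Beta (lam + of_nat N) (of_nat N + 1 - lam) + (- 4 * of_real s) * Jint (Suc N) lam s"
    unfolding Jint_def
    by (subst set_integral_add(2)[OF set_integrable_Beta_complex[OF b] set_integrable_mult_right[OF Jint_integrable[OF s ok]]])
       (simp only: Beta_set_integral[OF b] set_integral_mult_right)
  finally have JN: "Jint N lam s = Beta (lam + of_nat N) (of_nat N + 1 - lam) + (- 4 * of_real s) * Jint (Suc N) lam s" .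
  show ?case by (subst Suc.IH, subst JN) (simp add: algebra_simps)
qed simp

text \<open>For \<open>N = 0\<close> this is a partial fraction decomposition; summing a geometric series gives all \<open>N\<close> when
  \<open>0 < Re lam < 1\<close>, and analytic continuation in \<open>lam\<close> does the rest.\<close>

lemma cosh_expansion:
  assumes lam: "\<bar>Re lam - 1 / 2\<bar> < real N + 1 / 2" and \<eta>: "\<eta> > (0::real)"
  defines "s \<equiv> (sinh (\<eta> / 2))\<^sup>2"
  shows "cosh ((lam - 1 / 2) * of_real \<eta>) / of_real (cosh (\<eta> / 2)) =
    (\<Sum>n<N. kcoef n lam * of_real s ^ n) + sin (of_real pi * lam) / of_real pi * (- 4 * of_real s) ^ N * Jint N lam s"
proof -
  let ?S = "{lam. \<bar>Re lam - 1 / 2\<bar> < real N + 1 / 2}"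
  have e: "?S = {z. Re z < real N + 1} \<inter> {z. Re z > - real N}" by (auto simp: abs_less_iff)
  have S: "open ?S" "connected ?S" unfolding e
    by (intro open_Int open_halfspace_Re_lt open_halfspace_Re_gt convex_connected convex_Int convex_halfspace_Re_lt convex_halfspace_Re_gt)+
  have s: "s \<ge> 0" by (simp add: s_def)
  have chp: "cosh (\<eta> / 2) \<noteq> 0" by (metis cosh_real_pos less_irrefl)
  show ?thesis
  proof (rule holomorphic_eq_on_segment[where f = "\<lambda>lam. cosh ((lam - 1 / 2) * of_real \<eta>) / of_real (cosh (\<eta> / 2))" and
      g = "\<lambda>lam. (\<Sum>n<N. kcoef n lam * of_real s ^ n) + sin (of_real pi * lam) / of_real pi * (- 4 * of_real s) ^ N * Jint N lam s"
      and S = ?S and l = 0 and r = 1 and v = 1 and p = 0])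
    show "(\<lambda>lam. cosh ((lam - 1 / 2) * of_real \<eta>) / of_real (cosh (\<eta> / 2))) holomorphic_on ?S"
      unfolding cosh_field_def[of "(_ - 1 / 2) * of_real \<eta>"] using chp by (intro holomorphic_intros) auto
    show "(\<lambda>lam. (\<Sum>n<N. kcoef n lam * of_real s ^ n) + sin (of_real pi * lam) / of_real pi * (- 4 * of_real s) ^ N * Jint N lam s) holomorphic_on ?S"
      unfolding kcoef_def pochhammer_prod by (intro holomorphic_intros Jint_holomorphic[OF s]) auto
    fix t :: real assume t: "0 < t" "t < 1"
    define l where "l = complex_of_real t"
    have l: "0 < Re l" "Re l < 1" using t by (auto simp: l_def)
    have ni: "l \<notin> \<int>"
    proof
      assume "l \<in> \<int>"
      then obtain m :: int where "l = of_int m" by (auto elim: Ints_cases)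
      hence "t = of_int m" by (simp add: l_def complex_eq_iff)
      hence "0 < m" "m < 1" using t by simp_all
      thus False by simp
    qed
    have "Gamma l * Gamma (1 - l) = of_real pi / sin (of_real pi * l)" by (rule Gamma_reflection_complex)
    moreover have "Gamma l \<noteq> 0" "Gamma (1 - l) \<noteq> 0"
      using l nonpos_Ints_Re_pos[of l] nonpos_Ints_Re_pos[of "1 - l"] by (simp_all add: Gamma_eq_zero_iff)
    ultimately have one: "sin (of_real pi * l) / of_real pi * (Gamma l * Gamma (1 - l)) = 1" by auto
    define q where "q = sin (of_real pi * l) / of_real pi"
    have "cosh ((l - 1 / 2) * of_real \<eta>) / of_real (cosh (\<eta> / 2)) = (q * (Gamma l * Gamma (1 - l))) * (cosh ((l - 1 / 2) * of_real \<eta>) / of_real (cosh (\<eta> / 2)))"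
      using one by (simp add: q_def)
    also have "\<dots> = q * Jint 0 l s" unfolding s_def Jint_0[OF l \<eta>] by (simp only: mult.assoc)
    also have "\<dots> = (\<Sum>n<N. (- 4 * of_real s) ^ n * (q * Beta (l + of_nat n) (of_nat n + 1 - l))) + q * (- 4 * of_real s) ^ N * Jint N l s"
      unfolding Jint_geometric[OF l s, of N] by (simp only: distrib_left sum_distrib_left mult_ac)
    also have "(\<Sum>n<N. (- 4 * of_real s) ^ n * (q * Beta (l + of_nat n) (of_nat n + 1 - l))) = (\<Sum>n<N. kcoef n l * of_real s ^ n)"
      unfolding q_def Beta_pair[OF ni] kcoef_def
      by (intro sum.cong refl) (simp only: power_mult_distrib mult_ac times_divide_eq_left times_divide_eq_right)
    finally show "0 + of_real t * 1 \<in> ?S \<and> cosh ((0 + of_real t * 1 - 1 / 2) * of_real \<eta>) / of_real (cosh (\<eta> / 2)) =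
       (\<Sum>n<N. kcoef n (0 + of_real t * 1) * of_real s ^ n) + sin (of_real pi * (0 + of_real t * 1)) / of_real pi * (- 4 * of_real s) ^ N * Jint N (0 + of_real t * 1) s"
      using l unfolding q_def l_def by (auto simp: abs_less_iff)
  qed (use S lam in auto)
qed

text \<open>Absolute convergence is checked iteratively here: the inner integral of the norm has an
  integrable bound in the outer variable. In \<open>Dh_Beta_integral\<close> the natural bound
  couples the variables through exp (- t s) and does not split into a product.\<close>

lemma set_integral_Fubini_bound:
  fixes f :: "real \<Rightarrow> real \<Rightarrow> complex" and g :: "real \<Rightarrow> real"
  assumes A: "A \<in> sets borel" and B: "B \<in> sets borel"
    and c: "continuous_on (A \<times> B) (\<lambda>(x,y). f x y)"
    and int: "\<And>x. x \<in> A \<Longrightarrow> set_integrable lborel B (f x)"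
    and bd: "\<And>x. x \<in> A \<Longrightarrow> (LINT y:B|lborel. norm (f x y)) \<le> g x"
    and g: "set_integrable lborel A g"
  shows "(LINT x:A|lborel. LINT y:B|lborel. f x y) = (LINT y:B|lborel. LINT x:A|lborel. f x y)"
    and "set_integrable lborel B (\<lambda>y. LINT x:A|lborel. f x y)"
proof -
  let ?F = "\<lambda>(x,y). indicator A x *\<^sub>R (indicator B y *\<^sub>R f x y)"
  have AB: "A \<times> B \<in> sets borel" using A B by (rule borel_Times)
  have m: "?F \<in> borel_measurable (lborel \<Otimes>\<^sub>M lborel)"
  proof -
    have "(\<lambda>z. indicator (A \<times> B) z *\<^sub>R (case z of (x,y) \<Rightarrow> f x y)) \<in> borel_measurable borel"
      by (rule borel_measurable_continuous_on_indicator[OF AB c])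
    also have "(\<lambda>z. indicator (A \<times> B) z *\<^sub>R (case z of (x,y) \<Rightarrow> f x y)) = ?F"
      by (auto simp: indicator_def fun_eq_iff)
    finally show ?thesis by (simp add: lborel_prod)
  qed
  have I: "integrable (lborel \<Otimes>\<^sub>M lborel) ?F"
  proof (rule lborel_pair.Fubini_integrable[OF m])
    have mm: "(\<lambda>x. \<integral>y. norm (?F (x, y)) \<partial>lborel) \<in> borel_measurable lborel"
      using m by measurable
    have gi: "integrable lborel (\<lambda>x. indicator A x *\<^sub>R g x)" using g by (simp add: set_integrable_def)
    show "integrable lborel (\<lambda>x. \<integral>y. norm (?F (x, y)) \<partial>lborel)"
    proof (rule Bochner_Integration.integrable_bound[OF gi mm], intro AE_I2)
      fix x
      show "norm (\<integral>y. norm (?F (x, y)) \<partial>lborel) \<le> norm (indicator A x *\<^sub>R g x)"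
      proof (cases "x \<in> A")
        case True
        have "(\<integral>y. norm (?F (x, y)) \<partial>lborel) = (LINT y:B|lborel. norm (f x y))"
          using True by (simp add: set_lebesgue_integral_def)
        also have "\<dots> \<le> g x" using bd[OF True] .
        finally have "(\<integral>y. norm (?F (x, y)) \<partial>lborel) \<le> g x" .
        moreover have "(\<integral>y. norm (?F (x, y)) \<partial>lborel) \<ge> 0" by (intro integral_nonneg_AE AE_I2) simp
        ultimately show ?thesis using True by simp
      qed simp
    qed
    show "AE x in lborel. integrable lborel (\<lambda>y. ?F (x, y))"
    proof (rule AE_I2)
      fix x show "integrable lborel (\<lambda>y. ?F (x, y))"
        using int[of x] by (cases "x \<in> A") (auto simp: set_integrable_def)
    qed
  qed
  show "(LINT x:A|lborel. LINT y:B|lborel. f x y) = (LINT y:B|lborel. LINT x:A|lborel. f x y)"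
    using lborel_pair.Fubini_integral[OF I] unfolding set_lebesgue_integral_def
    by (simp add: mult.commute flip: integral_scaleR_right)
  have "integrable lborel (\<lambda>y. \<integral>x. ?F (x, y) \<partial>lborel)"
    using lborel_pair.integrable_snd[OF I] by simp
  moreover have "(\<lambda>y. \<integral>x. ?F (x, y) \<partial>lborel) = (\<lambda>y. indicator B y *\<^sub>R (\<integral>x. indicator A x *\<^sub>R f x y \<partial>lborel))"
    by (simp add: mult.commute flip: integral_scaleR_right)
  ultimately show "set_integrable lborel B (\<lambda>y. LINT x:A|lborel. f x y)"
    unfolding set_lebesgue_integral_def set_integrable_def by simp
qed

section \<open>The nested integrals that make up the remainder\<close>

lemma set_integral_scale:
  fixes f :: "real \<Rightarrow> complex"
  assumes c: "c > 0" and f: "continuous_on {0<..} f"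
  shows "(LINT x:{0<..}|lborel. f x) = (LINT x:{0<..}|lborel. of_real c * f (c * x))"
proof (rule set_integral_substitution(2)[where g = "\<lambda>x. c * x" and h = "\<lambda>_. c"])
  show "(*) c ` {0<..} = {0<..}"
  proof
    show "{0<..} \<subseteq> (*) c ` {0<..}"
      using c by (intro subsetI, rule_tac x = "x / c" in image_eqI) auto
  qed (use c in auto)
qed (use c f in \<open>auto intro!: derivative_eq_intros inj_onI\<close>)

lemma Gamma_real_set_integral:
  assumes "a > 0" "c > (0::real)"
  shows "(LINT s:{0<..}|lborel. s powr (a - 1) * exp (- c * s)) = Gamma a * c powr (- a)"
proof -
  have "complex_of_real (LINT s:{0<..}|lborel. s powr (a - 1) * exp (- c * s)) =
     (LINT s:{0<..}|lborel. of_real (s powr (a - 1) * exp (- c * s)))"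
    by (rule set_integral_complex_of_real[symmetric])
  also have "\<dots> = (LINT s:{0<..}|lborel. of_real s powr (of_real a - 1) * exp (- of_real c * of_real s))"
  proof (intro set_lebesgue_integral_cong allI impI)
    fix s :: real assume s: "s \<in> {0<..}"
    have e: "complex_of_real a - 1 = of_real (a - 1)" by simp
    have "exp (- complex_of_real c * of_real s) = of_real (exp (- c * s))"
      by (simp add: exp_of_real[symmetric])
    thus "complex_of_real (s powr (a - 1) * exp (- c * s)) = of_real s powr (of_real a - 1) * exp (- of_real c * of_real s)"
      unfolding e using s by (subst powr_of_real) auto
  qed auto
  also have "\<dots> = Gamma (of_real a) * of_real c powr (- of_real a)"
    using assms by (intro Gamma_set_integral) auto
  also have "\<dots> = of_real (Gamma a * c powr (- a))"
  proof -
    have "complex_of_real c powr (- of_real a) = of_real (c powr (- a))"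
      using assms by (metis less_imp_le of_real_minus powr_of_real)
    thus ?thesis by (simp add: Gamma_complex_of_real)
  qed
  finally show ?thesis by (simp only: of_real_eq_iff)
qed

text \<open>Up to elementary factors and \<Gamma>(N + 1/2), an incomplete gamma function of 1/c. The
  shapes \<open>real N + 1 / 2 - 1\<close> and \<open>- 1 * v\<close> are those of the Gamma
  integral lemmas, so that these apply without rewriting.\<close>

definition Lam :: "nat \<Rightarrow> complex \<Rightarrow> complex" where
  "Lam N c = (LINT v:{0<..}|lborel. of_real (v powr (real N + 1 / 2 - 1) * exp (- 1 * v)) * (1 / (1 + c * of_real v)))"

text \<open>Writing 1 + c v as v (c + 1/v) reduces this to \<open>norm_add_nonneg_lower\<close> with
  S = 1/v, and v d (1 + 1/v) = d v + d exceeds d.\<close>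

lemma denominator_lower:
  assumes "c \<notin> \<real>\<^sub>\<le>\<^sub>0"
  obtains e d where "e > 0" "d > 0" "\<And>c' v. c' \<in> ball c e \<Longrightarrow> v > 0 \<Longrightarrow> norm (1 + c' * complex_of_real v) \<ge> d"
proof -
  obtain e d where d: "e > 0" "d > 0" "\<And>c' S. c' \<in> ball c e \<Longrightarrow> S \<ge> 0 \<Longrightarrow> norm (c' + complex_of_real S) \<ge> d * (1 + S)"
    using norm_add_nonneg_lower[OF assms] by metis
  have "norm (1 + c' * complex_of_real v) \<ge> d" if "c' \<in> ball c e" "v > 0" for c' v
  proof -
    have "1 + c' * complex_of_real v = of_real v * (c' + of_real (1 / v))" using that by (simp add: field_simps)
    hence "norm (1 + c' * complex_of_real v) = v * norm (c' + of_real (1 / v))" using that by (simp add: norm_mult)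
    also have "\<dots> \<ge> v * (d * (1 + 1 / v))" using that d(3)[of c' "1 / v"] by (intro mult_left_mono) auto
    also have "v * (d * (1 + 1 / v)) = d * v + d" using that by (simp add: field_simps)
    finally show ?thesis using d that by (smt (verit) mult_pos_pos)
  qed
  thus ?thesis using that d by blast
qed

lemma continuous_recip_linear:
  assumes "c \<notin> \<real>\<^sub>\<le>\<^sub>0 \<or> c = 0"
  shows "continuous_on {0<..} (\<lambda>v. 1 / (1 + c * complex_of_real v))" "\<And>v. v > 0 \<Longrightarrow> 1 + c * complex_of_real v \<noteq> 0"
proof -
  show nz: "1 + c * complex_of_real v \<noteq> 0" if "v > 0" for v
  proof (cases "c = 0")
    case False
    then obtain e d where "e > 0" "d > 0" "\<And>c' v. c' \<in> ball c e \<Longrightarrow> v > 0 \<Longrightarrow> norm (1 + c' * complex_of_real v) \<ge> d"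
      using denominator_lower[of c] assms by metis
    thus ?thesis using that by (metis centre_in_ball norm_zero not_le)
  qed simp
  show "continuous_on {0<..} (\<lambda>v. 1 / (1 + c * complex_of_real v))"
    by (intro continuous_intros) (use nz in auto)
qed

lemma Lam_integrand_bound:
  assumes "d > 0" "norm (1 + c * complex_of_real v) \<ge> d"
  shows "norm (of_real (v powr (real N + 1 / 2 - 1) * exp (- 1 * v)) * (1 / (1 + c * of_real v))) \<le> v powr (real N + 1 / 2 - 1) * exp (- 1 * v) * (1 / d)"
proof -
  have "norm (1 / (1 + c * complex_of_real v)) \<le> 1 / d" using assms by (simp add: norm_divide frac_le)
  thus ?thesis unfolding norm_mult[of "of_real _"] norm_of_real by (intro mult_mono) auto
qed

lemma Lam_dom_integrable:
  "set_integrable lborel {0<..} (\<lambda>v. v powr (real N + 1 / 2 - 1) * exp (- 1 * v) * (1 / d))"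
  by (intro set_integrable_mult_left set_integrable_powr_exp) auto

lemma Lam_continuous_integrand:
  assumes "c \<notin> \<real>\<^sub>\<le>\<^sub>0 \<or> c = 0"
  shows "continuous_on {0<..} (\<lambda>v. complex_of_real (v powr (real N + 1 / 2 - 1) * exp (- 1 * v)) * (1 / (1 + c * of_real v)))"
  by (intro continuous_intros continuous_on_mult continuous_recip_linear[OF assms]) (use continuous_recip_linear(2)[OF assms] in auto)

lemma Lam_bound:
  assumes c: "c \<notin> \<real>\<^sub>\<le>\<^sub>0 \<or> c = 0" and d: "d > 0" and lb: "\<And>v. v > 0 \<Longrightarrow> norm (1 + c * complex_of_real v) \<ge> d"
  shows "set_integrable lborel {0<..} (\<lambda>v. of_real (v powr (real N + 1 / 2 - 1) * exp (- 1 * v)) * (1 / (1 + c * of_real v)))"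
    and "norm (Lam N c) \<le> Gamma (real N + 1 / 2) / d"
proof -
  show I: "set_integrable lborel {0<..} (\<lambda>v. of_real (v powr (real N + 1 / 2 - 1) * exp (- 1 * v)) * (1 / (1 + c * of_real v)))"
    by (rule set_integrable_dominated[OF Lam_dom_integrable _ Lam_continuous_integrand[OF c] Lam_integrand_bound[OF d lb]]) auto
  have "norm (Lam N c) \<le> (LINT v:{0<..}|lborel. norm (of_real (v powr (real N + 1 / 2 - 1) * exp (- 1 * v)) * (1 / (1 + c * of_real v))))"
    unfolding Lam_def by (rule set_integral_norm_bound[OF I])
  also have "\<dots> \<le> (LINT v:{0<..}|lborel. v powr (real N + 1 / 2 - 1) * exp (- 1 * v) * (1 / d))"
    by (rule set_integral_mono[OF set_integrable_norm[OF I] Lam_dom_integrable]) (rule Lam_integrand_bound[OF d lb], simp)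
  also have "\<dots> = Gamma (real N + 1 / 2) / d"
    using Gamma_real_set_integral[of "real N + 1 / 2" 1] by simp
  finally show "norm (Lam N c) \<le> Gamma (real N + 1 / 2) / d" .
qed

lemma open_slit: "open (- \<real>\<^sub>\<le>\<^sub>0 :: complex set)" by (simp add: open_Compl)

lemma Lam_holomorphic: "Lam N holomorphic_on (- \<real>\<^sub>\<le>\<^sub>0)"
proof -
  have "(\<lambda>c. Lam N c) holomorphic_on (- \<real>\<^sub>\<le>\<^sub>0)" unfolding Lam_def
  proof (rule holomorphic_on_set_integral[OF open_slit])
    fix c :: complex assume "c \<in> - \<real>\<^sub>\<le>\<^sub>0"
    hence c: "c \<notin> \<real>\<^sub>\<le>\<^sub>0" by simp
    thus "continuous_on {0<..} (\<lambda>v. of_real (v powr (real N + 1 / 2 - 1) * exp (- 1 * v)) * (1 / (1 + c * of_real v)))"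
      by (intro Lam_continuous_integrand) auto
    obtain e d where d: "e > 0" "d > 0" "\<And>c' v. c' \<in> ball c e \<Longrightarrow> v > 0 \<Longrightarrow> norm (1 + c' * complex_of_real v) \<ge> d"
      using denominator_lower[OF c] by metis
    show "\<exists>e>0. \<exists>h. set_integrable lborel {0<..} h \<and> (\<forall>c'\<in>ball c e \<inter> - \<real>\<^sub>\<le>\<^sub>0. \<forall>v\<in>{0<..}.
        norm (of_real (v powr (real N + 1 / 2 - 1) * exp (- 1 * v)) * (1 / (1 + c' * of_real v))) \<le> h v)"
      using d Lam_dom_integrable[of N d] Lam_integrand_bound[OF d(2) d(3)] by (intro exI[of _ e] conjI exI[of _ "\<lambda>v. v powr (real N + 1 / 2 - 1) * exp (- 1 * v) * (1 / d)"]) auto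
  next
    fix v :: real assume "v \<in> {0<..}"
    thus "(\<lambda>c. of_real (v powr (real N + 1 / 2 - 1) * exp (- 1 * v)) * (1 / (1 + c * of_real v))) holomorphic_on (- \<real>\<^sub>\<le>\<^sub>0)"
      using continuous_recip_linear(2) by (intro holomorphic_intros) auto
  qed auto
  thus ?thesis by simp
qed

lemma slit_scale: "c \<notin> \<real>\<^sub>\<le>\<^sub>0 \<Longrightarrow> t > 0 \<Longrightarrow> c / complex_of_real t \<notin> \<real>\<^sub>\<le>\<^sub>0" "c \<notin> \<real>\<^sub>\<le>\<^sub>0 \<Longrightarrow> t > 0 \<Longrightarrow> complex_of_real t * c \<notin> \<real>\<^sub>\<le>\<^sub>0"
  by (auto simp: complex_nonpos_Reals_iff divide_le_0_iff mult_le_0_iff)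

lemma Lam_scaled_continuous:
  assumes "c \<notin> \<real>\<^sub>\<le>\<^sub>0 \<or> c = 0"
  shows "continuous_on {0<..} (\<lambda>t. Lam N (c / complex_of_real t))"
proof (cases "c = 0")
  case False
  hence c: "c \<notin> \<real>\<^sub>\<le>\<^sub>0" using assms by simp
  show ?thesis
    by (rule continuous_on_compose2[OF holomorphic_on_imp_continuous_on[OF Lam_holomorphic]])
       (use slit_scale[OF c] in \<open>auto intro!: continuous_intros\<close>)
qed simp

text \<open>The variable t comes from writing (w + s) powr (-\<kappa>) as a Gamma integral. Because
  \<open>Lam\<close> is evaluated at positive multiples of c only, a bound for \<open>Lam\<close>
  along a ray is inherited with the factor \<Gamma>(Re \<alpha> - N).\<close>

definition Dh :: "complex \<Rightarrow> nat \<Rightarrow> complex \<Rightarrow> complex" where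
  "Dh \<alpha> N c = (LINT t:{0<..}|lborel. of_real t powr (\<alpha> - of_nat N - 1) * exp (- 1 * of_real t) * Lam N (c / of_real t))"

lemma Dh_bound:
  assumes c: "c \<notin> \<real>\<^sub>\<le>\<^sub>0 \<or> c = 0" and \<alpha>: "Re \<alpha> > real N" and K: "\<And>t. t > 0 \<Longrightarrow> norm (Lam N (c / of_real t)) \<le> K"
  shows "set_integrable lborel {0<..} (\<lambda>t. of_real t powr (\<alpha> - of_nat N - 1) * exp (- 1 * of_real t) * Lam N (c / of_real t))"
    and "norm (Dh \<alpha> N c) \<le> Gamma (Re \<alpha> - real N) * K"
proof -
  have dom: "set_integrable lborel {0<..} (\<lambda>t. t powr (Re \<alpha> - real N - 1) * exp (- 1 * t) * K)"
    by (intro set_integrable_mult_left set_integrable_powr_exp) (use \<alpha> in auto)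
  have bd: "norm (of_real t powr (\<alpha> - of_nat N - 1) * exp (- 1 * of_real t) * Lam N (c / of_real t)) \<le> t powr (Re \<alpha> - real N - 1) * exp (- 1 * t) * K"
    if "t \<in> {0<..}" for t
  proof -
    have "norm (of_real t powr (\<alpha> - of_nat N - 1) * exp (- 1 * complex_of_real t)) = t powr (Re \<alpha> - real N - 1) * exp (- 1 * t)"
      using that norm_of_real_powr[of t "\<alpha> - of_nat N - 1"] by (simp add: norm_mult)
    thus ?thesis unfolding norm_mult[of "_ * _" "Lam _ _"] using K[of t] that by (simp add: mult_left_mono)
  qed
  show I: "set_integrable lborel {0<..} (\<lambda>t. of_real t powr (\<alpha> - of_nat N - 1) * exp (- 1 * of_real t) * Lam N (c / of_real t))"
    by (rule set_integrable_dominated[OF dom _ _ bd])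
       (auto intro!: continuous_intros continuous_on_of_real_powr Lam_scaled_continuous c)
  have "norm (Dh \<alpha> N c) \<le> (LINT t:{0<..}|lborel. norm (of_real t powr (\<alpha> - of_nat N - 1) * exp (- 1 * of_real t) * Lam N (c / of_real t)))"
    unfolding Dh_def by (rule set_integral_norm_bound[OF I])
  also have "\<dots> \<le> (LINT t:{0<..}|lborel. t powr (Re \<alpha> - real N - 1) * exp (- 1 * t) * K)"
    by (rule set_integral_mono[OF set_integrable_norm[OF I] dom bd])
  also have "\<dots> = Gamma (Re \<alpha> - real N) * K"
    using Gamma_real_set_integral[of "Re \<alpha> - real N" 1] \<alpha> by simp
  finally show "norm (Dh \<alpha> N c) \<le> Gamma (Re \<alpha> - real N) * K" .
qed

text \<open>A lower bound demanded for all v > 0 does not notice positive multiples of c. This is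
  why one constant serves all the multiples of w that occur inside the remainder.\<close>

lemma lower_scale:
  assumes "\<And>v. v > 0 \<Longrightarrow> norm (1 + c * complex_of_real v) \<ge> d" "y > 0" "v > 0"
  shows "norm (1 + (of_real y * c) * complex_of_real v) \<ge> d" "norm (1 + c / of_real y * complex_of_real v) \<ge> d"
  using assms(1)[of "y * v"] assms(1)[of "v / y"] assms(2,3) by (auto simp: field_simps)

lemma Dh_holomorphic:
  assumes \<alpha>: "Re \<alpha> > real N"
  shows "Dh \<alpha> N holomorphic_on (- \<real>\<^sub>\<le>\<^sub>0)"
proof -
  have "(\<lambda>c. Dh \<alpha> N c) holomorphic_on (- \<real>\<^sub>\<le>\<^sub>0)" unfolding Dh_def
  proof (rule holomorphic_on_set_integral[OF open_slit])
    fix c :: complex assume "c \<in> - \<real>\<^sub>\<le>\<^sub>0"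
    hence c: "c \<notin> \<real>\<^sub>\<le>\<^sub>0" by simp
    thus "continuous_on {0<..} (\<lambda>t. of_real t powr (\<alpha> - of_nat N - 1) * exp (- 1 * of_real t) * Lam N (c / of_real t))"
      by (auto intro!: continuous_intros continuous_on_of_real_powr Lam_scaled_continuous)
    obtain e d where d: "e > 0" "d > 0" "\<And>c' v. c' \<in> ball c e \<Longrightarrow> v > 0 \<Longrightarrow> norm (1 + c' * complex_of_real v) \<ge> d"
      using denominator_lower[OF c] by metis
    have "norm (of_real t powr (\<alpha> - of_nat N - 1) * exp (- 1 * of_real t) * Lam N (c' / of_real t)) \<le> t powr (Re \<alpha> - real N - 1) * exp (- 1 * t) * (Gamma (real N + 1 / 2) / d)"
      if c': "c' \<in> ball c e" "c' \<notin> \<real>\<^sub>\<le>\<^sub>0" and t: "t \<in> {0<..}" for c' t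
    proof -
      have tp: "t > 0" using t by simp
      have "norm (Lam N (c' / of_real t)) \<le> Gamma (real N + 1 / 2) / d"
        by (rule Lam_bound(2)[OF _ d(2)]) (use slit_scale(1)[OF c'(2) tp] lower_scale(2)[OF d(3)[OF c'(1)] tp] in auto)
      moreover have "norm (of_real t powr (\<alpha> - of_nat N - 1) * exp (- 1 * complex_of_real t)) = t powr (Re \<alpha> - real N - 1) * exp (- 1 * t)"
        using tp norm_of_real_powr[of t "\<alpha> - of_nat N - 1"] by (simp add: norm_mult)
      ultimately show ?thesis unfolding norm_mult[of "_ * _" "Lam _ _"] by (metis mult_left_mono norm_ge_zero)
    qed
    moreover have "set_integrable lborel {0<..} (\<lambda>t. t powr (Re \<alpha> - real N - 1) * exp (- 1 * t) * (Gamma (real N + 1 / 2) / d))"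
      by (intro set_integrable_mult_left set_integrable_powr_exp) (use \<alpha> in auto)
    ultimately show "\<exists>e>0. \<exists>h. set_integrable lborel {0<..} h \<and> (\<forall>c'\<in>ball c e \<inter> - \<real>\<^sub>\<le>\<^sub>0. \<forall>t\<in>{0<..}.
        norm (of_real t powr (\<alpha> - of_nat N - 1) * exp (- 1 * of_real t) * Lam N (c' / of_real t)) \<le> h t)"
      using d(1) by (intro exI[of _ e] conjI
          exI[of _ "\<lambda>t. t powr (Re \<alpha> - real N - 1) * exp (- 1 * t) * (Gamma (real N + 1 / 2) / d)"]) blast+
  next
    fix t :: real assume t: "t \<in> {0<..}"
    have "(Lam N \<circ> (\<lambda>c. c / of_real t)) holomorphic_on (- \<real>\<^sub>\<le>\<^sub>0)"
      by (rule holomorphic_on_compose_gen[OF _ Lam_holomorphic]) (use t slit_scale in \<open>auto intro!: holomorphic_intros\<close>)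
    thus "(\<lambda>c. of_real t powr (\<alpha> - of_nat N - 1) * exp (- 1 * of_real t) * Lam N (c / of_real t)) holomorphic_on (- \<real>\<^sub>\<le>\<^sub>0)"
      by (intro holomorphic_intros) (simp add: o_def)
  qed auto
  thus ?thesis by simp
qed

text \<open>The factor sin (\<pi> lam) / \<pi> normalises the Beta moments, 1 / sqrt \<pi> comes
  from \<open>gfun\<close>, (-4)^N from the geometric tail and w^N from
  \<open>Dh_Beta_integral\<close>. For real parameters and w > 0 the integrands of the three nested
  integrals, in x, t and v, are all positive.\<close>

definition remainder :: "complex \<Rightarrow> complex \<Rightarrow> nat \<Rightarrow> complex \<Rightarrow> complex" where
  "remainder \<alpha> lam N w = sin (of_real pi * lam) / of_real (pi * sqrt pi) * (- 4 * w) ^ N *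
     (LINT x:{0<..<1}|lborel. of_real x powr (lam + of_nat N - 1) * of_real (1 - x) powr (of_nat N + 1 - lam - 1) *
        Dh \<alpha> N (of_real (4 * x * (1 - x)) * w))"

lemma four_mult_complement_pos: "x \<in> {0<..<1} \<Longrightarrow> 4 * x * (1 - x) > (0::real)" by simp

lemma remainder_integrand_continuous:
  assumes \<alpha>: "Re \<alpha> > real N" and w: "w \<notin> \<real>\<^sub>\<le>\<^sub>0"
  shows "continuous_on {0<..<1} (\<lambda>x. of_real x powr (lam + of_nat N - 1) * of_real (1 - x) powr (of_nat N + 1 - lam - 1) *
        Dh \<alpha> N (of_real (4 * x * (1 - x)) * w))"
proof -
  have "continuous_on {0<..<1} (\<lambda>x::real. Dh \<alpha> N (of_real (4 * x * (1 - x)) * w))"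
    by (rule continuous_on_compose2[OF holomorphic_on_imp_continuous_on[OF Dh_holomorphic[OF \<alpha>]]])
       (use slit_scale(2)[OF w four_mult_complement_pos] in \<open>auto intro!: continuous_intros simp del: of_real_mult\<close>)
  thus ?thesis by (intro continuous_on_mult continuous_on_of_real_powr continuous_intros) auto
qed

lemma remainder_integrand_bound:
  assumes x: "x \<in> {0<..<1}" and K: "\<And>y. y > 0 \<Longrightarrow> norm (Dh \<alpha> N (of_real y * w)) \<le> K"
  shows "norm (of_real x powr (lam + of_nat N - 1) * of_real (1 - x) powr (of_nat N + 1 - lam - 1) *
        Dh \<alpha> N (of_real (4 * x * (1 - x)) * w)) \<le> x powr (Re lam + real N - 1) * (1 - x) powr (real N + 1 - Re lam - 1) * K"
  unfolding norm_mult using x norm_of_real_powr[of x] norm_of_real_powr[of "1 - x"] K[OF four_mult_complement_pos[OF x]]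
  by (intro mult_mono) auto

text \<open>Moduli under the integral replace lam by Re lam in the Beta weight but leave sin (\<pi>
  lam) outside untouched. This mismatch is the quotient of sines in the final estimate.\<close>

lemma remainder_bound:
  assumes \<alpha>: "Re \<alpha> > real N" and lam: "\<bar>Re lam - 1 / 2\<bar> < real N + 1 / 2" and w: "w \<notin> \<real>\<^sub>\<le>\<^sub>0"
    and K: "\<And>y. y > 0 \<Longrightarrow> norm (Dh \<alpha> N (of_real y * w)) \<le> K"
  shows "norm (remainder \<alpha> lam N w) \<le> norm (sin (of_real pi * lam)) / (pi * sqrt pi) * (4 * norm w) ^ N * (Beta (Re lam + real N) (real N + 1 - Re lam) * K)"
proof -
  let ?f = "\<lambda>x. of_real x powr (lam + of_nat N - 1) * of_real (1 - x) powr (of_nat N + 1 - lam - 1) * Dh \<alpha> N (of_real (4 * x * (1 - x)) * w)"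
  have p: "Re lam + real N > 0" "real N + 1 - Re lam > 0" using lam by (auto simp: abs_less_iff)
  have dom: "set_integrable lborel {0<..<1} (\<lambda>x. x powr (Re lam + real N - 1) * (1 - x) powr (real N + 1 - Re lam - 1) * K)"
    by (intro set_integrable_mult_left set_integrable_Beta p)
  have I: "set_integrable lborel {0<..<1} ?f"
    by (rule set_integrable_dominated[OF dom _ remainder_integrand_continuous[OF \<alpha> w] remainder_integrand_bound[OF _ K]]) auto
  have "norm (LINT x:{0<..<1}|lborel. ?f x) \<le> (LINT x:{0<..<1}|lborel. norm (?f x))" by (rule set_integral_norm_bound[OF I])
  also have "\<dots> \<le> (LINT x:{0<..<1}|lborel. x powr (Re lam + real N - 1) * (1 - x) powr (real N + 1 - Re lam - 1) * K)"
    by (rule set_integral_mono[OF set_integrable_norm[OF I] dom remainder_integrand_bound[OF _ K]])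
  also have "\<dots> = (LINT x:{0<..<1}|lborel. x powr (Re lam + real N - 1) * (1 - x) powr (real N + 1 - Re lam - 1)) * K"
    by simp
  also have "(LINT x:{0<..<1}|lborel. x powr (Re lam + real N - 1) * (1 - x) powr (real N + 1 - Re lam - 1)) = Beta (Re lam + real N) (real N + 1 - Re lam)"
    unfolding set_borel_integral_eq_integral(2)[OF set_integrable_Beta[OF p]]
    using integral_unique[OF has_integral_Beta_real[OF p]] by (simp add: integral_open_interval_real)
  finally have "norm (LINT x:{0<..<1}|lborel. ?f x) \<le> Beta (Re lam + real N) (real N + 1 - Re lam) * K" .
  hence "norm (sin (of_real pi * lam)) / (pi * sqrt pi) * (4 * norm w) ^ N * norm (LINT x:{0<..<1}|lborel. ?f x) \<le>
      norm (sin (of_real pi * lam)) / (pi * sqrt pi) * (4 * norm w) ^ N * (Beta (Re lam + real N) (real N + 1 - Re lam) * K)"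
    by (rule mult_left_mono) (auto intro!: mult_nonneg_nonneg divide_nonneg_nonneg)
  thus ?thesis unfolding remainder_def norm_mult[of _ "set_lebesgue_integral _ _ _"]
    by (simp add: norm_mult norm_divide norm_power)
qed

lemma remainder_holomorphic:
  assumes \<alpha>: "Re \<alpha> > real N" and lam: "\<bar>Re lam - 1 / 2\<bar> < real N + 1 / 2"
  shows "remainder \<alpha> lam N holomorphic_on (- \<real>\<^sub>\<le>\<^sub>0)"
proof -
  let ?f = "\<lambda>w x. of_real x powr (lam + of_nat N - 1) * of_real (1 - x) powr (of_nat N + 1 - lam - 1) * Dh \<alpha> N (of_real (4 * x * (1 - x)) * w)"
  have p: "Re lam + real N > 0" "real N + 1 - Re lam > 0" using lam by (auto simp: abs_less_iff)
  have "(\<lambda>w. LINT x:{0<..<1}|lborel. ?f w x) holomorphic_on (- \<real>\<^sub>\<le>\<^sub>0)"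
  proof (rule holomorphic_on_set_integral[OF open_slit])
    fix w :: complex assume "w \<in> - \<real>\<^sub>\<le>\<^sub>0"
    hence w: "w \<notin> \<real>\<^sub>\<le>\<^sub>0" by simp
    show "continuous_on {0<..<1} (?f w)" by (rule remainder_integrand_continuous[OF \<alpha> w])
    obtain e d where d: "e > 0" "d > 0" "\<And>c' v. c' \<in> ball w e \<Longrightarrow> v > 0 \<Longrightarrow> norm (1 + c' * complex_of_real v) \<ge> d"
      using denominator_lower[OF w] by metis
    define K where "K = Gamma (Re \<alpha> - real N) * (Gamma (real N + 1 / 2) / d)"
    have K: "norm (Dh \<alpha> N (of_real y * w')) \<le> K" if w': "w' \<in> ball w e" "w' \<notin> \<real>\<^sub>\<le>\<^sub>0" and y: "y > 0" for w' y
      unfolding K_def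
    proof (rule Dh_bound(2)[OF _ \<alpha>])
      show "of_real y * w' \<notin> \<real>\<^sub>\<le>\<^sub>0 \<or> of_real y * w' = 0" using slit_scale(2)[OF w'(2) y] by simp
      fix t :: real assume t: "t > 0"
      have e: "of_real y * w' / of_real t = of_real (y / t) * w'" by simp
      have yt: "y / t > 0" using y t by simp
      show "norm (Lam N (of_real y * w' / of_real t)) \<le> Gamma (real N + 1 / 2) / d"
        unfolding e by (rule Lam_bound(2)[OF _ d(2)])
          (use slit_scale(2)[OF w'(2) yt] lower_scale(1)[OF d(3)[OF w'(1)] yt] in auto)
    qed
    have "set_integrable lborel {0<..<1} (\<lambda>x. x powr (Re lam + real N - 1) * (1 - x) powr (real N + 1 - Re lam - 1) * K)"
      by (intro set_integrable_mult_left set_integrable_Beta p)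
    moreover have "\<forall>w'\<in>ball w e \<inter> - \<real>\<^sub>\<le>\<^sub>0. \<forall>x\<in>{0<..<1}. norm (?f w' x) \<le> x powr (Re lam + real N - 1) * (1 - x) powr (real N + 1 - Re lam - 1) * K"
      by (intro ballI remainder_integrand_bound K) auto
    ultimately show "\<exists>e>0. \<exists>h. set_integrable lborel {0<..<1} h \<and> (\<forall>w'\<in>ball w e \<inter> - \<real>\<^sub>\<le>\<^sub>0. \<forall>x\<in>{0<..<1}. norm (?f w' x) \<le> h x)"
      using d(1) by blast
  next
    fix x :: real assume x: "x \<in> {0<..<1}"
    have "(Dh \<alpha> N \<circ> (\<lambda>w. of_real (4 * x * (1 - x)) * w)) holomorphic_on (- \<real>\<^sub>\<le>\<^sub>0)"
      by (rule holomorphic_on_compose_gen[OF _ Dh_holomorphic[OF \<alpha>]])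
         (use slit_scale(2)[OF _ four_mult_complement_pos[OF x]] in \<open>auto intro!: holomorphic_intros simp del: of_real_mult\<close>)
    thus "(\<lambda>w. ?f w x) holomorphic_on (- \<real>\<^sub>\<le>\<^sub>0)" by (intro holomorphic_on_mult holomorphic_on_const) (simp add: o_def)
  qed auto
  thus ?thesis unfolding remainder_def[abs_def] by (intro holomorphic_intros) auto
qed

text \<open>Both (2n)! and \<Gamma>(n + 1/2) contain the Pochhammer symbol of 1/2, which
  cancels.\<close>

lemma kcoef_acoef:
  "kcoef n lam * of_real (Gamma (real n + 1 / 2)) = of_real (sqrt pi) * 2 ^ n * acoef n (lam - 1 / 2)"
proof -
  define P where "P = pochhammer (1 / 2 :: real) n"
  have P: "P > 0" unfolding P_def by (rule pochhammer_pos) simp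
  have half: "(1 / 2 :: real) \<notin> \<int>\<^sub>\<le>\<^sub>0" by (auto elim!: nonpos_Ints_cases)
  have G: "Gamma (real n + 1 / 2) = sqrt pi * P"
    using pochhammer_Gamma[OF half, of n] by (simp add: P_def Gamma_one_half_real add.commute)
  have "pochhammer (1 / 2 :: complex) n = of_real P"
    unfolding P_def using pochhammer_of_real[of "1 / 2" n, where ?'a = complex] by simp
  hence F: "(fact (2 * n) :: complex) = 4 ^ n * of_real P * fact n" using fact_double[of n, where ?'a = complex] by (simp add: power_mult)
  have m: "(- 4 :: complex) ^ n = (- 1) ^ n * 4 ^ n" by (simp flip: power_mult_distrib)
  show ?thesis unfolding kcoef_def acoef_pochhammer G F m of_real_mult using P by simp
qed

lemma Dh_zero:
  assumes "Re \<alpha> > real N"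
  shows "Dh \<alpha> N 0 = Gamma (\<alpha> - of_nat N) * of_real (Gamma (real N + 1 / 2))"
proof -
  have L: "Lam N 0 = of_real (Gamma (real N + 1 / 2))"
  proof -
    have "Lam N 0 = (LINT v:{0<..}|lborel. complex_of_real (v powr (real N + 1 / 2 - 1) * exp (- 1 * v)))"
      unfolding Lam_def by simp
    also have "\<dots> = of_real (LINT v:{0<..}|lborel. v powr (real N + 1 / 2 - 1) * exp (- 1 * v))"
      by (rule set_integral_complex_of_real)
    finally show ?thesis using Gamma_real_set_integral[of "real N + 1 / 2" 1] by simp
  qed
  have "Dh \<alpha> N 0 = (LINT t:{0<..}|lborel. of_real t powr (\<alpha> - of_nat N - 1) * exp (- 1 * of_real t)) * of_real (Gamma (real N + 1 / 2))"
    unfolding Dh_def L[symmetric] by simp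
  also have "(LINT t:{0<..}|lborel. of_real t powr (\<alpha> - of_nat N - 1) * exp (- 1 * complex_of_real t)) = Gamma (\<alpha> - of_nat N) * 1 powr (- (\<alpha> - of_nat N))"
    by (rule Gamma_set_integral) (use assms in auto)
  finally show ?thesis by simp
qed

text \<open>(w + s) powr (-\<kappa>) is replaced by its Gamma integral in t and the order of
  integration is exchanged. With v = t s the inner integral becomes \<open>Lam\<close> at y/t, and
  scaling t by w moves w into the argument.\<close>

lemma Dh_Beta_integral:
  fixes w y :: real and \<alpha> :: complex and n :: nat
  assumes w: "w > 0" and y: "y \<ge> 0" and \<alpha>: "Re \<alpha> > real n"
  defines "\<kappa> \<equiv> \<alpha> + 1 / 2"
  shows "set_integrable lborel {0<..} (\<lambda>s. of_real (w + s) powr (- \<kappa>) * complex_of_real (s powr (real n + 1 / 2 - 1) * (1 / (1 + y * s))))"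
    and "Gamma \<kappa> * of_real w powr \<alpha> * (LINT s:{0<..}|lborel. of_real (w + s) powr (- \<kappa>) * complex_of_real (s powr (real n + 1 / 2 - 1) * (1 / (1 + y * s)))) =
       of_real w ^ n * Dh \<alpha> n (of_real (y * w))"
proof -
  define p where "p = real n + 1 / 2"
  have p: "p > 0" by (simp add: p_def)
  have \<kappa>: "Re \<kappa> > 0" "Gamma \<kappa> \<noteq> 0"
  proof -
    show "Re \<kappa> > 0" using \<alpha> by (simp add: \<kappa>_def)
    thus "Gamma \<kappa> \<noteq> 0" using nonpos_Ints_Re_pos[of \<kappa>] by (simp add: Gamma_eq_zero_iff)
  qed
  define f where "f = (\<lambda>t s. complex_of_real t powr (\<kappa> - 1) * exp (- of_real (w + s) * of_real t) * of_real (s powr (p - 1) * (1 / (1 + y * s))))"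
  have den: "1 + y * s \<ge> 1" "\<bar>1 / (1 + y * s)\<bar> \<le> 1" if "s > 0" for s
  proof -
    show "1 + y * s \<ge> 1" using that y by simp
    thus "\<bar>1 / (1 + y * s)\<bar> \<le> 1" by simp
  qed
  have den0: "1 + y * s \<noteq> 0" if "s > 0" for s using den(1)[OF that] by (metis not_one_le_zero)
  have cont: "continuous_on ({0<..} \<times> {0<..}) (\<lambda>(t,s). f t s)"
    unfolding f_def case_prod_beta
    by (intro continuous_on_mult continuous_on_of_real_powr continuous_intros) (use den0 in force)+
  have contS: "continuous_on {0<..} (\<lambda>s. f t s)" for t unfolding f_def
    by (intro continuous_on_mult continuous_on_of_real_powr continuous_intros) (use den0 in force)+
  have nf: "norm (f t s) \<le> t powr (Re \<kappa> - 1) * exp (- w * t) * (s powr (p - 1) * exp (- t * s))" if "t > 0" "s > 0" for t s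
  proof -
    have "norm (f t s) = t powr (Re \<kappa> - 1) * exp (- (w + s) * t) * (s powr (p - 1) * \<bar>1 / (1 + y * s)\<bar>)"
      unfolding f_def norm_mult norm_of_real abs_mult using that norm_of_real_powr[of t "\<kappa> - 1"] by simp
    also have "\<dots> \<le> t powr (Re \<kappa> - 1) * exp (- (w + s) * t) * (s powr (p - 1) * 1)"
      using den(2)[OF that(2)] by (intro mult_left_mono) auto
    also have "exp (- (w + s) * t) = exp (- w * t) * exp (- t * s)" unfolding exp_add[symmetric] by (simp add: algebra_simps)
    finally show ?thesis by (simp add: mult_ac)
  qed
  have domS: "set_integrable lborel {0<..} (\<lambda>s. t powr (Re \<kappa> - 1) * exp (- w * t) * (s powr (p - 1) * exp (- t * s)))" if "t > 0" for t
    by (intro set_integrable_mult_right set_integrable_powr_exp p that)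
  have intS: "set_integrable lborel {0<..} (f t)" if "t \<in> {0<..}" for t
    by (rule set_integrable_dominated[OF domS _ contS nf]) (use that in auto)
  \<comment> \<open>Integrating the bound over s costs t powr (-p), which lowers the exponent from
    Re \<kappa> - 1 to Re \<alpha> - n - 1; integrability at t = 0 then rests on Re \<alpha> >
    n.\<close>
  have bdS: "(LINT s:{0<..}|lborel. norm (f t s)) \<le> Gamma p * (t powr (Re \<alpha> - real n - 1) * exp (- w * t))" if t: "t \<in> {0<..}" for t
  proof -
    have tp: "t > 0" using t by simp
    have "(LINT s:{0<..}|lborel. norm (f t s)) \<le> (LINT s:{0<..}|lborel. t powr (Re \<kappa> - 1) * exp (- w * t) * (s powr (p - 1) * exp (- t * s)))"
      by (rule set_integral_mono[OF set_integrable_norm[OF intS[OF t]] domS[OF tp] nf[OF tp]]) simp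
    also have "\<dots> = t powr (Re \<kappa> - 1) * exp (- w * t) * (Gamma p * t powr (- p))"
      using Gamma_real_set_integral[OF p tp] by simp
    also have "t powr (Re \<kappa> - 1) * exp (- w * t) * (Gamma p * t powr (- p)) = Gamma p * ((t powr (Re \<kappa> - 1) * t powr (- p)) * exp (- w * t))" by simp
    also have "t powr (Re \<kappa> - 1) * t powr (- p) = t powr (Re \<alpha> - real n - 1)"
      unfolding powr_add[symmetric] by (simp add: \<kappa>_def p_def)
    finally show ?thesis .
  qed
  have gI: "set_integrable lborel {0<..} (\<lambda>t. Gamma p * (t powr (Re \<alpha> - real n - 1) * exp (- w * t)))"
    by (intro set_integrable_mult_right set_integrable_powr_exp) (use \<alpha> w in auto)
  note fub = set_integral_Fubini_bound[OF _ _ cont intS bdS gI]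
  have inner: "(LINT t:{0<..}|lborel. f t s) = Gamma \<kappa> * (of_real (w + s) powr (- \<kappa>) * complex_of_real (s powr (p - 1) * (1 / (1 + y * s))))" if "s \<in> {0<..}" for s
  proof -
    have "(LINT t:{0<..}|lborel. f t s) = (LINT t:{0<..}|lborel. complex_of_real t powr (\<kappa> - 1) * exp (- of_real (w + s) * of_real t)) * of_real (s powr (p - 1) * (1 / (1 + y * s)))"
      unfolding f_def by (rule set_integral_mult_left)
    also have "(LINT t:{0<..}|lborel. complex_of_real t powr (\<kappa> - 1) * exp (- of_real (w + s) * of_real t)) = Gamma \<kappa> * of_real (w + s) powr (- \<kappa>)"
      by (rule Gamma_set_integral) (use that w \<kappa> in auto)
    finally show ?thesis by (simp only: mult.assoc)
  qed
  have "set_integrable lborel {0<..} (\<lambda>s. LINT t:{0<..}|lborel. f t s)" by (rule fub(2)) auto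
  hence "set_integrable lborel {0<..} (\<lambda>s. Gamma \<kappa> * (of_real (w + s) powr (- \<kappa>) * complex_of_real (s powr (p - 1) * (1 / (1 + y * s)))))"
    by (rule set_integrable_cong[THEN iffD1, rotated -1]) (use inner in auto)
  thus "set_integrable lborel {0<..} (\<lambda>s. of_real (w + s) powr (- \<kappa>) * complex_of_real (s powr (real n + 1 / 2 - 1) * (1 / (1 + y * s))))"
    unfolding p_def using \<kappa>(2) by (simp only: set_integrable_mult_right_iff not_False_eq_True simp_thms)
  have yc: "complex_of_real (y * c) \<notin> \<real>\<^sub>\<le>\<^sub>0 \<or> complex_of_real (y * c) = 0" if "c > 0" for c
    using y that by (auto simp: complex_nonpos_Reals_iff mult_le_0_iff)
  have other: "(LINT s:{0<..}|lborel. f t s) = of_real t powr (\<alpha> - of_nat n - 1) * exp (- of_real w * of_real t) * Lam n (of_real y / of_real t)" if t: "t \<in> {0<..}" for t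
  proof -
    have tp: "t > 0" using t by simp
    have yt: "complex_of_real y / of_real t \<notin> \<real>\<^sub>\<le>\<^sub>0 \<or> complex_of_real y / of_real t = 0"
      using yc[of "1 / t"] tp by simp
    have "Lam n (of_real y / of_real t) = (LINT s:{0<..}|lborel. of_real t * (of_real ((t * s) powr (real n + 1 / 2 - 1) * exp (- 1 * (t * s))) * (1 / (1 + of_real y / of_real t * of_real (t * s)))))"
      unfolding Lam_def by (rule set_integral_scale[OF tp Lam_continuous_integrand[OF yt]])
    also have "\<dots> = (LINT s:{0<..}|lborel. of_real (t powr p) * of_real (exp (- t * s) * (s powr (p - 1) * (1 / (1 + y * s)))))"
    proof (intro set_lebesgue_integral_cong allI impI)
      fix s :: real assume s: "s \<in> {0<..}"
      have re: "t * ((t * s) powr (p - 1) * exp (- 1 * (t * s)) * (1 / (1 + y * s))) = t powr p * (exp (- t * s) * (s powr (p - 1) * (1 / (1 + y * s))))"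
      proof -
        have "t powr p = t * t powr (p - 1)" using tp powr_add[of t 1 "p - 1"] by simp
        thus ?thesis using tp s by (simp add: powr_mult mult_ac)
      qed
      have de: "1 + of_real y / of_real t * complex_of_real (t * s) = of_real (1 + y * s)" using tp by simp
      have "of_real t * (of_real ((t * s) powr (p - 1) * exp (- 1 * (t * s))) * (1 / complex_of_real (1 + y * s))) =
          of_real (t * ((t * s) powr (p - 1) * exp (- 1 * (t * s)) * (1 / (1 + y * s))))"
        by (simp only: of_real_mult of_real_divide of_real_1)
      also have "\<dots> = complex_of_real (t powr p) * of_real (exp (- t * s) * (s powr (p - 1) * (1 / (1 + y * s))))"
        unfolding re by (rule of_real_mult)
      finally show "of_real t * (of_real ((t * s) powr (real n + 1 / 2 - 1) * exp (- 1 * (t * s))) * (1 / (1 + of_real y / of_real t * complex_of_real (t * s)))) =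
         complex_of_real (t powr p) * of_real (exp (- t * s) * (s powr (p - 1) * (1 / (1 + y * s))))"
        unfolding p_def[symmetric] de .
    qed auto
    also have "\<dots> = of_real (t powr p) * (LINT s:{0<..}|lborel. of_real (exp (- t * s) * (s powr (p - 1) * (1 / (1 + y * s)))))"
      by (rule set_integral_mult_right)
    finally have L: "Lam n (of_real y / of_real t) = of_real (t powr p) * (LINT s:{0<..}|lborel. of_real (exp (- t * s) * (s powr (p - 1) * (1 / (1 + y * s)))))" .
    have "(LINT s:{0<..}|lborel. f t s) = (LINT s:{0<..}|lborel. (of_real t powr (\<kappa> - 1) * exp (- of_real w * of_real t)) * of_real (exp (- t * s) * (s powr (p - 1) * (1 / (1 + y * s)))))"
    proof (intro set_lebesgue_integral_cong allI impI)
      fix s :: real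
      have "exp (- complex_of_real (w + s) * of_real t) = exp (- of_real w * of_real t) * of_real (exp (- t * s))"
        unfolding exp_of_real[symmetric] exp_add[symmetric] by (simp add: algebra_simps)
      thus "f t s = (of_real t powr (\<kappa> - 1) * exp (- of_real w * of_real t)) * of_real (exp (- t * s) * (s powr (p - 1) * (1 / (1 + y * s))))"
        unfolding f_def by (simp only: of_real_mult mult.assoc)
    qed auto
    also have "\<dots> = (of_real t powr (\<kappa> - 1) * exp (- of_real w * of_real t)) * (LINT s:{0<..}|lborel. of_real (exp (- t * s) * (s powr (p - 1) * (1 / (1 + y * s)))))"
      by (rule set_integral_mult_right)
    also have "of_real t powr (\<kappa> - 1) = complex_of_real t powr (\<alpha> - of_nat n - 1) * of_real (t powr p)"
    proof -
      have "complex_of_real (t powr p) = of_real t powr of_real p" using tp by (simp add: powr_of_real)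
      moreover have "\<kappa> - 1 = (\<alpha> - of_nat n - 1) + of_real p" by (simp add: \<kappa>_def p_def)
      ultimately show ?thesis by (simp only: powr_add)
    qed
    finally show ?thesis unfolding L by (simp only: mult_ac)
  qed
  have "Dh \<alpha> n (of_real (y * w)) = (LINT t:{0<..}|lborel. of_real w * (of_real (w * t) powr (\<alpha> - of_nat n - 1) * exp (- 1 * of_real (w * t)) * Lam n (of_real (y * w) / of_real (w * t))))"
    unfolding Dh_def
    by (rule set_integral_scale[OF w])
       (intro continuous_on_mult continuous_on_of_real_powr continuous_intros Lam_scaled_continuous yc w, auto)
  also have "\<dots> = (LINT t:{0<..}|lborel. of_real w powr (\<alpha> - of_nat n) * (of_real t powr (\<alpha> - of_nat n - 1) * exp (- of_real w * of_real t) * Lam n (of_real y / of_real t)))"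
  proof (intro set_lebesgue_integral_cong allI impI)
    fix t :: real assume t: "t \<in> {0<..}"
    have a: "complex_of_real (w * t) powr (\<alpha> - of_nat n - 1) = of_real w powr (\<alpha> - of_nat n - 1) * of_real t powr (\<alpha> - of_nat n - 1)"
      using powr_of_real_mult[of w "of_real t"] w t by simp
    have b: "complex_of_real w powr (\<alpha> - of_nat n) = of_real w * of_real w powr (\<alpha> - of_nat n - 1)"
      using powr_add[of "of_real w" 1 "\<alpha> - of_nat n - 1"] w by simp
    have c: "complex_of_real (y * w) / of_real (w * t) = of_real y / of_real t" using w t by simp
    have d: "- 1 * complex_of_real (w * t) = - of_real w * of_real t" by simp
    show "of_real w * (of_real (w * t) powr (\<alpha> - of_nat n - 1) * exp (- 1 * of_real (w * t)) * Lam n (of_real (y * w) / of_real (w * t))) =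
       of_real w powr (\<alpha> - of_nat n) * (of_real t powr (\<alpha> - of_nat n - 1) * exp (- of_real w * of_real t) * Lam n (of_real y / of_real t))"
      unfolding a b c d by (simp only: mult_ac)
  qed auto
  also have "\<dots> = of_real w powr (\<alpha> - of_nat n) * (LINT t:{0<..}|lborel. of_real t powr (\<alpha> - of_nat n - 1) * exp (- of_real w * of_real t) * Lam n (of_real y / of_real t))"
    by (rule set_integral_mult_right)
  also have "(LINT t:{0<..}|lborel. of_real t powr (\<alpha> - of_nat n - 1) * exp (- of_real w * of_real t) * Lam n (of_real y / of_real t)) = (LINT t:{0<..}|lborel. LINT s:{0<..}|lborel. f t s)"
    by (intro set_lebesgue_integral_cong allI impI other[symmetric]) auto
  also have "\<dots> = (LINT s:{0<..}|lborel. LINT t:{0<..}|lborel. f t s)" by (rule fub(1)) auto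
  also have "\<dots> = (LINT s:{0<..}|lborel. Gamma \<kappa> * (of_real (w + s) powr (- \<kappa>) * complex_of_real (s powr (p - 1) * (1 / (1 + y * s)))))"
    by (intro set_lebesgue_integral_cong allI impI inner) auto
  also have "\<dots> = Gamma \<kappa> * (LINT s:{0<..}|lborel. of_real (w + s) powr (- \<kappa>) * complex_of_real (s powr (p - 1) * (1 / (1 + y * s))))"
    by (rule set_integral_mult_right)
  finally have D: "Dh \<alpha> n (of_real (y * w)) = of_real w powr (\<alpha> - of_nat n) * (Gamma \<kappa> * (LINT s:{0<..}|lborel. of_real (w + s) powr (- \<kappa>) * complex_of_real (s powr (p - 1) * (1 / (1 + y * s)))))" .
  have wn: "complex_of_real w powr \<alpha> = of_real w ^ n * of_real w powr (\<alpha> - of_nat n)"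
    using powr_add[of "of_real w" "of_nat n" "\<alpha> - of_nat n"] w by (simp add: powr_nat')
  show "Gamma \<kappa> * of_real w powr \<alpha> * (LINT s:{0<..}|lborel. of_real (w + s) powr (- \<kappa>) * complex_of_real (s powr (real n + 1 / 2 - 1) * (1 / (1 + y * s)))) =
       of_real w ^ n * Dh \<alpha> n (of_real (y * w))"
    unfolding D wn p_def by (simp only: mult_ac)
qed

section \<open>The expansion of \<open>gfun\<close>, on the positive axis and in the slit
  plane\<close>

lemma integral_fold:
  fixes F :: "real \<Rightarrow> complex"
  assumes F: "integrable lborel F"
  shows "(LINT x|lborel. F x) = (LINT x:{0<..}|lborel. F x + F (- x))"
    and "set_integrable lborel {0<..} (\<lambda>x. F x + F (- x))"
proof -
  have F': "integrable lborel (\<lambda>x. F (- x))"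
    using lborel_integrable_real_affine[OF F, of "-1" 0] by simp
  have i1: "integrable lborel (\<lambda>x. indicator {0<..} x *\<^sub>R F x)" "integrable lborel (\<lambda>x. indicator {0<..} x *\<^sub>R F (- x))"
    "integrable lborel (\<lambda>x. indicator {..<0} x *\<^sub>R F x)"
    using F F' by (auto intro!: integrable_mult_indicator)
  show "set_integrable lborel {0<..} (\<lambda>x. F x + F (- x))"
    unfolding set_integrable_def scaleR_add_right by (intro Bochner_Integration.integrable_add i1)
  have "(LINT x|lborel. F x) = (LINT x|lborel. indicator {0<..} x *\<^sub>R F x + indicator {..<0} x *\<^sub>R F x)"
  proof (rule integral_cong_AE)
    have "AE x in lborel. x \<noteq> (0::real)" by (rule AE_lborel_singleton)
    thus "AE x in lborel. F x = indicator {0<..} x *\<^sub>R F x + indicator {..<0} x *\<^sub>R F x"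
      by eventually_elim (auto simp: indicator_def)
  qed (use F i1 in auto)
  also have "\<dots> = (LINT x|lborel. indicator {0<..} x *\<^sub>R F x) + (LINT x|lborel. indicator {..<0} x *\<^sub>R F x)"
    by (rule Bochner_Integration.integral_add[OF i1(1) i1(3)])
  also have "(LINT x|lborel. indicator {..<0} x *\<^sub>R F x) = (LINT x|lborel. indicator {0<..} x *\<^sub>R F (- x))"
    using lborel_integral_real_affine[of "-1" "\<lambda>x. indicator {..<0} x *\<^sub>R F x" 0] by (simp add: indicator_def)
  finally show "(LINT x|lborel. F x) = (LINT x:{0<..}|lborel. F x + F (- x))"
    unfolding set_lebesgue_integral_def scaleR_add_right using i1 by simp
qed

text \<open>Folding the real line onto its positive half turns exp (-\<mu> \<eta>) into 2 cosh
  (\<mu> \<eta>). With s = sinh^2 (\<eta>/2) one has d\<eta> = ds / (sqrt s cosh (\<eta>/2)), which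
  yields exactly the quotient that \<open>cosh_expansion\<close> expands.\<close>

lemma legint_substitution:
  fixes w :: real
  assumes w: "w > 0" and k: "\<bar>Re \<mu>\<bar> < Re \<kappa>"
  shows "legint \<kappa> \<mu> (of_real w) = (LINT s:{0<..}|lborel. 2 * (of_real (w + s) powr (- \<kappa>) *
      (of_real (s powr (- 1 / 2)) * (cosh (\<mu> * of_real (2 * arsinh (sqrt s))) / of_real (cosh (2 * arsinh (sqrt s) / 2))))))"
proof -
  define F where "F = (\<lambda>\<eta>. (of_real w + complex_of_real ((sinh (\<eta> / 2))\<^sup>2)) powr (- \<kappa>) * exp (- \<mu> * of_real \<eta>))"
  have wn: "complex_of_real w \<notin> \<real>\<^sub>\<le>\<^sub>0" using w by simp
  have I: "integrable lborel F" unfolding F_def by (rule legint_integrable[OF wn k])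
  define g where "g = (\<lambda>s. 2 * arsinh (sqrt s))"
  define h where "h = (\<lambda>s. 1 / (sqrt s * sqrt (1 + s)))"
  define f where "f = (\<lambda>\<eta>. F \<eta> + F (- \<eta>))"
  have sh: "sinh (g s / 2) = sqrt s" for s by (simp add: g_def)
  have ch: "cosh (g s / 2) = sqrt (1 + s)" if "s > 0" for s
    using cosh_square_eq[of "g s / 2"] that unfolding sh by (metis cosh_real_nonneg less_imp_le real_sqrt_pow2 real_sqrt_unique add.commute)
  have "legint \<kappa> \<mu> (of_real w) = (LINT \<eta>|lborel. F \<eta>)" by (simp add: legint_def F_def)
  also have "\<dots> = (LINT \<eta>:{0<..}|lborel. f \<eta>)" unfolding f_def by (rule integral_fold[OF I])
  also have "\<dots> = (LINT s:{0<..}|lborel. 2 * (of_real (w + s) powr (- \<kappa>) *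
      (of_real (s powr (- 1 / 2)) * (cosh (\<mu> * of_real (g s)) / of_real (cosh (g s / 2))))))"
  proof (rule set_integral_substitution(2)[where g = g and h = h])
    show "g ` {0<..} = {0<..}"
    proof (intro equalityI subsetI)
      fix x assume "x \<in> g ` {0<..}" thus "x \<in> {0<..}" by (auto simp: g_def)
    next
      fix x :: real assume x: "x \<in> {0<..}"
      have "sqrt ((sinh (x / 2))\<^sup>2) = sinh (x / 2)" using x by simp
      hence "x = g ((sinh (x / 2))\<^sup>2)" unfolding g_def by (simp only: arsinh_sinh_real)
      moreover have "(sinh (x / 2))\<^sup>2 \<in> {0<..}" using x by simp
      ultimately show "x \<in> g ` {0<..}" by blast
    qed
    show "inj_on g {0<..}" by (rule inj_onI) (metis sh real_sqrt_eq_iff)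
    show "(g has_field_derivative h s) (at s)" if "s \<in> {0<..}" for s
    proof -
      have "((\<lambda>s. arsinh (sqrt s)) has_field_derivative (1 / sqrt ((sqrt s)\<^sup>2 + 1)) * (inverse (sqrt s) / 2)) (at s)"
        using that by (intro DERIV_chain2[OF arsinh_real_has_field_derivative] DERIV_real_sqrt) auto
      hence "(g has_field_derivative 2 * ((1 / sqrt ((sqrt s)\<^sup>2 + 1)) * (inverse (sqrt s) / 2))) (at s)"
        unfolding g_def by (rule DERIV_cmult)
      moreover have "2 * ((1 / sqrt ((sqrt s)\<^sup>2 + 1)) * (inverse (sqrt s) / 2)) = h s"
        using that by (simp add: h_def field_simps add.commute)
      ultimately show ?thesis by simp
    qed
    have "continuous_on {0<..} (\<lambda>\<eta>. F \<eta>)" "continuous_on {0<..} (\<lambda>\<eta>. F (- \<eta>))"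
    proof -
      show "continuous_on {0<..} F" unfolding F_def by (rule continuous_legint_integrand[OF wn])
      have "continuous_on UNIV F" unfolding F_def by (rule continuous_legint_integrand[OF wn])
      thus "continuous_on {0<..} (\<lambda>\<eta>. F (- \<eta>))" by (rule continuous_on_compose2) (auto intro!: continuous_intros)
    qed
    thus "continuous_on {0<..} f" unfolding f_def by (rule continuous_on_add)
    show "continuous_on {0<..} h" unfolding h_def by (intro continuous_intros) auto
    fix s :: real assume "s \<in> {0<..}"
    hence s: "s > 0" by simp
    have hs: "\<bar>h s\<bar> = s powr (- 1 / 2) * (1 / cosh (g s / 2))"
    proof -
      have "s powr (- 1 / 2) = s powr (- (1 / 2))" by simp
      also have "\<dots> = inverse (s powr (1 / 2))" by (rule powr_minus)
      also have "s powr (1 / 2) = sqrt s" using s by (simp add: powr_half_sqrt)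
      finally have p: "s powr (- 1 / 2) = inverse (sqrt s)" .
      have "h s \<ge> 0" using s by (simp add: h_def)
      hence "\<bar>h s\<bar> = h s" by (rule abs_of_nonneg)
      thus ?thesis unfolding p ch[OF s] h_def by (simp only: divide_inverse inverse_mult_distrib mult_1 mult_1_right)
    qed
    have "f (g s) = of_real (w + s) powr (- \<kappa>) * (exp (- \<mu> * of_real (g s)) + exp (\<mu> * of_real (g s)))"
    proof -
      have q: "(sinh (g s / 2))\<^sup>2 = s" using s unfolding sh by simp
      have e: "- g s / 2 = - (g s / 2)" by simp
      have q': "(sinh (- g s / 2))\<^sup>2 = s" unfolding e sinh_minus power2_minus by (rule q)
      show ?thesis unfolding f_def F_def q q' of_real_add by (simp add: distrib_left)
    qed
    also have "\<dots> = of_real (w + s) powr (- \<kappa>) * (2 * cosh (\<mu> * of_real (g s)))" by (simp add: cosh_field_def add.commute)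
    finally show "2 * (of_real (w + s) powr (- \<kappa>) * (of_real (s powr (- 1 / 2)) * (cosh (\<mu> * of_real (g s)) / of_real (cosh (g s / 2))))) = of_real \<bar>h s\<bar> * f (g s)"
      unfolding hs by simp
  qed auto
  finally show ?thesis unfolding g_def .
qed

text \<open>\<open>cosh_expansion\<close> is inserted under the integral. Up to powers of w,
  \<open>T n 0\<close> integrates to \<Gamma>(\<alpha> - n) \<Gamma>(n + 1/2); in the tail the
  weight variable x is moved outside and leaves \<open>T N (4 * x * (1 - x))\<close>. Real w > 0 is
  the range of \<open>Dh_Beta_integral\<close>, and other w are reached by continuation.\<close>

lemma gfun_expansion_pos:
  fixes w :: real
  assumes w: "w > 0" and \<alpha>: "Re \<alpha> > real N" and lam: "\<bar>Re lam - 1 / 2\<bar> < real N + 1 / 2"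
  shows "gfun \<alpha> lam (of_real w) = (\<Sum>n<N. acoef n (lam - 1 / 2) * Gamma (\<alpha> - of_nat n) * (2 * of_real w) ^ n) + remainder \<alpha> lam N (of_real w)"
proof -
  define \<kappa> where "\<kappa> = \<alpha> + 1 / 2"
  define \<mu> where "\<mu> = lam - 1 / 2"
  have k: "\<bar>Re \<mu>\<bar> < Re \<kappa>" using \<alpha> lam by (simp add: \<mu>_def \<kappa>_def)
  define q where "q = sin (of_real pi * lam) / complex_of_real pi"
  define W where "W = (\<lambda>s. complex_of_real (w + s) powr (- \<kappa>))"
  define T where "T = (\<lambda>n y s. W s * complex_of_real (s powr (real n + 1 / 2 - 1) * (1 / (1 + y * s))))"
  define c where "c = Gamma \<kappa> * of_real w powr \<alpha>"
  have TI: "set_integrable lborel {0<..} (T n y)" and TV: "c * (LINT s:{0<..}|lborel. T n y s) = of_real w ^ n * Dh \<alpha> n (of_real (y * w))"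
    if "y \<ge> 0" "n \<le> N" for n y
  proof -
    have "Re \<alpha> > real n" using \<alpha> that by (meson of_nat_le_iff order.strict_trans1)
    from Dh_Beta_integral[OF w that(1) this]
    show "set_integrable lborel {0<..} (T n y)" "c * (LINT s:{0<..}|lborel. T n y s) = of_real w ^ n * Dh \<alpha> n (of_real (y * w))"
      unfolding T_def W_def c_def \<kappa>_def by simp_all
  qed
  define R where "R = (\<lambda>s. T N 0 s * Jint N lam s)"
  define B where "B = (\<lambda>x. complex_of_real x powr (lam + of_nat N - 1) * of_real (1 - x) powr (of_nat N + 1 - lam - 1))"
  define f where "f = (\<lambda>s x. T N 0 s * (B x * complex_of_real (1 / (1 + 4 * x * (1 - x) * s))))"
  have Rf: "R s = (LINT x:{0<..<1}|lborel. f s x)" for s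
    unfolding R_def f_def Jint_def B_def by (rule set_integral_mult_right[symmetric])
  have p: "Re lam + real N > 0" "real N + 1 - Re lam > 0" using lam by (auto simp: abs_less_iff)
  have fcont: "continuous_on ({0<..} \<times> {0<..<1}) (\<lambda>(s,x). f s x)"
  proof -
    have nz: "1 + 4 * x * (1 - x) * s \<noteq> 0" if "s > 0" "0 < x" "x < 1" for s x :: real
      using Jint_integrand_bound(1)[of x s] that by (metis greaterThanLessThan_iff less_imp_le not_one_le_zero)
    show ?thesis unfolding f_def T_def W_def B_def case_prod_beta
      by (intro continuous_on_mult continuous_on_of_real_powr continuous_intros) (use nz w in auto)
  qed
  have fbd: "norm (f s x) \<le> norm (T N 0 s) * (x powr (Re lam + real N - 1) * (1 - x) powr (real N + 1 - Re lam - 1))" if "s \<in> {0<..}" and x: "x \<in> {0<..<1}" for s x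
  proof -
    have "norm (B x * complex_of_real (1 / (1 + 4 * x * (1 - x) * s))) \<le> x powr (Re lam + real N - 1) * (1 - x) powr (real N + 1 - Re lam - 1) * 1"
      unfolding norm_mult norm_of_real B_def
      using x that norm_of_real_powr[of x] norm_of_real_powr[of "1 - x"] Jint_integrand_bound(2)[OF x, of s]
      by (intro mult_mono) auto
    thus ?thesis unfolding f_def norm_mult[of "T N 0 s"] by (intro mult_left_mono) auto
  qed
  have T0: "set_integrable lborel {0<..} (\<lambda>s. norm (T N 0 s))" by (rule set_integrable_norm[OF TI]) auto
  note fub = set_integral_Fubini_dominated[OF _ _ fcont T0 set_integrable_Beta[OF p] fbd]
  have RI: "set_integrable lborel {0<..} R"
    using fub(2) unfolding Rf[abs_def] by auto
  have "(LINT s:{0<..}|lborel. R s) = (LINT x:{0<..<1}|lborel. LINT s:{0<..}|lborel. f s x)"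
    unfolding Rf using fub(1) by auto
  also have "\<dots> = (LINT x:{0<..<1}|lborel. B x * (LINT s:{0<..}|lborel. T N (4 * x * (1 - x)) s))"
  proof (intro set_lebesgue_integral_cong allI impI)
    fix x :: real assume "x \<in> {0<..<1}"
    have "f s x = B x * T N (4 * x * (1 - x)) s" for s
      unfolding f_def T_def by (simp add: mult_ac)
    thus "(LINT s:{0<..}|lborel. f s x) = B x * (LINT s:{0<..}|lborel. T N (4 * x * (1 - x)) s)" by simp
  qed auto
  finally have "c * (LINT s:{0<..}|lborel. R s) = (LINT x:{0<..<1}|lborel. c * (B x * (LINT s:{0<..}|lborel. T N (4 * x * (1 - x)) s)))"
    by (simp only: set_integral_mult_right)
  also have "\<dots> = (LINT x:{0<..<1}|lborel. of_real w ^ N * (B x * Dh \<alpha> N (of_real (4 * x * (1 - x)) * of_real w)))"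
  proof (intro set_lebesgue_integral_cong allI impI)
    fix x :: real assume "x \<in> {0<..<1}"
    hence y: "4 * x * (1 - x) \<ge> 0" by simp
    have "c * (B x * (LINT s:{0<..}|lborel. T N (4 * x * (1 - x)) s)) = B x * (c * (LINT s:{0<..}|lborel. T N (4 * x * (1 - x)) s))" by (simp only: mult_ac)
    also have "\<dots> = of_real w ^ N * (B x * Dh \<alpha> N (of_real (4 * x * (1 - x)) * of_real w))"
      unfolding TV[OF y order_refl] of_real_mult[of "4 * x * (1 - x)" w, symmetric] by (simp only: mult_ac)
    finally show "c * (B x * (LINT s:{0<..}|lborel. T N (4 * x * (1 - x)) s)) = of_real w ^ N * (B x * Dh \<alpha> N (of_real (4 * x * (1 - x)) * of_real w))" .
  qed auto
  also have "\<dots> = of_real w ^ N * (LINT x:{0<..<1}|lborel. B x * Dh \<alpha> N (of_real (4 * x * (1 - x)) * of_real w))"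
    by (rule set_integral_mult_right)
  finally have RV: "c * (LINT s:{0<..}|lborel. R s) = of_real w ^ N * (LINT x:{0<..<1}|lborel. B x * Dh \<alpha> N (of_real (4 * x * (1 - x)) * of_real w))" .
  have "legint \<kappa> \<mu> (of_real w) = (LINT s:{0<..}|lborel. (\<Sum>n<N. 2 * kcoef n lam * T n 0 s) + 2 * q * (- 4) ^ N * R s)"
    unfolding legint_substitution[OF w k]
  proof (intro set_lebesgue_integral_cong allI impI)
    fix s :: real assume "s \<in> {0<..}"
    hence s: "s > 0" by simp
    define \<eta> where "\<eta> = 2 * arsinh (sqrt s)"
    have \<eta>: "\<eta> > 0" using s by (simp add: \<eta>_def)
    have sh: "(sinh (\<eta> / 2))\<^sup>2 = s" using s by (simp add: \<eta>_def)
    have tn: "T n 0 s = W s * (of_real (s powr (- 1 / 2)) * of_real s ^ n)" for n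
    proof -
      have "s powr (real n + 1 / 2 - 1) = s powr (- 1 / 2 + real n)" by (simp add: algebra_simps)
      also have "\<dots> = s powr (- 1 / 2) * s powr real n" by (rule powr_add)
      also have "s powr real n = s ^ n" using s by (simp add: powr_realpow)
      finally show ?thesis by (simp add: T_def)
    qed
    have "2 * (of_real (w + s) powr (- \<kappa>) * (of_real (s powr (- 1 / 2)) * (cosh (\<mu> * of_real \<eta>) / of_real (cosh (\<eta> / 2))))) =
       2 * (W s * (of_real (s powr (- 1 / 2)) * ((\<Sum>n<N. kcoef n lam * of_real s ^ n) + q * (- 4 * of_real s) ^ N * Jint N lam s)))"
      unfolding W_def \<mu>_def cosh_expansion[OF lam \<eta>] sh q_def by (simp only:)
    also have "\<dots> = (\<Sum>n<N. 2 * kcoef n lam * T n 0 s) + 2 * q * (- 4) ^ N * R s"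
      unfolding R_def tn power_mult_distrib by (simp only: distrib_left sum_distrib_left mult_ac)
    finally show "2 * (of_real (w + s) powr (- \<kappa>) * (of_real (s powr (- 1 / 2)) * (cosh (\<mu> * of_real (2 * arsinh (sqrt s))) / of_real (cosh (2 * arsinh (sqrt s) / 2))))) =
       (\<Sum>n<N. 2 * kcoef n lam * T n 0 s) + 2 * q * (- 4) ^ N * R s" unfolding \<eta>_def .
  qed auto
  also have "\<dots> = (\<Sum>n<N. 2 * kcoef n lam * (LINT s:{0<..}|lborel. T n 0 s)) + 2 * q * (- 4) ^ N * (LINT s:{0<..}|lborel. R s)"
  proof -
    have i: "set_integrable lborel {0<..} (\<lambda>s. 2 * kcoef n lam * T n 0 s)" if "n \<in> {..<N}" for n
      by (intro set_integrable_mult_right TI) (use that in auto)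
    have isum: "set_integrable lborel {0<..} (\<lambda>s. \<Sum>n<N. 2 * kcoef n lam * T n 0 s)"
      using i unfolding set_integrable_def scaleR_sum_right by (intro Bochner_Integration.integrable_sum) auto
    have "(LINT s:{0<..}|lborel. \<Sum>n<N. 2 * kcoef n lam * T n 0 s) = (\<Sum>n<N. LINT s:{0<..}|lborel. 2 * kcoef n lam * T n 0 s)"
      using i unfolding set_integrable_def set_lebesgue_integral_def scaleR_sum_right by (intro Bochner_Integration.integral_sum) auto
    thus ?thesis
      by (subst set_integral_add(2)[OF isum set_integrable_mult_right[OF RI]]) (simp only: set_integral_mult_right)
  qed
  finally have L: "legint \<kappa> \<mu> (of_real w) = (\<Sum>n<N. 2 * kcoef n lam * (LINT s:{0<..}|lborel. T n 0 s)) + 2 * q * (- 4) ^ N * (LINT s:{0<..}|lborel. R s)" .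
  have sp: "complex_of_real (sqrt pi) \<noteq> 0" by simp
  have "gfun \<alpha> lam (of_real w) = 1 / (2 * of_real (sqrt pi)) * (c * legint \<kappa> \<mu> (of_real w))"
    unfolding gfun_def c_def \<kappa>_def \<mu>_def by simp
  also have "c * legint \<kappa> \<mu> (of_real w) = (\<Sum>n<N. 2 * kcoef n lam * (c * (LINT s:{0<..}|lborel. T n 0 s))) + 2 * q * (- 4) ^ N * (c * (LINT s:{0<..}|lborel. R s))"
    unfolding L by (simp only: distrib_left sum_distrib_left mult_ac)
  also have "(\<Sum>n<N. 2 * kcoef n lam * (c * (LINT s:{0<..}|lborel. T n 0 s))) = (\<Sum>n<N. 2 * of_real (sqrt pi) * (acoef n (lam - 1 / 2) * Gamma (\<alpha> - of_nat n) * (2 * of_real w) ^ n))"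
  proof (intro sum.cong refl)
    fix n assume "n \<in> {..<N}"
    hence n: "n < N" by simp
    have an: "Re \<alpha> > real n" using \<alpha> n by (smt (verit) of_nat_less_iff)
    have "c * (LINT s:{0<..}|lborel. T n 0 s) = of_real w ^ n * (Gamma (\<alpha> - of_nat n) * of_real (Gamma (real n + 1 / 2)))"
      using TV[of 0 n] n Dh_zero[OF an] by simp
    hence "2 * kcoef n lam * (c * (LINT s:{0<..}|lborel. T n 0 s)) = 2 * (kcoef n lam * of_real (Gamma (real n + 1 / 2))) * of_real w ^ n * Gamma (\<alpha> - of_nat n)"
      by (simp only: mult_ac)
    thus "2 * kcoef n lam * (c * (LINT s:{0<..}|lborel. T n 0 s)) = 2 * of_real (sqrt pi) * (acoef n (lam - 1 / 2) * Gamma (\<alpha> - of_nat n) * (2 * of_real w) ^ n)"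
      unfolding kcoef_acoef power_mult_distrib by (simp only: mult_ac)
  qed
  also have "2 * q * (- 4) ^ N * (c * (LINT s:{0<..}|lborel. R s)) = 2 * of_real (sqrt pi) * remainder \<alpha> lam N (of_real w)"
    unfolding RV remainder_def B_def q_def power_mult_distrib using sp by simp
  finally show ?thesis unfolding sum_distrib_left[symmetric] distrib_left[symmetric] using sp by simp
qed

lemma connected_slit: "connected (- \<real>\<^sub>\<le>\<^sub>0 :: complex set)"
proof -
  have "(- \<real>\<^sub>\<le>\<^sub>0 :: complex set) = (\<lambda>w. 1 - w) ` cutplane"
  proof (intro equalityI subsetI)
    fix w :: complex assume "w \<in> - \<real>\<^sub>\<le>\<^sub>0"
    thus "w \<in> (\<lambda>w. 1 - w) ` cutplane" by (intro image_eqI[of _ _ "1 - w"]) (auto simp: cutplane_iff)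
  qed (auto simp: cutplane_iff)
  thus ?thesis using connected_continuous_image[OF _ connected_cutplane, of "\<lambda>w. 1 - w"]
    by (simp add: continuous_intros)
qed

theorem gfun_expansion:
  assumes w: "w \<notin> \<real>\<^sub>\<le>\<^sub>0" and \<alpha>: "Re \<alpha> > real N" and lam: "\<bar>Re lam - 1 / 2\<bar> < real N + 1 / 2"
  shows "gfun \<alpha> lam w = (\<Sum>n<N. acoef n (lam - 1 / 2) * Gamma (\<alpha> - of_nat n) * (2 * w) ^ n) + remainder \<alpha> lam N w"
proof (rule holomorphic_eq_on_segment[where f = "gfun \<alpha> lam" and g = "\<lambda>w. (\<Sum>n<N. acoef n (lam - 1 / 2) * Gamma (\<alpha> - of_nat n) * (2 * w) ^ n) + remainder \<alpha> lam N w"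
      and S = "- \<real>\<^sub>\<le>\<^sub>0" and l = 0 and r = 1 and v = 1 and p = 0])
  show "gfun \<alpha> lam holomorphic_on - \<real>\<^sub>\<le>\<^sub>0"
    by (rule holomorphic_on_gfun[OF open_slit, where a = "\<lambda>_. \<alpha>" and l = "\<lambda>_. lam" and w = "\<lambda>w. w"])
       (use \<alpha> lam in \<open>auto intro!: holomorphic_intros\<close>)
  show "(\<lambda>w. (\<Sum>n<N. acoef n (lam - 1 / 2) * Gamma (\<alpha> - of_nat n) * (2 * w) ^ n) + remainder \<alpha> lam N w) holomorphic_on - \<real>\<^sub>\<le>\<^sub>0"
    by (intro holomorphic_intros remainder_holomorphic \<alpha> lam)
  fix t :: real assume t: "0 < t" "t < 1"
  thus "0 + of_real t * 1 \<in> - \<real>\<^sub>\<le>\<^sub>0 \<and> gfun \<alpha> lam (0 + of_real t * 1) =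
    (\<Sum>n<N. acoef n (lam - 1 / 2) * Gamma (\<alpha> - of_nat n) * (2 * (0 + of_real t * 1)) ^ n) + remainder \<alpha> lam N (0 + of_real t * 1)"
    using gfun_expansion_pos[OF t(1) \<alpha> lam] by simp
qed (use w open_slit connected_slit in auto)

section \<open>Bounds for the remainder\<close>

lemma Lam_bound_Re:
  assumes "Re c \<ge> 0"
  shows "norm (Lam N c) \<le> 1 * Gamma (real N + 1 / 2)"
proof -
  have "norm (1 + c * complex_of_real v) \<ge> 1" if "v > 0" for v
  proof -
    have "1 \<le> Re (1 + c * complex_of_real v)" using assms that by simp
    also have "\<dots> \<le> norm (1 + c * complex_of_real v)" by (rule complex_Re_le_cmod)
    finally show ?thesis .
  qed
  moreover have "c \<notin> \<real>\<^sub>\<le>\<^sub>0 \<or> c = 0" using assms by (auto simp: complex_nonpos_Reals_iff complex_eq_iff)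
  ultimately show ?thesis using Lam_bound(2)[of c 1 N] by simp
qed

lemma Lam_bound_Im:
  assumes "Im c \<noteq> 0"
  shows "norm (Lam N c) \<le> norm c / \<bar>Im c\<bar> * Gamma (real N + 1 / 2)"
proof -
  have c0: "norm c > 0" using assms by auto
  have "norm (1 + c * complex_of_real v) \<ge> \<bar>Im c\<bar> / norm c" for v
  proof -
    \<comment> \<open>Multiplying by the conjugate of c makes the term with v real, so the imaginary
      part is the same for every v. The resulting bound |Im c| / |c| is the distance from 0 to the
      line through 1 in the direction of c.\<close>
    have "Im ((1 + c * of_real v) * cnj c) = - Im c" by (simp add: algebra_simps)
    hence "\<bar>Im c\<bar> \<le> norm ((1 + c * of_real v) * cnj c)" using abs_Im_le_cmod[of "(1 + c * of_real v) * cnj c"] by simp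
    moreover have "norm ((1 + c * of_real v) * cnj c) = norm (1 + c * of_real v) * norm c" by (simp only: norm_mult complex_mod_cnj)
    ultimately show ?thesis using c0 by (simp only: pos_divide_le_eq)
  qed
  moreover have "c \<notin> \<real>\<^sub>\<le>\<^sub>0 \<or> c = 0" using assms by (auto simp: complex_nonpos_Reals_iff)
  moreover have "\<bar>Im c\<bar> / norm c > 0" using assms c0 by simp
  ultimately show ?thesis using Lam_bound(2)[of c "\<bar>Im c\<bar> / norm c" N] by (simp add: field_simps)
qed

lemma norm_powr_of_real_exponent:
  assumes "z \<noteq> 0"
  shows "norm (z powr complex_of_real a) = norm z powr a"
  using assms by (simp add: powr_def)

lemma chi_integral:
  assumes p: "p > (0::real)"
  shows "set_integrable lborel {0<..} (\<lambda>r::real. (1 + r\<^sup>2) powr (- (p + 1) / 2))"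
    and "(LINT r:{0<..}|lborel. (1 + r\<^sup>2) powr (- (p + 1) / 2)) = Beta (1 / 2) (p / 2) / 2"
proof -
  define f where "f = (\<lambda>r::real. complex_of_real ((1 + r\<^sup>2) powr (- (p + 1) / 2)))"
  \<comment> \<open>Chosen so that 1 + r^2 = 1 / (1 - x) at r = g x; integrand and derivative then
    combine to half a Beta weight with exponents -1/2 and p/2 - 1.\<close>
  define g where "g = (\<lambda>x::real. sqrt (x / (1 - x)))"
  define h where "h = (\<lambda>x::real. inverse (sqrt (x / (1 - x))) / 2 * (1 / (1 - x)\<^sup>2))"
  define B where "B = (\<lambda>x::real. x powr (1 / 2 - 1) * (1 - x) powr (p / 2 - 1))"
  have img: "g ` {0<..<1} = {0<..}"
  proof (intro equalityI subsetI)
    fix r :: real assume "r \<in> {0<..}"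
    hence r: "r > 0" by simp
    have d: "1 + r\<^sup>2 > 0" by (simp add: add_pos_nonneg)
    have "1 - r\<^sup>2 / (1 + r\<^sup>2) = 1 / (1 + r\<^sup>2)" using d by (simp add: field_simps)
    hence "g (r\<^sup>2 / (1 + r\<^sup>2)) = r" using d r by (simp add: g_def)
    moreover have "r\<^sup>2 / (1 + r\<^sup>2) \<in> {0<..<1}" using r d by simp
    ultimately show "r \<in> g ` {0<..<1}" by (metis image_eqI)
  qed (auto simp: g_def)
  have inj: "inj_on g {0<..<1}"
  proof (rule inj_onI)
    fix x y assume x: "x \<in> {0<..<1}" and y: "y \<in> {0<..<1}" and "g x = g y"
    hence "x / (1 - x) = y / (1 - y)" by (simp add: g_def)
    hence "x * (1 - y) = y * (1 - x)" using x y by (simp add: frac_eq_eq)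
    thus "x = y" by (simp add: algebra_simps)
  qed
  have der: "(g has_field_derivative h x) (at x)" if "x \<in> {0<..<1}" for x
  proof -
    have "((\<lambda>x. x / (1 - x)) has_field_derivative 1 / (1 - x)\<^sup>2) (at x)"
      using that by (auto intro!: derivative_eq_intros simp: power2_eq_square)
    thus ?thesis unfolding g_def h_def using that
      by (intro DERIV_chain2[OF DERIV_real_sqrt]) auto
  qed
  have F: "complex_of_real (1 / 2) * of_real (B x) = of_real \<bar>h x\<bar> * f (g x)" if "x \<in> {0<..<1}" for x
  proof -
    have x: "0 < x" "x < 1" using that by auto
    define L where "L = ln (1 - x)"
    have g2: "1 + (g x)\<^sup>2 = 1 / (1 - x)" using x by (simp add: g_def field_simps)
    have a: "inverse (sqrt (x / (1 - x))) = exp (- (ln x - L) / 2)"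
    proof -
      have "sqrt (x / (1 - x)) = (x / (1 - x)) powr (1 / 2)" using x by (simp add: powr_half_sqrt)
      also have "\<dots> = exp ((ln x - L) / 2)" using x by (simp add: powr_def ln_div L_def)
      finally have "inverse (sqrt (x / (1 - x))) = exp (- ((ln x - L) / 2))" by (simp only: exp_minus)
      thus ?thesis by (simp only: minus_divide_left)
    qed
    have b: "1 / (1 - x)\<^sup>2 = exp (- 2 * L)"
    proof -
      have "exp (- 2 * L) = inverse (exp L * exp L)" by (simp add: exp_minus[symmetric] flip: exp_add)
      thus ?thesis using x by (simp add: L_def power2_eq_square inverse_eq_divide)
    qed
    have c: "(1 / (1 - x)) powr (- (p + 1) / 2) = exp ((p + 1) / 2 * L)"
      using x by (simp add: powr_def ln_div L_def) (simp add: algebra_simps)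
    have h0: "h x \<ge> 0" using x by (simp add: h_def)
    have "\<bar>h x\<bar> * (1 + (g x)\<^sup>2) powr (- (p + 1) / 2) = 1 / 2 * (exp (- (ln x - L) / 2) * exp (- 2 * L) * exp ((p + 1) / 2 * L))"
      unfolding abs_of_nonneg[OF h0] g2 c unfolding h_def a b by simp
    also have "exp (- (ln x - L) / 2) * exp (- 2 * L) * exp ((p + 1) / 2 * L) = exp ((1 / 2 - 1) * ln x) * exp ((p / 2 - 1) * L)"
      unfolding exp_add[symmetric] by (rule arg_cong[where f = exp]) (simp add: field_simps)
    also have "\<dots> = B x" using x by (simp add: B_def powr_def L_def)
    finally show ?thesis unfolding f_def by (metis of_real_mult)
  qed
  have nz: "1 + r\<^sup>2 \<noteq> 0" for r :: real by (metis add_pos_nonneg less_irrefl zero_le_power2 zero_less_one)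
  have fc: "continuous_on {0<..} f" unfolding f_def by (intro continuous_intros) (use nz in auto)
  have hc: "continuous_on {0<..<1} h" unfolding h_def by (intro continuous_intros) auto
  note sub = set_integral_substitution[where F = "\<lambda>x. complex_of_real (1 / 2) * of_real (B x)", OF _ img _ der inj fc hc F]
  have BI: "set_integrable lborel {0<..<1} B" unfolding B_def by (rule set_integrable_Beta) (use p in auto)
  have "(\<lambda>x. indicator {0<..<1} x *\<^sub>R complex_of_real (B x)) = (\<lambda>x. complex_of_real (indicator {0<..<1} x *\<^sub>R B x))"
    by (auto simp: indicator_def)
  hence "set_integrable lborel {0<..<1} (\<lambda>x. complex_of_real (B x))"
    using BI unfolding set_integrable_def by (simp only: complex_of_real_integrable_eq)
  hence "set_integrable lborel {0<..<1} (\<lambda>x. complex_of_real (1 / 2) * of_real (B x))"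
    by (rule set_integrable_mult_right)
  hence "set_integrable lborel {0<..} f" using sub(1) by auto
  hence "set_integrable lborel {0<..} (\<lambda>r. norm (f r))" by (rule set_integrable_norm)
  thus "set_integrable lborel {0<..} (\<lambda>r::real. (1 + r\<^sup>2) powr (- (p + 1) / 2))" by (simp add: f_def)
  have "complex_of_real (LINT r:{0<..}|lborel. (1 + r\<^sup>2) powr (- (p + 1) / 2)) = (LINT r:{0<..}|lborel. f r)"
    unfolding f_def by (rule set_integral_complex_of_real[symmetric])
  also have "\<dots> = of_real (1 / 2) * (LINT x:{0<..<1}|lborel. of_real (B x))" using sub(2) by auto
  also have "(LINT x:{0<..<1}|lborel. complex_of_real (B x)) = of_real (LINT x:{0<..<1}|lborel. B x)" by (rule set_integral_complex_of_real)
  also have "(LINT x:{0<..<1}|lborel. B x) = Beta (1 / 2) (p / 2)"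
    unfolding set_borel_integral_eq_integral(2)[OF BI] unfolding B_def
    using integral_unique[OF has_integral_Beta_real[of "1 / 2" "p / 2"]] p by (simp add: integral_open_interval_real)
  finally show "(LINT r:{0<..}|lborel. (1 + r\<^sup>2) powr (- (p + 1) / 2)) = Beta (1 / 2) (p / 2) / 2"
    by (metis (no_types, lifting) of_real_eq_iff of_real_mult mult.commute times_divide_eq_right mult_1_right)
qed

lemma chi_Beta:
  assumes "p > 0"
  shows "Gamma (p + 1) * (Beta (1 / 2) (p / 2) / 2) = chi p * Gamma p"
proof -
  have g1: "Gamma (p + 1) = p * Gamma p" using assms by (intro Gamma_plus1) (auto dest: nonpos_Ints_nonpos)
  have g2: "Gamma (p / 2 + 1) = p / 2 * Gamma (p / 2)" using assms by (intro Gamma_plus1) (auto dest: nonpos_Ints_nonpos)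
  have g3: "Gamma (1 / 2 + p / 2) = Gamma (p / 2 + 1 / 2)" by (simp add: add.commute)
  show ?thesis unfolding chi_def Beta_def g1 g2 g3 Gamma_one_half_real by (simp add: mult_ac)
qed

text \<open>With \<open>z = 1 / c\<close> one has \<open>\<Lambda>(c) = \<Gamma>(p) - \<integral> v\<^sup>p e\<^bsup>-v\<^esup> / (z + v) dv\<close>, where \<open>p = N + 1 / 2\<close>. Inserting
  \<open>1 / (z + v) = \<minusplus> i \<integral> e\<^bsup>\<plusminus>i(z + v)r\<^esup> dr\<close> and integrating over \<open>v\<close> first bounds the integral by
  \<open>\<Gamma>(p + 1) \<integral> (1 + r\<^sup>2)\<^bsup>-(p + 1)/2\<^esup> dr = \<chi>(p) \<Gamma>(p)\<close>.\<close>

lemma Lam_bound_chi: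
  assumes "Im c \<noteq> 0"
  shows "norm (Lam N c) \<le> (1 + chi (real N + 1 / 2)) * Gamma (real N + 1 / 2)"
proof -
  define p where "p = real N + 1 / 2"
  have p: "p > 0" by (simp add: p_def)
  define z where "z = 1 / c"
  have c0: "c \<noteq> 0" using assms by auto
  have zim: "Im z \<noteq> 0" using assms c0 by (simp add: z_def Im_divide)
  \<comment> \<open>The sign of Im z selects the kernel: with it exp (i \<sigma> (z + v) r) has
    modulus exp (- |Im z| r) and decays in r.\<close>
  define \<sigma> where "\<sigma> = sgn (Im z)"
  have \<sigma>: "\<sigma> = 1 \<or> \<sigma> = -1" "\<sigma> * Im z = \<bar>Im z\<bar>" using zim by (auto simp: \<sigma>_def sgn_if)
  define m where "m = \<bar>Im z\<bar>"
  have m: "m > 0" using zim by (simp add: m_def)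
  define f where "f = (\<lambda>v r. complex_of_real (v powr (p + 1 - 1) * exp (- 1 * v)) * exp (- (- \<i> * of_real \<sigma> * (z + of_real v)) * of_real r))"
  have expo: "norm (exp (- (- \<i> * of_real \<sigma> * (z + of_real v)) * of_real r)) = exp (- m * r)" for v r
    using \<sigma>(2) by (simp add: m_def mult.assoc[symmetric])
  have inner_r: "(LINT r:{0<..}|lborel. f v r) = \<i> * of_real \<sigma> * (of_real (v powr (p + 1 - 1) * exp (- 1 * v)) * (1 / (z + of_real v)))" if "v \<in> {0<..}" for v
  proof -
    define y where "y = - \<i> * of_real \<sigma> * (z + of_real v)"
    have Rey: "Re y > 0" using \<sigma> m by (auto simp: y_def m_def)
    have "(LINT r:{0<..}|lborel. of_real r powr (1 - 1) * exp (- y * of_real r)) = Gamma 1 * y powr (- 1)"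
      by (rule Gamma_set_integral) (use Rey in auto)
    moreover have "(LINT r:{0<..}|lborel. complex_of_real r powr (1 - 1) * exp (- y * of_real r)) = (LINT r:{0<..}|lborel. exp (- y * of_real r))"
      by (intro set_lebesgue_integral_cong) auto
    moreover have "y powr (- 1) = 1 / y" using Rey by (simp add: powr_minus inverse_eq_divide)
    ultimately have "(LINT r:{0<..}|lborel. exp (- y * of_real r)) = 1 / y" by simp
    moreover have "1 / y = \<i> * of_real \<sigma> * (1 / (z + of_real v))"
      using \<sigma>(1) by (auto simp: y_def divide_inverse)
    ultimately have E: "(LINT r:{0<..}|lborel. exp (- y * of_real r)) = \<i> * of_real \<sigma> * (1 / (z + of_real v))" by simp
    have "(LINT r:{0<..}|lborel. f v r) = of_real (v powr (p + 1 - 1) * exp (- 1 * v)) * (LINT r:{0<..}|lborel. exp (- y * of_real r))"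
      unfolding f_def y_def[symmetric] by (rule set_integral_mult_right)
    thus ?thesis unfolding E by (simp only: mult_ac)
  qed
  have inner_v: "(LINT v:{0<..}|lborel. f v r) = exp (\<i> * of_real \<sigma> * z * of_real r) * (Gamma (of_real (p + 1)) * (1 - \<i> * of_real (\<sigma> * r)) powr (- of_real (p + 1)))" if "r \<in> {0<..}" for r
  proof -
    have "(LINT v:{0<..}|lborel. f v r) = (LINT v:{0<..}|lborel. exp (\<i> * of_real \<sigma> * z * of_real r) * (of_real v powr (of_real (p + 1) - 1) * exp (- (1 - \<i> * of_real (\<sigma> * r)) * of_real v)))"
    proof (intro set_lebesgue_integral_cong allI impI)
      fix v :: real assume v: "v \<in> {0<..}"
      have e: "complex_of_real (v powr (p + 1 - 1)) = of_real v powr (of_real (p + 1) - 1)"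
        using powr_of_real[of v "p + 1 - 1"] v by simp
      have e2: "complex_of_real (exp (- 1 * v)) * exp (- (- \<i> * of_real \<sigma> * (z + of_real v)) * of_real r) =
         exp (\<i> * of_real \<sigma> * z * of_real r) * exp (- (1 - \<i> * of_real (\<sigma> * r)) * of_real v)"
        unfolding exp_of_real[symmetric] exp_add[symmetric] by (rule arg_cong[where f = exp]) (simp add: algebra_simps)
        have "f v r = complex_of_real (v powr (p + 1 - 1)) * (complex_of_real (exp (- 1 * v)) * exp (- (- \<i> * of_real \<sigma> * (z + of_real v)) * of_real r))"
          unfolding f_def of_real_mult[of "v powr _"] by (rule mult.assoc)
        thus "f v r = exp (\<i> * of_real \<sigma> * z * of_real r) * (of_real v powr (of_real (p + 1) - 1) * exp (- (1 - \<i> * of_real (\<sigma> * r)) * of_real v))"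
          unfolding e e2 by (simp only: mult_ac)
    qed auto
    also have "\<dots> = exp (\<i> * of_real \<sigma> * z * of_real r) * (LINT v:{0<..}|lborel. of_real v powr (of_real (p + 1) - 1) * exp (- (1 - \<i> * of_real (\<sigma> * r)) * of_real v))"
      by (rule set_integral_mult_right)
    also have "(LINT v:{0<..}|lborel. of_real v powr (of_real (p + 1) - 1) * exp (- (1 - \<i> * of_real (\<sigma> * r)) * of_real v)) = Gamma (of_real (p + 1)) * (1 - \<i> * of_real (\<sigma> * r)) powr (- of_real (p + 1))"
      by (rule Gamma_set_integral) (use p in auto)
    finally show ?thesis .
  qed
  have hI: "set_integrable lborel {0<..} (\<lambda>v::real. v powr (p + 1 - 1) * exp (- 1 * v))"
    by (rule set_integrable_powr_exp) (use p in auto)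
  have kI: "set_integrable lborel {0<..} (\<lambda>r::real. exp (- m * r))"
    by (rule set_integrable_cong[THEN iffD1, OF _ _ _ set_integrable_powr_exp[of 1 m]]) (use m in auto)
  have cont: "continuous_on ({0<..} \<times> {0<..}) (\<lambda>(v,r). f v r)"
    unfolding f_def case_prod_beta by (intro continuous_intros) auto
  have bd: "norm (f v r) \<le> v powr (p + 1 - 1) * exp (- 1 * v) * exp (- m * r)" for v r
    unfolding f_def norm_mult[of "of_real _"] expo norm_of_real by simp
  note fub = set_integral_Fubini_dominated[OF _ _ cont hI kI bd]
  define U where "U = (LINT v:{0<..}|lborel. of_real (v powr (p + 1 - 1) * exp (- 1 * v)) * (1 / (z + of_real v)))"
  have swap: "(LINT v:{0<..}|lborel. LINT r:{0<..}|lborel. f v r) = (LINT r:{0<..}|lborel. LINT v:{0<..}|lborel. f v r)"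
    by (rule fub(1)) auto
  have lhs: "(LINT v:{0<..}|lborel. LINT r:{0<..}|lborel. f v r) = \<i> * of_real \<sigma> * U"
  proof -
    have "(LINT v:{0<..}|lborel. LINT r:{0<..}|lborel. f v r) = (LINT v:{0<..}|lborel. \<i> * of_real \<sigma> * (of_real (v powr (p + 1 - 1) * exp (- 1 * v)) * (1 / (z + of_real v))))"
      by (intro set_lebesgue_integral_cong allI impI inner_r) auto
    thus ?thesis unfolding U_def by (simp only: set_integral_mult_right)
  qed
  have "norm (LINT r:{0<..}|lborel. LINT v:{0<..}|lborel. f v r) \<le> (LINT r:{0<..}|lborel. Gamma (p + 1) * (1 + r\<^sup>2) powr (- (p + 1) / 2))"
  proof -
    have nb: "norm (LINT v:{0<..}|lborel. f v r) \<le> Gamma (p + 1) * (1 + r\<^sup>2) powr (- (p + 1) / 2)" if r: "r \<in> {0<..}" for r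
    proof -
      have nz: "1 - \<i> * complex_of_real (\<sigma> * r) \<noteq> 0" by (simp add: complex_eq_iff)
      have "norm (1 - \<i> * complex_of_real (\<sigma> * r)) = sqrt (1 + r\<^sup>2)" using \<sigma>(1) by (auto simp: cmod_def power2_eq_square)
      hence n1: "norm (1 - \<i> * complex_of_real (\<sigma> * r)) = (1 + r\<^sup>2) powr (1 / 2)" by (simp add: powr_half_sqrt)
      have "norm ((1 - \<i> * of_real (\<sigma> * r)) powr (- complex_of_real (p + 1))) = ((1 + r\<^sup>2) powr (1 / 2)) powr (- (p + 1))"
        using norm_powr_of_real_exponent[OF nz, of "- (p + 1)"] n1 by simp
      also have "\<dots> = (1 + r\<^sup>2) powr (- (p + 1) / 2)" unfolding powr_powr by (simp add: field_simps)
      finally have n2: "norm ((1 - \<i> * of_real (\<sigma> * r)) powr (- complex_of_real (p + 1))) = (1 + r\<^sup>2) powr (- (p + 1) / 2)" .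
      have "norm (Gamma (complex_of_real (p + 1))) = Gamma (p + 1)"
        using Gamma_real_pos[of "p + 1"] p by (simp only: Gamma_complex_of_real norm_of_real) simp
      moreover have "norm (exp (\<i> * of_real \<sigma> * z * of_real r)) \<le> 1"
      proof -
        have "Re (\<i> * of_real \<sigma> * z * of_real r) = - (\<sigma> * Im z) * r" by simp
        also have "\<dots> \<le> 0" using \<sigma>(2) r by simp
        finally show ?thesis by simp
      qed
      ultimately show ?thesis unfolding inner_v[OF r] norm_mult n2
        using Gamma_real_pos[of "p + 1"] p by (simp add: mult_left_le_one_le)
    qed
    have dI: "set_integrable lborel {0<..} (\<lambda>r. Gamma (p + 1) * (1 + r\<^sup>2) powr (- (p + 1) / 2))"
      by (intro set_integrable_mult_right chi_integral p)
    \<comment> \<open>The same Fubini lemma with the variables exchanged, because integrability of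
      the inner integral is now needed in r.\<close>
    have cI: "set_integrable lborel {0<..} (\<lambda>r. LINT v:{0<..}|lborel. f v r)"
    proof (rule set_integral_Fubini_dominated(2)[where f = "\<lambda>r v. f v r", OF _ _ _ kI hI])
      show "continuous_on ({0<..} \<times> {0<..}) (\<lambda>(r,v). f v r)" unfolding f_def case_prod_beta by (intro continuous_intros) auto
      show "norm (f v r) \<le> exp (- m * r) * (v powr (p + 1 - 1) * exp (- 1 * v))" for r v using bd[of v r] by (simp add: mult.commute)
    qed auto
    have "norm (LINT r:{0<..}|lborel. LINT v:{0<..}|lborel. f v r) \<le> (LINT r:{0<..}|lborel. norm (LINT v:{0<..}|lborel. f v r))"
      by (rule set_integral_norm_bound[OF cI])
    also have "\<dots> \<le> (LINT r:{0<..}|lborel. Gamma (p + 1) * (1 + r\<^sup>2) powr (- (p + 1) / 2))"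
      by (rule set_integral_mono[OF set_integrable_norm[OF cI] dI nb])
    finally show ?thesis .
  qed
  also have "\<dots> = Gamma (p + 1) * (LINT r:{0<..}|lborel. (1 + r\<^sup>2) powr (- (p + 1) / 2))" by (rule set_integral_mult_right)
  also have "\<dots> = chi p * Gamma p" unfolding chi_integral(2)[OF p] by (rule chi_Beta[OF p])
  finally have "norm (\<i> * of_real \<sigma> * U) \<le> chi p * Gamma p" unfolding swap[symmetric] lhs .
  hence U: "norm U \<le> chi p * Gamma p" using \<sigma>(1) by (auto simp: norm_mult)
  have "Lam N c = of_real (Gamma p) - U"
  proof -
    have cn: "c \<notin> \<real>\<^sub>\<le>\<^sub>0 \<or> c = 0" using assms by (auto simp: complex_nonpos_Reals_iff)
    have "Lam N c = (LINT v:{0<..}|lborel. of_real (v powr (p - 1) * exp (- 1 * v)) - of_real (v powr (p + 1 - 1) * exp (- 1 * v)) * (1 / (z + of_real v)))"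
      unfolding Lam_def p_def[symmetric]
    proof (intro set_lebesgue_integral_cong allI impI)
      fix v :: real assume "v \<in> {0<..}"
      hence v: "v > 0" by simp
      have nz: "1 + c * of_real v \<noteq> 0" by (rule continuous_recip_linear(2)[OF cn v])
      have "z + of_real v = (1 + c * of_real v) / c" using c0 by (simp add: z_def field_simps)
      hence "1 / (z + of_real v) = c / (1 + c * of_real v)" by simp
      moreover have "1 / (1 + c * of_real v) = 1 - of_real v * (c / (1 + c * of_real v))" using nz by (simp add: field_simps)
      ultimately have e: "1 / (1 + c * of_real v) = 1 - of_real v * (1 / (z + of_real v))" by simp
      have pw: "v powr (p + 1 - 1) = v powr (p - 1) * v" using v powr_add[of v "p - 1" 1] by simp
      show "of_real (v powr (p - 1) * exp (- 1 * v)) * (1 / (1 + c * of_real v)) =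
        of_real (v powr (p - 1) * exp (- 1 * v)) - complex_of_real (v powr (p + 1 - 1) * exp (- 1 * v)) * (1 / (z + of_real v))"
        unfolding e pw by (simp add: algebra_simps)
    qed auto
    also have "\<dots> = (LINT v:{0<..}|lborel. complex_of_real (v powr (p - 1) * exp (- 1 * v))) - U" unfolding U_def
    proof (rule set_integral_diff(2))
      show "set_integrable lborel {0<..} (\<lambda>v. complex_of_real (v powr (p - 1) * exp (- 1 * v)))"
        using Lam_bound(1)[of 0 1 N] by (simp add: p_def)
      have znz: "z + complex_of_real v \<noteq> 0" for v using zim by (auto simp: complex_eq_iff)
      show "set_integrable lborel {0<..} (\<lambda>v. complex_of_real (v powr (p + 1 - 1) * exp (- 1 * v)) * (1 / (z + of_real v)))"
      proof (rule set_integrable_dominated[OF set_integrable_mult_left[OF hI, of "1 / m"]])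
        show "continuous_on {0<..} (\<lambda>v. complex_of_real (v powr (p + 1 - 1) * exp (- 1 * v)) * (1 / (z + of_real v)))"
          using znz by (intro continuous_intros) auto
        fix v :: real
        have "m \<le> norm (z + of_real v)" unfolding m_def using abs_Im_le_cmod[of "z + of_real v"] by simp
        hence "norm (1 / (z + complex_of_real v)) \<le> 1 / m" using m by (simp add: norm_divide frac_le)
        thus "norm (complex_of_real (v powr (p + 1 - 1) * exp (- 1 * v)) * (1 / (z + of_real v))) \<le> v powr (p + 1 - 1) * exp (- 1 * v) * (1 / m)"
          unfolding norm_mult[of "of_real _"] norm_of_real by (intro mult_mono) auto
      qed auto
    qed
    also have "(LINT v:{0<..}|lborel. complex_of_real (v powr (p - 1) * exp (- 1 * v))) = of_real (Gamma p)"
      using Gamma_real_set_integral[OF p, of 1] by (simp only: set_integral_complex_of_real) simp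
    finally show ?thesis .
  qed
  hence "norm (Lam N c) \<le> norm (complex_of_real (Gamma p)) + norm U" by (simp only: norm_triangle_ineq4)
  also have "\<dots> \<le> Gamma p + chi p * Gamma p" using U Gamma_real_pos[OF p] by simp
  finally show ?thesis unfolding p_def by (simp add: algebra_simps)
qed

text \<open>At an integer l in the allowed window one of the two Pochhammer symbols in a_k vanishes
  together with sin (\<pi> l); elsewhere this is \<open>Beta_pair\<close>. Isolating the sine
  leaves, apart from the sign, a factor that is continuous and positive on the whole window.\<close>

lemma acoef_Gamma:
  fixes l :: real
  assumes l: "\<bar>l - 1 / 2\<bar> < real k + 1 / 2"
  shows "acoef k (l - 1 / 2) = (- 1) ^ k * sin (pi * l) * (Gamma (l + real k) * Gamma (real k + 1 - l) / (pi * 2 ^ k * fact k))"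
proof (cases "l \<in> \<int>")
  case True
  then obtain i where i: "l = of_int i" by (auto elim: Ints_cases)
  have "pochhammer l k = 0 \<or> pochhammer (1 - l) k = 0"
  proof (cases "i \<le> 0")
    case True
    hence "l = - real (nat (- i))" "nat (- i) < k" using l i by (auto simp: abs_less_iff)
    thus ?thesis unfolding pochhammer_eq_0_iff by blast
  next
    case False
    hence "1 - l = - real (nat (i - 1))" "nat (i - 1) < k" using l i by (auto simp: abs_less_iff)
    thus ?thesis unfolding pochhammer_eq_0_iff by blast
  qed
  thus ?thesis unfolding acoef_pochhammer i by auto
next
  case False
  have "complex_of_real l \<notin> \<int>" using False by simp
  note B = Beta_pair[OF this, of k]
  have "complex_of_real l + of_nat k + (of_nat k + 1 - of_real l) = 1 + of_nat (2 * k)" by simp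
  hence F: "Gamma (complex_of_real l + of_nat k + (of_nat k + 1 - of_real l)) = fact (2 * k)" by (simp only: Gamma_fact)
  have "complex_of_real (sin (pi * l) / pi * (Gamma (l + real k) * Gamma (real k + 1 - l))) / fact (2 * k) =
     of_real (pochhammer l k * pochhammer (1 - l) k) / fact (2 * k)"
    using B unfolding Beta_def F
    by (simp add: Gamma_complex_of_real[symmetric] sin_of_real[symmetric] pochhammer_of_real[symmetric])
  hence "sin (pi * l) / pi * (Gamma (l + real k) * Gamma (real k + 1 - l)) = pochhammer l k * pochhammer (1 - l) k"
    by (simp only: divide_cancel_right fact_nonzero simp_thms of_real_eq_iff)
  thus ?thesis unfolding acoef_pochhammer by (simp add: field_simps)
qed

text \<open>Inside the window both arguments of \<Gamma> are positive, so the quotient of a_k by the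
  sine extends continuously across the integers, and limiting values and plain quotients obey one
  formula.\<close>

lemma acoef_over_sin_Gamma:
  fixes l :: real
  assumes l: "\<bar>l - 1 / 2\<bar> < real k + 1 / 2"
  shows "acoef_over_sin k l = Gamma (l + real k) * Gamma (real k + 1 - l) / (pi * 2 ^ k * fact k)"
proof -
  define G where "G = (\<lambda>t. Gamma (t + real k) * Gamma (real k + 1 - t) / (pi * 2 ^ k * fact k))"
  have pos: "G t > 0" if "\<bar>t - 1 / 2\<bar> < real k + 1 / 2" for t
    using that by (auto simp: G_def abs_less_iff intro!: mult_pos_pos divide_pos_pos Gamma_real_pos)
  have eq: "\<bar>acoef k (t - 1 / 2)\<bar> / \<bar>sin (pi * t)\<bar> = G t" if t: "\<bar>t - 1 / 2\<bar> < real k + 1 / 2" and i: "t \<notin> \<int>" for t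
  proof -
    have "sin (pi * t) \<noteq> 0"
    proof
      assume "sin (pi * t) = 0"
      then obtain i where "pi * t = of_int i * pi" by (auto simp: sin_zero_iff_int2)
      hence "t = of_int i" by simp
      thus False using i by simp
    qed
    moreover have "acoef k (t - 1 / 2) = (- 1) ^ k * sin (pi * t) * G t" using acoef_Gamma[OF t] by (simp add: G_def)
    ultimately show ?thesis using pos[OF t] by (simp add: abs_mult power_abs)
  qed
  show ?thesis
  proof (cases "l \<in> \<int>")
    case False
    thus ?thesis using eq[OF l False] by (simp add: acoef_over_sin_def G_def)
  next
    case True
    have G: "(G \<longlongrightarrow> G l) (at l)" unfolding G_def
      by (intro tendsto_intros tendsto_Gamma) (use l in \<open>auto simp: abs_less_iff dest: nonpos_Ints_nonpos\<close>)
    have "open {t::real. \<bar>t - 1 / 2\<bar> < real k + 1 / 2}" by (intro open_Collect_less continuous_intros)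
    hence "\<forall>\<^sub>F t in at l. t \<in> {t. \<bar>t - 1 / 2\<bar> < real k + 1 / 2}" by (rule eventually_at_in_open') (use l in simp)
    moreover have "\<forall>\<^sub>F t in at l. t \<notin> \<int>"
    proof -
      have "\<forall>\<^sub>F t in at l. t \<in> ball l 1 - {l}" by (rule eventually_at_in_open) auto
      thus ?thesis
      proof eventually_elim
        case (elim t)
        show ?case
        proof
          assume "t \<in> \<int>"
          then obtain i j where "t = of_int i" "l = of_int j" using True by (auto elim!: Ints_cases)
          thus False using elim by (auto simp: dist_real_def)
        qed
      qed
    qed
    ultimately have "\<forall>\<^sub>F t in at l. G t = \<bar>acoef k (t - 1 / 2)\<bar> / \<bar>sin (pi * t)\<bar>"
      by eventually_elim (use eq in auto)
    hence "((\<lambda>t. \<bar>acoef k (t - 1 / 2)\<bar> / \<bar>sin (pi * t)\<bar>) \<longlongrightarrow> G l) (at l)"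
      using G by (rule Lim_transform_eventually[rotated])
    hence "Lim (at l) (\<lambda>t. \<bar>acoef k (t - 1 / 2)\<bar> / \<bar>sin (pi * t)\<bar>) = G l" by (intro tendsto_Lim) auto
    thus ?thesis using True by (simp add: acoef_over_sin_def G_def)
  qed
qed

lemma acoef_over_sin_pos: "\<bar>l - 1 / 2\<bar> < real k + 1 / 2 \<Longrightarrow> acoef_over_sin k l > 0"
  unfolding acoef_over_sin_Gamma
  by (auto simp: abs_less_iff intro!: mult_pos_pos divide_pos_pos Gamma_real_pos)

lemma Gamma_nat_half: "Gamma (real N + 1 / 2) * (4 ^ N * fact N) = sqrt pi * fact (2 * N)"
proof (induction N)
  case (Suc N)
  have e: "real (Suc N) + 1 / 2 = (real N + 1 / 2) + 1" by simp
  have "Gamma (real (Suc N) + 1 / 2) = (real N + 1 / 2) * Gamma (real N + 1 / 2)"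
    unfolding e by (rule Gamma_plus1) (use nonpos_Ints_nonpos[of "real N + 1 / 2"] in auto)
  hence "Gamma (real (Suc N) + 1 / 2) * (4 ^ Suc N * fact (Suc N)) =
      (Gamma (real N + 1 / 2) * (4 ^ N * fact N)) * ((real N + 1 / 2) * 4 * (real N + 1))"
    by (simp add: mult_ac)
  also have "\<dots> = sqrt pi * fact (2 * N) * ((real N + 1 / 2) * 4 * (real N + 1))" unfolding Suc.IH by simp
  also have "\<dots> = sqrt pi * fact (2 * Suc N)" by (simp add: algebra_simps)
  finally show ?case .
qed (simp add: Gamma_one_half_real)

text \<open>\<open>F\<close> measures \<open>Lam\<close> against \<Gamma>(N + 1/2) along the whole
  ray of w; all other factors are constants. The duplication identity \<Gamma>(N + 1/2) 4^N N! =
  sqrt \<pi> (2N)! clears the factorials and leaves \<open>acoef_over_sin\<close>.\<close>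

lemma remainder_estimate:
  assumes \<alpha>: "Re \<alpha> > real N" and lam: "\<bar>Re lam - 1 / 2\<bar> < real N + 1 / 2" and w: "w \<notin> \<real>\<^sub>\<le>\<^sub>0"
    and F: "\<And>y. y > 0 \<Longrightarrow> norm (Lam N (of_real y * w)) \<le> F * Gamma (real N + 1 / 2)"
  shows "norm (remainder \<alpha> lam N w) \<le> norm (sin (of_real pi * lam)) * acoef_over_sin N (Re lam) * Gamma (Re \<alpha> - real N) * norm (2 * w) ^ N * F"
proof -
  define s G A where "s = norm (sin (of_real pi * lam))" and "G = Gamma (Re lam + real N) * Gamma (real N + 1 - Re lam)"
    and "A = Gamma (Re \<alpha> - real N)"
  define H where "H = Gamma (real N + 1 / 2)"
  have "norm (remainder \<alpha> lam N w) \<le> s / (pi * sqrt pi) * (4 * norm w) ^ N * (Beta (Re lam + real N) (real N + 1 - Re lam) * (A * (F * H)))"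
    unfolding s_def
  proof (rule remainder_bound[OF \<alpha> lam w])
    fix y :: real assume y: "y > 0"
    show "norm (Dh \<alpha> N (of_real y * w)) \<le> A * (F * H)" unfolding A_def H_def
    proof (rule Dh_bound(2)[OF _ \<alpha>])
      show "of_real y * w \<notin> \<real>\<^sub>\<le>\<^sub>0 \<or> of_real y * w = 0" using slit_scale(2)[OF w y] by simp
      fix t :: real assume t: "t > 0"
      have e: "of_real y * w / of_real t = of_real (y / t) * w" by simp
      show "norm (Lam N (of_real y * w / of_real t)) \<le> F * Gamma (real N + 1 / 2)"
        unfolding e by (rule F) (use y t in simp)
    qed
  qed
  also have "Beta (Re lam + real N) (real N + 1 - Re lam) = G / fact (2 * N)"
  proof -
    have e: "Re lam + real N + (real N + 1 - Re lam) = 1 + real (2 * N)" by simp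
    show ?thesis unfolding Beta_def G_def e Gamma_fact ..
  qed
  also have "H = sqrt pi * fact (2 * N) / (4 ^ N * fact N)"
    unfolding H_def Gamma_nat_half[symmetric] by simp
  also have "s / (pi * sqrt pi) * (4 * norm w) ^ N * (G / fact (2 * N) * (A * (F * (sqrt pi * fact (2 * N) / (4 ^ N * fact N))))) =
     s * (G / (pi * 2 ^ N * fact N)) * A * norm (2 * w) ^ N * F"
    by (simp add: norm_mult power_mult_distrib)
  finally show ?thesis unfolding s_def A_def G_def acoef_over_sin_Gamma[OF lam] .
qed

section \<open>Remainder estimates at the two arguments\<close>

lemma two_div_one_minus_exp:
  fixes \<xi> :: complex
  shows "2 * (1 / (1 - exp (2 * \<xi>))) = - exp (- \<xi>) / sinh \<xi>" "2 * (1 / (1 - exp (- 2 * \<xi>))) = exp \<xi> / sinh \<xi>"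
proof -
  have A: "2 * (1 / (- 2 * (x * s))) = - inverse x / s" for x s :: complex
    by (cases "x = 0 \<or> s = 0") (auto simp: field_simps)
  have A': "2 * (1 / (2 * (inverse x * s))) = x / s" for x s :: complex
    by (cases "x = 0 \<or> s = 0") (auto simp: field_simps)
  have e: "exp (2 * \<xi>) = exp \<xi> * exp \<xi>" "exp (- 2 * \<xi>) = exp (- \<xi>) * exp (- \<xi>)" by (simp_all flip: exp_add)
  have i: "exp \<xi> * exp (- \<xi>) = 1" by (simp flip: exp_add)
  have E: "1 - exp (2 * \<xi>) = - 2 * (exp \<xi> * sinh \<xi>)" unfolding e sinh_field_def using i by (simp add: algebra_simps)
  show "2 * (1 / (1 - exp (2 * \<xi>))) = - exp (- \<xi>) / sinh \<xi>" unfolding E exp_minus by (rule A)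
  have E': "1 - exp (- 2 * \<xi>) = 2 * (exp (- \<xi>) * sinh \<xi>)" unfolding e sinh_field_def using i by (simp add: algebra_simps)
  show "2 * (1 / (1 - exp (- 2 * \<xi>))) = exp \<xi> / sinh \<xi>" unfolding E' exp_minus by (rule A')
qed

text \<open>Since |exp (-2 \<xi>)| < 1, the denominator lies in the right half-plane and so does its
  inverse. All positive multiples then fall under \<open>Lam_bound_Re\<close>, which is why the
  second remainder carries no extra factor.\<close>

lemma Re_second_arg_pos:
  assumes "\<xi> \<in> D1"
  shows "Re (1 / (1 - exp (- 2 * \<xi>))) > 0"
proof -
  have "Re (exp (- 2 * \<xi>)) \<le> norm (exp (- 2 * \<xi>))" by (rule complex_Re_le_cmod)
  also have "\<dots> < 1" using assms by (simp add: D1_def)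
  finally have r: "Re (1 - exp (- 2 * \<xi>)) > 0" by simp
  hence "1 - exp (- 2 * \<xi>) \<noteq> 0" by (metis less_irrefl zero_complex.sel(1))
  thus ?thesis using r unfolding Re_divide by (simp add: cmod_power2[symmetric] del: minus_complex.sel)
qed

lemma Re_pos_notin_nonpos: "Re z > 0 \<Longrightarrow> z \<notin> \<real>\<^sub>\<le>\<^sub>0" by (auto simp: complex_nonpos_Reals_iff)

lemma chi_nonneg: "p > 0 \<Longrightarrow> chi p \<ge> 0"
  unfolding chi_def by (intro divide_nonneg_nonneg mult_nonneg_nonneg less_imp_le[OF Gamma_real_pos]) auto

lemma C1_factor_le: "C1_factor N \<xi> \<le> 1 + chi (real N + 1 / 2)"
  using chi_nonneg[of "real N + 1 / 2"] by (auto simp: C1_factor_def)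

lemma second_remainder_bound:
  assumes \<xi>: "\<xi> \<in> D1" and \<alpha>: "Re \<alpha> > real M" and lam: "\<bar>Re lam - 1 / 2\<bar> < real M + 1 / 2"
  shows "norm (remainder \<alpha> lam M (1 / (1 - exp (- 2 * \<xi>)))) \<le>
    norm (sin (of_real pi * lam)) * acoef_over_sin M (Re lam) * Gamma (Re \<alpha> - real M) * norm (exp \<xi> / sinh \<xi>) ^ M"
proof -
  let ?w = "1 / (1 - exp (- 2 * \<xi>))"
  note w = Re_second_arg_pos[OF \<xi>]
  have "norm (remainder \<alpha> lam M ?w) \<le> norm (sin (of_real pi * lam)) * acoef_over_sin M (Re lam) * Gamma (Re \<alpha> - real M) * norm (2 * ?w) ^ M * 1"
  proof (rule remainder_estimate[OF \<alpha> lam Re_pos_notin_nonpos[OF w]])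
    fix y :: real assume "y > 0"
    hence "Re (of_real y * ?w) \<ge> 0" using w by (simp only: Re_complex_of_real Im_complex_of_real times_complex.sel) simp
    thus "norm (Lam M (of_real y * ?w)) \<le> 1 * Gamma (real M + 1 / 2)" by (rule Lam_bound_Re)
  qed
  thus ?thesis unfolding two_div_one_minus_exp(2) by (simp only: mult_1_right)
qed

text \<open>A zero off the real axis forces cos (2 Im \<xi>) = -1, which would make exp (2 \<xi>)
  negative. On D1 the infinite cosecant in \<open>C1_factor\<close> therefore matters only for real
  \<xi>.\<close>

lemma sin_double_nonzero:
  assumes "Im \<xi> \<noteq> 0" "\<bar>Im \<xi>\<bar> < pi" "Re (exp (2 * \<xi>)) > 1"
  shows "sin (2 * Im \<xi>) \<noteq> 0"
proof
  assume "sin (2 * Im \<xi>) = 0"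
  hence "sin (Im \<xi>) * cos (Im \<xi>) = 0" by (simp add: sin_double)
  moreover have "sin (Im \<xi>) \<noteq> 0"
    using assms(1,2) sin_gt_zero[of "Im \<xi>"] sin_gt_zero[of "- Im \<xi>"] by (cases "Im \<xi> > 0") auto
  ultimately have "cos (2 * Im \<xi>) = - 1" by (simp add: cos_double_cos)
  thus False using assms(3) by (simp add: Re_exp) (smt (verit) exp_gt_zero)
qed

lemma first_remainder_bound:
  assumes \<xi>: "\<xi> \<in> D1" "Im \<xi> \<noteq> 0" and \<alpha>: "Re \<alpha> > real N" and lam: "\<bar>Re lam - 1 / 2\<bar> < real N + 1 / 2"
  shows "norm (remainder \<alpha> lam N (1 / (1 - exp (2 * \<xi>)))) \<le>
    norm (sin (of_real pi * lam)) * acoef_over_sin N (Re lam) * Gamma (Re \<alpha> - real N) * norm (exp (- \<xi>) / sinh \<xi>) ^ N * C1_factor N \<xi>"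
proof -
  define z where "z = 1 - exp (2 * \<xi>)"
  define w where "w = 1 / z"
  have im: "\<bar>Im \<xi>\<bar> < pi" using \<xi> by (simp add: D1_def)
  have w: "w \<notin> \<real>\<^sub>\<le>\<^sub>0" unfolding w_def z_def by (rule recip_one_minus_exp_notin(1)[OF \<xi>(2) im])
  have z0: "z \<noteq> 0" using w by (auto simp: w_def)
  have n: "norm (2 * w) = norm (exp (- \<xi>) / sinh \<xi>)"
    unfolding w_def z_def two_div_one_minus_exp(1) by (simp add: norm_divide)
  have "norm (remainder \<alpha> lam N w) \<le> norm (sin (of_real pi * lam)) * acoef_over_sin N (Re lam) * Gamma (Re \<alpha> - real N) * norm (2 * w) ^ N * C1_factor N \<xi>"
  proof (rule remainder_estimate[OF \<alpha> lam w])
    fix y :: real assume y: "y > 0"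
    define c where "c = of_real y * w"
    have c: "Re c = y * Re w" "Im c = y * Im w" "norm c = y * norm w" using y by (simp_all add: c_def norm_mult)
    show "norm (Lam N (of_real y * w)) \<le> C1_factor N \<xi> * Gamma (real N + 1 / 2)"
      unfolding c_def[symmetric]
    proof (cases "Re (exp (2 * \<xi>)) \<le> 1")
      case True
      hence "Re z \<ge> 0" by (simp add: z_def)
      hence "Re w \<ge> 0" by (simp add: w_def Re_divide)
      hence "Re c \<ge> 0" using y c by simp
      hence "norm (Lam N c) \<le> 1 * Gamma (real N + 1 / 2)" by (rule Lam_bound_Re)
      thus "norm (Lam N c) \<le> C1_factor N \<xi> * Gamma (real N + 1 / 2)" using True by (simp add: C1_factor_def)
    next
      case False
      have s: "sin (2 * Im \<xi>) \<noteq> 0" by (rule sin_double_nonzero[OF \<xi>(2) im]) (use False in simp)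
      have imz: "Im z = - (exp (2 * Re \<xi>) * sin (2 * Im \<xi>))" by (simp add: z_def Im_exp)
      have imw: "Im w = - Im z / (norm z)\<^sup>2" by (simp add: w_def Im_divide cmod_power2)
      have nw: "norm w = 1 / norm z" by (simp add: w_def norm_divide)
      have w0: "Im w \<noteq> 0" using s z0 imz imw by simp
      hence c0: "Im c \<noteq> 0" using y c by simp
      \<comment> \<open>The quantity |c| / |Im c| is constant on the ray of w and unchanged by
        inversion, so it can be computed from z = 1 - exp (2 \<xi>). Cancelling exp (2 Re \<xi>)
        gives the cosecant expression of the bound.\<close>
      have "norm c / \<bar>Im c\<bar> = norm w / \<bar>Im w\<bar>" using y c by (simp add: abs_mult)
      also have "\<dots> = norm z / \<bar>Im z\<bar>" using z0 nw by (simp add: imw power2_eq_square)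
      also have "norm z = exp (2 * Re \<xi>) * norm (1 - exp (- 2 * \<xi>))"
      proof -
        have "z = - (exp (2 * \<xi>) * (1 - exp (- 2 * \<xi>)))" by (simp add: z_def algebra_simps flip: exp_add)
        thus ?thesis by (simp add: norm_mult)
      qed
      also have "\<bar>Im z\<bar> = exp (2 * Re \<xi>) * \<bar>sin (2 * Im \<xi>)\<bar>" by (simp add: imz abs_mult)
      finally have q: "norm c / \<bar>Im c\<bar> = norm (1 - exp (- 2 * \<xi>)) * \<bar>1 / sin (2 * Im \<xi>)\<bar>" by simp
      have "norm (Lam N c) \<le> min (norm c / \<bar>Im c\<bar>) (1 + chi (real N + 1 / 2)) * Gamma (real N + 1 / 2)"
        using Lam_bound_Im[OF c0, of N] Lam_bound_chi[OF c0, of N] by (simp add: min_def)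
      thus "norm (Lam N c) \<le> C1_factor N \<xi> * Gamma (real N + 1 / 2)"
        using False s unfolding q by (simp add: C1_factor_def)
    qed
  qed
  thus ?thesis unfolding n unfolding w_def z_def .
qed

section \<open>Positivity for real parameters\<close>

lemma set_integral_of_real_pos:
  fixes f :: "real \<Rightarrow> complex"
  assumes I: "set_integrable lborel A f" and A: "a < b" "{a<..<b} \<subseteq> A"
    and f: "\<And>x. x \<in> A \<Longrightarrow> \<exists>r>0. f x = of_real r"
  shows "\<exists>r>0. (LINT x:A|lborel. f x) = of_real r"
proof -
  define g where "g = (\<lambda>x. indicator A x * Re (f x))"
  have g: "indicator A x *\<^sub>R f x = of_real (g x)" for x using f[of x] by (auto simp: g_def indicator_def)
  have gi: "integrable lborel g" using I unfolding set_integrable_def g complex_of_real_integrable_eq .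
  have gn: "g x \<ge> 0" for x using f[of x] by (auto simp: g_def indicator_def)
  have "integral\<^sup>L lborel g \<noteq> 0"
  proof
    assume "integral\<^sup>L lborel g = 0"
    hence "AE x in lborel. g x = 0" using integral_nonneg_eq_0_iff_AE[OF gi] gn by simp
    hence "AE x in lborel. x \<notin> A"
    proof eventually_elim
      case (elim x)
      show ?case
      proof
        assume x: "x \<in> A"
        then obtain r where "r > 0" "f x = of_real r" using f by blast
        thus False using elim x by (simp add: g_def)
      qed
    qed
    hence "AE x in lborel. x \<notin> {a<..<b}" by eventually_elim (use A in auto)
    \<comment> \<open>Strictness comes from the interval inside A: a vanishing integral would make
      it a null set although it has positive length.\<close>
    hence "emeasure lborel {a<..<b} = 0" by (subst (asm) AE_iff_measurable[of "{a<..<b}"]) auto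
    thus False using A(1) by simp
  qed
  moreover have "integral\<^sup>L lborel g \<ge> 0" by (rule integral_nonneg_AE) (use gn in simp)
  moreover have "(LINT x:A|lborel. f x) = of_real (integral\<^sup>L lborel g)"
    unfolding set_lebesgue_integral_def g by (rule integral_complex_of_real)
  ultimately show ?thesis by (intro exI[of _ "integral\<^sup>L lborel g"]) auto
qed

lemma Lam_pos:
  assumes "c > 0"
  shows "\<exists>r>0. Lam N (of_real c) = of_real r"
  unfolding Lam_def
proof (rule set_integral_of_real_pos[of _ _ 0 1])
  show "set_integrable lborel {0<..} (\<lambda>v. of_real (v powr (real N + 1 / 2 - 1) * exp (- 1 * v)) * (1 / (1 + complex_of_real c * of_real v)))"
  proof (rule Lam_bound(1)[where d = 1])
    fix v :: real assume v: "v > 0"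
    have "norm (1 + complex_of_real c * of_real v) = \<bar>1 + c * v\<bar>" by (metis norm_of_real of_real_1 of_real_add of_real_mult)
    thus "1 \<le> norm (1 + complex_of_real c * of_real v)" using assms v by simp
  qed (use assms in auto)
  fix v :: real assume "v \<in> {0<..}"
  hence v: "v > 0" by simp
  have "1 + c * v > 0" using assms v by (simp add: add_pos_pos)
  thus "\<exists>r>0. of_real (v powr (real N + 1 / 2 - 1) * exp (- 1 * v)) * (1 / (1 + complex_of_real c * of_real v)) = of_real r"
    using v by (intro exI[of _ "v powr (real N + 1 / 2 - 1) * exp (- 1 * v) * (1 / (1 + c * v))"]) simp
qed auto

lemma of_real_powr_of_real:
  assumes "x > 0"
  shows "complex_of_real x powr (of_real a + of_nat n - 1) = of_real (x powr (a + real n - 1))"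
    "complex_of_real x powr (of_nat n + 1 - of_real a - 1) = of_real (x powr (real n + 1 - a - 1))"
    "complex_of_real x powr (of_real a - of_nat n - 1) = of_real (x powr (a - real n - 1))"
  using powr_of_real[of x "a + real n - 1"] powr_of_real[of x "real n + 1 - a - 1"] powr_of_real[of x "a - real n - 1"] assms by simp_all

lemma Dh_pos:
  assumes c: "c > 0" and a: "a > real N"
  shows "\<exists>r>0. Dh (of_real a) N (of_real c) = of_real r"
  unfolding Dh_def
proof (rule set_integral_of_real_pos[of _ _ 0 1])
  show "set_integrable lborel {0<..} (\<lambda>t. of_real t powr (of_real a - of_nat N - 1) * exp (- 1 * of_real t) * Lam N (of_real c / of_real t))"
  proof (rule Dh_bound(1))
    fix t :: real assume "t > 0"
    thus "norm (Lam N (of_real c / of_real t)) \<le> 1 * Gamma (real N + 1 / 2)"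
      using c by (intro Lam_bound_Re) simp
  qed (use c a in auto)
  fix t :: real assume "t \<in> {0<..}"
  hence t: "t > 0" by simp
  obtain r where r: "r > 0" "Lam N (of_real (c / t)) = of_real r" using Lam_pos[of "c / t" N] c t by auto
  have "complex_of_real t powr (of_real a - of_nat N - 1) * exp (- 1 * of_real t) * Lam N (of_real c / of_real t) = of_real (t powr (a - real N - 1) * exp (- t) * r)"
    unfolding of_real_powr_of_real[OF t] using r(2) by (simp add: exp_of_real[symmetric])
  moreover have "t powr (a - real N - 1) * exp (- t) * r > 0" using t r by simp
  ultimately show "\<exists>r>0. complex_of_real t powr (of_real a - of_nat N - 1) * exp (- 1 * of_real t) * Lam N (of_real c / of_real t) = of_real r" by blast
qed auto

text \<open>Positive integrands at all three levels leave (-1)^N sin (\<pi> l) as the only source of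
  sign, and by \<open>acoef_Gamma\<close> this is also the sign of a_N.\<close>

lemma remainder_real:
  fixes a l w :: real
  assumes w: "w > 0" and a: "a > real N" and l: "\<bar>l - 1 / 2\<bar> < real N + 1 / 2"
  shows "\<exists>r>0. remainder (of_real a) (of_real l) N (of_real w) = of_real ((- 1) ^ N * sin (pi * l) * r)"
proof -
  let ?f = "\<lambda>x. of_real x powr (of_real l + of_nat N - 1) * of_real (1 - x) powr (of_nat N + 1 - of_real l - 1) * Dh (of_real a) N (of_real (4 * x * (1 - x)) * of_real w)"
  have ca: "Re (complex_of_real a) > real N" using a by simp
  have cw: "complex_of_real w \<notin> \<real>\<^sub>\<le>\<^sub>0" using w by simp
  have p: "Re (complex_of_real l) + real N > 0" "real N + 1 - Re (complex_of_real l) > 0" using l by (auto simp: abs_less_iff)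
  have K: "norm (Dh (of_real a) N (of_real y * of_real w)) \<le> Gamma (Re (of_real a) - real N) * (1 * Gamma (real N + 1 / 2))" if y: "y > 0" for y
  proof (rule Dh_bound(2)[OF _ ca])
    show "complex_of_real y * of_real w \<notin> \<real>\<^sub>\<le>\<^sub>0 \<or> complex_of_real y * of_real w = 0" using slit_scale(2)[OF cw y] by simp
    fix t :: real assume "t > 0"
    thus "norm (Lam N (of_real y * of_real w / of_real t)) \<le> 1 * Gamma (real N + 1 / 2)"
      using y w by (intro Lam_bound_Re) simp
  qed
  have "\<exists>r>0. (LINT x:{0<..<1}|lborel. ?f x) = of_real r"
  proof (rule set_integral_of_real_pos[of _ _ 0 1])
    show "set_integrable lborel {0<..<1} ?f"
      by (rule set_integrable_dominated[OF set_integrable_mult_left[OF set_integrable_Beta[OF p]] _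
            remainder_integrand_continuous[OF ca cw] remainder_integrand_bound[OF _ K]]) auto
    fix x :: real assume x: "x \<in> {0<..<1}"
    hence x': "0 < x" "0 < 1 - x" by auto
    have "4 * x * (1 - x) * w > 0" using four_mult_complement_pos[OF x] w by simp
    then obtain r where r: "r > 0" "Dh (of_real a) N (of_real (4 * x * (1 - x) * w)) = of_real r" using Dh_pos a by blast
    have "?f x = of_real (x powr (l + real N - 1) * (1 - x) powr (real N + 1 - l - 1) * r)"
      unfolding of_real_powr_of_real[OF x'(1)] of_real_powr_of_real[OF x'(2)] of_real_mult[symmetric, of _ w] r(2) by simp
    moreover have "x powr (l + real N - 1) * (1 - x) powr (real N + 1 - l - 1) * r > 0" using x' r by simp
    ultimately show "\<exists>r>0. ?f x = of_real r" by blast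
  qed auto
  then obtain r where r: "r > 0" "(LINT x:{0<..<1}|lborel. ?f x) = of_real r" by blast
  have "remainder (of_real a) (of_real l) N (of_real w) = of_real (sin (pi * l) / (pi * sqrt pi) * (- 4 * w) ^ N * r)"
    unfolding remainder_def r(2) by (simp add: sin_of_real[symmetric])
  also have "sin (pi * l) / (pi * sqrt pi) * (- 4 * w) ^ N * r = (- 1) ^ N * sin (pi * l) * ((4 * w) ^ N * r / (pi * sqrt pi))"
    using power_mult_distrib[of "- 1" "4 * w" N] by (simp add: mult_ac)
  finally show ?thesis using w r(1) by (intro exI[of _ "(4 * w) ^ N * r / (pi * sqrt pi)"]) simp
qed

lemma gfun_expansion_divided:
  assumes "w \<notin> \<real>\<^sub>\<le>\<^sub>0" "Re \<alpha> > real N" "\<bar>Re lam - 1 / 2\<bar> < real N + 1 / 2"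
  shows "(\<Sum>n<N. acoef n (lam - 1 / 2) * (Gamma (\<alpha> - of_nat n) / G) * (2 * w) ^ n) + remainder \<alpha> lam N w / G = gfun \<alpha> lam w / G"
  unfolding gfun_expansion[OF assms] add_divide_distrib sum_divide_distrib by simp

section \<open>The Gegenbauer function\<close>

text \<open>Off the real axis, with \<open>K = Kfac \<xi> lam\<close>, this is \<^term>\<open>remainder\<close> at the first argument
  divided by \<open>\<Gamma>(\<nu> + 1)\<close>; it stays continuous across the real axis, where that argument lies on
  the cut.\<close>

definition first_remainder :: "complex \<Rightarrow> nat \<Rightarrow> complex \<Rightarrow> complex \<Rightarrow> complex \<Rightarrow> complex" where
  "first_remainder K N \<xi> lam \<nu> =
     (conn_lhs (\<nu> + lam) lam \<xi> - K * (exp (- \<xi> * (\<nu> + lam)) * gfun (\<nu> + lam) lam (1 / (1 - exp (- 2 * \<xi>)))))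
       / (exp (\<xi> * (\<nu> + lam)) * Gamma (\<nu> + 1))
     - (\<Sum>n<N. acoef n (lam - 1 / 2) * (Gamma (\<nu> + lam - of_nat n) / Gamma (\<nu> + 1)) * (2 * (1 / (1 - exp (2 * \<xi>)))) ^ n)"

lemma first_remainder_nonreal:
  assumes \<xi>: "\<xi> \<in> D1" "Im \<xi> \<noteq> 0" and \<alpha>: "Re (\<nu> + lam) > real N" and lam: "\<bar>Re lam - 1 / 2\<bar> < real N + 1 / 2"
  shows "first_remainder (Kfac \<xi> lam) N \<xi> lam \<nu> = remainder (\<nu> + lam) lam N (1 / (1 - exp (2 * \<xi>))) / Gamma (\<nu> + 1)"
proof -
  have im: "\<bar>Im \<xi>\<bar> < pi" using \<xi> by (simp add: D1_def)
  have "conn_lhs (\<nu> + lam) lam \<xi> = exp (\<xi> * (\<nu> + lam)) * gfun (\<nu> + lam) lam (1 / (1 - exp (2 * \<xi>))) +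
      Kfac \<xi> lam * (exp (- \<xi> * (\<nu> + lam)) * gfun (\<nu> + lam) lam (1 / (1 - exp (- 2 * \<xi>))))"
    by (rule connection[OF \<xi>]) (use \<alpha> lam in linarith)+
  hence "first_remainder (Kfac \<xi> lam) N \<xi> lam \<nu> = gfun (\<nu> + lam) lam (1 / (1 - exp (2 * \<xi>))) / Gamma (\<nu> + 1)
     - (\<Sum>n<N. acoef n (lam - 1 / 2) * (Gamma (\<nu> + lam - of_nat n) / Gamma (\<nu> + 1)) * (2 * (1 / (1 - exp (2 * \<xi>)))) ^ n)"
    unfolding first_remainder_def by simp
  thus ?thesis
    unfolding gfun_expansion_divided[OF recip_one_minus_exp_notin(1)[OF \<xi>(2) im] \<alpha> lam, symmetric] by simp
qed

text \<open>\<open>Kfac\<close> jumps at the real axis, so K is frozen as a parameter. With K fixed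
  every ingredient is continuous on D1, because the second argument stays in the right half-plane
  and \<open>conn_lhs\<close> is analytic on all of D1.\<close>

lemma continuous_on_first_remainder:
  assumes \<alpha>: "Re (\<nu> + lam) > real N" and lam: "\<bar>Re lam - 1 / 2\<bar> < real N + 1 / 2" and G: "Gamma (\<nu> + 1) \<noteq> 0"
  shows "continuous_on D1 (\<lambda>\<xi>. first_remainder K N \<xi> lam \<nu>)"
proof -
  have nz: "1 - exp (- 2 * \<xi>) \<noteq> 0" if "\<xi> \<in> D1" for \<xi> using Re_second_arg_pos[OF that] by auto
  have nz': "1 - exp (2 * \<xi>) \<noteq> 0" if "\<xi> \<in> D1" for \<xi>
    using nz[OF that] by (auto simp: exp_minus)
  have "(\<lambda>\<xi>. gfun (\<nu> + lam) lam (1 / (1 - exp (- 2 * \<xi>)))) holomorphic_on D1"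
  proof (rule holomorphic_on_gfun[OF open_D1])
    show "(\<lambda>\<xi>. 1 / (1 - exp (- 2 * \<xi>))) holomorphic_on D1" using nz by (intro holomorphic_intros) auto
    fix \<xi> assume "\<xi> \<in> D1"
    thus "1 / (1 - exp (- 2 * \<xi>)) \<notin> \<real>\<^sub>\<le>\<^sub>0" by (intro Re_pos_notin_nonpos Re_second_arg_pos)
  qed (use \<alpha> lam in \<open>(linarith | intro holomorphic_intros)+\<close>)
  hence g: "continuous_on D1 (\<lambda>\<xi>. gfun (\<nu> + lam) lam (1 / (1 - exp (- 2 * \<xi>))))"
    by (rule holomorphic_on_imp_continuous_on)
  have c: "continuous_on D1 (\<lambda>\<xi>. conn_lhs (\<nu> + lam) lam \<xi>)"
    using holomorphic_on_imp_continuous_on[OF conn_lhs_holomorphic_D1[of "\<nu> + lam" lam]] by simp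
  show ?thesis unfolding first_remainder_def
    by (intro continuous_intros g c) (use nz' G in auto)
qed

text \<open>The point x is approached along x + i s t, where \<open>Kfac\<close> has the constant
  value K and the bound off the real axis applies. \<open>C1_factor\<close> is replaced by its
  constant upper bound, which leaves a majorant continuous at x.\<close>

lemma first_remainder_real_limit:
  assumes x: "x > 0" and s: "s = 1 \<or> s = - 1" and \<alpha>: "Re (\<nu> + lam) > real N" and lam: "\<bar>Re lam - 1 / 2\<bar> < real N + 1 / 2"
    and G: "Gamma (\<nu> + 1) \<noteq> 0"
  shows "norm (first_remainder (exp (of_real s * (of_real pi * \<i> * lam))) N (of_real x) lam \<nu>) \<le>
    norm (sin (of_real pi * lam)) * acoef_over_sin N (Re lam) * Gamma (Re (\<nu> + lam) - real N) * norm (exp (- of_real x) / sinh (complex_of_real x)) ^ N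
      * (1 + chi (real N + 1 / 2)) / norm (Gamma (\<nu> + 1))"
proof -
  define K where "K = exp (of_real s * (of_real pi * \<i> * lam))"
  define b where "b = norm (sin (of_real pi * lam)) * acoef_over_sin N (Re lam) * Gamma (Re (\<nu> + lam) - real N)"
  define B where "B = (\<lambda>\<xi>::complex. b * norm (exp (- \<xi>) / sinh \<xi>) ^ N * (1 + chi (real N + 1 / 2)) / norm (Gamma (\<nu> + 1)))"
  define \<zeta> where "\<zeta> = (\<lambda>t::real. complex_of_real x + \<i> * of_real (s * t))"
  have b0: "b \<ge> 0" unfolding b_def
    using acoef_over_sin_pos[OF lam] \<alpha> by (intro mult_nonneg_nonneg less_imp_le[OF Gamma_real_pos]) auto
  have xD: "complex_of_real x \<in> D1" using x by (simp add: D1_def)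
  have "(\<zeta> \<longlongrightarrow> complex_of_real x + \<i> * of_real (s * 0)) (at_right 0)"
    unfolding \<zeta>_def by (intro tendsto_intros)
  hence z: "(\<zeta> \<longlongrightarrow> of_real x) (at_right 0)" by simp
  have "isCont (\<lambda>\<xi>. first_remainder K N \<xi> lam \<nu>) (of_real x)"
    using continuous_on_first_remainder[OF \<alpha> lam G] xD open_D1 by (simp add: continuous_on_eq_continuous_at)
  hence l: "((\<lambda>t. norm (first_remainder K N (\<zeta> t) lam \<nu>)) \<longlongrightarrow> norm (first_remainder K N (of_real x) lam \<nu>)) (at_right 0)"
    using isCont_tendsto_compose[OF _ z, of "\<lambda>\<xi>. first_remainder K N \<xi> lam \<nu>"] by (intro tendsto_norm)
  have sn: "sinh (complex_of_real x) \<noteq> 0" using sinh_D1_notin[OF xD] by auto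
  have "isCont B (of_real x)" unfolding B_def sinh_field_def by (intro continuous_intros) (use sn G in \<open>auto simp: sinh_field_def\<close>)
  hence r: "((\<lambda>t. B (\<zeta> t)) \<longlongrightarrow> B (of_real x)) (at_right 0)" by (rule isCont_tendsto_compose[OF _ z])
  have "\<forall>\<^sub>F t in at_right 0. t \<in> {0<..<pi}" by (rule eventually_at_right_real) simp
  hence "\<forall>\<^sub>F t in at_right 0. norm (first_remainder K N (\<zeta> t) lam \<nu>) \<le> B (\<zeta> t)"
  proof eventually_elim
    case (elim t)
    have D: "\<zeta> t \<in> D1" "Im (\<zeta> t) \<noteq> 0" using elim s x by (auto simp: D1_def \<zeta>_def)
    have K: "Kfac (\<zeta> t) lam = K" using elim s by (auto simp: Kfac_def K_def \<zeta>_def)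
    have "norm (first_remainder K N (\<zeta> t) lam \<nu>) = norm (remainder (\<nu> + lam) lam N (1 / (1 - exp (2 * \<zeta> t)))) / norm (Gamma (\<nu> + 1))"
      unfolding K[symmetric] first_remainder_nonreal[OF D \<alpha> lam] by (rule norm_divide)
    also have "\<dots> \<le> b * norm (exp (- \<zeta> t) / sinh (\<zeta> t)) ^ N * C1_factor N (\<zeta> t) / norm (Gamma (\<nu> + 1))"
      unfolding b_def by (intro divide_right_mono first_remainder_bound[OF D \<alpha> lam]) simp
    also have "\<dots> \<le> B (\<zeta> t)" unfolding B_def
      by (intro divide_right_mono mult_left_mono C1_factor_le mult_nonneg_nonneg b0) auto
    finally show ?case .
  qed
  hence "norm (first_remainder K N (of_real x) lam \<nu>) \<le> B (of_real x)"
    by (rule tendsto_le[OF _ r l, rotated]) simp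
  thus ?thesis unfolding K_def B_def b_def .
qed

lemma first_remainder_estimate:
  assumes \<xi>: "\<xi> \<in> D1" and \<alpha>: "Re (\<nu> + lam) > real N" and lam: "\<bar>Re lam - 1 / 2\<bar> < real N + 1 / 2"
    and G: "Gamma (\<nu> + 1) \<noteq> 0"
  shows "norm (first_remainder (Kfac \<xi> lam) N \<xi> lam \<nu>) \<le>
    norm (sin (of_real pi * lam)) * acoef_over_sin N (Re lam) * Gamma (Re (\<nu> + lam) - real N) * norm (exp (- \<xi>) / sinh \<xi>) ^ N
      * C1_factor N \<xi> / norm (Gamma (\<nu> + 1))"
proof (cases "Im \<xi> = 0")
  case False
  show ?thesis unfolding first_remainder_nonreal[OF \<xi> False \<alpha> lam] norm_divide[of _ "Gamma (\<nu> + 1)"]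
    by (intro divide_right_mono first_remainder_bound[OF \<xi> False \<alpha> lam]) simp
next
  case True
  define x where "x = Re \<xi>"
  have x: "x > 0" "\<xi> = of_real x" using True \<xi> by (simp_all add: x_def D1_def complex_eq_iff)
  let ?H = "\<lambda>K. first_remainder K N \<xi> lam \<nu>"
  define B where "B = norm (sin (of_real pi * lam)) * acoef_over_sin N (Re lam) * Gamma (Re (\<nu> + lam) - real N) * norm (exp (- \<xi>) / sinh \<xi>) ^ N
      * (1 + chi (real N + 1 / 2)) / norm (Gamma (\<nu> + 1))"
  have f: "C1_factor N \<xi> = 1 + chi (real N + 1 / 2)" using x by (simp add: C1_factor_def Re_exp)
  have p: "norm (?H (exp (of_real pi * \<i> * lam))) \<le> B"
    using first_remainder_real_limit[OF x(1) _ \<alpha> lam G, of 1] by (simp add: B_def x(2))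
  have m: "norm (?H (exp (- (of_real pi * \<i> * lam)))) \<le> B"
    using first_remainder_real_limit[OF x(1) _ \<alpha> lam G, of "- 1"] by (simp add: B_def x(2))
  have K: "Kfac \<xi> lam = (exp (of_real pi * \<i> * lam) + exp (- (of_real pi * \<i> * lam))) / 2"
    using True by (simp add: Kfac_def cos_exp_eq mult_ac)
  \<comment> \<open>The dependence on K is affine, and cos (\<pi> lam) is the mean of the two
    exponentials; the bounds obtained from above and from below therefore average.\<close>
  have avg: "?H ((k + k') / 2) = (?H k + ?H k') / 2" for k k'
    unfolding first_remainder_def by (simp add: add_divide_distrib diff_divide_distrib algebra_simps)
  have "norm (?H (Kfac \<xi> lam)) = norm (?H (exp (of_real pi * \<i> * lam)) + ?H (exp (- (of_real pi * \<i> * lam)))) / 2"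
    unfolding K avg by (simp add: norm_divide)
  also have "\<dots> \<le> (B + B) / 2" using norm_triangle_mono[OF p m] by simp
  finally have "norm (?H (Kfac \<xi> lam)) \<le> B" by simp
  thus ?thesis unfolding f B_def .
qed

text \<open>The first bracket collapses by the very definition of \<open>first_remainder\<close>, so
  apart from \<open>gegenbauer_conn\<close> only the expansion of the second \<open>gfun\<close> has
  analytic content here. The connection formula enters through the estimate of the first
  remainder.\<close>

lemma gegenbauer_expansion:
  assumes \<xi>: "\<xi> \<in> D1" and \<alpha>: "Re (\<nu> + lam) > real M" and lam: "\<bar>Re lam - 1 / 2\<bar> < real M + 1 / 2"
    and G: "Gamma (\<nu> + 1) \<noteq> 0"
  shows "gegenbauer_C lam \<nu> (cosh \<xi>) =
         exp (\<xi> * (\<nu> + lam)) * rGamma lam / (2 * sinh \<xi>) powr lam *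
           ((\<Sum>n<N. acoef n (lam - 1 / 2) * (Gamma (\<nu> + lam - of_nat n) / Gamma (\<nu> + 1))
                      * (- exp (- \<xi>) / sinh \<xi>) ^ n)
            + first_remainder (Kfac \<xi> lam) N \<xi> lam \<nu>)
         + Kfac \<xi> lam * (exp (- \<xi> * (\<nu> + lam)) * rGamma lam / (2 * sinh \<xi>) powr lam) *
           ((\<Sum>m<M. acoef m (lam - 1 / 2) * (Gamma (\<nu> + lam - of_nat m) / Gamma (\<nu> + 1))
                      * (exp \<xi> / sinh \<xi>) ^ m)
            + remainder (\<nu> + lam) lam M (1 / (1 - exp (- 2 * \<xi>))) / Gamma (\<nu> + 1))"
proof -
  define g e e' p K L g2 where "g = Gamma (\<nu> + 1)" and "e = exp (\<xi> * (\<nu> + lam))" and "e' = exp (- \<xi> * (\<nu> + lam))"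
    and "p = (2 * sinh \<xi>) powr lam" and "K = Kfac \<xi> lam" and "L = conn_lhs (\<nu> + lam) lam \<xi>"
    and "g2 = gfun (\<nu> + lam) lam (1 / (1 - exp (- 2 * \<xi>)))"
  have e0: "e \<noteq> 0" by (simp add: e_def)
  have r: "rGamma (\<nu> + 1) = 1 / g" by (simp add: g_def Gamma_def inverse_eq_divide)
  have 1: "(\<Sum>n<N. acoef n (lam - 1 / 2) * (Gamma (\<nu> + lam - of_nat n) / g) * (- exp (- \<xi>) / sinh \<xi>) ^ n)
      + first_remainder K N \<xi> lam \<nu> = (L - K * (e' * g2)) / (e * g)"
    unfolding first_remainder_def two_div_one_minus_exp(1) g_def e_def e'_def g2_def L_def by simp
  have 2: "(\<Sum>m<M. acoef m (lam - 1 / 2) * (Gamma (\<nu> + lam - of_nat m) / g) * (exp \<xi> / sinh \<xi>) ^ m)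
      + remainder (\<nu> + lam) lam M (1 / (1 - exp (- 2 * \<xi>))) / g = g2 / g"
    using gfun_expansion_divided[OF Re_pos_notin_nonpos[OF Re_second_arg_pos[OF \<xi>]] \<alpha> lam]
    unfolding two_div_one_minus_exp(2) g2_def .
  have "e * rGamma lam / p * ((L - K * (e' * g2)) / (e * g)) = rGamma lam / p * ((L - K * (e' * g2)) / g)"
    using e0 by simp
  hence "rGamma lam * (1 / g) / p * L = e * rGamma lam / p * ((L - K * (e' * g2)) / (e * g)) + K * (e' * rGamma lam / p) * (g2 / g)"
    by (simp add: diff_divide_distrib algebra_simps)
  thus ?thesis
    unfolding gegenbauer_conn[OF \<xi>] r unfolding g_def[symmetric] e_def[symmetric] e'_def[symmetric] p_def[symmetric] K_def[symmetric] L_def[symmetric]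
    unfolding 1 2 .
qed

text \<open>R and T are both (-1)^M sin (\<pi> l) times a positive number, so their signs agree,
  also when both vanish. For real parameters the bound of \<open>second_remainder_bound\<close> is
  |T| itself.\<close>

lemma second_remainder_sign:
  fixes x l v :: real
  assumes x: "x > 0" and l: "\<bar>l - 1 / 2\<bar> < real M + 1 / 2" and v: "v > real M - l"
    and R: "R = remainder (of_real v + of_real l) (of_real l) M (1 / (1 - exp (- 2 * of_real x))) / Gamma (of_real v + 1)"
    and T: "T = acoef M (l - 1 / 2) * (Gamma (v + l - real M) / Gamma (v + 1)) * (exp x / sinh x) ^ M"
  shows "R \<in> \<real>" "\<bar>Re R\<bar> \<le> \<bar>T\<bar>" "sgn (Re R) = sgn T"
proof -
  define w where "w = 1 / (1 - exp (- 2 * x))"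
  have w: "w > 0" using x by (simp add: w_def)
  have vp: "v + 1 > 0" "v + l > real M" using v l by (auto simp: abs_less_iff)
  have cw: "1 / (1 - exp (- 2 * complex_of_real x)) = of_real w"
    by (simp add: w_def exp_of_real[symmetric])
  have g: "Gamma (complex_of_real v + 1) = of_real (Gamma (v + 1))" by (simp add: Gamma_complex_of_real[symmetric])
  obtain r where r: "r > 0" "remainder (of_real (v + l)) (of_real l) M (of_real w) = of_real ((- 1) ^ M * sin (pi * l) * r)"
    using remainder_real[OF w vp(2) l] by blast
  define q where "q = r / Gamma (v + 1)"
  have q: "q > 0" using r(1) Gamma_real_pos[OF vp(1)] by (simp add: q_def)
  have Rr: "R = of_real ((- 1) ^ M * sin (pi * l) * q)" using r(2) unfolding R cw g q_def by simp
  thus "R \<in> \<real>" by simp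
  define t where "t = acoef_over_sin M l * (Gamma (v + l - real M) / Gamma (v + 1)) * (exp x / sinh x) ^ M"
  have t: "t > 0" unfolding t_def
    using x vp acoef_over_sin_pos[OF l] by (intro mult_pos_pos divide_pos_pos Gamma_real_pos zero_less_power) auto
  have Tt: "T = (- 1) ^ M * sin (pi * l) * t" unfolding T t_def acoef_Gamma[OF l] acoef_over_sin_Gamma[OF l] by simp
  show "sgn (Re R) = sgn T" unfolding Rr Tt using q t by (simp add: sgn_mult)
  have D: "complex_of_real x \<in> D1" using x by (simp add: D1_def)
  have "norm (remainder (of_real v + of_real l) (of_real l) M (1 / (1 - exp (- 2 * of_real x)))) \<le>
    norm (sin (of_real pi * complex_of_real l)) * acoef_over_sin M (Re (of_real l)) * Gamma (Re (of_real v + of_real l) - real M) * norm (exp (of_real x) / sinh (complex_of_real x)) ^ M"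
    by (rule second_remainder_bound[OF D]) (use vp l in auto)
  hence "norm R \<le> norm (sin (of_real pi * complex_of_real l)) * acoef_over_sin M l * Gamma (v + l - real M) * norm (exp (of_real x) / sinh (complex_of_real x)) ^ M / Gamma (v + 1)"
    unfolding R norm_divide g norm_of_real using Gamma_real_pos[OF vp(1)] by (simp add: divide_right_mono)
  also have "norm (sin (of_real pi * complex_of_real l)) = \<bar>sin (pi * l)\<bar>" by (metis norm_of_real of_real_mult sin_of_real)
  also have "norm (exp (of_real x) / sinh (complex_of_real x)) = exp x / sinh x"
  proof -
    have "exp (of_real x) / sinh (complex_of_real x) = of_real (exp x / sinh x)" by (simp add: sinh_field_def exp_of_real[symmetric])
    thus ?thesis using x by (simp only: norm_of_real) simp
  qed
  finally have "norm R \<le> \<bar>sin (pi * l)\<bar> * t" by (simp add: t_def)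
  also have "\<dots> = \<bar>T\<bar>" using t by (simp add: Tt abs_mult power_abs)
  finally show "\<bar>Re R\<bar> \<le> \<bar>T\<bar>" using abs_Re_le_cmod[of R] by linarith
qed

text \<open>The remainders are chosen before all parameters, so that the sign statement concerns the
  same R2 as the expansion. The quotient of |a_k| by |sin (\<pi> Re lam)| is kept together in
  \<open>acoef_over_sin\<close>, which contains the limiting values; \<open>rGamma\<close> gives
  1/\<Gamma>(lam) its value 0 at the poles.\<close>

theorem corollary5p1:
  shows "\<exists>R1 R2 :: nat \<Rightarrow> complex \<Rightarrow> complex \<Rightarrow> complex \<Rightarrow> complex.
    (\<forall>\<xi> \<in> D1. \<forall>(N::nat) (M::nat) (lam::complex) (\<nu>::complex).
       \<bar>Re lam - 1 / 2\<bar> < min (real N + 1 / 2) (real M + 1 / 2) \<longrightarrow>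
       Re \<nu> > max (real N - Re lam) (real M - Re lam) \<longrightarrow>
       gegenbauer_C lam \<nu> (cosh \<xi>) =
         exp (\<xi> * (\<nu> + lam)) * rGamma lam / (2 * sinh \<xi>) powr lam *
           ((\<Sum>n<N. acoef n (lam - 1 / 2) * (Gamma (\<nu> + lam - of_nat n) / Gamma (\<nu> + 1))
                      * (- exp (- \<xi>) / sinh \<xi>) ^ n)
            + R1 N \<xi> lam \<nu>)
         + Kfac \<xi> lam * (exp (- \<xi> * (\<nu> + lam)) * rGamma lam / (2 * sinh \<xi>) powr lam) *
           ((\<Sum>m<M. acoef m (lam - 1 / 2) * (Gamma (\<nu> + lam - of_nat m) / Gamma (\<nu> + 1))
                      * (exp \<xi> / sinh \<xi>) ^ m)
            + R2 M \<xi> lam \<nu>)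
       \<and> norm (R1 N \<xi> lam \<nu>)
           \<le> norm (sin (of_real pi * lam)) * acoef_over_sin N (Re lam)
              * (Gamma (Re \<nu> + Re lam - real N) / norm (Gamma (\<nu> + 1)))
              * norm (exp (- \<xi>) / sinh \<xi>) ^ N * C1_factor N \<xi>
       \<and> norm (R2 M \<xi> lam \<nu>)
           \<le> norm (sin (of_real pi * lam)) * acoef_over_sin M (Re lam)
              * (Gamma (Re \<nu> + Re lam - real M) / norm (Gamma (\<nu> + 1)))
              * norm (exp \<xi> / sinh \<xi>) ^ M)
    \<and> (\<forall>(x::real) (l::real) (v::real) (M::nat).
         x > 0 \<longrightarrow> \<bar>l - 1 / 2\<bar> < real M + 1 / 2 \<longrightarrow> v > real M - l \<longrightarrow>
         (let R = R2 M (of_real x) (of_real l) (of_real v);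
              T = acoef M (l - 1 / 2) * (Gamma (v + l - real M) / Gamma (v + 1))
                    * (exp x / sinh x) ^ M
          in R \<in> \<real> \<and> \<bar>Re R\<bar> \<le> \<bar>T\<bar> \<and> sgn (Re R) = sgn T))"
proof (rule exI[of _ "\<lambda>N \<xi> lam \<nu>. first_remainder (Kfac \<xi> lam) N \<xi> lam \<nu>"],
    rule exI[of _ "\<lambda>M \<xi> lam \<nu>. remainder (\<nu> + lam) lam M (1 / (1 - exp (- 2 * \<xi>))) / Gamma (\<nu> + 1)"],
    intro conjI ballI allI impI)
  fix \<xi> :: complex and N M :: nat and lam \<nu> :: complex
  assume \<xi>: "\<xi> \<in> D1" and "\<bar>Re lam - 1 / 2\<bar> < min (real N + 1 / 2) (real M + 1 / 2)"
    and "Re \<nu> > max (real N - Re lam) (real M - Re lam)"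
  hence lam: "\<bar>Re lam - 1 / 2\<bar> < real N + 1 / 2" "\<bar>Re lam - 1 / 2\<bar> < real M + 1 / 2"
    and \<alpha>: "Re (\<nu> + lam) > real N" "Re (\<nu> + lam) > real M" by auto
  \<comment> \<open>Re lam < N + 1 and Re \<nu> > N - Re lam give Re \<nu> > -1, so \<nu> + 1 is not
    a pole and \<open>Gamma\<close>, which is 0 at poles by convention, does not vanish
    there.\<close>
  have "Re (\<nu> + 1) > 0" using lam(1) \<alpha>(1) by (simp add: abs_less_iff)
  hence G: "Gamma (\<nu> + 1) \<noteq> 0" using nonpos_Ints_Re_pos[of "\<nu> + 1"] by (simp add: Gamma_eq_zero_iff)
  show "gegenbauer_C lam \<nu> (cosh \<xi>) =
         exp (\<xi> * (\<nu> + lam)) * rGamma lam / (2 * sinh \<xi>) powr lam *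
           ((\<Sum>n<N. acoef n (lam - 1 / 2) * (Gamma (\<nu> + lam - of_nat n) / Gamma (\<nu> + 1))
                      * (- exp (- \<xi>) / sinh \<xi>) ^ n)
            + first_remainder (Kfac \<xi> lam) N \<xi> lam \<nu>)
         + Kfac \<xi> lam * (exp (- \<xi> * (\<nu> + lam)) * rGamma lam / (2 * sinh \<xi>) powr lam) *
           ((\<Sum>m<M. acoef m (lam - 1 / 2) * (Gamma (\<nu> + lam - of_nat m) / Gamma (\<nu> + 1))
                      * (exp \<xi> / sinh \<xi>) ^ m)
            + remainder (\<nu> + lam) lam M (1 / (1 - exp (- 2 * \<xi>))) / Gamma (\<nu> + 1))"
    by (rule gegenbauer_expansion[OF \<xi> \<alpha>(2) lam(2) G])
  have re: "Re \<nu> + Re lam = Re (\<nu> + lam)" by simp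
  show "norm (first_remainder (Kfac \<xi> lam) N \<xi> lam \<nu>)
           \<le> norm (sin (of_real pi * lam)) * acoef_over_sin N (Re lam)
              * (Gamma (Re \<nu> + Re lam - real N) / norm (Gamma (\<nu> + 1)))
              * norm (exp (- \<xi>) / sinh \<xi>) ^ N * C1_factor N \<xi>"
    unfolding re using first_remainder_estimate[OF \<xi> \<alpha>(1) lam(1) G]
    by (simp only: times_divide_eq_left times_divide_eq_right)
  show "norm (remainder (\<nu> + lam) lam M (1 / (1 - exp (- 2 * \<xi>))) / Gamma (\<nu> + 1))
           \<le> norm (sin (of_real pi * lam)) * acoef_over_sin M (Re lam)
              * (Gamma (Re \<nu> + Re lam - real M) / norm (Gamma (\<nu> + 1)))
              * norm (exp \<xi> / sinh \<xi>) ^ M"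
    unfolding re norm_divide[of _ "Gamma _"]
    using divide_right_mono[OF second_remainder_bound[OF \<xi> \<alpha>(2) lam(2)] norm_ge_zero[of "Gamma (\<nu> + 1)"]]
    by (simp only: times_divide_eq_left times_divide_eq_right)
next
  fix x l v :: real and M :: nat
  assume "x > 0" "\<bar>l - 1 / 2\<bar> < real M + 1 / 2" "v > real M - l"
  note s = second_remainder_sign[OF this refl refl]
  show "let R = remainder (of_real v + of_real l) (of_real l) M (1 / (1 - exp (- 2 * of_real x))) / Gamma (of_real v + 1);
            T = acoef M (l - 1 / 2) * (Gamma (v + l - real M) / Gamma (v + 1)) * (exp x / sinh x) ^ M
          in R \<in> \<real> \<and> \<bar>Re R\<bar> \<le> \<bar>T\<bar> \<and> sgn (Re R) = sgn T"
    unfolding Let_def using s by blast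
qed

end
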